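(* Suppose that $T:[0,1]\to[0,1]$ is a $\mathcal{C}^\infty$ piecewise monotone transformation with associated partition $\Omega$, and that $\varphi:[0,1]\to\mathbb{C}$ admits a $\mathcal{C}^\infty$ extension to $\overline\omega$ for each $\omega\in\Omega$ and is uniformly bounded away from zero. Further suppose that $T$ is uniformly expanding, in the sense that there exist $C>0$ and $0<\lambda<1$ such that $|(T^n)'|\ge C\lambda^{-n}$ for all $n$, and that $\|\varphi\cdot T'\|_{L^\infty}<\infty$. Then, for all $\tilde\Lambda>\Lambda^{\sup}(T,\varphi)$, there exists a Banach space $\mathfrak{B}\subset L^\infty([0,1])$ such that: (1) $\mathcal{C}^\infty(\mathcal{I})\subseteq\mathfrak{B}$; (2) $\mathcal{L}_\varphi$ extends to a continuous operator on $\mathfrak{B}$; (3) the essential spectral radius of $\mathcal{L}_\varphi:\mathfrak{B}\to\mathfrak{B}$ is at most $\tilde\Lambda$.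
   Context: A map $T:[0,1]\to[0,1]$ is a $\mathcal{C}^{r}$ piecewise monotone transformation if there is a finite partition $\Omega$ of a full measure subset of $[0,1]$ into open intervals such that $T|_\omega$ is strictly monotone and $r$-times differentiable with continuous derivative for each $\omega\in\Omega$; $\Omega$ always denotes the maximal such partition (the one with the largest elements). $\mathcal{I}$ denotes the disjoint union of the closed intervals $\overline{\omega}$, $\omega\in\Omega$. $\mathcal{C}^\infty(\mathcal{I})$ is the set of $h:[0,1]\to\mathbb{C}$ such that, for each $\omega\in\Omega$, $h|_\omega$ is $\mathcal{C}^\infty$ and extends to a $\mathcal{C}^\infty$ function on $\overline{\omega}$. The transfer operator is defined pointwise, for $h:[0,1]\to\mathbb{C}$, by $\mathcal{L}_\varphi h=\sum_{\omega\in\Omega}(\varphi\cdot h)\circ(T|_\omega)^{-1}\cdot\mathbf{1}_{T\omega}$. $T$ is viewed as a map on $\mathcal{I}$: for an endpoint $a\in\partial\omega$, regarded as a point of $\overline\omega$, $T^k a$ denotes the one-sided limit of $T^k x$ as $x\to a$, $x\in\omega$, and $\varphi(T^k a)$ denotes the corresponding limit of $\varphi(T^k x)$. A point $a\in\mathcal{I}$ is a non-trivial discontinuity of $T$ if $a\in\partial\omega$ for some $\omega\in\Omega$ and $\{T^k a\}_{k=1}^\infty$ is an infinite set. $\Lambda^{\sup}(T,\varphi)$ is the maximum, over the (finitely many) non-trivial discontinuities $a$, of $$\Lambda^{\sup}(T,\varphi,a)=\limsup_{n\to\infty}\Big|\prod_{k=1}^n\varphi(T^k a)\Big|^{1/n},$$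 and $\Lambda^{\sup}(T,\varphi)=0$ if $T$ has no non-trivial discontinuity. The essential spectrum of a bounded operator $\mathcal{L}$ is the set of $z\in\mathbb{C}$ such that $z\,\mathrm{id}-\mathcal{L}$ is not Fredholm; the essential spectral radius is the supremum of $|z|$ over the essential spectrum.
   Formalization: Each branch of T is required to extend to a C^∞ function on the closed interval, as φ does; with C^∞ only on the open intervals the claim fails, e.g. if the slope at a fixed endpoint alternates between 3/2 and 3 on ever longer logarithmic scales. *)

theory Defs
  imports "HOL-Analysis.Analysis" "HOL-Probability.Essential_Supremum"
begin

text \<open>Functions on \<open>[0,1]\<close> are total functions on \<^typ>\<open>real\<close> whose values outside \<open>{0..1}\<close> are
  never used.\<close>

section \<open>Piecewise smooth functions and maps\<close>

text \<open>Derivatives are taken within \<open>S\<close>, so they are one-sided at the endpoints of a closed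
  interval.\<close>

definition smooth_within :: "real set \<Rightarrow> (real \<Rightarrow> 'a::real_normed_vector) \<Rightarrow> bool" where
  "smooth_within S f \<longleftrightarrow>
     (\<exists>D :: nat \<Rightarrow> real \<Rightarrow> 'a.
        (\<forall>x\<in>S. D 0 x = f x) \<and>
        (\<forall>n. \<forall>x\<in>S. (D n has_vector_derivative D (Suc n) x) (at x within S)))"

definition smooth_up_to_boundary :: "real set \<Rightarrow> (real \<Rightarrow> 'a::real_normed_vector) \<Rightarrow> bool" where
  "smooth_up_to_boundary \<omega> f \<longleftrightarrow> (\<exists>g. smooth_within (closure \<omega>) g \<and> (\<forall>x\<in>\<omega>. g x = f x))"

text \<open>\<open>T\<close> is regarded as a map on the disjoint union of the closed intervals \<open>closure \<omega>\<close>, hence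
  smoothness of a branch is smoothness up to the endpoints of \<open>\<omega>\<close>. Smoothness on the open interval
  alone would be too weak: at a fixed endpoint the slope could then alternate between 3/2 and 3 on
  longer and longer logarithmic scales, and the essential spectral radius cannot be made arbitrarily
  small for such a map, even if every discontinuity has a finite orbit.\<close>

definition smooth_monotone_partition :: "(real \<Rightarrow> real) \<Rightarrow> real set set \<Rightarrow> bool" where
  "smooth_monotone_partition T \<Omega> \<longleftrightarrow>
     finite \<Omega> \<and> disjoint \<Omega> \<and>
     (\<forall>\<omega>\<in>\<Omega>. \<exists>a b. 0 \<le> a \<and> a < b \<and> b \<le> 1 \<and> \<omega> = {a<..<b}) \<and>
     {0..1} - \<Union>\<Omega> \<in> null_sets lborel \<and>
     (\<forall>\<omega>\<in>\<Omega>. (strict_mono_on \<omega> T \<or> strict_antimono_on \<omega> T) \<and> smooth_up_to_boundary \<omega> T)"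

text \<open>\<open>T\<close> is a smooth piecewise monotone transformation, and \<open>\<Omega>\<close> is its coarsest partition, of
  which every other admissible partition is a refinement.\<close>

definition smooth_piecewise_monotone :: "(real \<Rightarrow> real) \<Rightarrow> real set set \<Rightarrow> bool" where
  "smooth_piecewise_monotone T \<Omega> \<longleftrightarrow>
     T ` {0..1} \<subseteq> {0..1} \<and> smooth_monotone_partition T \<Omega> \<and>
     (\<forall>\<Omega>'. smooth_monotone_partition T \<Omega>' \<longrightarrow> (\<forall>\<omega>'\<in>\<Omega>'. \<exists>\<omega>\<in>\<Omega>. \<omega>' \<subseteq> \<omega>))"

definition piecewise_smooth_functions :: "real set set \<Rightarrow> (real \<Rightarrow> complex) set" where
  "piecewise_smooth_functions \<Omega> = {h. \<forall>\<omega>\<in>\<Omega>. smooth_up_to_boundary \<omega> h}"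

text \<open>The derivative of \<open>T^n\<close> is considered at the points whose first \<open>n\<close> iterates meet no
  endpoint; these are all but finitely many points of \<open>[0,1]\<close>.\<close>

definition uniformly_expanding :: "(real \<Rightarrow> real) \<Rightarrow> real set set \<Rightarrow> bool" where
  "uniformly_expanding T \<Omega> \<longleftrightarrow>
     (\<exists>C>0. \<exists>r. 0 < r \<and> r < 1 \<and>
        (\<forall>n. \<forall>x\<in>{0..1}. (\<forall>k<n. (T ^^ k) x \<in> \<Union>\<Omega>) \<longrightarrow>
            \<bar>deriv (T ^^ n) x\<bar> \<ge> C * (1 / r) ^ n))"

definition transfer_operator ::
    "(real \<Rightarrow> real) \<Rightarrow> real set set \<Rightarrow> (real \<Rightarrow> complex) \<Rightarrow> (real \<Rightarrow> complex) \<Rightarrow> (real \<Rightarrow> complex)" where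
  "transfer_operator T \<Omega> \<phi> h = (\<lambda>y. \<Sum>\<omega>\<in>\<Omega>.
     if y \<in> T ` \<omega> then \<phi> (inv_into \<omega> T y) * h (inv_into \<omega> T y) else 0)"


section \<open>Orbits of discontinuities\<close>

text \<open>The boundary point \<open>a\<close> of \<open>\<omega>\<close>, regarded as a point of \<open>closure \<omega>\<close>, is encoded as the pair
  \<open>(\<omega>, a)\<close>: a common endpoint of two elements of \<open>\<Omega>\<close> has two one-sided orbits.\<close>

definition orbit_point :: "(real \<Rightarrow> real) \<Rightarrow> real set \<times> real \<Rightarrow> nat \<Rightarrow> real" where
  "orbit_point T = (\<lambda>(\<omega>, a) k. Lim (at a within \<omega>) (T ^^ k))"

definition weight_along_orbit ::
    "(real \<Rightarrow> real) \<Rightarrow> (real \<Rightarrow> complex) \<Rightarrow> real set \<times> real \<Rightarrow> nat \<Rightarrow> complex" where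
  "weight_along_orbit T \<phi> = (\<lambda>(\<omega>, a) k. Lim (at a within \<omega>) (\<lambda>x. \<phi> ((T ^^ k) x)))"

definition nontrivial_discontinuities ::
    "(real \<Rightarrow> real) \<Rightarrow> real set set \<Rightarrow> (real set \<times> real) set" where
  "nontrivial_discontinuities T \<Omega> =
     {(\<omega>, a). \<omega> \<in> \<Omega> \<and> a \<in> frontier \<omega> \<and> infinite (orbit_point T (\<omega>, a) ` {1..})}"

definition Lambda_sup_at ::
    "(real \<Rightarrow> real) \<Rightarrow> (real \<Rightarrow> complex) \<Rightarrow> real set \<times> real \<Rightarrow> ereal" where
  "Lambda_sup_at T \<phi> p =
     limsup (\<lambda>n. ereal (root n (cmod (\<Prod>k=1..n. weight_along_orbit T \<phi> p k))))"

definition Lambda_sup :: "(real \<Rightarrow> real) \<Rightarrow> real set set \<Rightarrow> (real \<Rightarrow> complex) \<Rightarrow> ereal" where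
  "Lambda_sup T \<Omega> \<phi> =
     (if nontrivial_discontinuities T \<Omega> = {} then 0
      else Max (Lambda_sup_at T \<phi> ` nontrivial_discontinuities T \<Omega>))"


section \<open>Banach spaces of essentially bounded functions\<close>

definition Linf_norm :: "(real \<Rightarrow> complex) \<Rightarrow> ereal" where
  "Linf_norm f = esssup (lebesgue_on {0..1}) (\<lambda>x. ereal (cmod (f x)))"

definition Linf :: "(real \<Rightarrow> complex) set" where
  "Linf = {f \<in> borel_measurable (lebesgue_on {0..1}). Linf_norm f < \<infinity>}"

text \<open>A subspace of \<open>L\<^sup>\<infinity>\<close> is represented by the set \<open>B\<close> of all representatives of its elements,
  which is closed under changes on null sets, and its norm by a seminorm \<open>N\<close> on \<open>B\<close> that vanishes
  exactly on the functions that are zero almost everywhere. The Banach space itself is the quotient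
  of \<open>B\<close> by these functions. As usual for Banach spaces, the inclusion into \<open>L\<^sup>\<infinity>\<close> is continuous.\<close>

definition banach_subspace_Linf ::
    "(real \<Rightarrow> complex) set \<Rightarrow> ((real \<Rightarrow> complex) \<Rightarrow> real) \<Rightarrow> bool" where
  "banach_subspace_Linf B N \<longleftrightarrow>
     B \<subseteq> Linf \<and>
     (\<forall>f\<in>B. \<forall>g. (AE x in lebesgue_on {0..1}. f x = g x) \<longrightarrow> g \<in> B) \<and>
     (\<lambda>x. 0) \<in> B \<and>
     (\<forall>f\<in>B. \<forall>g\<in>B. (\<lambda>x. f x + g x) \<in> B) \<and>
     (\<forall>c. \<forall>f\<in>B. (\<lambda>x. c * f x) \<in> B) \<and>
     (\<forall>f\<in>B. 0 \<le> N f) \<and>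
     (\<forall>f\<in>B. N f = 0 \<longleftrightarrow> (AE x in lebesgue_on {0..1}. f x = 0)) \<and>
     (\<forall>f\<in>B. \<forall>g\<in>B. N (\<lambda>x. f x + g x) \<le> N f + N g) \<and>
     (\<forall>c. \<forall>f\<in>B. N (\<lambda>x. c * f x) = cmod c * N f) \<and>
     (\<forall>F :: nat \<Rightarrow> real \<Rightarrow> complex.
        (\<forall>n. F n \<in> B) \<and>
        (\<forall>e>0. \<exists>M. \<forall>m\<ge>M. \<forall>n\<ge>M. N (\<lambda>x. F m x - F n x) < e) \<longrightarrow>
        (\<exists>f\<in>B. (\<lambda>n. N (\<lambda>x. F n x - f x)) \<longlonglongrightarrow> 0)) \<and>
     (\<exists>K::real. \<forall>f\<in>B. Linf_norm f \<le> ereal (K * N f))"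

definition bounded_operator ::
    "(real \<Rightarrow> complex) set \<Rightarrow> ((real \<Rightarrow> complex) \<Rightarrow> real) \<Rightarrow>
     ((real \<Rightarrow> complex) \<Rightarrow> (real \<Rightarrow> complex)) \<Rightarrow> bool" where
  "bounded_operator B N A \<longleftrightarrow>
     (\<forall>f\<in>B. A f \<in> B) \<and>
     (\<forall>f\<in>B. \<forall>g\<in>B. \<forall>c. N (\<lambda>x. A (\<lambda>y. f y + c * g y) x - (A f x + c * A g x)) = 0) \<and>
     (\<exists>K. \<forall>f\<in>B. N (A f) \<le> K * N f)"

text \<open>The quotient \<open>U / V\<close> is finite-dimensional.\<close>

definition finite_codim :: "(real \<Rightarrow> complex) set \<Rightarrow> (real \<Rightarrow> complex) set \<Rightarrow> bool" where
  "finite_codim U V \<longleftrightarrow>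
     (\<exists>F. finite F \<and> F \<subseteq> U \<and> (\<forall>u\<in>U. \<exists>c. (\<lambda>x. u x - (\<Sum>f\<in>F. c f * f x)) \<in> V))"

text \<open>Finite-dimensional kernel and cokernel, both taken modulo functions that vanish almost
  everywhere. For a bounded operator the range is then automatically closed.\<close>

definition fredholm ::
    "(real \<Rightarrow> complex) set \<Rightarrow> ((real \<Rightarrow> complex) \<Rightarrow> real) \<Rightarrow>
     ((real \<Rightarrow> complex) \<Rightarrow> (real \<Rightarrow> complex)) \<Rightarrow> bool" where
  "fredholm B N A \<longleftrightarrow>
     bounded_operator B N A \<and>
     finite_codim {f \<in> B. N (A f) = 0} {f \<in> B. N f = 0} \<and>
     finite_codim B {f \<in> B. \<exists>g\<in>B. N (\<lambda>x. f x - A g x) = 0}"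

definition essential_spectrum ::
    "(real \<Rightarrow> complex) set \<Rightarrow> ((real \<Rightarrow> complex) \<Rightarrow> real) \<Rightarrow>
     ((real \<Rightarrow> complex) \<Rightarrow> (real \<Rightarrow> complex)) \<Rightarrow> complex set" where
  "essential_spectrum B N A = {z. \<not> fredholm B N (\<lambda>f x. z * f x - A f x)}"

definition essential_spectral_radius ::
    "(real \<Rightarrow> complex) set \<Rightarrow> ((real \<Rightarrow> complex) \<Rightarrow> real) \<Rightarrow>
     ((real \<Rightarrow> complex) \<Rightarrow> (real \<Rightarrow> complex)) \<Rightarrow> ereal" where
  "essential_spectral_radius B N A = (SUP z\<in>essential_spectrum B N A. ereal (cmod z))"

end

theory Submission
  imports Defs
begin

text \<open>The transfer operator \<open>L\<close> moves a jump of a function, or of one of its derivatives,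
  from a point \<open>p\<close> to \<open>T p\<close>, and multiplies a jump of the derivative of
  order \<open>j\<close>, up to sign, by \<open>\<phi> p / T' p ^ j\<close>, apart from
  contributions to jumps of derivatives of higher order. It creates new jumps only at the finitely
  many images of end points of the partition, and these jumps then travel along the orbits of the
  discontinuities. The weight \<open>\<phi>\<close> along these orbits, and hence
  \<open>Lambda_sup\<close>, is therefore the only obstruction to a small essential spectral
  radius: everything else is either of finite rank or is contracted by taking many derivatives,
  since \<open>T\<close> expands.

  The Banach space makes the jumps visible. For a large \<open>r\<close>, a function is described
  by its derivative \<open>G\<close> of order \<open>r\<close>, which is bounded and continuous
  off a countable set, and by the jumps of its lower derivatives at the points of a set
  \<open>P\<close>, of which a weighted sum is finite; the function is obtained from these data by
  integrating \<open>r\<close> times and adding the jumps (\<open>glue\<close>). A function that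
  vanishes almost everywhere has vanishing data (\<open>glue_eq_0_imp\<close>), so that the
  weighted sum of the jumps plus the weighted supremum of \<open>G\<close> is a norm on functions.

  Let \<open>\<Lambda>'\<close> lie strictly between \<open>Lambda_sup\<close> and
  \<open>\<Lambda>\<close>. Two suprema over orbits turn asymptotic assumptions into estimates for
  a single step. Where the products of \<open>|\<phi>| / \<Lambda>'\<close> along an orbit are
  bounded, their supremum \<open>w\<close> satisfies \<open>|\<phi> x| * w (T x) \<le> \<Lambda>'
  * w x\<close>. Likewise the supremum \<open>u\<close> of the products of \<open>1 / (\<theta> *
  |T'|)\<close>, where \<open>\<theta>\<close> is the rate of expansion, satisfies \<open>u (T x)
  / |T' x| \<le> \<theta> * u x\<close>. The jump of the derivative of order \<open>j\<close> at
  \<open>p\<close> gets the weight \<open>w p * (\<eta> * u p) ^ j\<close> and the top derivative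
  the weight \<open>(\<eta> * u) ^ r\<close>. Then each atom, that is, a function with a single
  jump, is contracted by the factor \<open>\<Lambda>'\<close>; the contributions to jumps of
  higher derivatives and to the top derivative carry additional factors \<open>\<eta>\<close>, and
  a small \<open>\<eta>\<close> makes their sum at most \<open>\<Lambda> - \<Lambda>'\<close>. The
  jumps on finite orbits and the new jumps at images of end points span a space of finite
  dimension. On functions without jumps, the term of top order is contracted by at most
  \<open>card \<Omega> * sup |\<phi>| * \<theta> ^ r\<close>, which is smaller than
  \<open>\<Lambda>'\<close> for large \<open>r\<close>, and the terms of lower order are
  approximated by operators of finite rank, because the lower derivatives are Lipschitz
  continuous.

  Altogether \<open>L\<close> is, up to an operator of finite rank, bounded by
  \<open>\<Lambda>\<close> (\<open>quasi_compact\<close>), and a Neumann series shows that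
  \<open>z - L\<close> is Fredholm for \<open>|z| > \<Lambda>\<close>
  (\<open>fredholm_if_contraction_plus_finite_rank\<close>).\<close>

section \<open>Calculus off a countable set\<close>

text \<open>If \<open>F b < F a\<close>, some value \<open>y\<close> between the two is attained neither at
  \<open>a\<close> or \<open>b\<close> nor on the countable set \<open>Z\<close>. At the last
  point where \<open>F \<ge> y\<close> the function has the value \<open>y\<close> and a positive
  derivative, so it would exceed \<open>y\<close> again to the right.\<close>

lemma le_if_pos_deriv_off_countable:
  fixes F :: "real \<Rightarrow> real"
  assumes "a \<le> b" and cont: "continuous_on {a..b} F" and Z: "countable Z"
    and der: "\<And>x. x \<in> {a<..<b} - Z \<Longrightarrow> \<exists>l>0. (F has_real_derivative l) (at x)"
  shows "F a \<le> F b"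
proof (rule ccontr)
  assume "\<not> F a \<le> F b"
  hence lt: "F b < F a" by simp
  have "uncountable {F b<..<F a}" using lt by (simp add: uncountable_open_interval)
  moreover have "countable (F ` (Z \<union> {a,b}))" using Z by simp
  ultimately obtain y where y: "y \<in> {F b<..<F a}" "y \<notin> F ` (Z \<union> {a,b})"
    by (meson countable_subset subsetI)
  define S where "S = {x\<in>{a..b}. F x \<ge> y}"
  have "closed S"
    unfolding S_def by (intro continuous_on_closed_Collect_le continuous_intros) (use cont in auto)
  have "a \<in> S" using y \<open>a \<le> b\<close> by (auto simp: S_def)
  have bdd: "bdd_above S" by (auto simp: S_def)
  define x where "x = Sup S"
  have xS: "x \<in> S" unfolding x_def
    using closed_contains_Sup[OF _ bdd \<open>closed S\<close>] \<open>a \<in> S\<close> by auto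
  have xb: "x \<in> {a..b}" using xS by (auto simp: S_def)
  have "x \<noteq> b" using xS y by (auto simp: S_def)
  hence "x < b" using xb by simp
  have up: "F t < y" if "t \<in> {x<..b}" for t
    using that cSup_upper[OF _ bdd, of t] xb unfolding x_def[symmetric]
    by (force simp: S_def)
  have "F x \<le> y"
  proof (rule tendsto_upperbound[of F _ "at_right x"])
    have "(F \<longlongrightarrow> F x) (at x within {a..b})" using cont xb by (auto simp: continuous_on_def)
    thus "(F \<longlongrightarrow> F x) (at_right x)"
      using at_within_Icc_at_right[of x b] \<open>x < b\<close> xb
      by (metis atLeastAtMost_iff atLeastatMost_subset_iff order_refl tendsto_within_subset)
    show "\<forall>\<^sub>F t in at_right x. F t \<le> y"
      unfolding eventually_at_right[OF \<open>x < b\<close>] using up \<open>x < b\<close> by (auto intro!: exI[of _ b] less_imp_le)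
  qed simp
  hence Fx: "F x = y" using xS by (auto simp: S_def)
  hence "x \<in> {a<..<b} - Z" using y xb \<open>x < b\<close> by (auto simp: less_le)
  then obtain l where "l > 0" "(F has_real_derivative l) (at x)" using der by blast
  then obtain d where d: "d > 0" "\<And>h. h > 0 \<Longrightarrow> h < d \<Longrightarrow> F x < F (x + h)"
    using DERIV_pos_inc_right by blast
  define h where "h = min (d/2) (b - x)"
  have "h > 0" "h < d" "x + h \<in> {x<..b}" using d \<open>x < b\<close> by (auto simp: h_def min_def)
  with d(2)[of h] up[of "x + h"] Fx show False by auto
qed

text \<open>Adding a function of small positive slope makes the derivative positive.\<close>

lemma zero_deriv_off_countable_real:
  fixes F :: "real \<Rightarrow> real"
  assumes "a \<le> b" and cont: "continuous_on {a..b} F" and Z: "countable Z"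
    and der: "\<And>x. x \<in> {a<..<b} - Z \<Longrightarrow> (F has_real_derivative 0) (at x)"
  shows "F a = F b"
proof -
  have *: "H a \<le> H b" if cont: "continuous_on {a..b} H"
    and der: "\<And>x. x \<in> {a<..<b} - Z \<Longrightarrow> (H has_real_derivative 0) (at x)" for H :: "real \<Rightarrow> real"
  proof (rule field_le_epsilon)
    fix e :: real assume "e > 0"
    define c where "c = e / (b - a + 1)"
    have c: "c > 0" "c * (b - a) \<le> e" using \<open>e > 0\<close> \<open>a \<le> b\<close> by (auto simp: c_def field_simps)
    have "H a + c * a \<le> H b + c * b"
    proof (rule le_if_pos_deriv_off_countable[OF \<open>a \<le> b\<close> _ Z])
      show "continuous_on {a..b} (\<lambda>x. H x + c * x)" by (intro continuous_intros cont)
      fix x assume "x \<in> {a<..<b} - Z"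
      from der[OF this] have "((\<lambda>x. H x + c * x) has_real_derivative c) (at x)"
        by (auto intro!: derivative_eq_intros)
      thus "\<exists>l>0. ((\<lambda>x. H x + c * x) has_real_derivative l) (at x)" using c by blast
    qed
    thus "H a \<le> H b + e" using c by (simp add: algebra_simps)
  qed
  have "F a \<le> F b" by (rule *[OF cont der])
  moreover have "- F a \<le> - F b"
  proof (rule *)
    show "continuous_on {a..b} (\<lambda>x. - F x)" by (intro continuous_intros cont)
    fix x assume "x \<in> {a<..<b} - Z"
    from der[OF this] show "((\<lambda>x. - F x) has_real_derivative 0) (at x)"
      by (auto intro!: derivative_eq_intros)
  qed
  ultimately show ?thesis by simp
qed

lemma zero_deriv_off_countable:
  fixes F :: "real \<Rightarrow> complex"
  assumes "a \<le> b" and cont: "continuous_on {a..b} F" and Z: "countable Z"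
    and der: "\<And>x. x \<in> {a<..<b} - Z \<Longrightarrow> (F has_vector_derivative 0) (at x)"
  shows "F a = F b"
proof -
  have "Re (F a) = Re (F b)"
  proof (rule zero_deriv_off_countable_real[OF \<open>a \<le> b\<close> _ Z])
    show "continuous_on {a..b} (\<lambda>x. Re (F x))" by (intro continuous_intros cont)
    fix x assume "x \<in> {a<..<b} - Z"
    from bounded_linear.has_vector_derivative[OF bounded_linear_Re der[OF this]]
    show "((\<lambda>x. Re (F x)) has_real_derivative 0) (at x)" by (simp add: has_real_derivative_iff_has_vector_derivative)
  qed
  moreover have "Im (F a) = Im (F b)"
  proof (rule zero_deriv_off_countable_real[OF \<open>a \<le> b\<close> _ Z])
    show "continuous_on {a..b} (\<lambda>x. Im (F x))" by (intro continuous_intros cont)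
    fix x assume "x \<in> {a<..<b} - Z"
    from bounded_linear.has_vector_derivative[OF bounded_linear_Im der[OF this]]
    show "((\<lambda>x. Im (F x)) has_real_derivative 0) (at x)" by (simp add: has_real_derivative_iff_has_vector_derivative)
  qed
  ultimately show ?thesis by (simp add: complex_eq_iff)
qed

text \<open>The class of functions that serve as derivatives of top order. It is closed under uniform limits
  and under composition with diffeomorphisms, indefinite integrals of its members are
  differentiable off a countable set, and a member that vanishes almost everywhere on an open set
  vanishes there off a countable set.\<close>

definition tame_on :: "real set \<Rightarrow> (real \<Rightarrow> complex) \<Rightarrow> bool" where
  "tame_on S f \<longleftrightarrow> bounded (f ` S) \<and> (\<exists>Z. countable Z \<and> (\<forall>x\<in>S - Z. isCont f x))"

lemma tame_on_subset: "tame_on S f \<Longrightarrow> R \<subseteq> S \<Longrightarrow> tame_on R f"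
  unfolding tame_on_def by (meson bounded_subset image_mono Diff_mono subset_eq order_refl)

lemma tame_onI:
  assumes "\<And>x. x \<in> S \<Longrightarrow> cmod (f x) \<le> M" "countable Z" "\<And>x. x \<in> S \<Longrightarrow> x \<notin> Z \<Longrightarrow> isCont f x"
  shows "tame_on S f"
  unfolding tame_on_def using assms by (auto simp: bounded_iff intro!: exI[of _ M] exI[of _ Z])

lemma tame_on_bounded: "tame_on S f \<Longrightarrow> \<exists>M\<ge>0. \<forall>x\<in>S. cmod (f x) \<le> M"
  unfolding tame_on_def bounded_iff by (metis imageI norm_ge_zero order_trans nle_le)

lemma tame_on_cont: "tame_on S f \<Longrightarrow> \<exists>Z. countable Z \<and> (\<forall>x\<in>S. x \<notin> Z \<longrightarrow> isCont f x)"
  unfolding tame_on_def by blast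

lemma tame_on_const [simp]: "tame_on S (\<lambda>x. c)"
  by (rule tame_onI[of _ _ "cmod c" "{}"]) auto

lemma tame_on_add: assumes "tame_on S f" "tame_on S h" shows "tame_on S (\<lambda>x. f x + h x)"
proof -
  obtain M where f1: "M \<ge> 0" "\<And>x. x \<in> S \<Longrightarrow> cmod (f x) \<le> M"
    using tame_on_bounded[OF assms(1)] by blast
  obtain Z where f2: "countable Z" "\<And>x. x \<in> S \<Longrightarrow> x \<notin> Z \<Longrightarrow> isCont f x"
    using tame_on_cont[OF assms(1)] by blast
  obtain M' where h1: "M' \<ge> 0" "\<And>x. x \<in> S \<Longrightarrow> cmod (h x) \<le> M'"
    using tame_on_bounded[OF assms(2)] by blast
  obtain Z' where h2: "countable Z'" "\<And>x. x \<in> S \<Longrightarrow> x \<notin> Z' \<Longrightarrow> isCont h x"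
    using tame_on_cont[OF assms(2)] by blast
  show ?thesis
    by (intro tame_onI[of _ _ "M + M'" "Z \<union> Z'"]) (use f1 f2 h1 h2 in \<open>auto intro!: norm_triangle_mono continuous_intros\<close>)
qed

lemma tame_on_mult: assumes "tame_on S f" "tame_on S h" shows "tame_on S (\<lambda>x. f x * h x)"
proof -
  obtain M where f1: "M \<ge> 0" "\<And>x. x \<in> S \<Longrightarrow> cmod (f x) \<le> M"
    using tame_on_bounded[OF assms(1)] by blast
  obtain Z where f2: "countable Z" "\<And>x. x \<in> S \<Longrightarrow> x \<notin> Z \<Longrightarrow> isCont f x"
    using tame_on_cont[OF assms(1)] by blast
  obtain M' where h1: "M' \<ge> 0" "\<And>x. x \<in> S \<Longrightarrow> cmod (h x) \<le> M'"
    using tame_on_bounded[OF assms(2)] by blast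
  obtain Z' where h2: "countable Z'" "\<And>x. x \<in> S \<Longrightarrow> x \<notin> Z' \<Longrightarrow> isCont h x"
    using tame_on_cont[OF assms(2)] by blast
  show ?thesis
    by (intro tame_onI[of _ _ "M * M'" "Z \<union> Z'"]) (use f1 f2 h1 h2 in \<open>auto simp: norm_mult intro!: mult_mono continuous_intros\<close>)
qed

lemma tame_on_sum: "finite I \<Longrightarrow> (\<And>i. i \<in> I \<Longrightarrow> tame_on S (f i)) \<Longrightarrow> tame_on S (\<lambda>x. \<Sum>i\<in>I. f i x)"
  by (induction I rule: finite_induct) (auto intro: tame_on_add)

lemma tame_on_cmult: "tame_on S f \<Longrightarrow> tame_on S (\<lambda>x. c * f x)"
  by (rule tame_on_mult) auto

lemma tame_on_cutoff_measurable:
  assumes "tame_on {a<..<b} f"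
  shows "(\<lambda>x. if x \<in> {a<..<b} then f x else 0) \<in> borel_measurable borel"
proof -
  obtain Z where Z: "countable Z" "\<And>x. x \<in> {a<..<b} \<Longrightarrow> x \<notin> Z \<Longrightarrow> isCont f x"
    using tame_on_cont[OF assms] by blast
  show ?thesis
  proof (rule borel_measurable_continuous_countable_exceptions[of "Z \<union> {a,b}"])
    show "countable (Z \<union> {a,b})" using Z by simp
    let ?g = "\<lambda>x. if x \<in> {a<..<b} then f x else 0"
    have "isCont ?g x" if "x \<notin> Z \<union> {a,b}" for x
    proof (cases "x \<in> {a<..<b}")
      case True
      hence "isCont f x" using Z that by auto
      moreover have "\<forall>\<^sub>F y in nhds x. ?g y = f y"
        using eventually_nhds_in_open[of "{a<..<b}" x] True by (auto elim: eventually_mono)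
      ultimately show ?thesis using isCont_cong by fastforce
    next
      case False
      have "x \<in> - {a..b}" using False that by auto
      hence "\<forall>\<^sub>F y in nhds x. y \<in> - {a..b}"
        by (intro eventually_nhds_in_open) auto
      hence "\<forall>\<^sub>F y in nhds x. ?g y = 0" by eventually_elim auto
      thus ?thesis using isCont_cong[of ?g "\<lambda>_. 0" x] by simp
    qed
    thus "continuous_on (- (Z \<union> {a,b})) ?g"
      by (intro continuous_at_imp_continuous_on) blast
  qed
qed

lemma tame_on_integrable:
  assumes "tame_on {a<..<b} f"
  shows "f integrable_on {a..b}"
proof -
  let ?g = "\<lambda>x. if x \<in> {a<..<b} then f x else 0"
  obtain M where M: "M \<ge> 0" "\<And>x. x \<in> {a<..<b} \<Longrightarrow> cmod (f x) \<le> M"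
    using tame_on_bounded[OF assms] by blast
  have "?g integrable_on {a..b}"
  proof (rule measurable_bounded_by_integrable_imp_integrable)
    show "?g \<in> borel_measurable (lebesgue_on {a..b})"
      using tame_on_cutoff_measurable[OF assms] by (metis borel_measurable_if_D measurable_completion measurable_lborel2 measurable_restrict_space1)
    show "(\<lambda>x. M) integrable_on {a..b}" by (rule integrable_const_ivl)
    show "\<And>x. x \<in> {a..b} \<Longrightarrow> norm (?g x) \<le> M" using M by auto
  qed auto
  thus ?thesis
    by (rule integrable_spike[of _ _ "{a,b}"]) auto
qed

lemma tame_on_integral_bound:
  assumes f: "tame_on {a<..<b} f" and M: "\<And>x. x \<in> {a<..<b} \<Longrightarrow> cmod (f x) \<le> M" and "a \<le> b"
  shows "cmod (integral {a..b} f) \<le> M * (b - a)"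
proof (cases "a < b")
  case True
  obtain c where "c \<in> {a<..<b}" using dense[OF True] by auto
  hence "M \<ge> 0" using M[of c] norm_ge_zero[of "f c"] by linarith
  let ?g = "\<lambda>x. if x \<in> {a<..<b} then f x else 0"
  have eq: "integral {a..b} f = integral {a..b} ?g"
    by (rule integral_spike[of "{a,b}"]) auto
  have "?g integrable_on {a..b}"
    by (rule integrable_spike[OF tame_on_integrable[OF f], of "{a,b}"]) auto
  hence "norm (integral (cbox a b) ?g) \<le> M * Henstock_Kurzweil_Integration.content (cbox a b)"
    by (intro has_integral_bound[of M ?g]) (use M \<open>M \<ge> 0\<close> in \<open>auto\<close>)
  thus ?thesis using eq True by simp
next
  case False thus ?thesis using assms by simp
qed

lemma integral_split_diff:
  fixes f :: "real \<Rightarrow> complex"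
  assumes "tame_on {a<..<b} f" "a \<le> x" "x \<le> y" "y \<le> b"
  shows "integral {a..y} f - integral {a..x} f = integral {x..y} f"
proof -
  have "f integrable_on {a..y}"
    by (rule tame_on_integrable, rule tame_on_subset[OF assms(1)]) (use assms in auto)
  thus ?thesis
    using Henstock_Kurzweil_Integration.integral_combine[of a x y f] assms by (auto simp: algebra_simps)
qed

lemma tame_on_integral_lipschitz:
  assumes f: "tame_on {a<..<b} f" and M: "\<And>x. x \<in> {a<..<b} \<Longrightarrow> cmod (f x) \<le> M"
    and x: "x \<in> {a..b}" and y: "y \<in> {a..b}"
  shows "cmod (integral {a..y} f - integral {a..x} f) \<le> M * \<bar>y - x\<bar>"
proof -
  have *: "cmod (integral {a..y} f - integral {a..x} f) \<le> M * (y - x)" if "a \<le> x" "x \<le> y" "y \<le> b" for x y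
  proof -
    have "tame_on {x<..<y} f" by (rule tame_on_subset[OF f]) (use that in auto)
    hence "cmod (integral {x..y} f) \<le> M * (y - x)"
      by (rule tame_on_integral_bound) (use M that in auto)
    thus ?thesis using integral_split_diff[OF f that] by simp
  qed
  show ?thesis
    using *[of x y] *[of y x] x y by (cases "x \<le> y") (auto simp: norm_minus_commute)
qed

lemma tame_on_integral_continuous:
  assumes f: "tame_on {a<..<b} f"
  shows "continuous_on {a..b} (\<lambda>x. integral {a..x} f)"
  by (rule indefinite_integral_continuous_1[OF tame_on_integrable[OF f]])

lemma integral_deriv_at_cont:
  assumes f: "tame_on {a<..<b} f" and x: "x \<in> {a<..<b}" and c: "isCont f x"
  shows "((\<lambda>u. integral {a..u} f) has_vector_derivative f x) (at x)"
proof -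
  have "((\<lambda>u. integral {a..u} f) has_vector_derivative f x) (at x within ({a..b} - {}))"
    by (rule integral_has_vector_derivative_continuous_at[OF tame_on_integrable[OF f]])
      (use x c in \<open>auto intro: continuous_at_imp_continuous_at_within\<close>)
  thus ?thesis using x by (simp add: at_within_Icc_at)
qed

text \<open>The difference between \<open>F\<close> and the indefinite integral of \<open>f\<close> has
  derivative zero off a countable set.\<close>

lemma FTC_off_countable:
  fixes F f :: "real \<Rightarrow> complex"
  assumes "a \<le> b" and f: "tame_on {a<..<b} f" and cont: "continuous_on {a..b} F" and Z: "countable Z"
    and der: "\<And>x. x \<in> {a<..<b} - Z \<Longrightarrow> (F has_vector_derivative f x) (at x)"
  shows "integral {a..b} f = F b - F a"
proof -
  obtain Z' where Z': "countable Z'" "\<And>x. x \<in> {a<..<b} \<Longrightarrow> x \<notin> Z' \<Longrightarrow> isCont f x"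
    using tame_on_cont[OF f] by blast
  have "F a - integral {a..a} f = F b - integral {a..b} f"
  proof (rule zero_deriv_off_countable[OF \<open>a \<le> b\<close>])
    show "continuous_on {a..b} (\<lambda>x. F x - integral {a..x} f)"
      by (intro continuous_intros cont tame_on_integral_continuous f)
    show "countable (Z \<union> Z')" using Z Z' by simp
    fix x assume x: "x \<in> {a<..<b} - (Z \<union> Z')"
    have "((\<lambda>x. F x - integral {a..x} f) has_vector_derivative f x - f x) (at x)"
      by (intro has_vector_derivative_diff der integral_deriv_at_cont[OF f]) (use x Z' in auto)
    thus "((\<lambda>x. F x - integral {a..x} f) has_vector_derivative 0) (at x)" by simp
  qed
  thus ?thesis by (simp add: algebra_simps)
qed

section \<open>Finite-rank perturbations of contractions\<close>

locale Linf_banach =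
  fixes B :: "(real \<Rightarrow> complex) set" and N :: "(real \<Rightarrow> complex) \<Rightarrow> real"
  assumes banach: "banach_subspace_Linf B N"
begin

lemma zero_mem: "(\<lambda>x. 0) \<in> B"
  and add_mem: "f \<in> B \<Longrightarrow> h \<in> B \<Longrightarrow> (\<lambda>x. f x + h x) \<in> B"
  and scale_mem: "f \<in> B \<Longrightarrow> (\<lambda>x. c * f x) \<in> B"
  and norm_nonneg: "f \<in> B \<Longrightarrow> 0 \<le> N f"
  and norm_triangle: "f \<in> B \<Longrightarrow> h \<in> B \<Longrightarrow> N (\<lambda>x. f x + h x) \<le> N f + N h"
  and norm_scale: "f \<in> B \<Longrightarrow> N (\<lambda>x. c * f x) = cmod c * N f"
  using banach unfolding banach_subspace_Linf_def by auto

lemma complete: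
  assumes "\<And>n. F n \<in> B" "\<And>e. e > 0 \<Longrightarrow> \<exists>M. \<forall>m\<ge>M. \<forall>n\<ge>M. N (\<lambda>x. F m x - F n x) < e"
  obtains f where "f \<in> B" "(\<lambda>n. N (\<lambda>x. F n x - f x)) \<longlonglongrightarrow> 0"
proof -
  have "(\<forall>n. F n \<in> B) \<and> (\<forall>e>0. \<exists>M. \<forall>m\<ge>M. \<forall>n\<ge>M. N (\<lambda>x. F m x - F n x) < e) \<longrightarrow>
     (\<exists>f\<in>B. (\<lambda>n. N (\<lambda>x. F n x - f x)) \<longlonglongrightarrow> 0)"
    using banach unfolding banach_subspace_Linf_def by simp
  thus thesis using assms that by blast
qed

lemma comb_mem: "f \<in> B \<Longrightarrow> h \<in> B \<Longrightarrow> (\<lambda>x. f x + a * h x) \<in> B"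
  using add_mem scale_mem by blast

lemma diff_mem: "f \<in> B \<Longrightarrow> h \<in> B \<Longrightarrow> (\<lambda>x. f x - h x) \<in> B"
  using comb_mem[of f h "-1"] by simp

lemma norm_zero: "N (\<lambda>x. 0) = 0"
  using norm_scale[OF zero_mem, of 0] by simp

lemma norm_diff_le: "f \<in> B \<Longrightarrow> h \<in> B \<Longrightarrow> N (\<lambda>x. f x - h x) \<le> N f + N h"
  using norm_triangle[of f "\<lambda>x. (-1) * h x"] scale_mem[of h "-1"] norm_scale[of h "-1"] by simp

lemma sum_mem: "finite I \<Longrightarrow> (\<And>i. i \<in> I \<Longrightarrow> f i \<in> B) \<Longrightarrow> (\<lambda>x. \<Sum>i\<in>I. c i * f i x) \<in> B"
  by (induction I rule: finite_induct) (simp_all add: zero_mem add_mem scale_mem)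

lemma norm_sum: "finite I \<Longrightarrow> (\<And>i. i \<in> I \<Longrightarrow> f i \<in> B) \<Longrightarrow>
    N (\<lambda>x. \<Sum>i\<in>I. c i * f i x) \<le> (\<Sum>i\<in>I. cmod (c i) * N (f i))"
proof (induction I rule: finite_induct)
  case empty thus ?case by (simp add: norm_zero)
next
  case (insert i I)
  have "N (\<lambda>x. c i * f i x + (\<Sum>i\<in>I. c i * f i x)) \<le> N (\<lambda>x. c i * f i x) + N (\<lambda>x. \<Sum>i\<in>I. c i * f i x)"
    by (rule norm_triangle) (use insert in \<open>auto intro: scale_mem sum_mem\<close>)
  with insert show ?case by (simp add: norm_scale)
qed

definition null_functions :: "(real \<Rightarrow> complex) set" where
  "null_functions = {f \<in> B. N f = 0}"

lemma null_comb: assumes "f \<in> null_functions" "h \<in> null_functions" shows "(\<lambda>x. f x + a * h x) \<in> null_functions"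
proof -
  have m: "f \<in> B" "h \<in> B" "N f = 0" "N h = 0" using assms by (auto simp: null_functions_def)
  have "N (\<lambda>x. f x + a * h x) \<le> 0"
    using norm_triangle[OF m(1) scale_mem[OF m(2)], of a] norm_scale[OF m(2), of a] m by simp
  thus ?thesis using m comb_mem[OF m(1,2), of a] norm_nonneg[of "\<lambda>x. f x + a * h x"]
    by (auto simp: null_functions_def)
qed

text \<open>Operators on the space are defined on functions rather than on classes of functions, so the
  seminorm has to be transferred along equality almost everywhere.\<close>

lemma norm_null_cong:
  assumes "f \<in> B" "h \<in> B" "N (\<lambda>x. f x - h x) = 0" shows "N f \<le> N h"
  using norm_triangle[OF diff_mem[OF assms(1,2)] assms(2)] assms(3) by simp

text \<open>A subspace that is spanned, modulo null functions, by finitely many functions which need not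
  belong to it is also spanned by finitely many of its own elements: this is the elimination step
  behind ``a subspace of a finite-dimensional space is finite-dimensional''.\<close>

lemma finite_codim_null_if_spanned:
  assumes "finite I"
    and "\<And>f h a. f \<in> U \<Longrightarrow> h \<in> U \<Longrightarrow> (\<lambda>x. f x + a * h x) \<in> U"
    and "null_functions \<subseteq> U"
    and "\<And>u. u \<in> U \<Longrightarrow> \<exists>c. (\<lambda>x. u x - (\<Sum>i\<in>I. c i * e i x)) \<in> null_functions"
  shows "finite_codim U null_functions"
  using assms
proof (induction I arbitrary: U rule: finite_induct)
  case empty
  thus ?case unfolding finite_codim_def by (intro exI[of _ "{}"]) auto
next
  case (insert i I)
  define V where "V = {u \<in> U. \<exists>c. (\<lambda>x. u x - (\<Sum>i\<in>I. c i * e i x)) \<in> null_functions}"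
  have V: "(\<lambda>x. f x + a * h x) \<in> V" if fhV: "f \<in> V" "h \<in> V" for f h a
  proof -
    obtain c c' where c: "(\<lambda>x. f x - (\<Sum>i\<in>I. c i * e i x)) \<in> null_functions"
       "(\<lambda>x. h x - (\<Sum>i\<in>I. c' i * e i x)) \<in> null_functions" and fh: "f \<in> U" "h \<in> U"
      using fhV unfolding V_def by blast
    have "(\<lambda>x. (f x + a * h x) - (\<Sum>i\<in>I. (c i + a * c' i) * e i x)) =
        (\<lambda>x. (f x - (\<Sum>i\<in>I. c i * e i x)) + a * (h x - (\<Sum>i\<in>I. c' i * e i x)))"
    proof
      fix x
      have "(\<Sum>i\<in>I. (c i + a * c' i) * e i x) = (\<Sum>i\<in>I. c i * e i x) + a * (\<Sum>i\<in>I. c' i * e i x)"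
        by (simp add: distrib_right sum.distrib sum_distrib_left mult.assoc)
      thus "(f x + a * h x) - (\<Sum>i\<in>I. (c i + a * c' i) * e i x) =
          (f x - (\<Sum>i\<in>I. c i * e i x)) + a * (h x - (\<Sum>i\<in>I. c' i * e i x))"
        by (simp add: right_diff_distrib)
    qed
    hence "(\<lambda>x. (f x + a * h x) - (\<Sum>i\<in>I. (c i + a * c' i) * e i x)) \<in> null_functions"
      using null_comb[OF c, of a] by (simp only:)
    thus ?thesis using insert.prems(1)[OF fh] unfolding V_def mem_Collect_eq
      by (intro conjI exI[of _ "\<lambda>i. c i + a * c' i"])
  qed
  have nullV: "null_functions \<subseteq> V"
    using insert.prems(2) by (auto simp: V_def intro!: exI[of _ "\<lambda>_. 0"])
  have fcV: "finite_codim V null_functions"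
    by (rule insert.IH) (use V nullV in \<open>auto simp: V_def\<close>)
  show ?case
  proof (cases "U \<subseteq> V")
    case True
    hence "V = U" by (auto simp: V_def)
    thus ?thesis using fcV by simp
  next
    case False
    then obtain u0 where u0: "u0 \<in> U" "u0 \<notin> V" by auto
    obtain c0 where c0: "(\<lambda>x. u0 x - (\<Sum>j\<in>insert i I. c0 j * e j x)) \<in> null_functions"
      using insert.prems(3)[OF u0(1)] by auto
    have "c0 i \<noteq> 0"
    proof
      assume "c0 i = 0"
      hence "(\<lambda>x. u0 x - (\<Sum>j\<in>I. c0 j * e j x)) \<in> null_functions"
        using c0 insert.hyps by simp
      thus False using u0 by (auto simp: V_def)
    qed
    obtain F where F: "finite F" "F \<subseteq> V" "\<And>v. v \<in> V \<Longrightarrow> \<exists>c. (\<lambda>x. v x - (\<Sum>f\<in>F. c f * f x)) \<in> null_functions"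
      using fcV unfolding finite_codim_def by blast
    have "u0 \<notin> F" using F u0 by auto
    show ?thesis
      unfolding finite_codim_def
    proof (intro exI[of _ "insert u0 F"] conjI ballI)
      show "finite (insert u0 F)" "insert u0 F \<subseteq> U" using F u0 by (auto simp: V_def)
      fix u assume u: "u \<in> U"
      obtain c where c: "(\<lambda>x. u x - (\<Sum>j\<in>insert i I. c j * e j x)) \<in> null_functions"
        using insert.prems(3)[OF u] by auto
      define a where "a = c i / c0 i"
      define v where "v = (\<lambda>x. u x + (-a) * u0 x)"
      have "(\<lambda>x. v x - (\<Sum>j\<in>I. (c j - a * c0 j) * e j x)) =
         (\<lambda>x. (u x - (\<Sum>j\<in>insert i I. c j * e j x)) + (-a) * (u0 x - (\<Sum>j\<in>insert i I. c0 j * e j x)))"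
      proof
        fix x
        have "a * (c0 i * e i x) = c i * e i x" using \<open>c0 i \<noteq> 0\<close> by (simp add: a_def)
        moreover have "(\<Sum>j\<in>I. (c j - a * c0 j) * e j x) = (\<Sum>j\<in>I. c j * e j x) - a * (\<Sum>j\<in>I. c0 j * e j x)"
          by (simp add: left_diff_distrib sum_subtractf sum_distrib_left mult.assoc)
        ultimately show "v x - (\<Sum>j\<in>I. (c j - a * c0 j) * e j x) = (u x - (\<Sum>j\<in>insert i I. c j * e j x)) + (-a) * (u0 x - (\<Sum>j\<in>insert i I. c0 j * e j x))"
          using insert.hyps by (simp add: v_def ring_distribs)
      qed
      hence "(\<lambda>x. v x - (\<Sum>j\<in>I. (c j - a * c0 j) * e j x)) \<in> null_functions"
        using null_comb[OF c c0, of "-a"] by (simp only:)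
      moreover have "v \<in> U" using insert.prems(1)[OF u u0(1), of "-a"] by (simp add: v_def)
      ultimately have "v \<in> V" unfolding V_def mem_Collect_eq
        by (intro conjI exI[of _ "\<lambda>j. c j - a * c0 j"])
      then obtain c' where c': "(\<lambda>x. v x - (\<Sum>f\<in>F. c' f * f x)) \<in> null_functions" using F by blast
      have "(\<lambda>x. u x - (\<Sum>f\<in>insert u0 F. (c'(u0 := a)) f * f x)) = (\<lambda>x. v x - (\<Sum>f\<in>F. c' f * f x))"
      proof
        fix x
        have "(\<Sum>f\<in>F. (c'(u0 := a)) f * f x) = (\<Sum>f\<in>F. c' f * f x)"
          using \<open>u0 \<notin> F\<close> by (intro sum.cong) auto
        thus "u x - (\<Sum>f\<in>insert u0 F. (c'(u0 := a)) f * f x) = v x - (\<Sum>f\<in>F. c' f * f x)"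
          using F(1) \<open>u0 \<notin> F\<close> by (simp add: v_def)
      qed
      thus "\<exists>c. (\<lambda>x. u x - (\<Sum>f\<in>insert u0 F. c f * f x)) \<in> null_functions"
        using c' by (intro exI[of _ "c'(u0 := a)"]) (simp only:)
    qed
  qed
qed

text \<open>The partial sums of the Neumann series \<open>\<Sum>n. S ^^ n f / z ^ (n + 1)\<close> are a Cauchy
  sequence, and their limit solves \<open>z h - S h = f\<close>.\<close>

lemma contraction_resolvent:
  assumes mem: "\<And>f. f \<in> B \<Longrightarrow> S f \<in> B"
    and lin: "\<And>f h a. f \<in> B \<Longrightarrow> h \<in> B \<Longrightarrow> S (\<lambda>x. f x + a * h x) = (\<lambda>x. S f x + a * S h x)"
    and contr: "\<And>f. f \<in> B \<Longrightarrow> N (S f) \<le> q * N f"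
    and q: "0 \<le> q" "q < cmod z" and f: "f \<in> B"
  obtains h where "h \<in> B" "N (\<lambda>x. f x - (z * h x - S h x)) = 0"
proof -
  have z: "z \<noteq> 0" "cmod z > 0" using q by auto
  define t where "t = q / cmod z"
  have t: "0 \<le> t" "t < 1" using q z by (auto simp: t_def field_simps)
  define p where "p n = (S ^^ n) f" for n
  have pB: "p n \<in> B" for n by (induction n) (auto simp: p_def f mem)
  have pN: "N (p n) \<le> q ^ n * N f" for n
  proof (induction n)
    case (Suc n)
    have "N (p (Suc n)) \<le> q * N (p n)" using contr[OF pB[of n]] by (simp add: p_def)
    also have "\<dots> \<le> q * (q ^ n * N f)" using Suc q by (intro mult_left_mono) auto
    finally show ?case by simp
  qed (simp add: p_def)
  define h where "h n = (\<lambda>x. \<Sum>k<n. (1 / z ^ Suc k) * p k x)" for n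
  have hB: "h n \<in> B" for n unfolding h_def by (rule sum_mem) (auto simp: pB)
  have S0: "S (\<lambda>x. 0) = (\<lambda>x. 0)"
    using lin[OF zero_mem zero_mem, of "-1"] by simp
  have res: "z * h n x - S (h n) x = f x - (1 / z ^ n) * p n x" for n x
  proof (induction n)
    case 0 show ?case by (simp add: h_def S0 p_def)
  next
    case (Suc n)
    have "h (Suc n) = (\<lambda>x. h n x + (1 / z ^ Suc n) * p n x)" by (simp add: h_def)
    hence "S (h (Suc n)) x = S (h n) x + (1 / z ^ Suc n) * p (Suc n) x"
      using lin[OF hB[of n] pB[of n], of "1 / z ^ Suc n"] by (simp add: p_def)
    moreover have "z * h (Suc n) x = z * h n x + (1 / z ^ n) * p n x"
      using z by (simp add: h_def field_simps)
    ultimately show ?case using Suc by (simp add: algebra_simps)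
  qed
  define c where "c = N f / cmod z"
  have c: "c \<ge> 0" using norm_nonneg[OF f] by (simp add: c_def)
  have hd: "N (\<lambda>x. h m x - h n x) \<le> c * (t ^ n / (1 - t))" if "n \<le> m" for m n
  proof -
    have eq: "(\<lambda>x. h m x - h n x) = (\<lambda>x. \<Sum>k\<in>{n..<m}. (1 / z ^ Suc k) * p k x)"
      unfolding h_def using that by (auto simp: sum_diff_nat_ivl lessThan_atLeast0)
    have "N (\<lambda>x. h m x - h n x) \<le> (\<Sum>k\<in>{n..<m}. cmod (1 / z ^ Suc k) * N (p k))"
      unfolding eq by (rule norm_sum) (auto simp: pB)
    also have "\<dots> \<le> (\<Sum>k\<in>{n..<m}. c * t ^ k)"
    proof (rule sum_mono)
      fix k
      have "cmod (1 / z ^ Suc k) * N (p k) \<le> cmod (1 / z ^ Suc k) * (q ^ k * N f)"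
        by (intro mult_left_mono pN) auto
      also have "\<dots> = c * t ^ k" using z by (simp add: c_def t_def norm_divide norm_mult norm_power field_simps)
      finally show "cmod (1 / z ^ Suc k) * N (p k) \<le> c * t ^ k" .
    qed
    also have "\<dots> = c * ((t ^ n - t ^ m) / (1 - t))"
    proof -
      have "(\<Sum>k\<in>{n..<m}. t ^ k) * (1 - t) = t ^ n - t ^ m"
        using that
      proof (induction m rule: dec_induct)
        case (step m)
        have "(\<Sum>k\<in>{n..<Suc m}. t ^ k) * (1 - t) = (\<Sum>k\<in>{n..<m}. t ^ k) * (1 - t) + t ^ m * (1 - t)"
          using step.hyps by (simp add: distrib_right)
        thus ?case using step.IH by (simp add: algebra_simps)
      qed simp
      hence "(\<Sum>k\<in>{n..<m}. t ^ k) = (t ^ n - t ^ m) / (1 - t)" using t by (simp add: eq_divide_eq)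
      thus ?thesis by (simp add: sum_distrib_left[symmetric])
    qed
    also have "\<dots> \<le> c * (t ^ n / (1 - t))"
      using t c by (intro mult_left_mono divide_right_mono) auto
    finally show ?thesis .
  qed
  have lim0: "(\<lambda>n. c * (t ^ n / (1 - t))) \<longlonglongrightarrow> 0"
    using t by (auto intro!: tendsto_eq_intros LIMSEQ_realpow_zero)
  obtain g where g: "g \<in> B" "(\<lambda>n. N (\<lambda>x. h n x - g x)) \<longlonglongrightarrow> 0"
  proof (rule complete[OF hB])
    fix e :: real assume "e > 0"
    then obtain M where M: "\<And>n. n \<ge> M \<Longrightarrow> c * (t ^ n / (1 - t)) < e"
      using order_tendstoD(2)[OF lim0, of e] by (auto simp: eventually_sequentially)
    have "N (\<lambda>x. h m x - h n x) < e" if "m \<ge> M" "n \<ge> M" for m n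
    proof (cases "n \<le> m")
      case True thus ?thesis using hd[OF True] M[of n] that by simp
    next
      case False
      have "N (\<lambda>x. h m x - h n x) = N (\<lambda>x. (-1) * (h n x - h m x))" by simp
      also have "\<dots> = N (\<lambda>x. h n x - h m x)" by (subst norm_scale) (auto intro: diff_mem hB)
      finally show ?thesis using hd[of m n] False M[of m] that by simp
    qed
    thus "\<exists>M. \<forall>m\<ge>M. \<forall>n\<ge>M. N (\<lambda>x. h m x - h n x) < e" by blast
  qed blast
  have "N (\<lambda>x. f x - (z * g x - S g x)) \<le> N (\<lambda>x. h n x - g x) * (cmod z + q) + t ^ n * N f" for n
  proof -
    define w where "w = (\<lambda>x. h n x - g x)"
    have w: "w \<in> B" unfolding w_def by (intro diff_mem hB g)
    have "S w = (\<lambda>x. S (h n) x - S g x)"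
      using lin[OF hB[of n] g(1), of "-1"] by (simp add: w_def)
    hence "(\<lambda>x. f x - (z * g x - S g x)) = (\<lambda>x. (z * w x - S w x) + (1 / z ^ n) * p n x)"
      using res[of n] by (auto simp: w_def algebra_simps)
    hence "N (\<lambda>x. f x - (z * g x - S g x)) \<le> N (\<lambda>x. z * w x - S w x) + N (\<lambda>x. (1 / z ^ n) * p n x)"
      using norm_triangle[OF diff_mem[OF scale_mem[OF w] mem[OF w]] scale_mem[OF pB[of n]], of z "1 / z ^ n"]
      by simp
    also have "N (\<lambda>x. z * w x - S w x) \<le> cmod z * N w + q * N w"
      using norm_diff_le[of "\<lambda>x. z * w x" "S w"] w contr[OF w] by (simp add: scale_mem norm_scale mem)
    also have "N (\<lambda>x. (1 / z ^ n) * p n x) \<le> t ^ n * N f"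
    proof -
      have "N (\<lambda>x. (1 / z ^ n) * p n x) = N (p n) / cmod z ^ n"
        by (subst norm_scale[OF pB]) (simp add: norm_divide norm_power)
      also have "\<dots> \<le> q ^ n * N f / cmod z ^ n" using pN[of n] by (intro divide_right_mono) auto
      finally show ?thesis by (simp add: t_def power_divide)
    qed
    finally show ?thesis by (simp add: w_def algebra_simps)
  qed
  moreover have "(\<lambda>n. N (\<lambda>x. h n x - g x) * (cmod z + q) + t ^ n * N f) \<longlonglongrightarrow> 0"
    using t by (auto intro!: tendsto_eq_intros g LIMSEQ_realpow_zero)
  ultimately have "N (\<lambda>x. f x - (z * g x - S g x)) \<le> 0"
    by (intro LIMSEQ_le_const[OF _]) auto
  moreover have "N (\<lambda>x. f x - (z * g x - S g x)) \<ge> 0"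
    by (intro norm_nonneg diff_mem f scale_mem g mem)
  ultimately show thesis using that g by force
qed

text \<open>Let \<open>S\<close> be \<open>L\<close> without its part of finite rank, and \<open>R\<close> the
  inverse of \<open>z - S\<close>. An element \<open>f\<close> of the kernel of \<open>z -
  L\<close> satisfies \<open>z f - S f = \<Sum>e\<in>E. c f e * e\<close>, so it lies in the span
  of the functions \<open>R e\<close>; and for every \<open>u\<close>, the image of \<open>R
  u\<close> under \<open>z - L\<close> differs from \<open>u\<close> by an element of the span of
  \<open>E\<close>.\<close>

theorem fredholm_if_contraction_plus_finite_rank:
  assumes E: "finite E" "E \<subseteq> B"
    and lin: "\<And>f h a. L (\<lambda>x. f x + a * h x) = (\<lambda>x. L f x + a * L h x)"
    and clin: "\<And>f h a e. f \<in> B \<Longrightarrow> h \<in> B \<Longrightarrow> c (\<lambda>x. f x + a * h x) e = c f e + a * c h e"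
    and cbd: "\<And>f e. f \<in> B \<Longrightarrow> e \<in> E \<Longrightarrow> cmod (c f e) \<le> K * N f"
    and mem: "\<And>f. f \<in> B \<Longrightarrow> (\<lambda>x. L f x - (\<Sum>e\<in>E. c f e * e x)) \<in> B"
    and contr: "\<And>f. f \<in> B \<Longrightarrow> N (\<lambda>x. L f x - (\<Sum>e\<in>E. c f e * e x)) \<le> q * N f"
    and q: "0 \<le> q"
  shows "bounded_operator B N L"
    and "q < cmod z \<Longrightarrow> fredholm B N (\<lambda>f x. z * f x - L f x)"
proof -
  define S where "S f = (\<lambda>x. L f x - (\<Sum>e\<in>E. c f e * e x))" for f
  have SB: "S f \<in> B" and SN: "N (S f) \<le> q * N f" if "f \<in> B" for f
    using that mem contr by (auto simp: S_def)
  have CB: "(\<lambda>x. \<Sum>e\<in>E. a e * e x) \<in> B" for a using E by (intro sum_mem) auto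
  have LS: "L f = (\<lambda>x. S f x + (\<Sum>e\<in>E. c f e * e x))" for f by (simp add: S_def)
  have LB: "L f \<in> B" if "f \<in> B" for f
    using add_mem[OF SB[OF that] CB] by (simp only: LS[of f])
  define K' where "K' = q + (\<Sum>e\<in>E. K * N e)"
  have LN: "N (L f) \<le> K' * N f" if f: "f \<in> B" for f
  proof -
    have "N (L f) \<le> N (S f) + N (\<lambda>x. \<Sum>e\<in>E. c f e * e x)"
      unfolding LS[of f] by (rule norm_triangle[OF SB[OF f] CB])
    also have "N (\<lambda>x. \<Sum>e\<in>E. c f e * e x) \<le> (\<Sum>e\<in>E. cmod (c f e) * N e)"
      using E by (intro norm_sum) auto
    also have "\<dots> \<le> (\<Sum>e\<in>E. K * N f * N e)"
      using E f by (intro sum_mono mult_right_mono cbd norm_nonneg) auto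
    finally show ?thesis using SN[OF f] by (simp add: K'_def algebra_simps sum_distrib_left)
  qed
  show "bounded_operator B N L"
    unfolding bounded_operator_def using LB LN lin norm_zero by auto
  assume z: "q < cmod z"
  have Slin: "S (\<lambda>x. f x + a * h x) = (\<lambda>x. S f x + a * S h x)" if "f \<in> B" "h \<in> B" for f h a
    using clin[OF that, of a] lin[of f a h]
    by (auto simp: S_def sum.distrib sum_distrib_left algebra_simps)
  let ?A = "\<lambda>f x. z * f x - L f x"
  have AB: "?A f \<in> B" if "f \<in> B" for f using that by (intro diff_mem scale_mem LB)
  have Alin: "?A (\<lambda>x. f x + a * h x) = (\<lambda>x. ?A f x + a * ?A h x)" for f h a
    by (auto simp: lin algebra_simps)
  have AN: "N (?A f) \<le> (cmod z + K') * N f" if "f \<in> B" for f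
    using norm_diff_le[of "\<lambda>x. z * f x" "L f"] that LN[OF that] norm_scale[OF that, of z]
    by (simp add: scale_mem LB algebra_simps)
  have bA: "bounded_operator B N ?A"
    unfolding bounded_operator_def
  proof (intro conjI ballI allI)
    fix f h a show "N (\<lambda>x. z * (f x + a * h x) - L (\<lambda>y. f y + a * h y) x - (?A f x + a * ?A h x)) = 0"
      using norm_zero by (simp add: lin algebra_simps)
    show "\<exists>K. \<forall>f\<in>B. N (?A f) \<le> K * N f" using AN by blast
  qed (rule AB)
  have "\<exists>h. h \<in> B \<and> N (\<lambda>x. f x - (z * h x - S h x)) = 0" if "f \<in> B" for f
    using contraction_resolvent[OF SB Slin SN q z that] by blast
  then obtain R where R: "\<And>f. f \<in> B \<Longrightarrow> R f \<in> B" "\<And>f. f \<in> B \<Longrightarrow> N (\<lambda>x. f x - (z * R f x - S (R f) x)) = 0"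
    by metis
  have inj: "N f = 0" if f: "f \<in> B" and 0: "N (\<lambda>x. z * f x - S f x) = 0" for f
  proof -
    have "N (\<lambda>x. z * f x) \<le> N (S f)"
      using norm_null_cong[of "\<lambda>x. z * f x" "S f"] f 0 by (auto intro: scale_mem SB)
    hence "cmod z * N f \<le> q * N f" using SN[OF f] norm_scale[OF f] by simp
    hence "(cmod z - q) * N f \<le> 0" by (simp add: algebra_simps)
    hence "N f \<le> 0" using z by (simp add: mult_le_0_iff)
    thus ?thesis using norm_nonneg[OF f] by simp
  qed
  have "finite_codim {f \<in> B. N (?A f) = 0} null_functions"
  proof (rule finite_codim_null_if_spanned[OF E(1)])
    fix f h :: "real \<Rightarrow> complex" and a assume "f \<in> {f \<in> B. N (?A f) = 0}" "h \<in> {f \<in> B. N (?A f) = 0}"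
    hence fh: "f \<in> B" "h \<in> B" "?A f \<in> null_functions" "?A h \<in> null_functions"
      using AB by (auto simp: null_functions_def)
    have "?A (\<lambda>x. f x + a * h x) \<in> null_functions"
      unfolding Alin[of f a h] by (rule null_comb[OF fh(3,4)])
    thus "(\<lambda>x. f x + a * h x) \<in> {f \<in> B. N (?A f) = 0}"
      using comb_mem[OF fh(1,2), of a] by (simp add: null_functions_def)
  next
    show "null_functions \<subseteq> {f \<in> B. N (?A f) = 0}"
    proof
      fix f assume "f \<in> null_functions"
      hence "f \<in> B" "N f = 0" by (auto simp: null_functions_def)
      thus "f \<in> {f \<in> B. N (?A f) = 0}" using AN[of f] norm_nonneg[OF AB[of f]] by simp
    qed
  next
    fix f assume "f \<in> {f \<in> B. N (?A f) = 0}"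
    hence f: "f \<in> B" "N (?A f) = 0" by auto
    define r where "r = (\<lambda>x. \<Sum>e\<in>E. c f e * R e x)"
    have Re: "R e \<in> B" if "e \<in> E" for e using that E R(1) by blast
    have rB: "r \<in> B" unfolding r_def by (intro sum_mem E Re)
    have Sr: "S r = (\<lambda>x. \<Sum>e\<in>E. c f e * S (R e) x)"
    proof -
      have "S (\<lambda>x. \<Sum>e\<in>E'. c f e * R e x) = (\<lambda>x. \<Sum>e\<in>E'. c f e * S (R e) x)" if "E' \<subseteq> E" for E'
        using finite_subset[OF that E(1)] that
      proof (induction E' rule: finite_induct)
        case empty
        show ?case using Slin[OF zero_mem zero_mem, of "-1"] by simp
      next
        case (insert e E')
        have "S (\<lambda>x. (\<Sum>e\<in>E'. c f e * R e x) + c f e * R e x) =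
            (\<lambda>x. S (\<lambda>x. \<Sum>e\<in>E'. c f e * R e x) x + c f e * S (R e) x)"
          by (rule Slin) (use insert in \<open>auto intro!: sum_mem Re\<close>)
        thus ?case using insert by (simp add: add.commute)
      qed
      thus ?thesis by (simp add: r_def)
    qed
    define d where "d = (\<lambda>x. f x - r x)"
    have dB: "d \<in> B" unfolding d_def by (intro diff_mem f rB)
    have Sd: "S d = (\<lambda>x. S f x - S r x)" using Slin[OF f(1) rB, of "-1"] by (simp add: d_def)
    have "(\<lambda>x. z * d x - S d x) = (\<lambda>x. ?A f x + (\<Sum>e\<in>E. c f e * (e x - (z * R e x - S (R e) x))))"
    proof
      fix x
      have "(\<Sum>e\<in>E. c f e * (e x - (z * R e x - S (R e) x))) =
          (\<Sum>e\<in>E. c f e * e x) - z * r x + (\<Sum>e\<in>E. c f e * S (R e) x)"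
        by (simp add: r_def sum_distrib_left sum_subtractf sum.distrib right_diff_distrib mult.left_commute)
      thus "z * d x - S d x = ?A f x + (\<Sum>e\<in>E. c f e * (e x - (z * R e x - S (R e) x)))"
        unfolding Sd Sr LS[of f] by (simp add: d_def right_diff_distrib)
    qed
    moreover have "N (\<lambda>x. ?A f x + (\<Sum>e\<in>E. c f e * (e x - (z * R e x - S (R e) x)))) \<le>
        N (?A f) + N (\<lambda>x. \<Sum>e\<in>E. c f e * (\<lambda>x. e x - (z * R e x - S (R e) x)) x)"
    proof (rule norm_triangle)
      show "?A f \<in> B" by (rule AB[OF f(1)])
      show "(\<lambda>x. \<Sum>e\<in>E. c f e * (\<lambda>x. e x - (z * R e x - S (R e) x)) x) \<in> B"
        using E Re by (intro sum_mem) (auto intro!: diff_mem scale_mem SB)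
    qed
    moreover have "N (\<lambda>x. \<Sum>e\<in>E. c f e * (\<lambda>x. e x - (z * R e x - S (R e) x)) x) \<le>
        (\<Sum>e\<in>E. cmod (c f e) * N (\<lambda>x. e x - (z * R e x - S (R e) x)))"
      using E Re by (intro norm_sum) (auto intro!: diff_mem scale_mem SB)
    moreover have "\<dots> = 0" using E R(2) by (intro sum.neutral) auto
    ultimately have "N (\<lambda>x. z * d x - S d x) \<le> 0" using f by simp
    hence "N (\<lambda>x. z * d x - S d x) = 0"
      using norm_nonneg[OF diff_mem[OF scale_mem[OF dB] SB[OF dB]], of z] by linarith
    hence "N d = 0" using inj dB by blast
    thus "\<exists>b. (\<lambda>x. f x - (\<Sum>e\<in>E. b e * R e x)) \<in> null_functions"
      using dB by (intro exI[of _ "c f"]) (simp add: null_functions_def d_def r_def)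
  qed
  moreover have "finite_codim B {f \<in> B. \<exists>g\<in>B. N (\<lambda>x. f x - ?A g x) = 0}"
    unfolding finite_codim_def
  proof (intro exI[of _ E] conjI ballI E)
    fix u assume u: "u \<in> B"
    define g where "g = R u"
    have gB: "g \<in> B" using R(1)[OF u] by (simp add: g_def)
    define v where "v = (\<lambda>x. u x - (\<Sum>e\<in>E. c g e * e x))"
    have "v \<in> B" unfolding v_def by (intro diff_mem u CB)
    moreover have "(\<lambda>x. v x - ?A g x) = (\<lambda>x. u x - (z * g x - S g x))"
      by (auto simp: v_def LS[of g])
    ultimately have "v \<in> {f \<in> B. \<exists>g\<in>B. N (\<lambda>x. f x - ?A g x) = 0}"
      using R(2)[OF u] gB unfolding g_def mem_Collect_eq by (intro conjI bexI[of _ "R u"]) simp_all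
    thus "\<exists>c. (\<lambda>x. u x - (\<Sum>f\<in>E. c f * f x)) \<in> {f \<in> B. \<exists>g\<in>B. N (\<lambda>x. f x - ?A g x) = 0}"
      unfolding v_def by blast
  qed
  ultimately show "fredholm B N ?A"
    unfolding fredholm_def using bA by (auto simp: null_functions_def)
qed

end

section \<open>Banach spaces of essentially bounded functions from a gauge\<close>

text \<open>Read \<open>rep f M\<close> as: \<open>f\<close> has a representation of size at most
  \<open>M\<close>. The norm of \<open>f\<close> is the infimum of these sizes. The last
  assumption, that a series of functions of summable sizes converges with the expected remainders,
  yields completeness; the infimum itself need not be attained.\<close>

locale gauge =
  fixes rep :: "(real \<Rightarrow> complex) \<Rightarrow> real \<Rightarrow> bool" and K :: real
  assumes rep_nonneg: "rep f M \<Longrightarrow> 0 \<le> M"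
    and rep_mono: "rep f M \<Longrightarrow> M \<le> M' \<Longrightarrow> rep f M'"
    and rep_zero: "rep (\<lambda>x. 0) 0"
    and rep_add: "rep f M \<Longrightarrow> rep h M' \<Longrightarrow> rep (\<lambda>x. f x + h x) (M + M')"
    and rep_scale: "rep f M \<Longrightarrow> rep (\<lambda>x. c * f x) (cmod c * M)"
    and rep_cong: "rep f M \<Longrightarrow> AE x in lebesgue_on {0..1}. f x = h x \<Longrightarrow> rep h M"
    and rep_measurable: "rep f M \<Longrightarrow> f \<in> borel_measurable (lebesgue_on {0..1})"
    and rep_bound: "rep f M \<Longrightarrow> AE x in lebesgue_on {0..1}. cmod (f x) \<le> K * M"
    and rep_series: "(\<And>n. rep (F n) (m n)) \<Longrightarrow> summable m \<Longrightarrow>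
        \<exists>h. \<forall>n. rep (\<lambda>x. h x - (\<Sum>k<n. F k x)) (\<Sum>k. m (k + n))"
begin

definition space_of :: "(real \<Rightarrow> complex) set" where "space_of = {f. \<exists>M. rep f M}"

definition norm_of :: "(real \<Rightarrow> complex) \<Rightarrow> real" where "norm_of f = Inf {M. rep f M}"

lemma norm_of_le: "rep f M \<Longrightarrow> norm_of f \<le> M"
  unfolding norm_of_def by (rule cInf_lower) (auto simp: bdd_below_def intro: rep_nonneg)

lemma norm_of_nonneg: "f \<in> space_of \<Longrightarrow> 0 \<le> norm_of f"
  unfolding norm_of_def space_of_def by (rule cInf_greatest) (auto intro: rep_nonneg)

lemma rep_norm_of:
  assumes "f \<in> space_of" "norm_of f < M" shows "rep f M"
proof -
  obtain M' where "rep f M'" "M' < M"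
    using assms cInf_lessD[of "{M. rep f M}" M] by (auto simp: norm_of_def space_of_def)
  thus ?thesis using rep_mono by (meson less_imp_le)
qed

lemma rep_in_space: "rep f M \<Longrightarrow> f \<in> space_of" by (auto simp: space_of_def)

lemma rep_diff: "rep f M \<Longrightarrow> rep h M' \<Longrightarrow> rep (\<lambda>x. f x - h x) (M + M')"
  using rep_add[of f M "\<lambda>x. (-1) * h x" M'] rep_scale[of h M' "-1"] by simp

lemma space_of_add: "f \<in> space_of \<Longrightarrow> h \<in> space_of \<Longrightarrow> (\<lambda>x. f x + h x) \<in> space_of"
  unfolding space_of_def using rep_add by blast

lemma space_of_scale: "f \<in> space_of \<Longrightarrow> (\<lambda>x. c * f x) \<in> space_of"
  unfolding space_of_def using rep_scale by blast

lemma space_of_diff: "f \<in> space_of \<Longrightarrow> h \<in> space_of \<Longrightarrow> (\<lambda>x. f x - h x) \<in> space_of"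
  unfolding space_of_def using rep_diff by blast

lemma norm_of_add:
  assumes f: "f \<in> space_of" and h: "h \<in> space_of"
  shows "norm_of (\<lambda>x. f x + h x) \<le> norm_of f + norm_of h"
proof (rule field_le_epsilon)
  fix e :: real assume "e > 0"
  have "rep (\<lambda>x. f x + h x) ((norm_of f + e / 2) + (norm_of h + e / 2))"
    by (intro rep_add rep_norm_of f h) (use \<open>e > 0\<close> in auto)
  from norm_of_le[OF this] show "norm_of (\<lambda>x. f x + h x) \<le> norm_of f + norm_of h + e" by simp
qed

lemma norm_of_scale_le:
  assumes f: "f \<in> space_of" shows "norm_of (\<lambda>x. c * f x) \<le> cmod c * norm_of f"
proof (rule field_le_epsilon)
  fix e :: real assume "e > 0"
  define e' where "e' = e / (cmod c + 1)"
  have e': "e' > 0" "cmod c * e' \<le> e" using \<open>e > 0\<close> by (auto simp: e'_def field_simps add_pos_nonneg)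
  have "rep (\<lambda>x. c * f x) (cmod c * (norm_of f + e'))"
    by (intro rep_scale rep_norm_of f) (use e' in auto)
  from norm_of_le[OF this] show "norm_of (\<lambda>x. c * f x) \<le> cmod c * norm_of f + e"
    using e' by (simp add: algebra_simps)
qed

lemma norm_of_scale:
  assumes f: "f \<in> space_of" shows "norm_of (\<lambda>x. c * f x) = cmod c * norm_of f"
proof (cases "c = 0")
  case True
  have "norm_of (\<lambda>x. 0 * f x) \<le> cmod 0 * norm_of f" by (rule norm_of_scale_le[OF f])
  thus ?thesis using True norm_of_nonneg[OF space_of_scale[OF f, of 0]] by simp
next
  case False
  have "norm_of f = norm_of (\<lambda>x. (1/c) * (c * f x))" using False by simp
  also have "\<dots> \<le> cmod (1/c) * norm_of (\<lambda>x. c * f x)"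
    by (rule norm_of_scale_le[OF space_of_scale[OF f]])
  finally have "cmod c * norm_of f \<le> norm_of (\<lambda>x. c * f x)"
    using False by (simp add: norm_divide field_simps)
  thus ?thesis using norm_of_scale_le[OF f, of c] by simp
qed

lemma K_ex: "\<exists>K'\<ge>0. \<forall>f M. rep f M \<longrightarrow> (AE x in lebesgue_on {0..1}. cmod (f x) \<le> K' * M)"
proof (intro exI[of _ "\<bar>K\<bar>"] conjI allI impI)
  fix f M assume r: "rep f M"
  have "K * M \<le> \<bar>K\<bar> * M" using rep_nonneg[OF r] by (intro mult_right_mono) auto
  thus "AE x in lebesgue_on {0..1}. cmod (f x) \<le> \<bar>K\<bar> * M"
    using rep_bound[OF r] by (auto elim!: eventually_mono)
qed simp

lemma AE_bound_norm_of:
  assumes K': "K' \<ge> 0" "\<And>f M. rep f M \<Longrightarrow> AE x in lebesgue_on {0..1}. cmod (f x) \<le> K' * M"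
    and f: "f \<in> space_of"
  shows "AE x in lebesgue_on {0..1}. cmod (f x) \<le> K' * norm_of f"
proof -
  have "AE x in lebesgue_on {0..1}. \<forall>n. cmod (f x) \<le> K' * (norm_of f + 1 / real (Suc n))"
    by (subst AE_all_countable, intro allI K' rep_norm_of f) simp
  thus ?thesis
  proof eventually_elim
    case (elim x)
    have "(\<lambda>n. K' * (norm_of f + 1 / real (Suc n))) \<longlonglongrightarrow> K' * (norm_of f + 0)"
      by (intro tendsto_intros LIMSEQ_Suc[OF lim_1_over_n])
    thus ?case using elim by (intro LIMSEQ_le_const) auto
  qed
qed

lemma norm_of_eq_0_iff:
  assumes f: "f \<in> space_of"
  shows "norm_of f = 0 \<longleftrightarrow> (AE x in lebesgue_on {0..1}. f x = 0)"
proof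
  assume 0: "norm_of f = 0"
  obtain K' where K': "K' \<ge> 0" "\<And>f M. rep f M \<Longrightarrow> AE x in lebesgue_on {0..1}. cmod (f x) \<le> K' * M"
    using K_ex by blast
  show "AE x in lebesgue_on {0..1}. f x = 0"
    using AE_bound_norm_of[OF K' f] 0 by simp
next
  assume ae: "AE x in lebesgue_on {0..1}. f x = 0"
  have "rep f 0" by (rule rep_cong[OF rep_zero]) (use ae in \<open>auto elim: eventually_mono\<close>)
  thus "norm_of f = 0" using norm_of_le[of f 0] norm_of_nonneg[OF f] by simp
qed

text \<open>A Cauchy sequence has a subsequence whose increments have sizes \<open>(1/2) ^ k\<close>; the
  axiom on series provides the limit of the subsequence, which is the limit of the sequence.\<close>

lemma norm_of_complete:
  assumes F: "\<And>n. F n \<in> space_of" and C: "\<And>e. e > 0 \<Longrightarrow> \<exists>M. \<forall>m\<ge>M. \<forall>n\<ge>M. norm_of (\<lambda>x. F m x - F n x) < e"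
  shows "\<exists>f\<in>space_of. (\<lambda>n. norm_of (\<lambda>x. F n x - f x)) \<longlonglongrightarrow> 0"
proof -
  have "\<exists>M. \<forall>k. \<forall>m\<ge>M k. \<forall>n\<ge>M k. norm_of (\<lambda>x. F m x - F n x) < (1/2) ^ k"
    by (intro choice allI C) simp
  then obtain M where M: "\<And>k m n. m \<ge> M k \<Longrightarrow> n \<ge> M k \<Longrightarrow> norm_of (\<lambda>x. F m x - F n x) < (1/2) ^ k"
    by blast
  define s where "s k = (\<Sum>j\<le>k. M j)" for k
  have s: "s k \<ge> M k" "s (Suc k) \<ge> M k" for k
  proof -
    show "s k \<ge> M k" unfolding s_def by (rule member_le_sum) auto
    thus "s (Suc k) \<ge> M k" by (simp add: s_def)
  qed
  define f where "f k = (\<lambda>x. F (s (Suc k)) x - F (s k) x)" for k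
  have repf: "rep (f k) ((1/2) ^ k)" for k
    unfolding f_def by (rule rep_norm_of[OF space_of_diff[OF F F] M[OF s(2) s(1)]])
  have sm: "summable (\<lambda>k. (1/2::real) ^ k)" by (rule summable_geometric) simp
  obtain h where h: "\<And>n. rep (\<lambda>x. h x - (\<Sum>k<n. f k x)) (\<Sum>k. (1/2) ^ (k + n))"
    using rep_series[OF repf sm] by blast
  have tail: "(\<Sum>k. (1/2::real) ^ (k + n)) = 2 * (1/2) ^ n" for n
    using suminf_mult2[OF sm, of "(1/2)^n"] suminf_geometric[of "1/2::real"] by (simp add: power_add)
  define H where "H = (\<lambda>x. h x + F (s 0) x)"
  have "(\<Sum>k<n. f k x) = F (s n) x - F (s 0) x" for n x
    by (induction n) (auto simp: f_def)
  hence eq: "(\<lambda>x. h x - (\<Sum>k<n. f k x)) = (\<lambda>x. H x - F (s n) x)" for n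
    by (auto simp: H_def)
  have r: "rep (\<lambda>x. H x - F (s n) x) (2 * (1/2) ^ n)" for n
    using h[of n] unfolding eq tail .
  have "(\<lambda>x. (H x - F (s 0) x) + F (s 0) x) \<in> space_of"
    by (rule space_of_add[OF rep_in_space[OF r] F])
  hence HB: "H \<in> space_of" by simp
  have bd: "norm_of (\<lambda>x. F n x - H x) \<le> 3 * (1/2) ^ k" if "n \<ge> M k" for n k
  proof -
    have "rep (\<lambda>x. (F n x - F (s k) x) - (H x - F (s k) x)) ((1/2) ^ k + 2 * (1/2) ^ k)"
      by (intro rep_diff r rep_norm_of space_of_diff F M that s)
    thus ?thesis using norm_of_le by fastforce
  qed
  have "(\<lambda>n. norm_of (\<lambda>x. F n x - H x)) \<longlonglongrightarrow> 0"
  proof (rule LIMSEQ_I)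
    fix e :: real assume "e > 0"
    have "(\<lambda>k. 3 * (1/2::real) ^ k) \<longlonglongrightarrow> 0" by (auto intro!: tendsto_eq_intros LIMSEQ_realpow_zero)
    from order_tendstoD(2)[OF this \<open>e > 0\<close>] obtain k where k: "3 * (1/2::real) ^ k < e"
      by (auto simp: eventually_sequentially)
    have "norm (norm_of (\<lambda>x. F n x - H x) - 0) < e" if "n \<ge> M k" for n
      using bd[OF that] k norm_of_nonneg[OF space_of_diff[OF F HB], of n] by simp
    thus "\<exists>no. \<forall>n\<ge>no. norm (norm_of (\<lambda>x. F n x - H x) - 0) < e" by blast
  qed
  thus ?thesis using HB by blast
qed

lemma Linf_norm_le:
  assumes "f \<in> borel_measurable (lebesgue_on {0..1})" "AE x in lebesgue_on {0..1}. cmod (f x) \<le> c"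
  shows "Linf_norm f \<le> ereal c"
  unfolding Linf_norm_def
proof (rule esssup_I)
  show "(\<lambda>x. ereal (cmod (f x))) \<in> borel_measurable (lebesgue_on {0..1})" using assms(1) by measurable
qed (use assms(2) in \<open>auto\<close>)

theorem banach_space_of: "banach_subspace_Linf space_of norm_of"
proof -
  obtain K' where K': "K' \<ge> 0" "\<And>f M. rep f M \<Longrightarrow> AE x in lebesgue_on {0..1}. cmod (f x) \<le> K' * M"
    using K_ex by blast
  have me: "f \<in> borel_measurable (lebesgue_on {0..1})" if "f \<in> space_of" for f
    using that rep_measurable by (auto simp: space_of_def)
  have bd: "Linf_norm f \<le> ereal (K' * norm_of f)" if "f \<in> space_of" for f
    using Linf_norm_le[OF me[OF that] AE_bound_norm_of[OF K' that]] .
  have "Linf_norm f < \<infinity>" if "f \<in> space_of" for f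
    using bd[OF that] by (rule order_le_less_trans) simp
  hence sub: "space_of \<subseteq> Linf" using me by (auto simp: Linf_def)
  show ?thesis
    unfolding banach_subspace_Linf_def
  proof (intro conjI ballI allI impI sub)
    fix f h assume "f \<in> space_of" "AE x in lebesgue_on {0..1}. f x = h x"
    thus "h \<in> space_of" using rep_cong by (auto simp: space_of_def)
  next
    show "(\<lambda>x. 0) \<in> space_of" using rep_zero by (auto simp: space_of_def)
  next
    fix F :: "nat \<Rightarrow> real \<Rightarrow> complex"
    assume "(\<forall>n. F n \<in> space_of) \<and> (\<forall>e>0. \<exists>M. \<forall>m\<ge>M. \<forall>n\<ge>M. norm_of (\<lambda>x. F m x - F n x) < e)"
    thus "\<exists>f\<in>space_of. (\<lambda>n. norm_of (\<lambda>x. F n x - f x)) \<longlonglongrightarrow> 0" using norm_of_complete by blast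
  next
    show "\<exists>K. \<forall>f\<in>space_of. Linf_norm f \<le> ereal (K * norm_of f)" using bd by blast
  qed (auto intro: space_of_add space_of_scale norm_of_nonneg norm_of_add norm_of_scale simp: norm_of_eq_0_iff)
qed

end

section \<open>Jump functions\<close>

lemma AE_unit_interval_iff:
  "(AE x in lebesgue_on {0..1::real}. Q x) \<longleftrightarrow> negligible {x\<in>{0..1}. \<not> Q x}"
proof -
  have "(AE x in lebesgue_on {0..1::real}. Q x) \<longleftrightarrow> (AE x in lebesgue. x \<in> {0..1} \<longrightarrow> Q x)"
    by (rule AE_restrict_space_iff) simp
  also have "\<dots> \<longleftrightarrow> {x\<in>{0..1}. \<not> Q x} \<in> null_sets lebesgue"
    by (simp add: completion.AE_iff_null_sets)
  finally show ?thesis by (simp add: negligible_iff_null_sets)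
qed

lemma norm_infsum_le:
  fixes \<delta> :: "'a \<Rightarrow> complex"
  assumes "(\<lambda>p. cmod (\<delta> p)) summable_on P" "A \<subseteq> P"
  shows "cmod (infsum \<delta> A) \<le> infsum (\<lambda>p. cmod (\<delta> p)) P"
proof -
  have s: "(\<lambda>p. cmod (\<delta> p)) summable_on A" by (rule summable_on_subset_banach[OF assms])
  have "cmod (infsum \<delta> A) \<le> infsum (\<lambda>p. cmod (\<delta> p)) A" by (rule norm_infsum_bound[OF s])
  also have "\<dots> \<le> infsum (\<lambda>p. cmod (\<delta> p)) P" by (rule infsum_mono2) (use s assms in auto)
  finally show ?thesis .
qed

lemma summable_on_of_norm:
  fixes \<delta> :: "'a \<Rightarrow> complex"
  assumes "(\<lambda>p. cmod (\<delta> p)) summable_on P" "A \<subseteq> P"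
  shows "\<delta> summable_on A"
  by (rule abs_summable_summable, rule summable_on_subset_banach[OF assms])

text \<open>The mass near a point that is not carried by the point itself is small, because all but
  \<open>\<epsilon>\<close> of the mass sits on finitely many points.\<close>

lemma small_mass:
  fixes \<delta> :: "real \<Rightarrow> complex"
  assumes \<delta>: "(\<lambda>p. cmod (\<delta> p)) summable_on P" and "\<epsilon> > 0"
  shows "\<exists>\<rho>>0. \<forall>A\<subseteq>P. (\<forall>q\<in>A. q \<noteq> p \<and> \<bar>q - p\<bar> < \<rho>) \<longrightarrow> cmod (infsum \<delta> A) \<le> \<epsilon>"
proof -
  obtain F where F: "finite F" "F \<subseteq> P" "dist (\<Sum>p\<in>F. cmod (\<delta> p)) (infsum (\<lambda>p. cmod (\<delta> p)) P) \<le> \<epsilon>"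
    using infsum_finite_approximation[OF assms] by blast
  obtain \<rho> where \<rho>: "\<rho> > 0" "\<And>x. x \<in> F \<Longrightarrow> x \<noteq> p \<Longrightarrow> \<rho> \<le> dist p x"
    using finite_set_avoid[OF F(1), of p] by blast
  have "cmod (infsum \<delta> A) \<le> \<epsilon>" if A: "A \<subseteq> P" "\<forall>q\<in>A. q \<noteq> p \<and> \<bar>q - p\<bar> < \<rho>" for A
  proof -
    have "A \<inter> F = {}" using A \<rho> by (force simp: dist_real_def)
    hence sub: "A \<subseteq> P - F" using A by auto
    have s: "(\<lambda>p. cmod (\<delta> p)) summable_on (P - F)" by (rule summable_on_subset_banach[OF \<delta>]) auto
    have "infsum (\<lambda>p. cmod (\<delta> p)) P = infsum (\<lambda>p. cmod (\<delta> p)) (F \<union> (P - F))"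
      using F by (simp add: Un_absorb1)
    also have "\<dots> = (\<Sum>p\<in>F. cmod (\<delta> p)) + infsum (\<lambda>p. cmod (\<delta> p)) (P - F)"
      by (subst infsum_Un_disjoint) (use F s in auto)
    finally have "infsum (\<lambda>p. cmod (\<delta> p)) (P - F) \<le> \<epsilon>" using F(3) by (simp add: dist_real_def)
    thus ?thesis using norm_infsum_le[OF s sub] by simp
  qed
  thus ?thesis using \<rho>(1) by blast
qed

text \<open>The interval is open on the right, so the function is continuous from the left: the jump at
  \<open>p\<close> becomes visible immediately after \<open>p\<close>. In particular
  \<open>\<delta> a\<close> is the value at the left end point.\<close>

definition jumps_before :: "real set \<Rightarrow> real \<Rightarrow> (real \<Rightarrow> complex) \<Rightarrow> real \<Rightarrow> complex" where
  "jumps_before P a \<delta> x = infsum \<delta> (P \<inter> {a..<x})"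

lemma jumps_before_bound:
  "(\<lambda>p. cmod (\<delta> p)) summable_on P \<Longrightarrow> cmod (jumps_before P a \<delta> x) \<le> infsum (\<lambda>p. cmod (\<delta> p)) P"
  unfolding jumps_before_def by (rule norm_infsum_le) auto

lemma jumps_before_diff:
  assumes \<delta>: "(\<lambda>p. cmod (\<delta> p)) summable_on P" and "a \<le> x" "x \<le> y"
  shows "jumps_before P a \<delta> y - jumps_before P a \<delta> x = infsum \<delta> (P \<inter> {x..<y})"
proof -
  have "P \<inter> {a..<y} = (P \<inter> {a..<x}) \<union> (P \<inter> {x..<y})" using assms by auto
  moreover have "infsum \<delta> ((P \<inter> {a..<x}) \<union> (P \<inter> {x..<y})) = infsum \<delta> (P \<inter> {a..<x}) + infsum \<delta> (P \<inter> {x..<y})"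
    by (rule infsum_Un_disjoint) (auto intro!: summable_on_of_norm[OF \<delta>])
  ultimately show ?thesis by (simp add: jumps_before_def)
qed

lemma jumps_before_right:
  assumes \<delta>: "(\<lambda>p. cmod (\<delta> p)) summable_on P" and "a \<le> x" "\<epsilon> > 0"
  shows "\<exists>\<rho>>0. \<forall>y. x < y \<and> y < x + \<rho> \<longrightarrow>
    cmod (jumps_before P a \<delta> y - jumps_before P a \<delta> x - (if x \<in> P then \<delta> x else 0)) \<le> \<epsilon>"
proof -
  obtain \<rho> where \<rho>: "\<rho> > 0" "\<And>A. A \<subseteq> P \<Longrightarrow> \<forall>q\<in>A. q \<noteq> x \<and> \<bar>q - x\<bar> < \<rho> \<Longrightarrow> cmod (infsum \<delta> A) \<le> \<epsilon>"
    using small_mass[OF \<delta> \<open>\<epsilon> > 0\<close>, of x] by blast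
  have "cmod (jumps_before P a \<delta> y - jumps_before P a \<delta> x - (if x \<in> P then \<delta> x else 0)) \<le> \<epsilon>"
    if y: "x < y" "y < x + \<rho>" for y
  proof -
    have "P \<inter> {x..<y} = (P \<inter> {x}) \<union> (P \<inter> {x<..<y})" using y by auto
    moreover have "infsum \<delta> ((P \<inter> {x}) \<union> (P \<inter> {x<..<y})) = infsum \<delta> (P \<inter> {x}) + infsum \<delta> (P \<inter> {x<..<y})"
      by (rule infsum_Un_disjoint) (auto intro!: summable_on_of_norm[OF \<delta>])
    moreover have "infsum \<delta> (P \<inter> {x}) = (if x \<in> P then \<delta> x else 0)" by auto
    ultimately have "jumps_before P a \<delta> y - jumps_before P a \<delta> x - (if x \<in> P then \<delta> x else 0) = infsum \<delta> (P \<inter> {x<..<y})"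
      using jumps_before_diff[OF \<delta> \<open>a \<le> x\<close>, of y] y by simp
    thus ?thesis using \<rho>(2)[of "P \<inter> {x<..<y}"] y by auto
  qed
  thus ?thesis using \<rho>(1) by blast
qed

lemma jumps_before_left:
  assumes \<delta>: "(\<lambda>p. cmod (\<delta> p)) summable_on P" and "\<epsilon> > 0"
  shows "\<exists>\<rho>>0. \<forall>y. a \<le> y \<and> y < x \<and> x - \<rho> < y \<longrightarrow> cmod (jumps_before P a \<delta> x - jumps_before P a \<delta> y) \<le> \<epsilon>"
proof -
  obtain \<rho> where \<rho>: "\<rho> > 0" "\<And>A. A \<subseteq> P \<Longrightarrow> \<forall>q\<in>A. q \<noteq> x \<and> \<bar>q - x\<bar> < \<rho> \<Longrightarrow> cmod (infsum \<delta> A) \<le> \<epsilon>"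
    using small_mass[OF \<delta> \<open>\<epsilon> > 0\<close>, of x] by blast
  have "cmod (jumps_before P a \<delta> x - jumps_before P a \<delta> y) \<le> \<epsilon>"
    if y: "a \<le> y" "y < x" "x - \<rho> < y" for y
    using jumps_before_diff[OF \<delta> y(1), of x] \<rho>(2)[of "P \<inter> {y..<x}"] y by auto
  thus ?thesis using \<rho>(1) by blast
qed

lemma jumps_before_isCont:
  assumes \<delta>: "(\<lambda>p. cmod (\<delta> p)) summable_on P" and "a < x" and 0: "x \<in> P \<Longrightarrow> \<delta> x = 0"
  shows "isCont (jumps_before P a \<delta>) x"
  unfolding continuous_at_eps_delta
proof (intro allI impI)
  fix e :: real assume e: "e > 0"
  obtain r where r: "r > 0" "\<And>y. x < y \<Longrightarrow> y < x + r \<Longrightarrow> cmod (jumps_before P a \<delta> y - jumps_before P a \<delta> x - (if x \<in> P then \<delta> x else 0)) \<le> e/2"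
    using jumps_before_right[OF \<delta>, of a x "e/2"] e \<open>a < x\<close> by auto
  obtain l where l: "l > 0" "\<And>y. a \<le> y \<Longrightarrow> y < x \<Longrightarrow> x - l < y \<Longrightarrow> cmod (jumps_before P a \<delta> x - jumps_before P a \<delta> y) \<le> e/2"
    using jumps_before_left[OF \<delta>, of "e/2" a x] e by auto
  have "dist (jumps_before P a \<delta> y) (jumps_before P a \<delta> x) < e" if "dist y x < min r (min l (x - a))" for y
    using that r(2)[of y] l(2)[of y] e 0
    by (cases y x rule: linorder_cases) (auto simp: dist_norm norm_minus_commute split: if_splits)
  thus "\<exists>d>0. \<forall>y. dist y x < d \<longrightarrow> dist (jumps_before P a \<delta> y) (jumps_before P a \<delta> x) < e"
    using r l \<open>a < x\<close> by (intro exI[of _ "min r (min l (x - a))"]) auto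
qed

lemma negligible_avoid:
  fixes S :: "real set"
  assumes "negligible S" "s < t" obtains y where "s < y" "y < t" "y \<notin> S"
proof -
  have "\<not> {s<..<t} \<subseteq> S"
    using open_not_negligible[of "{s<..<t}"] negligible_subset[OF assms(1)] assms(2) by auto
  then obtain y where "y \<in> {s<..<t}" "y \<notin> S" by blast
  thus thesis using that by auto
qed

text \<open>The only way in which a jump part and an integral can cancel almost everywhere is that both
  vanish: each jump would be visible as a difference of one-sided limits.\<close>

lemma jumps_plus_integral_zero:
  assumes \<delta>: "(\<lambda>p. cmod (\<delta> p)) summable_on P" and f: "tame_on {a<..<b} f" and S: "negligible S"
    and zero: "\<And>x. x \<in> {a<..<b} - S \<Longrightarrow> jumps_before P a \<delta> x + integral {a..x} f = 0"
  shows "\<And>p. p \<in> P \<Longrightarrow> a \<le> p \<Longrightarrow> p < b \<Longrightarrow> \<delta> p = 0"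
    and "\<exists>Z. countable Z \<and> (\<forall>x\<in>{a<..<b} - Z. f x = 0)"
proof -
  obtain M where M: "M \<ge> 0" "\<And>x. x \<in> {a<..<b} \<Longrightarrow> cmod (f x) \<le> M" using tame_on_bounded[OF f] by blast
  let ?J = "jumps_before P a \<delta>" and ?I = "\<lambda>x. integral {a..x} f"
  have lip: "cmod (?I y - ?I x) \<le> M * \<bar>y - x\<bar>" if "x \<in> {a..b}" "y \<in> {a..b}" for x y
    by (rule tame_on_integral_lipschitz[OF f M(2) that])
  have R: "?J p + (if p \<in> P then \<delta> p else 0) + ?I p = 0" if p: "a \<le> p" "p < b" for p
  proof -
    have "cmod (?J p + (if p \<in> P then \<delta> p else 0) + ?I p) \<le> 0 + \<epsilon>" if \<epsilon>: "\<epsilon> > 0" for \<epsilon>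
    proof -
      obtain r where r: "r > 0" "\<And>y. p < y \<Longrightarrow> y < p + r \<Longrightarrow> cmod (?J y - ?J p - (if p \<in> P then \<delta> p else 0)) \<le> \<epsilon>/2"
        using jumps_before_right[OF \<delta> p(1), of "\<epsilon>/2"] \<epsilon> by auto
      define r' where "r' = min (min r (b - p)) (\<epsilon> / (2 * (M + 1)))"
      have "r' > 0" using r p \<epsilon> M by (auto simp: r'_def)
      then obtain y where y: "p < y" "y < p + r'" "y \<notin> S" using negligible_avoid[OF S, of p "p + r'"] by auto
      have yb: "y < b" using y by (auto simp: r'_def min_def split: if_splits)
      have "M * \<bar>y - p\<bar> \<le> M * (\<epsilon> / (2 * (M + 1)))"
        using y M by (intro mult_left_mono) (auto simp: r'_def)
      also have "\<dots> \<le> \<epsilon> / 2" using M \<epsilon> by (simp add: field_simps)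
      finally have "cmod (?I y - ?I p) \<le> \<epsilon> / 2" using lip[of p y] p y yb by auto
      moreover have "cmod (?J y - ?J p - (if p \<in> P then \<delta> p else 0)) \<le> \<epsilon>/2" using r(2)[of y] y by (simp add: r'_def)
      moreover have "?J y + ?I y = 0" using zero[of y] y p by (auto simp: r'_def)
      ultimately show ?thesis
        using norm_triangle_ineq[of "?J y - ?J p - (if p \<in> P then \<delta> p else 0)" "?I y - ?I p"]
          norm_minus_cancel[of "?J p + (if p \<in> P then \<delta> p else 0) + ?I p"]
        by (simp add: algebra_simps add_eq_0_iff)
    qed
    hence "cmod (?J p + (if p \<in> P then \<delta> p else 0) + ?I p) \<le> 0" by (rule field_le_epsilon)
    thus ?thesis by simp
  qed
  have L: "?J p + ?I p = 0" if p: "a < p" "p < b" for p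
  proof -
    have "cmod (?J p + ?I p) \<le> 0 + \<epsilon>" if \<epsilon>: "\<epsilon> > 0" for \<epsilon>
    proof -
      obtain r where r: "r > 0" "\<And>y. a \<le> y \<Longrightarrow> y < p \<Longrightarrow> p - r < y \<Longrightarrow> cmod (?J p - ?J y) \<le> \<epsilon>/2"
        using jumps_before_left[OF \<delta>, of "\<epsilon>/2" a p] \<epsilon> by auto
      define r' where "r' = min (min r (p - a)) (\<epsilon> / (2 * (M + 1)))"
      have "r' > 0" using r p \<epsilon> M by (auto simp: r'_def)
      then obtain y where y: "p - r' < y" "y < p" "y \<notin> S" using negligible_avoid[OF S, of "p - r'" p] by auto
      have ya: "a < y" using y by (auto simp: r'_def min_def split: if_splits)
      have "M * \<bar>p - y\<bar> \<le> M * (\<epsilon> / (2 * (M + 1)))"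
        using y M by (intro mult_left_mono) (auto simp: r'_def)
      also have "\<dots> \<le> \<epsilon> / 2" using M \<epsilon> by (simp add: field_simps)
      finally have "cmod (?I p - ?I y) \<le> \<epsilon> / 2" using lip[of y p] p y ya by auto
      moreover have "cmod (?J p - ?J y) \<le> \<epsilon>/2" using r(2)[of y] y by (simp add: r'_def)
      moreover have "?J y + ?I y = 0" using zero[of y] y p by (auto simp: r'_def)
      ultimately show ?thesis
        using norm_triangle_ineq[of "?J p - ?J y" "?I p - ?I y"] by (simp add: algebra_simps add_eq_0_iff)
    qed
    hence "cmod (?J p + ?I p) \<le> 0" by (rule field_le_epsilon)
    thus ?thesis by simp
  qed
  show d0: "\<delta> p = 0" if "p \<in> P" "a \<le> p" "p < b" for p
  proof (cases "p = a")
    case True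
    thus ?thesis using R[of p] that by (simp add: jumps_before_def)
  next
    case False
    have "\<delta> p = (?J p + \<delta> p + ?I p) - (?J p + ?I p)" by simp
    also have "\<dots> = 0" using R[of p] L[of p] that False by simp
    finally show ?thesis .
  qed
  have I0: "?I x = 0" if "x \<in> {a<..<b}" for x
  proof -
    have "?J x = 0" unfolding jumps_before_def by (rule infsum_0) (use d0 that in auto)
    thus ?thesis using L[of x] that by simp
  qed
  obtain Z where Z: "countable Z" "\<And>x. x \<in> {a<..<b} \<Longrightarrow> x \<notin> Z \<Longrightarrow> isCont f x" using tame_on_cont[OF f] by blast
  have "f x = 0" if x: "x \<in> {a<..<b} - Z" for x
  proof -
    have "(?I has_vector_derivative f x) (at x)" by (rule integral_deriv_at_cont[OF f]) (use x Z in auto)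
    moreover have "(?I has_vector_derivative 0) (at x)"
    proof (rule has_vector_derivative_transform_within_open)
      show "((\<lambda>_. 0) has_vector_derivative 0) (at x)" by simp
      show "open {a<..<b}" "x \<in> {a<..<b}" using x by auto
    qed (use I0 in auto)
    ultimately show ?thesis by (rule vector_derivative_unique_at)
  qed
  thus "\<exists>Z. countable Z \<and> (\<forall>x\<in>{a<..<b} - Z. f x = 0)" using Z(1) by blast
qed

text \<open>A uniform limit is continuous wherever all terms are, and the union of the countably many
  exceptional sets is countable.\<close>

lemma tame_on_series:
  fixes f :: "nat \<Rightarrow> real \<Rightarrow> complex"
  assumes U: "open U" and f: "\<And>n. tame_on U (f n)" and b: "\<And>n x. x \<in> U \<Longrightarrow> cmod (f n x) \<le> b n" and s: "summable b"
  shows "tame_on U (\<lambda>x. \<Sum>n. f n x)"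
proof -
  have "\<exists>Z. countable Z \<and> (\<forall>x\<in>U. x \<notin> Z \<longrightarrow> isCont (f n) x)" for n using tame_on_cont[OF f] .
  then obtain Z where Z: "\<And>n. countable (Z n)" "\<And>n x. x \<in> U \<Longrightarrow> x \<notin> Z n \<Longrightarrow> isCont (f n) x" by metis
  have ul: "uniform_limit U (\<lambda>n x. \<Sum>i<n. f i x) (\<lambda>x. \<Sum>n. f n x) sequentially"
    by (rule Weierstrass_m_test[OF _ s]) (use b in auto)
  show ?thesis
  proof (rule tame_onI[of _ _ "suminf b" "\<Union>n. Z n"])
    fix x assume x: "x \<in> U"
    have sn: "summable (\<lambda>n. cmod (f n x))" by (rule summable_comparison_test[OF _ s]) (use b x in auto)
    have "cmod (\<Sum>n. f n x) \<le> (\<Sum>n. cmod (f n x))" by (rule summable_norm[OF sn])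
    also have "\<dots> \<le> suminf b" by (rule suminf_le[OF _ sn s]) (use b x in auto)
    finally show "cmod (\<Sum>n. f n x) \<le> suminf b" .
    assume xZ: "x \<notin> (\<Union>n. Z n)"
    show "isCont (\<lambda>x. \<Sum>n. f n x) x"
      unfolding isCont_def
    proof (rule swap_uniform_limit'[OF _ _ ul])
      show "\<forall>\<^sub>F n in sequentially. ((\<lambda>x. \<Sum>i<n. f i x) \<longlongrightarrow> (\<Sum>i<n. f i x)) (at x)"
        using Z(2)[OF x] xZ by (intro always_eventually allI tendsto_sum) (auto simp: isCont_def)
      show "(\<lambda>n. \<Sum>i<n. f i x) \<longlonglongrightarrow> (\<Sum>n. f n x)"
        by (rule summable_LIMSEQ[OF summable_norm_cancel[OF sn]])
      show "\<forall>\<^sub>F x in at x. x \<in> U" using U x by (simp add: eventually_at_in_open')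
    qed simp
  qed (use Z in auto)
qed

section \<open>Functions glued from jumps and a top derivative\<close>

lemma tame_on_Union:
  assumes "finite A" "\<And>S. S \<in> A \<Longrightarrow> tame_on S f" shows "tame_on (\<Union>A) f"
proof -
  have "\<forall>S\<in>A. \<exists>M Z. (\<forall>x\<in>S. cmod (f x) \<le> M) \<and> countable Z \<and> (\<forall>x\<in>S. x \<notin> Z \<longrightarrow> isCont f x)"
    using tame_on_bounded tame_on_cont assms(2) by meson
  then obtain M Z where MZ: "\<And>S x. S \<in> A \<Longrightarrow> x \<in> S \<Longrightarrow> cmod (f x) \<le> M S" "\<And>S. S \<in> A \<Longrightarrow> countable (Z S)"
    "\<And>S x. S \<in> A \<Longrightarrow> x \<in> S \<Longrightarrow> x \<notin> Z S \<Longrightarrow> isCont f x" by metis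
  show ?thesis
  proof (rule tame_onI[of _ _ "\<Sum>S\<in>A. \<bar>M S\<bar>" "\<Union>S\<in>A. Z S"])
    fix x assume "x \<in> \<Union>A"
    then obtain S where S: "S \<in> A" "x \<in> S" by auto
    have "cmod (f x) \<le> \<bar>M S\<bar>" using MZ(1)[OF S] by simp
    also have "\<dots> \<le> (\<Sum>S\<in>A. \<bar>M S\<bar>)" by (rule member_le_sum) (use S assms in auto)
    finally show "cmod (f x) \<le> (\<Sum>S\<in>A. \<bar>M S\<bar>)" .
  qed (use MZ assms in \<open>auto intro: countable_finite\<close>)
qed

lemma tame_on_cong_open:
  assumes "open S" "\<And>x. x \<in> S \<Longrightarrow> f x = h x" "tame_on S h" shows "tame_on S f"
proof -
  obtain M where M: "\<And>x. x \<in> S \<Longrightarrow> cmod (h x) \<le> M" using tame_on_bounded[OF assms(3)] by blast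
  obtain Z where Z: "countable Z" "\<And>x. x \<in> S \<Longrightarrow> x \<notin> Z \<Longrightarrow> isCont h x" using tame_on_cont[OF assms(3)] by blast
  show ?thesis
  proof (rule tame_onI[of _ _ M Z])
    fix x assume x: "x \<in> S" "x \<notin> Z"
    have "\<forall>\<^sub>F y in nhds x. f y = h y"
      using eventually_nhds_in_open[OF assms(1) x(1)] by eventually_elim (use assms(2) in auto)
    thus "isCont f x" using Z(2)[OF x] isCont_cong by metis
  qed (use M Z assms(2) in auto)
qed

lemma negligible_if_countable: "countable (S :: real set) \<Longrightarrow> negligible S"
  using countable_imp_null_set_lborel[of S] null_sets_completionI[of S lborel] by (simp add: negligible_iff_null_sets)

text \<open>The points of \<open>P\<close> are those where jumps are allowed; a point of \<open>P\<close>
  belongs to the interval on its right, and the left end points of the partition stand for the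
  initial values on their intervals. The function \<open>g\<close> is the weight of the top
  derivative and \<open>wt p k\<close> that of the jump at \<open>p\<close> with index
  \<open>k\<close>. The common positive lower bound \<open>m\<close> of the weights makes the
  inclusion into the bounded functions continuous.\<close>

locale jump_space =
  fixes \<Omega> :: "real set set" and P :: "real set" and r :: nat
    and g :: "real \<Rightarrow> real" and wt :: "real \<Rightarrow> nat \<Rightarrow> real" and m :: real
  assumes fin: "finite \<Omega>"
    and ivl: "\<omega> \<in> \<Omega> \<Longrightarrow> \<exists>a b. 0 \<le> a \<and> a < b \<and> b \<le> 1 \<and> \<omega> = {a<..<b}"
    and disj: "disjoint \<Omega>"
    and null: "{0..1} - \<Union>\<Omega> \<in> null_sets lborel"
    and P: "p \<in> P \<Longrightarrow> \<exists>a b. {a<..<b} \<in> \<Omega> \<and> a \<le> p \<and> p < b"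
    and m: "0 < m" "x \<in> \<Union>\<Omega> \<Longrightarrow> m \<le> g x" "p \<in> P \<Longrightarrow> k < r \<Longrightarrow> m \<le> wt p k"
begin

abbreviation "U \<equiv> \<Union>\<Omega>"

lemma openU: "open U"
proof (intro open_Union ballI)
  fix \<omega> assume "\<omega> \<in> \<Omega>"
  then obtain a b where "\<omega> = {a<..<b}" using ivl by blast
  thus "open \<omega>" by simp
qed

lemma ivl': "{a<..<b} \<in> \<Omega> \<Longrightarrow> x \<in> {a<..<b} \<Longrightarrow> 0 \<le> a \<and> a < b \<and> b \<le> 1"
  using ivl[of "{a<..<b}"] by (auto simp: greaterThanLessThan_eq_iff)

lemma ivl_exists: assumes "x \<in> U" obtains a b where "{a<..<b} \<in> \<Omega>" "x \<in> {a<..<b}" "0 \<le> a" "a < b" "b \<le> 1"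
  using assms ivl by blast

definition left_end :: "real \<Rightarrow> real" where "left_end x = Inf (\<Union>{\<omega>\<in>\<Omega>. x \<in> \<omega>})"

lemma unique_ivl: "\<omega> \<in> \<Omega> \<Longrightarrow> \<omega>' \<in> \<Omega> \<Longrightarrow> x \<in> \<omega> \<Longrightarrow> x \<in> \<omega>' \<Longrightarrow> \<omega> = \<omega>'"
  using disj by (auto simp: disjoint_def)

lemma left_end_eq: assumes "{a<..<b} \<in> \<Omega>" "x \<in> {a<..<b}" shows "left_end x = a"
proof -
  have "\<Union>{\<omega>\<in>\<Omega>. x \<in> \<omega>} = {a<..<b}" using assms unique_ivl by blast
  thus ?thesis using assms by (simp add: left_end_def cInf_greaterThanLessThan)
qed

text \<open>The index counts integrations: \<open>glue d G r\<close> is the function itself and \<open>glue d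
  G k\<close> its derivative of order \<open>r - k\<close>, so \<open>d p k\<close> is the jump at
  \<open>p\<close> of the derivative of order \<open>r - Suc k\<close>. Counting integrations
  instead of derivatives allows the jets to be constructed by recursion from \<open>G\<close>.\<close>

primrec glue :: "(real \<Rightarrow> nat \<Rightarrow> complex) \<Rightarrow> (real \<Rightarrow> complex) \<Rightarrow> nat \<Rightarrow> real \<Rightarrow> complex" where
  "glue d G 0 = G"
| "glue d G (Suc k) = (\<lambda>x. jumps_before P (left_end x) (\<lambda>p. d p k) x + integral {left_end x..x} (glue d G k))"

definition jumps_ok :: "(real \<Rightarrow> nat \<Rightarrow> complex) \<Rightarrow> bool" where
  "jumps_ok d \<longleftrightarrow> (\<forall>k<r. (\<lambda>p. cmod (d p k)) summable_on P)"

lemma glue_on: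
  assumes "{a<..<b} \<in> \<Omega>" "x \<in> {a<..<b}"
  shows "glue d G (Suc k) x = jumps_before P a (\<lambda>p. d p k) x + integral {a..x} (glue d G k)"
  using left_end_eq[OF assms] by simp

lemma tame_glue_step:
  assumes f: "tame_on U f" and \<delta>: "(\<lambda>p. cmod (\<delta> p)) summable_on P"
  shows "tame_on U (\<lambda>x. jumps_before P (left_end x) \<delta> x + integral {left_end x..x} f)"
proof (rule tame_on_Union[OF fin])
  fix \<omega> assume \<omega>: "\<omega> \<in> \<Omega>"
  then obtain a b where ab: "\<omega> = {a<..<b}" "a < b" using ivl by blast
  have f': "tame_on {a<..<b} f" by (rule tame_on_subset[OF f]) (use \<omega> ab in auto)
  obtain M where M: "M \<ge> 0" "\<And>x. x \<in> {a<..<b} \<Longrightarrow> cmod (f x) \<le> M" using tame_on_bounded[OF f'] by blast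
  have "tame_on {a<..<b} (\<lambda>x. jumps_before P a \<delta> x + integral {a..x} f)"
  proof (rule tame_on_add)
    have "countable {p\<in>P. \<delta> p \<noteq> 0}" by (rule abs_summable_countable[OF \<delta>])
    thus "tame_on {a<..<b} (jumps_before P a \<delta>)"
      by (rule tame_onI[OF jumps_before_bound[OF \<delta>]]) (use jumps_before_isCont[OF \<delta>, of a] in auto)
    show "tame_on {a<..<b} (\<lambda>x. integral {a..x} f)"
    proof (rule tame_onI[of _ _ "M * (b - a)" "{}"])
      fix x assume x: "x \<in> {a<..<b}"
      have "cmod (integral {a..x} f) \<le> M * (x - a)"
        by (rule tame_on_integral_bound[OF tame_on_subset[OF f']]) (use x M in auto)
      also have "\<dots> \<le> M * (b - a)" using x M by (intro mult_left_mono) auto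
      finally show "cmod (integral {a..x} f) \<le> M * (b - a)" .
      show "isCont (\<lambda>x. integral {a..x} f) x"
        by (rule continuous_on_interior[OF tame_on_integral_continuous[OF f']]) (use x in auto)
    qed auto
  qed
  thus "tame_on \<omega> (\<lambda>x. jumps_before P (left_end x) \<delta> x + integral {left_end x..x} f)"
    unfolding ab(1) by (rule tame_on_cong_open[rotated 2]) (use left_end_eq[of a b] \<omega> ab in auto)
qed

lemma tame_glue:
  assumes "tame_on U G" "jumps_ok d" "k \<le> r" shows "tame_on U (glue d G k)"
  using assms(3)
proof (induction k)
  case (Suc k)
  thus ?case using tame_glue_step[of "glue d G k" "\<lambda>p. d p k"] assms(2) by (simp add: jumps_ok_def)
qed (use assms in auto)

lemma tame_glue_ivl:
  assumes "tame_on U G" "jumps_ok d" "k \<le> r" "{a<..<b} \<in> \<Omega>" "x \<le> b"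
  shows "tame_on {a<..<x} (glue d G k)"
  by (rule tame_on_subset[OF tame_glue[OF assms(1-3)]]) (use assms in auto)

lemma jumps_before_add_scale:
  assumes d: "(\<lambda>p. cmod (d p)) summable_on P" and e: "(\<lambda>p. cmod (e p)) summable_on P"
  shows "jumps_before P a (\<lambda>p. d p + c * e p) x = jumps_before P a d x + c * jumps_before P a e x"
proof -
  have s: "d summable_on (P \<inter> {a..<x})" "e summable_on (P \<inter> {a..<x})"
    by (rule summable_on_of_norm[OF d] summable_on_of_norm[OF e]; simp)+
  show ?thesis unfolding jumps_before_def
    by (subst infsum_add) (use s in \<open>auto simp: infsum_cmult_right intro: summable_on_cmult_right\<close>)
qed

lemma glue_add_scale:
  assumes G: "tame_on U G" and H: "tame_on U H" and d: "jumps_ok d" and e: "jumps_ok e"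
  shows "k \<le> r \<Longrightarrow> x \<in> U \<Longrightarrow>
    glue (\<lambda>p k. d p k + c * e p k) (\<lambda>x. G x + c * H x) k x = glue d G k x + c * glue e H k x"
proof (induction k arbitrary: x)
  case (Suc k)
  obtain a b where ab: "{a<..<b} \<in> \<Omega>" "x \<in> {a<..<b}" using ivl_exists[OF Suc.prems(2)] by blast
  have sub: "t \<in> U" if "t \<in> {a<..<b}" for t using that ab(1) by blast
  have dk: "(\<lambda>p. cmod (d p k)) summable_on P" "(\<lambda>p. cmod (e p k)) summable_on P"
    using d e Suc.prems by (auto simp: jumps_ok_def)
  have i1: "glue d G k integrable_on {a..x}" "glue e H k integrable_on {a..x}"
    by (rule tame_on_integrable[OF tame_glue_ivl[OF _ _ _ ab(1)]]; use G H d e Suc.prems ab in auto)+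
  have "integral {a..x} (glue (\<lambda>p k. d p k + c * e p k) (\<lambda>x. G x + c * H x) k) =
      integral {a..x} (\<lambda>t. glue d G k t + c * glue e H k t)"
    by (rule integral_spike[of "{a}"]) (use Suc.IH Suc.prems sub ab in auto)
  also have "\<dots> = integral {a..x} (glue d G k) + c * integral {a..x} (glue e H k)"
    using i1 by (simp add: integral_add integrable_on_mult_right)
  finally show ?case
    unfolding glue_on[OF ab] jumps_before_add_scale[OF dk] by (simp add: algebra_simps)
qed simp

lemma glue_bound:
  assumes G: "tame_on U G" and d: "jumps_ok d" and M: "\<And>x. x \<in> U \<Longrightarrow> cmod (G x) \<le> M"
    and D: "\<And>k. k < r \<Longrightarrow> infsum (\<lambda>p. cmod (d p k)) P \<le> D" and "0 \<le> M" "0 \<le> D"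
  shows "k \<le> r \<Longrightarrow> x \<in> U \<Longrightarrow> cmod (glue d G k x) \<le> M + real k * D"
proof (induction k arbitrary: x)
  case (Suc k)
  obtain a b where ab: "{a<..<b} \<in> \<Omega>" "x \<in> {a<..<b}" "0 \<le> a" "b \<le> 1" using ivl_exists[OF Suc.prems(2)] by blast
  have "cmod (integral {a..x} (glue d G k)) \<le> (M + real k * D) * (x - a)"
  proof (rule tame_on_integral_bound)
    show "tame_on {a<..<x} (glue d G k)"
      by (rule tame_glue_ivl[OF G d _ ab(1)]) (use Suc.prems ab in auto)
    fix t assume t: "t \<in> {a<..<x}"
    hence "t \<in> {a<..<b}" using ab by auto
    hence "t \<in> U" using ab by blast
    thus "cmod (glue d G k t) \<le> M + real k * D" using Suc by simp
  qed (use ab in auto)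
  also have "\<dots> \<le> M + real k * D"
    using ab \<open>0 \<le> M\<close> \<open>0 \<le> D\<close> mult_left_le[of "x - a" "M + real k * D"] by simp
  finally have "cmod (integral {a..x} (glue d G k)) \<le> M + real k * D" .
  moreover have "cmod (jumps_before P a (\<lambda>p. d p k) x) \<le> D"
    using jumps_before_bound[of "\<lambda>p. d p k" P a x] D[of k] d Suc.prems by (auto simp: jumps_ok_def)
  ultimately show ?case
    unfolding glue_on[OF ab(1,2)] by (intro norm_triangle_le) (simp add: algebra_simps)
qed (use M in auto)

text \<open>Remove one integration at a time: by \<open>jumps_plus_integral_zero\<close> the outermost jumps
  vanish, and so does the integrand off a countable set. Hence the jumps of an element of the
  space are unique, and so is its top derivative off a countable set.\<close>

theorem glue_eq_0_imp:
  assumes G: "tame_on U G" and d: "jumps_ok d"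
  shows "k \<le> r \<Longrightarrow> negligible S \<Longrightarrow> (\<And>x. x \<in> U - S \<Longrightarrow> glue d G k x = 0) \<Longrightarrow>
    (\<forall>j<k. \<forall>p\<in>P. d p j = 0) \<and> (\<exists>Z. countable Z \<and> (\<forall>x\<in>U - Z. G x = 0))"
proof (induction k arbitrary: S)
  case 0
  obtain Z where Z: "countable Z" "\<And>x. x \<in> U \<Longrightarrow> x \<notin> Z \<Longrightarrow> isCont G x" using tame_on_cont[OF G] by blast
  have "G x = 0" if x: "x \<in> U" "x \<notin> Z" for x
  proof (rule ccontr)
    assume "G x \<noteq> 0"
    have "isCont (\<lambda>x. cmod (G x)) x" using Z(2)[OF x] by (intro continuous_intros)
    hence "((\<lambda>x. cmod (G x)) \<longlongrightarrow> cmod (G x)) (nhds x)"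
      unfolding isCont_def by (rule tendsto_at_iff_tendsto_nhds[THEN iffD1])
    from order_tendstoD(1)[OF this, of 0] have "\<forall>\<^sub>F y in nhds x. cmod (G y) > 0" using \<open>G x \<noteq> 0\<close> by simp
    moreover have "\<forall>\<^sub>F y in nhds x. y \<in> U" by (rule eventually_nhds_in_open[OF openU x(1)])
    ultimately have "\<forall>\<^sub>F y in nhds x. y \<in> U \<and> G y \<noteq> 0" by eventually_elim auto
    then obtain e where e: "e > 0" "\<And>y. dist y x < e \<Longrightarrow> y \<in> U \<and> G y \<noteq> 0"
      by (auto simp: eventually_nhds_metric)
    obtain y where "x < y" "y < x + e" "y \<notin> S" using negligible_avoid[OF 0(2), of x "x + e"] e by auto
    thus False using e(2)[of y] 0(3)[of y] by (auto simp: dist_real_def)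
  qed
  thus ?case using Z(1) by auto
next
  case (Suc k)
  have dk: "(\<lambda>p. cmod (d p k)) summable_on P" using d Suc.prems by (auto simp: jumps_ok_def)
  have z: "jumps_before P a (\<lambda>p. d p k) x + integral {a..x} (glue d G k) = 0"
    if "{a<..<b} \<in> \<Omega>" "x \<in> {a<..<b} - S" for a b x
  proof -
    have "x \<in> U - S" using that by blast
    thus ?thesis using Suc.prems(3)[of x] glue_on[of a b x d G k] that by auto
  qed
  have t: "tame_on {a<..<b} (glue d G k)" if "{a<..<b} \<in> \<Omega>" for a b
    by (rule tame_glue_ivl[OF G d _ that]) (use Suc.prems in auto)
  have "d p k = 0" if p: "p \<in> P" for p
  proof -
    obtain a b where ab: "{a<..<b} \<in> \<Omega>" "a \<le> p" "p < b" using P[OF p] by blast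
    show ?thesis by (rule jumps_plus_integral_zero(1)[OF dk t[OF ab(1)] Suc.prems(2) z[OF ab(1)] p ab(2,3)])
  qed
  moreover have "\<forall>\<omega>\<in>\<Omega>. \<exists>Z. countable Z \<and> (\<forall>x\<in>\<omega> - Z. glue d G k x = 0)"
  proof
    fix \<omega> assume \<omega>: "\<omega> \<in> \<Omega>"
    obtain a b where ab: "\<omega> = {a<..<b}" using ivl[OF \<omega>] by blast
    have ab': "{a<..<b} \<in> \<Omega>" using \<omega> ab by simp
    show "\<exists>Z. countable Z \<and> (\<forall>x\<in>\<omega> - Z. glue d G k x = 0)" unfolding ab by (rule jumps_plus_integral_zero(2)[OF dk t[OF ab'] Suc.prems(2) z[OF ab']])
  qed
  from bchoice[OF this] obtain Z where Z0:
    "\<forall>\<omega>\<in>\<Omega>. countable (Z \<omega>) \<and> (\<forall>x\<in>\<omega> - Z \<omega>. glue d G k x = 0)" by blast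
  have Z: "countable (Z \<omega>)" if "\<omega> \<in> \<Omega>" for \<omega> using bspec[OF Z0 that] by simp
  have Z': "glue d G k x = 0" if "\<omega> \<in> \<Omega>" "x \<in> \<omega> - Z \<omega>" for \<omega> x using bspec[OF Z0 that(1)] that(2) by simp
  have "(\<forall>j<k. \<forall>p\<in>P. d p j = 0) \<and> (\<exists>Z. countable Z \<and> (\<forall>x\<in>U - Z. G x = 0))"
  proof (rule Suc.IH)
    show "negligible (\<Union>\<omega>\<in>\<Omega>. Z \<omega>)"
      using Z fin by (intro negligible_if_countable countable_UN) (auto intro: countable_finite)
    fix x assume "x \<in> U - (\<Union>\<omega>\<in>\<Omega>. Z \<omega>)"
    then obtain \<omega> where "\<omega> \<in> \<Omega>" "x \<in> \<omega> - Z \<omega>" by auto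
    thus "glue d G k x = 0" by (rule Z')
  qed (use Suc.prems in auto)
  ultimately show ?case by (auto simp: less_Suc_eq)
qed

text \<open>The bound on the jumps is stated for finite subsets, which includes summability and does not
  depend on the value of an infinite sum.\<close>

definition data_le :: "(real \<Rightarrow> nat \<Rightarrow> complex) \<Rightarrow> (real \<Rightarrow> complex) \<Rightarrow> real \<Rightarrow> real \<Rightarrow> bool" where
  "data_le d G M M' \<longleftrightarrow> 0 \<le> M \<and> 0 \<le> M' \<and> tame_on U G \<and> (\<forall>x\<in>U. g x * cmod (G x) \<le> M) \<and>
     (\<forall>F. finite F \<longrightarrow> F \<subseteq> P \<times> {..<r} \<longrightarrow> (\<Sum>(p,k)\<in>F. wt p k * cmod (d p k)) \<le> M')"

lemma g_pos: "x \<in> U \<Longrightarrow> g x > 0" using m(1,2) by (meson less_le_trans)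
lemma wt_pos: "p \<in> P \<Longrightarrow> k < r \<Longrightarrow> wt p k > 0" using m(1,3) by (meson less_le_trans)

lemma data_le_sum_le:
  "data_le d G M M' \<Longrightarrow> finite F \<Longrightarrow> F \<subseteq> P \<times> {..<r} \<Longrightarrow> (\<Sum>(p,k)\<in>F. wt p k * cmod (d p k)) \<le> M'"
  by (simp add: data_le_def)

lemma data_leD:
  assumes "data_le d G M M'"
  shows "0 \<le> M" "0 \<le> M'" "tame_on U G" "jumps_ok d" "\<And>x. x \<in> U \<Longrightarrow> cmod (G x) \<le> M / m"
    "\<And>k. k < r \<Longrightarrow> infsum (\<lambda>p. cmod (d p k)) P \<le> M' / m"
proof -
  show "0 \<le> M" "0 \<le> M'" "tame_on U G" using assms by (auto simp: data_le_def)
  have b: "(\<Sum>p\<in>F. cmod (d p k)) \<le> M' / m" if "finite F" "F \<subseteq> P" "k < r" for F k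
  proof -
    have "m * (\<Sum>p\<in>F. cmod (d p k)) \<le> (\<Sum>p\<in>F. wt p k * cmod (d p k))"
      unfolding sum_distrib_left using that m by (intro sum_mono mult_right_mono) auto
    also have "\<dots> = (\<Sum>(p,k)\<in>F \<times> {k}. wt p k * cmod (d p k))"
      using sum.cartesian_product[of "\<lambda>p k. wt p k * cmod (d p k)" "{k}" F] by simp
    also have "\<dots> \<le> M'" by (rule data_le_sum_le[OF assms]) (use that in auto)
    finally show ?thesis using m(1) by (simp add: field_simps)
  qed
  have s: "(\<lambda>p. cmod (d p k)) summable_on P" if "k < r" for k
    by (rule nonneg_bdd_above_summable_on) (use b that in \<open>auto simp: bdd_above_def\<close>)
  show "jumps_ok d" using s by (auto simp: jumps_ok_def)
  show "infsum (\<lambda>p. cmod (d p k)) P \<le> M' / m" if "k < r" for k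
    by (rule infsum_le_finite_sums[OF s[OF that]]) (use b that in auto)
  fix x assume x: "x \<in> U"
  have "m * cmod (G x) \<le> g x * cmod (G x)" using m(2)[OF x] by (intro mult_right_mono) auto
  also have "\<dots> \<le> M" using assms x by (auto simp: data_le_def)
  finally show "cmod (G x) \<le> M / m" using m(1) by (simp add: field_simps)
qed

lemma data_le_glue_bound:
  assumes "data_le d G M M'" "k \<le> r" "x \<in> U"
  shows "cmod (glue d G k x) \<le> (1 + real r) / m * (M + M')"
proof -
  note D = data_leD[OF assms(1)]
  have "cmod (glue d G k x) \<le> M / m + real k * (M' / m)"
    by (rule glue_bound[OF D(3,4,5,6)]) (use D m assms in auto)
  also have "\<dots> \<le> (1 + real r) * (M / m) + (1 + real r) * (M' / m)"
  proof (rule add_mono)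
    show "M / m \<le> (1 + real r) * (M / m)"
      using mult_right_mono[of 1 "1 + real r" "M / m"] D m by simp
    show "real k * (M' / m) \<le> (1 + real r) * (M' / m)"
      using D m assms by (intro mult_right_mono) auto
  qed
  also have "\<dots> = (1 + real r) / m * (M + M')" using m(1) by (simp add: field_simps)
  finally show ?thesis .
qed

lemma data_le_add:
  assumes "data_le d G M M'" "data_le e H L L'"
  shows "data_le (\<lambda>p k. d p k + c * e p k) (\<lambda>x. G x + c * H x) (M + cmod c * L) (M' + cmod c * L')"
  unfolding data_le_def
proof (intro conjI allI impI ballI)
  note 1 = data_leD[OF assms(1)] and 2 = data_leD[OF assms(2)]
  show "0 \<le> M + cmod c * L" "0 \<le> M' + cmod c * L'" using 1 2 by auto
  show "tame_on U (\<lambda>x. G x + c * H x)" by (intro tame_on_add tame_on_cmult 1 2)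
  fix x assume x: "x \<in> U"
  have "g x * cmod (G x + c * H x) \<le> g x * (cmod (G x) + cmod c * cmod (H x))"
    using g_pos[OF x] by (intro mult_left_mono) (metis norm_mult norm_triangle_ineq, simp)
  also have "\<dots> = g x * cmod (G x) + cmod c * (g x * cmod (H x))" by (simp add: algebra_simps)
  also have "\<dots> \<le> M + cmod c * L" using assms x by (intro add_mono mult_left_mono) (auto simp: data_le_def)
  finally show "g x * cmod (G x + c * H x) \<le> M + cmod c * L" .
next
  fix F :: "(real \<times> nat) set" assume F: "finite F" "F \<subseteq> P \<times> {..<r}"
  have "(\<Sum>(p,k)\<in>F. wt p k * cmod (d p k + c * e p k)) \<le>
      (\<Sum>(p,k)\<in>F. wt p k * cmod (d p k) + cmod c * (wt p k * cmod (e p k)))"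
  proof (intro sum_mono, clarify)
    fix p k assume "(p, k) \<in> F"
    hence "wt p k > 0" using F wt_pos by auto
    hence "wt p k * cmod (d p k + c * e p k) \<le> wt p k * (cmod (d p k) + cmod c * cmod (e p k))"
      by (intro mult_left_mono) (metis norm_mult norm_triangle_ineq, simp)
    thus "wt p k * cmod (d p k + c * e p k) \<le> wt p k * cmod (d p k) + cmod c * (wt p k * cmod (e p k))"
      by (simp add: algebra_simps)
  qed
  also have "\<dots> = (\<Sum>(p,k)\<in>F. wt p k * cmod (d p k)) + cmod c * (\<Sum>(p,k)\<in>F. wt p k * cmod (e p k))"
    by (simp add: case_prod_beta sum.distrib sum_distrib_left)
  also have "\<dots> \<le> M' + cmod c * L'"
    using assms F by (intro add_mono mult_left_mono) (auto simp: data_le_def)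
  finally show "(\<Sum>(p,k)\<in>F. wt p k * cmod (d p k + c * e p k)) \<le> M' + cmod c * L'" .
qed

lemma data_le_zero: "data_le (\<lambda>_ _. 0) (\<lambda>_. 0) 0 0"
  by (auto simp: data_le_def)

lemma data_le_sum:
  assumes "finite I" "\<And>i. i \<in> I \<Longrightarrow> data_le (d i) (G i) (M i) (M' i)"
  shows "data_le (\<lambda>p k. \<Sum>i\<in>I. c i * d i p k) (\<lambda>x. \<Sum>i\<in>I. c i * G i x) (\<Sum>i\<in>I. cmod (c i) * M i) (\<Sum>i\<in>I. cmod (c i) * M' i)"
  using assms
proof (induction I rule: finite_induct)
  case (insert i I)
  from data_le_add[of _ _ _ _ "d i" "G i" "M i" "M' i" "c i", OF insert.IH] insert
  show ?case by (simp add: add.commute)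
qed (use data_le_zero in auto)

lemma glue_zero: "x \<in> U \<Longrightarrow> k \<le> r \<Longrightarrow> glue (\<lambda>_ _. 0) (\<lambda>_. 0) k x = 0"
  using data_le_glue_bound[OF data_le_zero] by simp

lemma glue_sum:
  assumes "finite I" "\<And>i. i \<in> I \<Longrightarrow> data_le (d i) (G i) (M i) (M' i)" "x \<in> U" "k \<le> r"
  shows "glue (\<lambda>p k. \<Sum>i\<in>I. c i * d i p k) (\<lambda>x. \<Sum>i\<in>I. c i * G i x) k x = (\<Sum>i\<in>I. c i * glue (d i) (G i) k x)"
  using assms
proof (induction I rule: finite_induct)
  case (insert i I)
  note D = data_leD[OF data_le_sum[OF insert.hyps(1), of d G M M' c]] and D' = data_leD[OF insert.prems(1)[of i]]
  have "glue (\<lambda>p k. (\<Sum>i\<in>I. c i * d i p k) + c i * d i p k) (\<lambda>x. (\<Sum>i\<in>I. c i * G i x) + c i * G i x) k x =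
     glue (\<lambda>p k. (\<Sum>i\<in>I. c i * d i p k)) (\<lambda>x. (\<Sum>i\<in>I. c i * G i x)) k x + c i * glue (d i) (G i) k x"
    by (rule glue_add_scale) (use D D' insert in auto)
  thus ?case using insert by (simp add: add.commute)
qed (simp add: glue_zero)

text \<open>The limit of the sums over a finite set of jumps is taken termwise, and the top derivatives
  converge uniformly because \<open>g\<close> is bounded below by \<open>m\<close>.\<close>

lemma data_le_series:
  assumes D: "\<And>n. data_le (d n) (G n) (M n) (M' n)" and s: "summable M" "summable M'"
  shows "data_le (\<lambda>p k. \<Sum>n. d n p k) (\<lambda>x. \<Sum>n. G n x) (suminf M) (suminf M')"
  unfolding data_le_def
proof (intro conjI allI impI ballI)
  note D' = data_leD[OF D]
  show "0 \<le> suminf M" "0 \<le> suminf M'" using D' s by (auto intro: suminf_nonneg)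
  show "tame_on U (\<lambda>x. \<Sum>n. G n x)"
    by (rule tame_on_series[OF openU D'(3) D'(5)]) (use s in \<open>auto intro: summable_divide\<close>)
  fix x assume x: "x \<in> U"
  have sG: "summable (\<lambda>n. cmod (G n x))"
    by (rule summable_comparison_test[OF _ summable_divide[OF s(1), of m]]) (use D'(5) x in auto)
  have "g x * cmod (\<Sum>n. G n x) \<le> g x * (\<Sum>n. cmod (G n x))"
    using g_pos[OF x] by (intro mult_left_mono summable_norm[OF sG]) auto
  also have "\<dots> = (\<Sum>n. g x * cmod (G n x))" by (rule suminf_mult[OF sG, symmetric])
  also have "\<dots> \<le> suminf M"
    by (rule suminf_le[OF _ summable_mult[OF sG] s(1)]) (use D x in \<open>auto simp: data_le_def\<close>)
  finally show "g x * cmod (\<Sum>n. G n x) \<le> suminf M" .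
next
  note D' = data_leD[OF D]
  fix F :: "(real \<times> nat) set" assume F: "finite F" "F \<subseteq> P \<times> {..<r}"
  have b: "wt p k * cmod (d n p k) \<le> M' n" if "(p,k) \<in> F" for n p k
  proof -
    have "(\<Sum>(p,k)\<in>{(p,k)}. wt p k * cmod (d n p k)) \<le> M' n"
      by (rule data_le_sum_le[OF D]) (use that F in auto)
    thus ?thesis by simp
  qed
  have sm: "summable (\<lambda>n. wt p k * cmod (d n p k))" if "(p,k) \<in> F" for p k
  proof (rule summable_comparison_test[OF _ s(2)])
    have "wt p k > 0" using F that wt_pos by auto
    thus "\<exists>N. \<forall>n\<ge>N. norm (wt p k * cmod (d n p k)) \<le> M' n" using b[OF that] by (simp add: abs_mult)
  qed
  have "(\<Sum>(p,k)\<in>F. wt p k * cmod (\<Sum>n. d n p k)) \<le> (\<Sum>(p,k)\<in>F. \<Sum>n. wt p k * cmod (d n p k))"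
  proof (intro sum_mono, clarify)
    fix p k assume pk: "(p,k) \<in> F"
    hence w: "wt p k > 0" using F wt_pos by auto
    have sd: "summable (\<lambda>n. cmod (d n p k))"
      using summable_mult[OF sm[OF pk], of "1 / wt p k"] w by simp
    have "wt p k * cmod (\<Sum>n. d n p k) \<le> wt p k * (\<Sum>n. cmod (d n p k))"
      using w by (intro mult_left_mono summable_norm[OF sd]) auto
    thus "wt p k * cmod (\<Sum>n. d n p k) \<le> (\<Sum>n. wt p k * cmod (d n p k))"
      by (simp add: suminf_mult[OF sd])
  qed
  also have "\<dots> = (\<Sum>n. \<Sum>(p,k)\<in>F. wt p k * cmod (d n p k))"
    unfolding case_prod_beta by (rule suminf_sum[symmetric]) (use sm in auto)
  also have "\<dots> \<le> suminf M'"
  proof (rule suminf_le[OF _ _ s(2)])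
    show "(\<Sum>(p,k)\<in>F. wt p k * cmod (d n p k)) \<le> M' n" for n using D[of n] F by (auto simp: data_le_def)
    show "summable (\<lambda>n. \<Sum>(p,k)\<in>F. wt p k * cmod (d n p k))"
      unfolding case_prod_beta by (rule summable_sum) (use sm in auto)
  qed
  finally show "(\<Sum>(p,k)\<in>F. wt p k * cmod (\<Sum>n. d n p k)) \<le> suminf M'" .
qed

end

section \<open>The Banach space of glued functions\<close>

context jump_space begin

lemma glue_cong:
  assumes "\<And>p k. p \<in> P \<Longrightarrow> k < r \<Longrightarrow> d p k = e p k" "\<And>x. x \<in> U \<Longrightarrow> G x = H x"
  shows "k \<le> r \<Longrightarrow> x \<in> U \<Longrightarrow> glue d G k x = glue e H k x"
proof (induction k arbitrary: x)
  case (Suc k)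
  obtain a b where ab: "{a<..<b} \<in> \<Omega>" "x \<in> {a<..<b}" using ivl_exists[OF Suc.prems(2)] by blast
  have sub: "t \<in> U" if "t \<in> {a<..<b}" for t using that ab(1) by blast
  have "integral {a..x} (glue d G k) = integral {a..x} (glue e H k)"
    by (rule integral_spike[of "{a}"]) (use Suc.IH Suc.prems sub ab in auto)
  moreover have "jumps_before P a (\<lambda>p. d p k) x = jumps_before P a (\<lambda>p. e p k) x"
    unfolding jumps_before_def by (rule infsum_cong) (use assms Suc.prems in auto)
  ultimately show ?case unfolding glue_on[OF ab] by simp
qed (use assms in auto)

lemma AE_in_U: "AE x in lebesgue_on {0..1}. x \<in> U"
proof -
  have "{0..1} - U \<in> null_sets lebesgue" using null null_sets_completion_iff2 null_sets_completionI by blast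
  moreover have "{x\<in>{0..1}. x \<notin> U} = {0..1} - U" by auto
  ultimately show ?thesis unfolding AE_unit_interval_iff negligible_iff_null_sets by simp
qed

lemma AE_U: "(\<And>x. x \<in> U \<Longrightarrow> Q x) \<Longrightarrow> AE x in lebesgue_on {0..1}. Q x"
  using AE_in_U by eventually_elim auto

lemma U_sub: "U \<subseteq> {0..1}"
proof
  fix x assume "x \<in> U"
  then obtain a b where "x \<in> {a<..<b}" "0 \<le> a" "b \<le> 1" using ivl_exists by blast
  thus "x \<in> {0..1}" by auto
qed

lemma negligible_U_of_AE:
  assumes "AE x in lebesgue_on {0..1}. Q x" obtains S where "negligible S" "\<And>x. x \<in> U - S \<Longrightarrow> Q x"
proof (rule that)
  show "negligible {x\<in>{0..1}. \<not> Q x}" using assms unfolding AE_unit_interval_iff .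
  show "Q x" if "x \<in> U - {x\<in>{0..1}. \<not> Q x}" for x using that U_sub by blast
qed

lemma measurable_if_tame:
  assumes f: "tame_on U f" and h: "AE x in lebesgue_on {0..1}. h x = f x"
  shows "h \<in> borel_measurable (lebesgue_on {0..1})"
proof -
  define F where "F x = (\<Sum>\<omega>\<in>\<Omega>. if x \<in> \<omega> then f x else 0)" for x
  have [measurable]: "F \<in> borel_measurable borel"
    unfolding F_def
  proof (rule borel_measurable_sum)
    fix \<omega> assume \<omega>: "\<omega> \<in> \<Omega>"
    obtain a b where ab: "\<omega> = {a<..<b}" using ivl[OF \<omega>] by blast
    show "(\<lambda>x. if x \<in> \<omega> then f x else 0) \<in> borel_measurable borel"
      unfolding ab by (rule tame_on_cutoff_measurable[OF tame_on_subset[OF f]]) (use \<omega> ab in auto)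
  qed
  have "(\<lambda>x. if x \<in> {0..1} then F x else 0) \<in> borel_measurable lborel" by measurable
  hence Fm: "(\<lambda>x. if x \<in> {0..1} then F x else 0) \<in> borel_measurable lebesgue"
    by (rule measurable_completion)
  have Ff: "F x = f x" if x: "x \<in> U" for x
  proof -
    obtain \<omega> where \<omega>: "\<omega> \<in> \<Omega>" "x \<in> \<omega>" using x by blast
    have "F x = (\<Sum>\<omega>'\<in>{\<omega>}. if x \<in> \<omega>' then f x else 0)"
      unfolding F_def by (rule sum.mono_neutral_right[OF fin]) (use \<omega> unique_ivl in auto)
    thus ?thesis using \<omega> by simp
  qed
  have "AE x in lebesgue_on {0..1}. F x = h x"
    using h AE_in_U by eventually_elim (simp add: Ff del: Union_iff)
  hence "AE x in lebesgue. x \<in> {0..1} \<longrightarrow> F x = h x"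
    by (subst (asm) AE_restrict_space_iff) simp_all
  hence "AE x in lebesgue. (if x \<in> {0..1} then F x else 0) = (if x \<in> {0..1} then h x else 0)"
    by eventually_elim auto
  from borel_measurable_AE[OF Fm this] show ?thesis by (rule borel_measurable_if_D)
qed

definition rep :: "(real \<Rightarrow> complex) \<Rightarrow> real \<Rightarrow> bool" where
  "rep f M \<longleftrightarrow> (\<exists>d G M1 M2. data_le d G M1 M2 \<and> M1 + M2 \<le> M \<and> (AE x in lebesgue_on {0..1}. f x = glue d G r x))"

lemma repI: "data_le d G M1 M2 \<Longrightarrow> M1 + M2 \<le> M \<Longrightarrow> AE x in lebesgue_on {0..1}. f x = glue d G r x \<Longrightarrow> rep f M"
  unfolding rep_def by blast

lemma repE: assumes "rep f M"
  obtains d G M1 M2 where "data_le d G M1 M2" "M1 + M2 \<le> M" "AE x in lebesgue_on {0..1}. f x = glue d G r x"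
  using assms unfolding rep_def by blast

lemma rep_add_scale:
  assumes "rep f M" "rep h M'" shows "rep (\<lambda>x. f x + c * h x) (M + cmod c * M')"
proof -
  from assms(1) obtain d G M1 M2 where 1: "data_le d G M1 M2" "M1 + M2 \<le> M" "AE x in lebesgue_on {0..1}. f x = glue d G r x"
    by (rule repE)
  from assms(2) obtain e H L1 L2 where 2: "data_le e H L1 L2" "L1 + L2 \<le> M'" "AE x in lebesgue_on {0..1}. h x = glue e H r x"
    by (rule repE)
  have "cmod c * (L1 + L2) \<le> cmod c * M'" using 2 by (intro mult_left_mono) auto
  hence le: "(M1 + cmod c * L1) + (M2 + cmod c * L2) \<le> M + cmod c * M'" using 1 by (simp add: algebra_simps)
  show ?thesis
  proof (rule repI[OF data_le_add[OF 1(1) 2(1), of c] le])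
    show "AE x in lebesgue_on {0..1}. f x + c * h x = glue (\<lambda>p k. d p k + c * e p k) (\<lambda>x. G x + c * H x) r x"
      using 1(3) 2(3) AE_in_U
    proof eventually_elim
      case (elim x)
      thus ?case
        using glue_add_scale[OF data_leD(3)[OF 1(1)] data_leD(3)[OF 2(1)] data_leD(4)[OF 1(1)] data_leD(4)[OF 2(1)], of r x c]
        by simp
    qed
  qed
qed

text \<open>The series of the data represents the sum, and its tails represent the remainders: this follows
  from the linearity of \<open>glue\<close>, applied to the data of the sum split into an initial
  segment and a tail.\<close>

lemma rep_series_aux:
  assumes F: "\<And>n. rep (F n) (s n)" and s: "summable s"
  shows "\<exists>h. \<forall>n. rep (\<lambda>x. h x - (\<Sum>k<n. F k x)) (\<Sum>k. s (k + n))"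
proof -
  have "\<forall>n. \<exists>q. data_le (fst q) (fst (snd q)) (fst (snd (snd q))) (snd (snd (snd q))) \<and>
      fst (snd (snd q)) + snd (snd (snd q)) \<le> s n \<and> (AE x in lebesgue_on {0..1}. F n x = glue (fst q) (fst (snd q)) r x)"
  proof
    fix n
    from F[of n] obtain d G M1 M2 where "data_le d G M1 M2" "M1 + M2 \<le> s n" "AE x in lebesgue_on {0..1}. F n x = glue d G r x"
      by (rule repE)
    thus "\<exists>q. data_le (fst q) (fst (snd q)) (fst (snd (snd q))) (snd (snd (snd q))) \<and>
      fst (snd (snd q)) + snd (snd (snd q)) \<le> s n \<and> (AE x in lebesgue_on {0..1}. F n x = glue (fst q) (fst (snd q)) r x)"
      by (intro exI[of _ "(d, G, M1, M2)"]) simp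
  qed
  from choice[OF this] obtain q where q: "\<And>n. data_le (fst (q n)) (fst (snd (q n))) (fst (snd (snd (q n)))) (snd (snd (snd (q n)))) \<and>
      fst (snd (snd (q n))) + snd (snd (snd (q n))) \<le> s n \<and> (AE x in lebesgue_on {0..1}. F n x = glue (fst (q n)) (fst (snd (q n))) r x)"
    by blast
  define d G M M' where "d n = fst (q n)" and "G n = fst (snd (q n))" and "M n = fst (snd (snd (q n)))" and "M' n = snd (snd (snd (q n)))" for n
  have D: "data_le (d n) (G n) (M n) (M' n)" and le: "M n + M' n \<le> s n"
    and ae: "AE x in lebesgue_on {0..1}. F n x = glue (d n) (G n) r x" for n
    using q[of n] by (auto simp: d_def G_def M_def M'_def)
  note D' = data_leD[OF D]
  have nM: "norm (M n) \<le> s n" "norm (M' n) \<le> s n" for n using le[of n] D'(1,2)[of n] by auto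
  have sM: "summable M" "summable M'"
    by (rule summable_comparison_test'[OF s, of 0], rule nM)+
  define h where "h = glue (\<lambda>p k. \<Sum>n. d n p k) (\<lambda>x. \<Sum>n. G n x) r"
  have "rep (\<lambda>x. h x - (\<Sum>k<n. F k x)) (\<Sum>k. s (k + n))" for n
  proof (rule repI)
    have T: "data_le (\<lambda>p k. \<Sum>j. d (j + n) p k) (\<lambda>x. \<Sum>j. G (j + n) x) (\<Sum>j. M (j + n)) (\<Sum>j. M' (j + n))"
      by (rule data_le_series[OF D]) (use sM in \<open>simp_all add: summable_iff_shift\<close>)
    thus "data_le (\<lambda>p k. \<Sum>j. d (j + n) p k) (\<lambda>x. \<Sum>j. G (j + n) x) (\<Sum>j. M (j + n)) (\<Sum>j. M' (j + n))" .
    have "(\<Sum>j. M (j + n)) + (\<Sum>j. M' (j + n)) = (\<Sum>j. M (j + n) + M' (j + n))"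
      by (rule suminf_add) (use sM in \<open>simp_all add: summable_iff_shift\<close>)
    also have "\<dots> \<le> (\<Sum>j. s (j + n))"
      by (rule suminf_le) (use le sM s in \<open>auto simp: summable_iff_shift intro!: summable_add\<close>)
    finally show "(\<Sum>j. M (j + n)) + (\<Sum>j. M' (j + n)) \<le> (\<Sum>j. s (j + n))" .
    have S: "data_le (\<lambda>p k. \<Sum>i\<in>{..<n}. 1 * d i p k) (\<lambda>x. \<Sum>i\<in>{..<n}. 1 * G i x) (\<Sum>i\<in>{..<n}. cmod 1 * M i) (\<Sum>i\<in>{..<n}. cmod 1 * M' i)"
      by (rule data_le_sum) (use D in auto)
    have key: "h x - (\<Sum>k<n. glue (d k) (G k) r x) = glue (\<lambda>p k. \<Sum>j. d (j + n) p k) (\<lambda>x. \<Sum>j. G (j + n) x) r x" if x: "x \<in> U" for x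
    proof -
      have "h x = glue (\<lambda>p k. (\<Sum>j. d (j + n) p k) + 1 * (\<Sum>i\<in>{..<n}. 1 * d i p k)) (\<lambda>x. (\<Sum>j. G (j + n) x) + 1 * (\<Sum>i\<in>{..<n}. 1 * G i x)) r x"
        unfolding h_def
      proof (rule glue_cong[OF _ _ order_refl x])
        fix p k assume pk: "p \<in> P" "k < r"
        have "summable (\<lambda>n. d n p k)"
        proof (rule summable_norm_cancel, rule summable_comparison_test[OF _ summable_mult[OF sM(2), of "1 / wt p k"]])
          have w: "wt p k > 0" using wt_pos pk by auto
          have "wt p k * cmod (d n p k) \<le> M' n" for n
            using data_le_sum_le[OF D[of n], of "{(p,k)}"] pk by simp
          thus "\<exists>N. \<forall>n\<ge>N. norm (cmod (d n p k)) \<le> 1 / wt p k * M' n" using w by (simp add: field_simps)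
        qed
        from suminf_split_initial_segment[OF this, of n]
        show "(\<Sum>n. d n p k) = (\<Sum>j. d (j + n) p k) + 1 * (\<Sum>i\<in>{..<n}. 1 * d i p k)" by simp
      next
        fix t assume t: "t \<in> U"
        have "summable (\<lambda>n. G n t)"
        proof (rule summable_norm_cancel, rule summable_comparison_test[OF _ summable_divide[OF sM(1), of m]])
          show "\<exists>N. \<forall>n\<ge>N. norm (norm (G n t)) \<le> M n / m" using D'(5)[OF t] by auto
        qed
        from suminf_split_initial_segment[OF this, of n]
        show "(\<Sum>n. G n t) = (\<Sum>j. G (j + n) t) + 1 * (\<Sum>i\<in>{..<n}. 1 * G i t)" by simp
      qed
      also have "\<dots> = glue (\<lambda>p k. \<Sum>j. d (j + n) p k) (\<lambda>x. \<Sum>j. G (j + n) x) r x +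
          1 * glue (\<lambda>p k. \<Sum>i\<in>{..<n}. 1 * d i p k) (\<lambda>x. \<Sum>i\<in>{..<n}. 1 * G i x) r x"
        by (rule glue_add_scale[OF data_leD(3)[OF T] data_leD(3)[OF S] data_leD(4)[OF T] data_leD(4)[OF S] order_refl x])
      also have "glue (\<lambda>p k. \<Sum>i\<in>{..<n}. 1 * d i p k) (\<lambda>x. \<Sum>i\<in>{..<n}. 1 * G i x) r x = (\<Sum>i\<in>{..<n}. 1 * glue (d i) (G i) r x)"
        by (rule glue_sum[OF _ D x]) auto
      finally show ?thesis by simp
    qed
    have "AE x in lebesgue_on {0..1}. \<forall>k. F k x = glue (d k) (G k) r x" using ae by (simp add: AE_all_countable)
    thus "AE x in lebesgue_on {0..1}. h x - (\<Sum>k<n. F k x) = glue (\<lambda>p k. \<Sum>j. d (j + n) p k) (\<lambda>x. \<Sum>j. G (j + n) x) r x"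
      using AE_in_U by eventually_elim (simp add: key del: Union_iff)
  qed
  thus ?thesis by blast
qed

sublocale gauge rep "(1 + real r) / m"
proof
  fix f h :: "real \<Rightarrow> complex" and c :: complex and M M' :: real
  show "0 \<le> M" if "rep f M"
    using that
  proof (rule repE)
    fix d G M1 M2 assume a: "data_le d G M1 M2" "M1 + M2 \<le> M"
    show "0 \<le> M" using data_leD(1,2)[OF a(1)] a(2) by linarith
  qed
  show "rep f M'" if "rep f M" "M \<le> M'"
    using that unfolding rep_def by (meson order_trans)
  show "rep (\<lambda>x. 0) 0"
    by (rule repI[OF data_le_zero _ AE_U]) (simp_all add: glue_zero del: Union_iff)
  show "rep (\<lambda>x. f x + h x) (M + M')" if "rep f M" "rep h M'"
    using rep_add_scale[OF that, of 1] by simp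
  show "rep (\<lambda>x. c * f x) (cmod c * M)" if "rep f M"
    using rep_add_scale[OF \<open>rep (\<lambda>x. 0) 0\<close> that, of c] by simp
  show "rep h M" if r: "rep f M" and ae: "AE x in lebesgue_on {0..1}. f x = h x"
    using r
  proof (rule repE)
    fix d G M1 M2 assume a: "data_le d G M1 M2" "M1 + M2 \<le> M" "AE x in lebesgue_on {0..1}. f x = glue d G r x"
    show "rep h M"
      by (rule repI[OF a(1,2)]) (use a(3) ae in \<open>eventually_elim; simp\<close>)
  qed
  show "f \<in> borel_measurable (lebesgue_on {0..1})" if "rep f M"
    using that
  proof (rule repE)
    fix d G M1 M2 assume a: "data_le d G M1 M2" "M1 + M2 \<le> M" "AE x in lebesgue_on {0..1}. f x = glue d G r x"
    show ?thesis by (rule measurable_if_tame[OF tame_glue[OF data_leD(3,4)[OF a(1)] order_refl] a(3)])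
  qed
  show "AE x in lebesgue_on {0..1}. cmod (f x) \<le> (1 + real r) / m * M" if "rep f M"
    using that
  proof (rule repE)
    fix d G M1 M2 assume a: "data_le d G M1 M2" "M1 + M2 \<le> M" "AE x in lebesgue_on {0..1}. f x = glue d G r x"
    have "(1 + real r) / m * (M1 + M2) \<le> (1 + real r) / m * M" using a m by (intro mult_left_mono) auto
    hence le: "(1 + real r) / m * (M1 + M2) \<le> (1 + real r) / m * M" .
    show "AE x in lebesgue_on {0..1}. cmod (f x) \<le> (1 + real r) / m * M"
      using a(3) AE_in_U
    proof eventually_elim
      case (elim x)
      show ?case using data_le_glue_bound[OF a(1) order_refl elim(2)] elim(1) le by simp
    qed
  qed
  show "\<exists>h. \<forall>n. rep (\<lambda>x. h x - (\<Sum>k<n. F k x)) (\<Sum>k. s (k + n))" if "\<And>n. rep (F n) (s n)" "summable s" for F s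
    by (rule rep_series_aux[OF that])
qed

sublocale Linf_banach space_of norm_of
  by unfold_locales (rule banach_space_of)

end

section \<open>Atoms, regular functions, and functions smooth on an interval\<close>

context jump_space begin

definition left_ends :: "real set" where "left_ends = {a. \<exists>b. a < b \<and> {a<..<b} \<in> \<Omega>}"

lemma left_ends_not_U: assumes "a \<in> left_ends" shows "a \<notin> U"
proof
  assume "a \<in> U"
  then obtain a' b' where 1: "{a'<..<b'} \<in> \<Omega>" "a \<in> {a'<..<b'}" using ivl_exists by blast
  obtain b where 2: "a < b" "{a<..<b} \<in> \<Omega>" using assms by (auto simp: left_ends_def)
  obtain t where t: "a < t" "t < min b b'" using dense[of a "min b b'"] 1 2 by auto
  have "{a'<..<b'} = {a<..<b}" by (rule unique_ivl[of _ _ t]) (use 1 2 t in auto)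
  with 1(2) show False by auto
qed

text \<open>The jumps of the function that is \<open>E r\<close> on \<open>{\<alpha><..\<beta>}\<close> and
  zero elsewhere, where \<open>E k\<close> is its derivative of order \<open>r - k\<close>: up
  from zero at \<open>\<alpha>\<close>, down to zero at \<open>\<beta>\<close>, and an initial
  value at each left end point in between, where \<open>glue\<close> starts anew from zero. If
  \<open>\<beta>\<close> lies on the boundary of the partition, the function ends there without a
  jump.\<close>

definition jump_data :: "real \<Rightarrow> real \<Rightarrow> (nat \<Rightarrow> real \<Rightarrow> complex) \<Rightarrow> real \<Rightarrow> nat \<Rightarrow> complex" where
  "jump_data \<alpha> \<beta> E p k = (if p = \<alpha> \<or> p \<in> left_ends \<and> \<alpha> < p \<and> p < \<beta> then E (Suc k) p else 0)
     - (if p = \<beta> \<and> \<beta> \<in> U then E (Suc k) \<beta> else 0)"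

lemma tame_on_cutoff:
  assumes E: "tame_on {\<alpha><..<\<beta>} f"
  shows "tame_on S (\<lambda>x. if \<alpha> < x \<and> x \<le> \<beta> then f x else 0)"
proof -
  obtain M where M: "M \<ge> 0" "\<And>x. x \<in> {\<alpha><..<\<beta>} \<Longrightarrow> cmod (f x) \<le> M" using tame_on_bounded[OF E] by blast
  obtain Z where Z: "countable Z" "\<And>x. x \<in> {\<alpha><..<\<beta>} \<Longrightarrow> x \<notin> Z \<Longrightarrow> isCont f x" using tame_on_cont[OF E] by blast
  show ?thesis
  proof (rule tame_onI[of _ _ "max M (cmod (f \<beta>))" "Z \<union> {\<alpha>, \<beta>}"])
    fix x
    show "cmod (if \<alpha> < x \<and> x \<le> \<beta> then f x else 0) \<le> max M (cmod (f \<beta>))"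
      using M(1) M(2)[of x] by (cases "x = \<beta>") auto
    assume x: "x \<notin> Z \<union> {\<alpha>, \<beta>}"
    show "isCont (\<lambda>x. if \<alpha> < x \<and> x \<le> \<beta> then f x else 0) x"
    proof (cases "x \<in> {\<alpha><..<\<beta>}")
      case True
      have "\<forall>\<^sub>F y in nhds x. y \<in> {\<alpha><..<\<beta>}" by (rule eventually_nhds_in_open) (use True in auto)
      hence "\<forall>\<^sub>F y in nhds x. (if \<alpha> < y \<and> y \<le> \<beta> then f y else 0) = f y" by eventually_elim auto
      thus ?thesis using isCont_cong Z(2)[OF True] x by fastforce
    next
      case False
      have "\<forall>\<^sub>F y in nhds x. y \<in> - {\<alpha>..\<beta>}" by (rule eventually_nhds_in_open) (use False x in auto)
      hence "\<forall>\<^sub>F y in nhds x. (if \<alpha> < y \<and> y \<le> \<beta> then f y else 0) = 0" by eventually_elim auto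
      thus ?thesis using isCont_cong[of _ "\<lambda>_. 0" x] by simp
    qed
  qed (use Z in auto)
qed

text \<open>A function that is smooth on an interval and zero elsewhere is glued from its top derivative
  and from its Taylor data at the ends of the interval and at the left ends of the partition elements
  that the interval contains.\<close>

lemma jump_decomposition:
  assumes ab: "\<alpha> < \<beta>" and cont: "\<And>k. k < r \<Longrightarrow> continuous_on {\<alpha>..\<beta>} (E (Suc k))"
    and tame: "\<And>k. k \<le> r \<Longrightarrow> tame_on {\<alpha><..<\<beta>} (E k)"
    and Z: "countable Z"
    and der: "\<And>k x. k < r \<Longrightarrow> x \<in> {\<alpha><..<\<beta>} - Z \<Longrightarrow> (E (Suc k) has_vector_derivative E k x) (at x)"
    and left: "left_ends \<subseteq> P" and \<alpha>P: "\<alpha> \<in> U \<Longrightarrow> \<alpha> \<in> P" and \<beta>P: "\<beta> \<in> U \<Longrightarrow> \<beta> \<in> P"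
  shows "k \<le> r \<Longrightarrow> x \<in> U \<Longrightarrow>
    glue (jump_data \<alpha> \<beta> E) (\<lambda>x. if \<alpha> < x \<and> x \<le> \<beta> then E 0 x else 0) k x = (if \<alpha> < x \<and> x \<le> \<beta> then E k x else 0)"
proof (induction k arbitrary: x)
  case (Suc k)
  let ?G = "\<lambda>x. if \<alpha> < x \<and> x \<le> \<beta> then E 0 x else 0"
  let ?c = "\<lambda>x. if \<alpha> < x \<and> x \<le> \<beta> then E k x else 0"
  obtain a b where o: "{a<..<b} \<in> \<Omega>" "x \<in> {a<..<b}" "a < b" using ivl_exists[OF Suc.prems(2)] by blast
  have sub: "t \<in> U" if "t \<in> {a<..<b}" for t using that o(1) by blast
  have aL: "a \<in> left_ends" unfolding left_ends_def using o(1,3) by blast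
  have aU: "a \<notin> U" by (rule left_ends_not_U[OF aL])
  have Lonly: "p = a" if "p \<in> left_ends" "p \<in> {a..<b}" for p
    using left_ends_not_U[OF that(1)] sub[of p] that(2) by force
  have int: "integral {a..x} (glue (jump_data \<alpha> \<beta> E) ?G k) = integral {a..x} ?c"
    by (rule integral_spike[of "{a}"]) (use Suc.IH Suc.prems sub o in auto)
  have main: "glue (jump_data \<alpha> \<beta> E) ?G (Suc k) x = jumps_before P a (\<lambda>p. jump_data \<alpha> \<beta> E p k) x + integral {a..x} ?c"
    unfolding glue_on[OF o(1,2)] int ..
  show ?case
  proof (cases "x \<le> \<alpha> \<or> \<beta> \<le> a")
    case True
    have "jump_data \<alpha> \<beta> E p k = 0" if p: "p \<in> {a..<x}" for p
    proof -
      have "p \<noteq> \<alpha>" "\<not> (\<alpha> < p \<and> p < \<beta>)" using True p ab by auto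
      moreover have "\<not> (p = \<beta> \<and> \<beta> \<in> U)" using True p ab aU by (cases "\<beta> = a") auto
      ultimately show ?thesis by (auto simp: jump_data_def)
    qed
    hence "jumps_before P a (\<lambda>p. jump_data \<alpha> \<beta> E p k) x = 0"
      unfolding jumps_before_def by (intro infsum_0) auto
    moreover have "integral {a..x} ?c = integral {a..x} (\<lambda>_. 0)"
      by (rule integral_spike[of "{a, x}"]) (use True in auto)
    moreover have "(if \<alpha> < x \<and> x \<le> \<beta> then E (Suc k) x else 0) = 0" using True o by auto
    ultimately show ?thesis unfolding main by simp
  next
    case False
    define s where "s = max \<alpha> a"
    define t where "t = min x \<beta>"
    have st: "a \<le> s" "\<alpha> \<le> s" "s < t" "t \<le> x" "t \<le> \<beta>" "s < x" "s < \<beta>"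
      using False o ab by (auto simp: s_def t_def)
    have sP: "s \<in> P"
    proof (cases "a < \<alpha>")
      case True
      have "s \<in> U" by (rule sub) (use True st o in \<open>auto simp: s_def\<close>)
      thus ?thesis using \<alpha>P True by (simp add: s_def)
    next
      case False thus ?thesis using left aL by (auto simp: s_def max_def)
    qed
    have \<beta>U: "\<beta> \<in> U" if "\<beta> < x" by (rule sub) (use that st o in auto)
    have A: "p = s" if p: "p \<in> {a..<x}" "p = \<alpha> \<or> p \<in> left_ends \<and> \<alpha> < p \<and> p < \<beta>" for p
      using p Lonly[of p] o by (auto simp: s_def)
    have B: "s = \<alpha> \<or> s \<in> left_ends \<and> \<alpha> < s \<and> s < \<beta>"
      using aL st by (cases "\<alpha> < a") (auto simp: s_def)
    have "jumps_before P a (\<lambda>p. jump_data \<alpha> \<beta> E p k) x =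
        infsum (\<lambda>p. jump_data \<alpha> \<beta> E p k) ({s} \<union> (if \<beta> < x then {\<beta>} else {}))"
      unfolding jumps_before_def
    proof (rule infsum_cong_neutral)
      fix p assume "p \<in> (P \<inter> {a..<x}) - ({s} \<union> (if \<beta> < x then {\<beta>} else {}))"
      hence "p \<in> {a..<x}" "p \<noteq> s" "\<not> (p = \<beta>)" by (auto split: if_splits)
      thus "jump_data \<alpha> \<beta> E p k = 0" using A[of p] by (auto simp: jump_data_def)
    qed (use sP \<beta>P \<beta>U st in \<open>auto split: if_splits\<close>)
    also have "\<dots> = E (Suc k) s - (if \<beta> < x then E (Suc k) \<beta> else 0)"
      using st B \<beta>U A[of \<beta>] by (auto simp: jump_data_def simp del: Union_iff)
    finally have J: "jumps_before P a (\<lambda>p. jump_data \<alpha> \<beta> E p k) x = E (Suc k) s - (if \<beta> < x then E (Suc k) \<beta> else 0)" .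
    have "integral {a..x} ?c = integral {a..x} (\<lambda>y. if y \<in> {s..t} then E k y else 0)"
      by (rule integral_spike[of "{s, a}"]) (use st in \<open>auto simp: s_def t_def\<close>)
    also have "\<dots> = integral {s..t} (E k)"
    proof -
      have "{s..t} \<inter> {a..x} = {s..t}" using st by auto
      thus ?thesis by (simp only: integral_restrict_Int)
    qed
    also have "\<dots> = E (Suc k) t - E (Suc k) s"
    proof (rule FTC_off_countable[OF _ _ _ Z])
      show "tame_on {s<..<t} (E k)" by (rule tame_on_subset[OF tame]) (use Suc.prems st in auto)
      show "continuous_on {s..t} (E (Suc k))" by (rule continuous_on_subset[OF cont]) (use Suc.prems st in auto)
      show "\<And>y. y \<in> {s<..<t} - Z \<Longrightarrow> (E (Suc k) has_vector_derivative E k y) (at y)"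
        by (rule der) (use Suc.prems st in auto)
    qed (use st in auto)
    finally show ?thesis unfolding main J using st False o by (auto simp: t_def min_def)
  qed
qed simp

text \<open>An atom is a function with a single unit jump, of the derivative of order \<open>r - Suc
  j\<close>. A regular function is one without jumps.\<close>

definition atom_data :: "real \<Rightarrow> nat \<Rightarrow> real \<Rightarrow> nat \<Rightarrow> complex" where
  "atom_data q j = (\<lambda>p k. if p = q \<and> k = j then 1 else 0)"

definition atom :: "real \<Rightarrow> nat \<Rightarrow> real \<Rightarrow> complex" where
  "atom q j = glue (atom_data q j) (\<lambda>_. 0) r"

definition regular :: "(real \<Rightarrow> complex) \<Rightarrow> real \<Rightarrow> complex" where
  "regular G = glue (\<lambda>_ _. 0) G r"

lemma data_le_atom: assumes "q \<in> P" "j < r" shows "data_le (atom_data q j) (\<lambda>_. 0) 0 (wt q j)"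
  unfolding data_le_def
proof (intro conjI allI impI)
  show "0 \<le> wt q j" using wt_pos[OF assms] by simp
  fix F :: "(real \<times> nat) set" assume F: "finite F" "F \<subseteq> P \<times> {..<r}"
  have "(\<Sum>(p,k)\<in>F. wt p k * cmod (atom_data q j p k)) = (\<Sum>x\<in>F. if x = (q,j) then wt q j else 0)"
    by (intro sum.cong) (auto simp: atom_data_def split: if_splits)
  also have "\<dots> \<le> wt q j" using F wt_pos[OF assms] by (simp add: sum.delta)
  finally show "(\<Sum>(p,k)\<in>F. wt p k * cmod (atom_data q j p k)) \<le> wt q j" .
qed auto

lemma data_le_regular:
  "tame_on U G \<Longrightarrow> (\<And>x. x \<in> U \<Longrightarrow> g x * cmod (G x) \<le> M) \<Longrightarrow> 0 \<le> M \<Longrightarrow> data_le (\<lambda>_ _. 0) G M 0"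
  by (auto simp: data_le_def)

lemma rep_atom: "q \<in> P \<Longrightarrow> j < r \<Longrightarrow> rep (atom q j) (wt q j)"
  by (rule repI[OF data_le_atom]) (auto simp: atom_def)

lemma rep_regular: "data_le (\<lambda>_ _. 0) G M 0 \<Longrightarrow> rep (regular G) M"
  by (rule repI) (auto simp: regular_def)

lemma glue_finite:
  assumes Q: "finite Q" "Q \<subseteq> P \<times> {..<r}" and G: "data_le (\<lambda>_ _. 0) G M 0"
    and d: "\<And>p k. p \<in> P \<Longrightarrow> k < r \<Longrightarrow> (p, k) \<notin> Q \<Longrightarrow> d p k = 0" and x: "x \<in> U"
  shows "glue d G r x = regular G x + (\<Sum>(p,k)\<in>Q. d p k * atom p k x)"
proof -
  have D: "data_le (atom_data (fst i) (snd i)) (\<lambda>_. 0) 0 (wt (fst i) (snd i))" if "i \<in> Q" for i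
    by (rule data_le_atom) (use that Q in auto)
  note S = data_le_sum[OF Q(1) D, where c = "\<lambda>i. d (fst i) (snd i)"]
  have "glue d G r x = glue (\<lambda>p k. 0 + 1 * (\<Sum>i\<in>Q. d (fst i) (snd i) * atom_data (fst i) (snd i) p k))
      (\<lambda>x. G x + 1 * (\<Sum>i\<in>Q. d (fst i) (snd i) * 0)) r x"
  proof (rule glue_cong[OF _ _ order_refl x])
    fix p k assume pk: "p \<in> P" "k < r"
    have "(\<Sum>i\<in>Q. d (fst i) (snd i) * atom_data (fst i) (snd i) p k) = (\<Sum>i\<in>Q. if i = (p,k) then d p k else 0)"
      by (intro sum.cong) (auto simp: atom_data_def)
    also have "\<dots> = d p k" using Q d[OF pk] by (simp add: sum.delta)
    finally show "d p k = 0 + 1 * (\<Sum>i\<in>Q. d (fst i) (snd i) * atom_data (fst i) (snd i) p k)" by simp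
  qed simp
  also have "\<dots> = glue (\<lambda>_ _. 0) G r x + 1 * glue (\<lambda>p k. \<Sum>i\<in>Q. d (fst i) (snd i) * atom_data (fst i) (snd i) p k)
      (\<lambda>x. \<Sum>i\<in>Q. d (fst i) (snd i) * 0) r x"
    by (rule glue_add_scale[OF data_leD(3)[OF G] data_leD(3)[OF S] data_leD(4)[OF G] data_leD(4)[OF S] order_refl x])
  also have "glue (\<lambda>p k. \<Sum>i\<in>Q. d (fst i) (snd i) * atom_data (fst i) (snd i) p k)
      (\<lambda>x. \<Sum>i\<in>Q. d (fst i) (snd i) * 0) r x = (\<Sum>i\<in>Q. d (fst i) (snd i) * glue (atom_data (fst i) (snd i)) (\<lambda>_. 0) r x)"
    by (rule glue_sum[OF Q(1) D x]) auto
  finally show ?thesis by (simp add: regular_def atom_def case_prod_beta)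
qed

end

section \<open>Operators given on atoms and on regular functions\<close>

lemma (in gauge) space_of_cong:
  assumes "f \<in> space_of" "AE x in lebesgue_on {0..1}. f x = h x" shows "h \<in> space_of"
proof -
  obtain M where "rep f M" using assms(1) by (auto simp: space_of_def)
  thus ?thesis using rep_cong[OF _ assms(2)] rep_in_space by blast
qed

context jump_space begin

text \<open>A linear functional of the jumps, given by its values \<open>a p k\<close> on the atoms.\<close>

definition jump_functional :: "(real \<Rightarrow> nat \<Rightarrow> complex) \<Rightarrow> (real \<Rightarrow> nat \<Rightarrow> complex) \<Rightarrow> complex" where
  "jump_functional a d = infsum (\<lambda>(p,k). d p k * a p k) (P \<times> {..<r})"

lemma jump_functional_summable:
  assumes D: "data_le d G M M'" and a: "\<And>p k. p \<in> P \<Longrightarrow> k < r \<Longrightarrow> cmod (a p k) \<le> K * wt p k" and K: "0 \<le> K"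
  shows "(\<lambda>x. cmod (case x of (p,k) \<Rightarrow> d p k * a p k)) summable_on (P \<times> {..<r})"
    and "cmod (jump_functional a d) \<le> K * M'"
    and "\<And>F. finite F \<Longrightarrow> F \<subseteq> P \<times> {..<r} \<Longrightarrow> (\<Sum>(p,k)\<in>F. cmod (d p k * a p k)) \<le> K * (\<Sum>(p,k)\<in>F. wt p k * cmod (d p k))"
proof -
  show b: "(\<Sum>(p,k)\<in>F. cmod (d p k * a p k)) \<le> K * (\<Sum>(p,k)\<in>F. wt p k * cmod (d p k))"
    if "finite F" "F \<subseteq> P \<times> {..<r}" for F
    unfolding sum_distrib_left
  proof (intro sum_mono, clarify)
    fix p k assume "(p, k) \<in> F"
    hence "cmod (d p k) * cmod (a p k) \<le> cmod (d p k) * (K * wt p k)" using that by (intro mult_left_mono a) auto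
    thus "cmod (d p k * a p k) \<le> K * (wt p k * cmod (d p k))" by (simp add: norm_mult algebra_simps)
  qed
  have c: "(\<Sum>x\<in>F. cmod (case x of (p,k) \<Rightarrow> d p k * a p k)) \<le> K * M'" if F: "finite F" "F \<subseteq> P \<times> {..<r}" for F
  proof -
    have "(\<Sum>x\<in>F. cmod (case x of (p,k) \<Rightarrow> d p k * a p k)) = (\<Sum>(p,k)\<in>F. cmod (d p k * a p k))"
      by (intro sum.cong) auto
    also have "\<dots> \<le> K * (\<Sum>(p,k)\<in>F. wt p k * cmod (d p k))" by (rule b[OF F])
    also have "\<dots> \<le> K * M'" by (intro mult_left_mono data_le_sum_le[OF D F] K)
    finally show ?thesis .
  qed
  show s: "(\<lambda>x. cmod (case x of (p,k) \<Rightarrow> d p k * a p k)) summable_on (P \<times> {..<r})"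
    by (rule nonneg_bdd_above_summable_on) (use c in \<open>auto simp: bdd_above_def\<close>)
  have "cmod (jump_functional a d) \<le> infsum (\<lambda>x. cmod (case x of (p,k) \<Rightarrow> d p k * a p k)) (P \<times> {..<r})"
    unfolding jump_functional_def by (rule norm_infsum_le[OF s order_refl])
  also have "\<dots> \<le> K * M'" by (rule infsum_le_finite_sums[OF s c])
  finally show "cmod (jump_functional a d) \<le> K * M'" .
qed

lemma jump_functional_add:
  assumes D: "data_le d G M M'" "data_le e H L L'"
    and a: "\<And>p k. p \<in> P \<Longrightarrow> k < r \<Longrightarrow> cmod (a p k) \<le> K * wt p k" and K: "0 \<le> K"
  shows "jump_functional a (\<lambda>p k. d p k + c * e p k) = jump_functional a d + c * jump_functional a e"
proof -
  have s: "(\<lambda>(p,k). d p k * a p k) summable_on (P \<times> {..<r})" "(\<lambda>(p,k). e p k * a p k) summable_on (P \<times> {..<r})"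
    using jump_functional_summable(1)[OF D(1) a K] jump_functional_summable(1)[OF D(2) a K]
    by (auto intro: abs_summable_summable)
  have "(\<lambda>(p,k). (d p k + c * e p k) * a p k) = (\<lambda>x. (case x of (p,k) \<Rightarrow> d p k * a p k) + c * (case x of (p,k) \<Rightarrow> e p k * a p k))"
    by (auto simp: algebra_simps)
  thus ?thesis
    unfolding jump_functional_def
    by (simp add: infsum_add[OF s(1) summable_on_cmult_right[OF s(2)]] infsum_cmult_right[OF s(2)])
qed

text \<open>By \<open>glue_eq_0_imp\<close>, applied to the difference.\<close>

lemma data_unique:
  assumes D: "data_le d G M M'" "data_le e H L L'"
    and eq: "AE x in lebesgue_on {0..1}. glue d G r x = glue e H r x"
  shows "\<And>p k. p \<in> P \<Longrightarrow> k < r \<Longrightarrow> d p k = e p k" "\<exists>Z. countable Z \<and> (\<forall>x\<in>U - Z. G x = H x)"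
proof -
  let ?d = "\<lambda>p k. d p k + (-1) * e p k" and ?G = "\<lambda>x. G x + (-1) * H x"
  note 1 = data_leD[OF D(1)] and 2 = data_leD[OF D(2)] and 3 = data_leD[OF data_le_add[OF D, of "-1"]]
  have "\<exists>S. negligible S \<and> (\<forall>x\<in>U - S. glue d G r x = glue e H r x)"
    by (rule negligible_U_of_AE[OF eq]) blast
  then obtain S where S: "negligible S" "\<And>x. x \<in> U - S \<Longrightarrow> glue d G r x = glue e H r x" by blast
  have "glue ?d ?G r x = 0" if "x \<in> U - S" for x
    using glue_add_scale[OF 1(3) 2(3) 1(4) 2(4) order_refl, of x "-1"] S(2)[OF that] that by simp
  from glue_eq_0_imp[OF 3(3,4) order_refl S(1) this]
  have z: "\<forall>j<r. \<forall>p\<in>P. ?d p j = 0" "\<exists>Z. countable Z \<and> (\<forall>x\<in>U - Z. ?G x = 0)" by blast+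
  show "d p k = e p k" if "p \<in> P" "k < r" for p k using z(1) that by simp
  show "\<exists>Z. countable Z \<and> (\<forall>x\<in>U - Z. G x = H x)" using z(2) by simp
qed

text \<open>Finite truncations of the jump data approximate: this is how statements about single atoms
  extend to the whole space.\<close>

lemma finite_jumps_approx:
  assumes D: "data_le d G M M'" and \<epsilon>: "\<epsilon> > 0"
  shows "\<exists>F. finite F \<and> F \<subseteq> P \<times> {..<r} \<and>
    data_le (\<lambda>p k. if (p,k) \<in> F then 0 else d p k) (\<lambda>_. 0) 0 \<epsilon>"
proof -
  let ?w = "\<lambda>(p,k). wt p k * cmod (d p k)"
  have nn: "?w x \<ge> 0" if "x \<in> P \<times> {..<r}" for x using that wt_pos by (auto simp: less_imp_le)
  have s: "?w summable_on (P \<times> {..<r})"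
    by (rule nonneg_bdd_above_summable_on) (use data_le_sum_le[OF D] nn in \<open>auto simp: bdd_above_def\<close>)
  obtain F where F: "finite F" "F \<subseteq> P \<times> {..<r}" "dist (sum ?w F) (infsum ?w (P \<times> {..<r})) \<le> \<epsilon>"
    using infsum_finite_approximation[OF s \<epsilon>] by blast
  have "(\<Sum>(p,k)\<in>F'. wt p k * cmod (if (p,k) \<in> F then 0 else d p k)) \<le> \<epsilon>"
    if F': "finite F'" "F' \<subseteq> P \<times> {..<r}" for F'
  proof -
    have "(\<Sum>(p,k)\<in>F'. wt p k * cmod (if (p,k) \<in> F then 0 else d p k)) = sum ?w (F' - F)"
      by (rule sum.mono_neutral_cong_right) (use F' in auto)
    also have "\<dots> = sum ?w (F' \<union> F) - sum ?w F"
    proof -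
      have "(F' - F) \<inter> F = {}" by auto
      thus ?thesis using F F' sum.union_disjoint[of "F' - F" F ?w] by (simp add: Un_Diff_cancel2)
    qed
    also have "sum ?w (F' \<union> F) \<le> infsum ?w (P \<times> {..<r})"
      by (rule finite_sum_le_infsum[OF s]) (use F F' nn in auto)
    finally show ?thesis using F(3) by (simp add: dist_real_def)
  qed
  thus ?thesis using F \<epsilon> by (intro exI[of _ F]) (auto simp: data_le_def)
qed

text \<open>An operator is determined by its values on atoms and on regular functions. If it is bounded by
  \<open>q\<close> on both, up to elements of the span of a finite set \<open>E\<close>, then its
  finite-rank part \<open>cd\<close> extends to all data by summation over the jumps, and the
  bound for the remainder \<open>S\<close> extends because the norm of the jumps is a weighted
  sum. The passage from finitely many jumps to all of them needs \<open>L\<close> to be continuous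
  for uniform convergence: the limit in norm of the remainders of the truncations has to be
  identified with the remainder of the limit.\<close>

theorem fredholm_from_atoms:
  fixes L :: "(real \<Rightarrow> complex) \<Rightarrow> (real \<Rightarrow> complex)"
  assumes lin: "\<And>f h a. L (\<lambda>x. f x + a * h x) = (\<lambda>x. L f x + a * L h x)"
    and Linf: "\<And>f c. AE x in lebesgue_on {0..1}. cmod (f x) \<le> c \<Longrightarrow> AE x in lebesgue_on {0..1}. cmod (L f x) \<le> KL * c"
    and E: "finite E" "E \<subseteq> space_of"
    and atoms: "\<And>p k. p \<in> P \<Longrightarrow> k < r \<Longrightarrow> \<exists>c. (\<forall>e\<in>E. cmod (c e) \<le> K * wt p k) \<and>
        rep (\<lambda>x. L (atom p k) x - (\<Sum>e\<in>E. c e * e x)) (q * wt p k)"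
    and reg: "\<And>G M. data_le (\<lambda>_ _. 0) G M 0 \<Longrightarrow>
        rep (\<lambda>x. L (regular G) x - (\<Sum>e\<in>E. cr G e * e x)) (q * M)"
    and cr_lin: "\<And>G H a e. tame_on U G \<Longrightarrow> tame_on U H \<Longrightarrow> e \<in> E \<Longrightarrow> cr (\<lambda>x. G x + a * H x) e = cr G e + a * cr H e"
    and cr_bound: "\<And>G M e. data_le (\<lambda>_ _. 0) G M 0 \<Longrightarrow> e \<in> E \<Longrightarrow> cmod (cr G e) \<le> K * M"
    and cr_null: "\<And>G Z e. tame_on U G \<Longrightarrow> countable Z \<Longrightarrow> (\<And>x. x \<in> U - Z \<Longrightarrow> G x = 0) \<Longrightarrow> e \<in> E \<Longrightarrow> cr G e = 0"
    and nn: "0 \<le> K" "0 \<le> KL" "0 \<le> q"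
  shows "bounded_operator space_of norm_of L"
    and "\<And>z. q < cmod z \<Longrightarrow> fredholm space_of norm_of (\<lambda>f x. z * f x - L f x)"
proof -
  have "\<forall>i. \<exists>c. fst i \<in> P \<and> snd i < r \<longrightarrow> (\<forall>e\<in>E. cmod (c e) \<le> K * wt (fst i) (snd i)) \<and>
        rep (\<lambda>x. L (atom (fst i) (snd i)) x - (\<Sum>e\<in>E. c e * e x)) (q * wt (fst i) (snd i))"
  proof
    fix i :: "real \<times> nat"
    show "\<exists>c. fst i \<in> P \<and> snd i < r \<longrightarrow> (\<forall>e\<in>E. cmod (c e) \<le> K * wt (fst i) (snd i)) \<and>
        rep (\<lambda>x. L (atom (fst i) (snd i)) x - (\<Sum>e\<in>E. c e * e x)) (q * wt (fst i) (snd i))"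
      using atoms[of "fst i" "snd i"] by (cases "fst i \<in> P \<and> snd i < r") auto
  qed
  from choice[OF this] obtain ca' where ca': "\<And>i. fst i \<in> P \<and> snd i < r \<longrightarrow> (\<forall>e\<in>E. cmod (ca' i e) \<le> K * wt (fst i) (snd i)) \<and>
        rep (\<lambda>x. L (atom (fst i) (snd i)) x - (\<Sum>e\<in>E. ca' i e * e x)) (q * wt (fst i) (snd i))" by blast
  define ca where "ca e p k = ca' (p, k) e" for e p k
  have ca: "cmod (ca e p k) \<le> K * wt p k" if "e \<in> E" "p \<in> P" "k < r" for e p k
    using ca'[of "(p,k)"] that by (auto simp: ca_def)
  have ca_rep: "rep (\<lambda>x. L (atom p k) x - (\<Sum>e\<in>E. ca e p k * e x)) (q * wt p k)" if "p \<in> P" "k < r" for p k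
    using ca'[of "(p,k)"] that by (auto simp: ca_def)
  define cd where "cd d G e = cr G e + jump_functional (ca e) d" for d G e
  have D0: "data_le d (\<lambda>_. 0) 0 M2" and G0: "data_le (\<lambda>_ _. 0) G M1 0" if "data_le d G M1 M2" for d G M1 M2
    using that by (auto simp: data_le_def)
  have cd_lin: "cd (\<lambda>p k. d p k + a * d' p k) (\<lambda>x. G x + a * H x) e = cd d G e + a * cd d' H e"
    if "data_le d G M1 M2" "data_le d' H L1 L2" "e \<in> E" for d d' G H a e M1 M2 L1 L2
  proof -
    have "jump_functional (ca e) (\<lambda>p k. d p k + a * d' p k) = jump_functional (ca e) d + a * jump_functional (ca e) d'"
      by (rule jump_functional_add[OF that(1,2) _ nn(1)]) (rule ca[OF that(3)])
    thus ?thesis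
      unfolding cd_def cr_lin[OF data_leD(3)[OF that(1)] data_leD(3)[OF that(2)] that(3)] by (simp add: algebra_simps)
  qed
  have cd_bound: "cmod (cd d G e) \<le> K * (M1 + M2)" if "data_le d G M1 M2" "e \<in> E" for d G e M1 M2
  proof -
    have "cmod (cd d G e) \<le> K * M1 + K * M2"
      unfolding cd_def
    proof (rule norm_triangle_mono)
      show "cmod (cr G e) \<le> K * M1" by (rule cr_bound[OF G0[OF that(1)] that(2)])
      show "cmod (jump_functional (ca e) d) \<le> K * M2"
        by (rule jump_functional_summable(2)[OF that(1) _ nn(1)]) (rule ca[OF that(2)])
    qed
    thus ?thesis by (simp add: algebra_simps)
  qed
  have cd_unique: "cd d G e = cd d' H e"
    if D: "data_le d G M1 M2" "data_le d' H L1 L2" and e: "e \<in> E"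
      and eq: "AE x in lebesgue_on {0..1}. glue d G r x = glue d' H r x" for d d' G H e M1 M2 L1 L2
  proof -
    have "jump_functional (ca e) d = jump_functional (ca e) d'"
      unfolding jump_functional_def by (rule infsum_cong) (use data_unique(1)[OF D eq] in auto)
    moreover obtain Z where Z: "countable Z" "\<And>x. x \<in> U - Z \<Longrightarrow> G x = H x"
      using data_unique(2)[OF D eq] by blast
    have "tame_on U (\<lambda>x. G x + (-1) * H x)"
      by (intro tame_on_add tame_on_cmult data_leD(3)[OF D(1)] data_leD(3)[OF D(2)])
    hence "cr (\<lambda>x. G x + (-1) * H x) e = 0"
      by (rule cr_null[OF _ Z(1) _ e]) (simp add: Z(2) del: Union_iff)
    hence "cr G e = cr H e"
      using cr_lin[OF data_leD(3)[OF D(1)] data_leD(3)[OF D(2)] e, of "-1"] by simp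
    ultimately show ?thesis by (simp add: cd_def)
  qed
  define S where "S d G = (\<lambda>x. L (glue d G r) x - (\<Sum>e\<in>E. cd d G e * e x))" for d G
  have S_add: "AE x in lebesgue_on {0..1}. S (\<lambda>p k. d p k + a * d' p k) (\<lambda>x. G x + a * H x) x = S d G x + a * S d' H x"
    if D: "data_le d G M1 M2" "data_le d' H L1 L2" for d d' G H a M1 M2 L1 L2
  proof -
    let ?f = "glue (\<lambda>p k. d p k + a * d' p k) (\<lambda>x. G x + a * H x) r" and ?h = "\<lambda>x. glue d G r x + a * glue d' H r x"
    have "AE x in lebesgue_on {0..1}. cmod (?f x + (-1) * ?h x) \<le> 0"
      using glue_add_scale[OF data_leD(3)[OF D(1)] data_leD(3)[OF D(2)] data_leD(4)[OF D(1)] data_leD(4)[OF D(2)] order_refl, of _ a]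
      by (intro AE_U) (simp del: Union_iff)
    from Linf[OF this] have "AE x in lebesgue_on {0..1}. L ?f x = L (glue d G r) x + a * L (glue d' H r) x"
      unfolding lin by eventually_elim (simp add: algebra_simps)
    thus ?thesis
    proof eventually_elim
      case (elim x)
      have "(\<Sum>e\<in>E. cd (\<lambda>p k. d p k + a * d' p k) (\<lambda>x. G x + a * H x) e * e x) =
         (\<Sum>e\<in>E. cd d G e * e x) + a * (\<Sum>e\<in>E. cd d' H e * e x)"
        unfolding sum_distrib_left sum.distrib[symmetric]
        by (intro sum.cong refl) (simp add: cd_lin[OF D] algebra_simps)
      thus ?case using elim by (simp add: S_def algebra_simps)
    qed
  qed
  \<comment> \<open>Finitely many jumps are added one at a time, each at the cost of \<open>q\<close> times its
    share of the norm.\<close>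
  have S_atom: "rep (S (\<lambda>p k. if (p,k) \<in> F then d p k else 0) G) (q * (M1 + (\<Sum>(p,k)\<in>F. wt p k * cmod (d p k))))"
    if G: "data_le (\<lambda>_ _. 0) G M1 0" and F: "finite F" "F \<subseteq> P \<times> {..<r}" for F d G M1
    using F
  proof (induction F rule: finite_induct)
    case empty
    have "jump_functional (ca e) (\<lambda>p k. 0) = 0" for e unfolding jump_functional_def by (rule infsum_0) auto
    hence "S (\<lambda>p k. 0) G = (\<lambda>x. L (regular G) x - (\<Sum>e\<in>E. cr G e * e x))"
      by (simp add: S_def cd_def regular_def)
    thus ?case using reg[OF G] by simp
  next
    case (insert i F)
    obtain p k where i: "i = (p, k)" "p \<in> P" "k < r" using insert.prems by (cases i) auto
    let ?d = "\<lambda>F p k. if (p,k) \<in> F then d p k else 0"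
    have Dd: "\<exists>M2. data_le (?d F) G M1 M2"
    proof -
      have "data_le (\<lambda>p' k'. 0 + 1 * (\<Sum>i\<in>F. d (fst i) (snd i) * atom_data (fst i) (snd i) p' k')) (\<lambda>x. G x + 1 * (\<Sum>i\<in>F. d (fst i) (snd i) * 0))
          (M1 + cmod 1 * (\<Sum>i\<in>F. cmod (d (fst i) (snd i)) * 0)) (0 + cmod 1 * (\<Sum>i\<in>F. cmod (d (fst i) (snd i)) * wt (fst i) (snd i)))"
        by (intro data_le_add[OF G] data_le_sum data_le_atom) (use insert in auto)
      moreover have "(\<lambda>p' k'. 0 + 1 * (\<Sum>i\<in>F. d (fst i) (snd i) * atom_data (fst i) (snd i) p' k')) = ?d F"
      proof (intro ext)
        fix p' k'
        have "(\<Sum>i\<in>F. d (fst i) (snd i) * atom_data (fst i) (snd i) p' k') = (\<Sum>i\<in>F. if i = (p',k') then d p' k' else 0)"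
          by (intro sum.cong) (auto simp: atom_data_def)
        also have "\<dots> = ?d F p' k'" using insert.hyps by (simp add: sum.delta)
        finally show "0 + 1 * (\<Sum>i\<in>F. d (fst i) (snd i) * atom_data (fst i) (snd i) p' k') = ?d F p' k'" by simp
      qed
      ultimately show ?thesis by auto
    qed
    then obtain M2 where M2: "data_le (?d F) G M1 M2" by blast
    have eq: "?d (insert i F) = (\<lambda>p' k'. ?d F p' k' + d p k * atom_data p k p' k')" "G = (\<lambda>x. G x + d p k * 0)"
      using insert.hyps i by (auto simp: atom_data_def fun_eq_iff)
    have cda: "cd (atom_data p k) (\<lambda>_. 0) e = ca e p k" if "e \<in> E" for e
    proof -
      have "jump_functional (ca e) (atom_data p k) = infsum (\<lambda>(p,k). atom_data p k p k * ca e p k) {(p, k)}"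
        unfolding jump_functional_def by (rule infsum_cong_neutral) (use i in \<open>auto simp: atom_data_def split: if_splits\<close>)
      moreover have "cr (\<lambda>_. 0) e = 0" by (rule cr_null[of _ "{}"]) (use that in auto)
      ultimately show ?thesis by (simp add: cd_def atom_data_def)
    qed
    have "S (atom_data p k) (\<lambda>_. 0) = (\<lambda>x. L (atom p k) x - (\<Sum>e\<in>E. ca e p k * e x))"
      unfolding S_def atom_def by (simp add: cda cong: sum.cong)
    hence "rep (S (atom_data p k) (\<lambda>_. 0)) (q * wt p k)" using ca_rep i by simp
    hence R1: "rep (\<lambda>x. S (?d F) G x + d p k * S (atom_data p k) (\<lambda>_. 0) x)
        (q * (M1 + (\<Sum>(p,k)\<in>F. wt p k * cmod (d p k))) + cmod (d p k) * (q * wt p k))"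
      by (intro rep_add_scale insert.IH) (use insert in auto)
    have R2: "q * (M1 + (\<Sum>(p,k)\<in>F. wt p k * cmod (d p k))) + cmod (d p k) * (q * wt p k) =
        q * (M1 + (\<Sum>(p,k)\<in>insert i F. wt p k * cmod (d p k)))"
      using insert.hyps i by (simp add: algebra_simps)
    have R3: "AE x in lebesgue_on {0..1}. S (?d F) G x + d p k * S (atom_data p k) (\<lambda>_. 0) x = S (?d (insert i F)) G x"
      using S_add[OF M2 data_le_atom[OF i(2,3)], of "d p k"] unfolding eq(1) by eventually_elim simp
    show ?case using rep_cong[OF R1 R3] unfolding R2 .
  qed
  have S_bound: "S d G \<in> space_of \<and> norm_of (S d G) \<le> q * (M1 + M2)" if D: "data_le d G M1 M2" for d G M1 M2
  proof -
    \<comment> \<open>The data are truncated to a finite set \<open>T n\<close> of jumps which leaves a rest of size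
      \<open>1 / (n + 1)\<close>.\<close>
    define T where "T n = (SOME F. finite F \<and> F \<subseteq> P \<times> {..<r} \<and>
        data_le (\<lambda>p k. if (p,k) \<in> F then 0 else d p k) (\<lambda>_. 0) 0 (1 / real (Suc n)))" for n
    have T: "finite (T n)" "T n \<subseteq> P \<times> {..<r}" "data_le (\<lambda>p k. if (p,k) \<in> T n then 0 else d p k) (\<lambda>_. 0) 0 (1 / real (Suc n))" for n
      using someI_ex[OF finite_jumps_approx[OF D, of "1 / real (Suc n)"]] unfolding T_def by auto
    define dT where "dT n = (\<lambda>p k. if (p,k) \<in> T n then d p k else 0)" for n
    define dR where "dR n = (\<lambda>p k. if (p,k) \<in> T n then 0 else d p k)" for n
    have DR: "data_le (dR n) (\<lambda>_. 0) 0 (1 / real (Suc n))" for n using T(3) by (simp add: dR_def)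
    have repT: "rep (S (dT n) G) (q * (M1 + M2))" for n
    proof -
      have "(\<Sum>(p,k)\<in>T n. wt p k * cmod (d p k)) \<le> M2" by (rule data_le_sum_le[OF D T(1,2)])
      hence "q * (M1 + (\<Sum>(p,k)\<in>T n. wt p k * cmod (d p k))) \<le> q * (M1 + M2)"
        using nn by (intro mult_left_mono) auto
      thus ?thesis using rep_mono[OF S_atom[OF G0[OF D] T(1,2), of n d]] by (simp add: dT_def)
    qed
    have dT_eq: "dT n = (\<lambda>p k. d p k + (-1) * dR n p k)" for n by (auto simp: dT_def dR_def fun_eq_iff)
    have DT: "data_le (dT n) G M1 (M2 + 1 / real (Suc n))" for n
      using data_le_add[OF D DR, of "-1" n] unfolding dT_eq by simp
    have S_T: "AE x in lebesgue_on {0..1}. S (dT n) G x = S d G x + (-1) * S (dR n) (\<lambda>_. 0) x" for n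
      using S_add[OF D DR, of "-1" n] unfolding dT_eq by simp
    have "\<exists>K3\<ge>0. \<forall>n. AE x in lebesgue_on {0..1}. cmod (S (dR n) (\<lambda>_. 0) x) \<le> K3 / real (Suc n)"
    proof -
      obtain K' where K': "K' \<ge> 0" "\<And>f M. rep f M \<Longrightarrow> AE x in lebesgue_on {0..1}. cmod (f x) \<le> K' * M"
        using K_ex by blast
      define K3 where "K3 = KL * ((1 + real r) / m) + (\<Sum>e\<in>E. K * (K' * norm_of e))"
      have ae: "AE x in lebesgue_on {0..1}. \<forall>e\<in>E. cmod (e x) \<le> K' * norm_of e"
        using E AE_bound_norm_of[OF K'] by (intro AE_finite_allI) auto
      have nE: "K' * norm_of e \<ge> 0" if "e \<in> E" for e using that E K' norm_of_nonneg by auto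
      have "AE x in lebesgue_on {0..1}. cmod (S (dR n) (\<lambda>_. 0) x) \<le> K3 / real (Suc n)" for n
      proof -
        have "AE x in lebesgue_on {0..1}. cmod (glue (dR n) (\<lambda>_. 0) r x) \<le> (1 + real r) / m * (0 + 1 / real (Suc n))"
          by (intro AE_U data_le_glue_bound[OF DR order_refl])
        from Linf[OF this] ae show ?thesis
        proof eventually_elim
          case (elim x)
          have "cmod (S (dR n) (\<lambda>_. 0) x) \<le> cmod (L (glue (dR n) (\<lambda>_. 0) r) x) + cmod (\<Sum>e\<in>E. cd (dR n) (\<lambda>_. 0) e * e x)"
            unfolding S_def by (rule norm_triangle_ineq4)
          also have "cmod (\<Sum>e\<in>E. cd (dR n) (\<lambda>_. 0) e * e x) \<le> (\<Sum>e\<in>E. K * (0 + 1 / real (Suc n)) * (K' * norm_of e))"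
          proof (rule sum_norm_le)
            fix e assume e: "e \<in> E"
            show "cmod (cd (dR n) (\<lambda>_. 0) e * e x) \<le> K * (0 + 1 / real (Suc n)) * (K' * norm_of e)"
              unfolding norm_mult using cd_bound[OF DR e, of n] elim(2) e nn
              by (intro mult_mono) auto
          qed
          also have "\<dots> = (\<Sum>e\<in>E. K * (K' * norm_of e)) / real (Suc n)"
            by (simp add: sum_divide_distrib)
          finally have 1: "cmod (S (dR n) (\<lambda>_. 0) x) \<le> cmod (L (glue (dR n) (\<lambda>_. 0) r) x) + (\<Sum>e\<in>E. K * (K' * norm_of e)) / real (Suc n)"
            by simp
          have "KL * ((1 + real r) / m * (0 + 1 / real (Suc n))) = KL * ((1 + real r) / m) / real (Suc n)" by simp
          with 1 elim(1) show ?case unfolding K3_def add_divide_distrib[of _ _ "real (Suc n)"] by linarith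
        qed
      qed
      moreover have "(\<Sum>e\<in>E. K * (K' * norm_of e)) \<ge> 0"
        by (rule sum_nonneg) (rule mult_nonneg_nonneg[OF nn(1) nE])
      hence "K3 \<ge> 0" unfolding K3_def using nn m by (intro add_nonneg_nonneg mult_nonneg_nonneg) auto
      ultimately show ?thesis by blast
    qed
    then obtain K3 where K3: "K3 \<ge> 0" "\<And>n. AE x in lebesgue_on {0..1}. cmod (S (dR n) (\<lambda>_. 0) x) \<le> K3 / real (Suc n)" by blast
    have repdiff: "rep (\<lambda>x. S (dT n) G x - S (dT l) G x) (q * (1 / real (Suc n) + 1 / real (Suc l)))" for n l
    proof -
      define F where "F = (T n - T l) \<union> (T l - T n)"
      define d' where "d' = (\<lambda>p k. if (p,k) \<in> T n then d p k else - d p k)"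
      define e' where "e' = (\<lambda>p k. if (p,k) \<in> F then d' p k else 0)"
      have F: "finite F" "F \<subseteq> P \<times> {..<r}" using T by (auto simp: F_def)
      have e': "dT n = (\<lambda>p k. dT l p k + 1 * e' p k)" by (auto simp: dT_def e'_def d'_def F_def fun_eq_iff)
      have sumF: "(\<Sum>(p,k)\<in>F'. wt p k * cmod (d' p k)) = (\<Sum>(p,k)\<in>F'. wt p k * cmod (d p k))" for F'
        by (intro sum.cong) (auto simp: d'_def)
      have part: "(\<Sum>(p,k)\<in>T n - T l. wt p k * cmod (d p k)) \<le> 1 / real (Suc l)" for n l
      proof -
        have "(\<Sum>(p,k)\<in>T n - T l. wt p k * cmod (d p k)) = (\<Sum>(p,k)\<in>T n - T l. wt p k * cmod (dR l p k))"
          by (intro sum.cong) (auto simp: dR_def)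
        also have "\<dots> \<le> 1 / real (Suc l)" by (rule data_le_sum_le[OF DR]) (use T in auto)
        finally show ?thesis .
      qed
      have "(\<Sum>(p,k)\<in>F. wt p k * cmod (d p k)) = (\<Sum>(p,k)\<in>T n - T l. wt p k * cmod (d p k)) + (\<Sum>(p,k)\<in>T l - T n. wt p k * cmod (d p k))"
        unfolding F_def by (rule sum.union_disjoint) (use T in auto)
      hence sF: "(\<Sum>(p,k)\<in>F. wt p k * cmod (d' p k)) \<le> 1 / real (Suc n) + 1 / real (Suc l)"
        using part[of n l] part[of l n] by (simp add: sumF)
      have e'R: "e' = (\<lambda>p k. dR l p k + (-1) * dR n p k)"
        by (auto simp: dR_def e'_def d'_def F_def fun_eq_iff)
      have De: "data_le e' (\<lambda>_. 0) 0 (1 / real (Suc l) + 1 / real (Suc n))"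
        using data_le_add[OF DR[of l] DR[of n], of "-1"] unfolding e'R by simp
      have "rep (S e' (\<lambda>_. 0)) (q * (0 + (\<Sum>(p,k)\<in>F. wt p k * cmod (d' p k))))"
        unfolding e'_def by (rule S_atom[OF data_le_zero F])
      hence R: "rep (S e' (\<lambda>_. 0)) (q * (1 / real (Suc n) + 1 / real (Suc l)))"
        by (rule rep_mono) (use sF nn in \<open>auto intro: mult_left_mono\<close>)
      have "AE x in lebesgue_on {0..1}. S e' (\<lambda>_. 0) x = S (dT n) G x - S (dT l) G x"
        using S_add[OF DT[of l] De, of 1] unfolding e' mult_zero_right add_0_right by eventually_elim simp
      thus ?thesis by (rule rep_cong[OF R])
    qed
    have TB: "S (dT n) G \<in> space_of" for n by (rule rep_in_space[OF repT])
    obtain h where h: "h \<in> space_of" "(\<lambda>n. norm_of (\<lambda>x. S (dT n) G x - h x)) \<longlonglongrightarrow> 0"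
    proof (rule complete[OF TB])
      fix \<epsilon> :: real assume "\<epsilon> > 0"
      have "(\<lambda>n. 2 * q * (1 / real (Suc n))) \<longlonglongrightarrow> 2 * q * 0" by (intro tendsto_intros LIMSEQ_Suc[OF lim_1_over_n])
      from order_tendstoD(2)[OF this, of \<epsilon>] \<open>\<epsilon> > 0\<close> obtain n0 where n0: "2 * q * (1 / real (Suc n0)) < \<epsilon>"
        by (auto simp: eventually_sequentially)
      have "norm_of (\<lambda>x. S (dT n) G x - S (dT l) G x) < \<epsilon>" if "n \<ge> n0" "l \<ge> n0" for n l
      proof -
        have "norm_of (\<lambda>x. S (dT n) G x - S (dT l) G x) \<le> q * (1 / real (Suc n) + 1 / real (Suc l))"
          by (rule norm_of_le[OF repdiff])
        also have "\<dots> \<le> q * (1 / real (Suc n0) + 1 / real (Suc n0))"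
          using that nn by (intro mult_left_mono add_mono divide_left_mono) auto
        also have "\<dots> = 2 * q * (1 / real (Suc n0))" by simp
        finally show ?thesis using n0 by linarith
      qed
      thus "\<exists>M. \<forall>n\<ge>M. \<forall>l\<ge>M. norm_of (\<lambda>x. S (dT n) G x - S (dT l) G x) < \<epsilon>" by blast
    qed blast
    obtain K' where K': "K' \<ge> 0" "\<And>f M. rep f M \<Longrightarrow> AE x in lebesgue_on {0..1}. cmod (f x) \<le> K' * M"
      using K_ex by blast
    have "AE x in lebesgue_on {0..1}. \<forall>n. cmod (S (dT n) G x - h x) \<le> K' * norm_of (\<lambda>x. S (dT n) G x - h x) \<and>
        cmod (S (dR n) (\<lambda>_. 0) x) \<le> K3 / real (Suc n) \<and> S (dT n) G x = S d G x + (-1) * S (dR n) (\<lambda>_. 0) x"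
      unfolding AE_all_countable
      using AE_bound_norm_of[OF K' space_of_diff[OF TB h(1)]] K3(2) S_T by (intro allI AE_conjI) auto
    hence hS: "AE x in lebesgue_on {0..1}. h x = S d G x"
    proof eventually_elim
      case (elim x)
      have "cmod (S d G x - h x) \<le> K' * norm_of (\<lambda>x. S (dT n) G x - h x) + K3 * (1 / real (Suc n))" for n
      proof -
        have "S d G x - h x = (S (dT n) G x - h x) + S (dR n) (\<lambda>_. 0) x" using elim by simp
        hence "cmod (S d G x - h x) \<le> cmod (S (dT n) G x - h x) + cmod (S (dR n) (\<lambda>_. 0) x)"
          by (metis norm_triangle_ineq)
        moreover have "cmod (S (dT n) G x - h x) \<le> K' * norm_of (\<lambda>x. S (dT n) G x - h x)"
          "cmod (S (dR n) (\<lambda>_. 0) x) \<le> K3 / real (Suc n)" using elim by blast+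
        ultimately show ?thesis by simp
      qed
      moreover have "(\<lambda>n. K' * norm_of (\<lambda>x. S (dT n) G x - h x) + K3 * (1 / real (Suc n))) \<longlonglongrightarrow> K' * 0 + K3 * 0"
        by (intro tendsto_intros h(2) LIMSEQ_Suc[OF lim_1_over_n])
      ultimately have "cmod (S d G x - h x) \<le> K' * 0 + K3 * 0" by (intro LIMSEQ_le_const) auto
      thus ?case by simp
    qed
    have SB: "S d G \<in> space_of" by (rule space_of_cong[OF h(1) hS])
    have "norm_of (S d G) \<le> norm_of h"
    proof (rule norm_null_cong[OF SB h(1)])
      show "norm_of (\<lambda>x. S d G x - h x) = 0"
        unfolding norm_of_eq_0_iff[OF space_of_diff[OF SB h(1)]] using hS by eventually_elim simp
    qed
    also have "norm_of h \<le> q * (M1 + M2)"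
    proof (rule LIMSEQ_le_const)
      have "norm_of h \<le> q * (M1 + M2) + norm_of (\<lambda>x. S (dT n) G x - h x)" for n
        using norm_diff_le[OF TB diff_mem[OF TB[of n] h(1)], of n] norm_of_le[OF repT[of n]] by simp
      thus "\<exists>N. \<forall>n\<ge>N. norm_of h \<le> q * (M1 + M2) + norm_of (\<lambda>x. S (dT n) G x - h x)" by blast
      show "(\<lambda>n. q * (M1 + M2) + norm_of (\<lambda>x. S (dT n) G x - h x)) \<longlonglongrightarrow> q * (M1 + M2)"
        using tendsto_add[OF tendsto_const h(2), of "q * (M1 + M2)"] by simp
    qed
    finally show ?thesis using SB by simp
  qed
  \<comment> \<open>The functionals on data descend to functions because the data of a function are unique.\<close>
  define dat where "dat f = (SOME i. \<exists>M1 M2. data_le (fst i) (snd i) M1 M2 \<and> (AE x in lebesgue_on {0..1}. f x = glue (fst i) (snd i) r x))" for f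
  have dat: "\<exists>M1 M2. data_le (fst (dat f)) (snd (dat f)) M1 M2 \<and> (AE x in lebesgue_on {0..1}. f x = glue (fst (dat f)) (snd (dat f)) r x)"
    if f: "f \<in> space_of" for f
  proof -
    obtain M where "rep f M" using f by (auto simp: space_of_def)
    then obtain d G M1 M2 where "data_le d G M1 M2" "AE x in lebesgue_on {0..1}. f x = glue d G r x" by (rule repE)
    hence "\<exists>i. \<exists>M1 M2. data_le (fst i) (snd i) M1 M2 \<and> (AE x in lebesgue_on {0..1}. f x = glue (fst i) (snd i) r x)"
      by (intro exI[of _ "(d, G)"]) auto
    thus ?thesis unfolding dat_def by (rule someI_ex)
  qed
  define c where "c f e = cd (fst (dat f)) (snd (dat f)) e" for f e
  have c_eq: "c f e = cd d G e" if D: "data_le d G M1 M2" and ae: "AE x in lebesgue_on {0..1}. f x = glue d G r x" and e: "e \<in> E" for f d G e M1 M2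
  proof -
    have "f \<in> space_of" using repI[OF D order_refl ae] by (rule rep_in_space)
    from dat[OF this] obtain L1 L2 where d: "data_le (fst (dat f)) (snd (dat f)) L1 L2"
      "AE x in lebesgue_on {0..1}. f x = glue (fst (dat f)) (snd (dat f)) r x" by blast
    show ?thesis unfolding c_def
      by (rule cd_unique[OF d(1) D e]) (use d(2) ae in \<open>eventually_elim; simp\<close>)
  qed
  have spaceE: "\<exists>d G M1 M2. data_le d G M1 M2 \<and> (AE x in lebesgue_on {0..1}. f x = glue d G r x)" if "f \<in> space_of" for f
    using dat[OF that] by blast
  define c' where "c' f e = (if e \<in> E then c f e else 0)" for f e
  have clin: "c' (\<lambda>x. f x + a * h x) e = c' f e + a * c' h e" if fh: "f \<in> space_of" "h \<in> space_of" for f h a e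
  proof (cases "e \<in> E")
    case e: True
    obtain d G M1 M2 where 1: "data_le d G M1 M2" "AE x in lebesgue_on {0..1}. f x = glue d G r x" using spaceE[OF fh(1)] by blast
    obtain d' H L1 L2 where 2: "data_le d' H L1 L2" "AE x in lebesgue_on {0..1}. h x = glue d' H r x" using spaceE[OF fh(2)] by blast
    have "AE x in lebesgue_on {0..1}. f x + a * h x = glue (\<lambda>p k. d p k + a * d' p k) (\<lambda>x. G x + a * H x) r x"
      using 1(2) 2(2) AE_in_U
    proof eventually_elim
      case (elim x)
      thus ?case using glue_add_scale[OF data_leD(3)[OF 1(1)] data_leD(3)[OF 2(1)] data_leD(4)[OF 1(1)] data_leD(4)[OF 2(1)] order_refl, of x a] by simp
    qed
    from c_eq[OF data_le_add[OF 1(1) 2(1)] this e] show ?thesis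
      using c_eq[OF 1 e] c_eq[OF 2 e] cd_lin[OF 1(1) 2(1) e] e by (simp add: c'_def)
  qed (simp add: c'_def)
  have S_eq: "AE x in lebesgue_on {0..1}. S d G x = L f x - (\<Sum>e\<in>E. c' f e * e x)"
    if D: "data_le d G M1 M2" and ae: "AE x in lebesgue_on {0..1}. f x = glue d G r x" for f d G M1 M2
  proof -
    have "AE x in lebesgue_on {0..1}. cmod (f x + (-1) * glue d G r x) \<le> 0" using ae by eventually_elim simp
    from Linf[OF this] have "AE x in lebesgue_on {0..1}. L f x = L (glue d G r) x"
      unfolding lin by eventually_elim simp
    thus ?thesis
    proof eventually_elim
      case (elim x)
      have "(\<Sum>e\<in>E. c' f e * e x) = (\<Sum>e\<in>E. cd d G e * e x)"
        by (intro sum.cong) (auto simp: c'_def c_eq[OF D ae])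
      thus ?case using elim by (simp add: S_def)
    qed
  qed
  have main: "(\<lambda>x. L f x - (\<Sum>e\<in>E. c' f e * e x)) \<in> space_of \<and>
      norm_of (\<lambda>x. L f x - (\<Sum>e\<in>E. c' f e * e x)) \<le> q * M \<and> (\<forall>e\<in>E. cmod (c' f e) \<le> K * M)" if rf: "rep f M" for f M
  proof -
    obtain d G M1 M2 where D: "data_le d G M1 M2" "M1 + M2 \<le> M" "AE x in lebesgue_on {0..1}. f x = glue d G r x"
      using rf by (rule repE)
    have SB: "S d G \<in> space_of" "norm_of (S d G) \<le> q * (M1 + M2)" using S_bound[OF D(1)] by auto
    let ?h = "\<lambda>x. L f x - (\<Sum>e\<in>E. c' f e * e x)"
    have hB: "?h \<in> space_of" by (rule space_of_cong[OF SB(1) S_eq[OF D(1,3)]])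
    have "norm_of ?h \<le> norm_of (S d G)"
    proof (rule norm_null_cong[OF hB SB(1)])
      show "norm_of (\<lambda>x. ?h x - S d G x) = 0"
        unfolding norm_of_eq_0_iff[OF space_of_diff[OF hB SB(1)]] using S_eq[OF D(1,3)] by eventually_elim simp
    qed
    also have "\<dots> \<le> q * M" using SB(2) D(2) nn mult_left_mono[OF D(2) nn(3)] by simp
    finally have "norm_of ?h \<le> q * M" .
    moreover have "cmod (c' f e) \<le> K * M" if "e \<in> E" for e
      using cd_bound[OF D(1) that] mult_left_mono[OF D(2) nn(1)] that by (simp add: c'_def c_eq[OF D(1,3) that])
    ultimately show ?thesis using hB by blast
  qed
  have approx: "(x::real) \<le> C * norm_of f" if "f \<in> space_of" "C \<ge> 0" "\<And>M. rep f M \<Longrightarrow> x \<le> C * M" for x C f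
  proof (rule LIMSEQ_le_const)
    have "rep f (norm_of f + 1 / real (Suc n))" for n by (rule rep_norm_of[OF that(1)]) simp
    thus "\<exists>N. \<forall>n\<ge>N. x \<le> C * (norm_of f + 1 / real (Suc n))" using that(3) by blast
    have "(\<lambda>n. C * (norm_of f + 1 / real (Suc n))) \<longlonglongrightarrow> C * (norm_of f + 0)"
      by (intro tendsto_intros LIMSEQ_Suc[OF lim_1_over_n])
    thus "(\<lambda>n. C * (norm_of f + 1 / real (Suc n))) \<longlonglongrightarrow> C * norm_of f" by simp
  qed
  have m1: "(\<lambda>x. L f x - (\<Sum>e\<in>E. c' f e * e x)) \<in> space_of" if "f \<in> space_of" for f
    using that main by (auto simp: space_of_def)
  have m2: "norm_of (\<lambda>x. L f x - (\<Sum>e\<in>E. c' f e * e x)) \<le> q * norm_of f" if "f \<in> space_of" for f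
    by (rule approx[OF that nn(3)]) (use main in blast)
  have m3: "cmod (c' f e) \<le> K * norm_of f" if "f \<in> space_of" "e \<in> E" for f e
    by (rule approx[OF that(1) nn(1)]) (use main that(2) in blast)
  show "bounded_operator space_of norm_of L"
    by (rule fredholm_if_contraction_plus_finite_rank(1)[OF E lin clin m3 m1 m2 nn(3)])
  show "fredholm space_of norm_of (\<lambda>f x. z * f x - L f x)" if "q < cmod z" for z
    by (rule fredholm_if_contraction_plus_finite_rank(2)[OF E lin clin m3 m1 m2 nn(3) that])
qed

end

section \<open>Derivatives of a function transported by a branch\<close>

text \<open>The algebra generated by the derivatives of the weight and of the map, and by \<open>1 /
  T'\<close>. It is closed under derivatives, so it contains the coefficients of all derivatives
  of \<open>(\<phi> * h) \<circ> T\<^sup>-\<^sup>1\<close>; this avoids explicit formulas for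
  higher derivatives of inverse functions.\<close>

inductive derivative_algebra :: "real set \<Rightarrow> (nat \<Rightarrow> real \<Rightarrow> complex) \<Rightarrow> (nat \<Rightarrow> real \<Rightarrow> real) \<Rightarrow> (real \<Rightarrow> complex) \<Rightarrow> bool"
  for S \<phi> \<tau> where
  const: "derivative_algebra S \<phi> \<tau> (\<lambda>x. c)"
| weight: "derivative_algebra S \<phi> \<tau> (\<phi> n)"
| map: "derivative_algebra S \<phi> \<tau> (\<lambda>x. of_real (\<tau> n x))"
| inverse: "derivative_algebra S \<phi> \<tau> (\<lambda>x. of_real (inverse (\<tau> 1 x)))"
| add: "derivative_algebra S \<phi> \<tau> f \<Longrightarrow> derivative_algebra S \<phi> \<tau> h \<Longrightarrow> derivative_algebra S \<phi> \<tau> (\<lambda>x. f x + h x)"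
| mult: "derivative_algebra S \<phi> \<tau> f \<Longrightarrow> derivative_algebra S \<phi> \<tau> h \<Longrightarrow> derivative_algebra S \<phi> \<tau> (\<lambda>x. f x * h x)"

lemma derivative_algebra_derivative:
  assumes f: "derivative_algebra S \<phi> \<tau> f"
    and \<phi>: "\<And>n x. x \<in> S \<Longrightarrow> (\<phi> n has_vector_derivative \<phi> (Suc n) x) (at x within S)"
    and \<tau>: "\<And>n x. x \<in> S \<Longrightarrow> (\<tau> n has_vector_derivative \<tau> (Suc n) x) (at x within S)"
    and nz: "\<And>x. x \<in> S \<Longrightarrow> \<tau> 1 x \<noteq> 0"
  shows "\<exists>f'. derivative_algebra S \<phi> \<tau> f' \<and> (\<forall>x\<in>S. (f has_vector_derivative f' x) (at x within S))"
  using f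
proof induction
  case (const c)
  show ?case by (intro exI[of _ "\<lambda>x. 0"]) (auto intro: derivative_algebra.const)
next
  case (weight n)
  show ?case using \<phi> by (intro exI[of _ "\<phi> (Suc n)"]) (auto intro: derivative_algebra.weight)
next
  case (map n)
  show ?case using \<tau>
    by (intro exI[of _ "\<lambda>x. of_real (\<tau> (Suc n) x)"]) (auto intro!: derivative_algebra.map has_vector_derivative_of_real simp: has_real_derivative_iff_has_vector_derivative)
next
  case inverse
  let ?d = "\<lambda>x. (of_real (\<tau> 2 x) * (of_real (inverse (\<tau> 1 x)) * of_real (inverse (\<tau> 1 x)))) * (-1 :: complex)"
  have "((\<lambda>x. complex_of_real (inverse (\<tau> 1 x))) has_vector_derivative ?d x) (at x within S)" if x: "x \<in> S" for x
  proof -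
    have "(\<tau> 1 has_real_derivative \<tau> 2 x) (at x within S)"
      using \<tau>[OF x, of 1] by (simp add: has_real_derivative_iff_has_vector_derivative numeral_2_eq_2)
    from DERIV_inverse'[OF this nz[OF x]]
    have r: "((\<lambda>x. inverse (\<tau> 1 x)) has_real_derivative - (inverse (\<tau> 1 x) * \<tau> 2 x * inverse (\<tau> 1 x))) (at x within S)" .
    from has_vector_derivative_of_real[OF r] show ?thesis by (simp add: mult_ac del: of_real_inverse)
  qed
  moreover have "derivative_algebra S \<phi> \<tau> ?d"
    by (intro derivative_algebra.intros derivative_algebra.inverse)
  ultimately show ?case by (intro exI[of _ ?d]) simp
next
  case (add f h)
  then obtain f' h' where "derivative_algebra S \<phi> \<tau> f'" "\<forall>x\<in>S. (f has_vector_derivative f' x) (at x within S)"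
    "derivative_algebra S \<phi> \<tau> h'" "\<forall>x\<in>S. (h has_vector_derivative h' x) (at x within S)" by blast
  thus ?case by (intro exI[of _ "\<lambda>x. f' x + h' x"]) (auto intro: derivative_algebra.add has_vector_derivative_add)
next
  case (mult f h)
  then obtain f' h' where "derivative_algebra S \<phi> \<tau> f'" "\<forall>x\<in>S. (f has_vector_derivative f' x) (at x within S)"
    "derivative_algebra S \<phi> \<tau> h'" "\<forall>x\<in>S. (h has_vector_derivative h' x) (at x within S)" by blast
  thus ?case using mult.hyps
    by (intro exI[of _ "\<lambda>x. f x * h' x + f' x * h x"])
      (auto intro!: derivative_algebra.add derivative_algebra.mult has_vector_derivative_mult)
qed

lemma derivative_zero_if_zero:
  fixes f :: "real \<Rightarrow> complex"
  assumes f: "(f has_vector_derivative v) (at x within {a..b})" and z: "\<And>t. t \<in> {a..b} \<Longrightarrow> f t = 0"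
    and x: "x \<in> {a..b}" and "a < b"
  shows "v = 0"
proof -
  have 1: "((\<lambda>x. 0) has_vector_derivative v) (at x within {a..b})"
    by (rule has_vector_derivative_transform[OF x _ f]) (use z in auto)
  have 2: "((\<lambda>x. 0 :: complex) has_vector_derivative 0) (at x within {a..b})" by simp
  show ?thesis
    by (rule vector_derivative_unique_within_closed_interval[of a b x]) (use 1 2 x \<open>a < b\<close> in auto)
qed

text \<open>If \<open>\<psi>\<close> is the inverse of the branch, the derivative of order \<open>n\<close> of
  \<open>(\<phi> * h) \<circ> \<psi>\<close> is \<open>\<Sum>j\<le>n. (\<kappa> n j *
  h\<^sup>(\<^sup>j\<^sup>)) \<circ> \<psi>\<close>. The recursion for \<open>\<kappa>\<close> is
  the product rule together with \<open>\<psi>' = (1 / \<tau>') \<circ> \<psi>\<close>. The matrix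
  is triangular, and only its diagonal matters for the spectral estimate.\<close>

lemma chain_rule_coefficients:
  fixes \<phi> :: "nat \<Rightarrow> real \<Rightarrow> complex" and \<tau> :: "nat \<Rightarrow> real \<Rightarrow> real"
  assumes ab: "a < b"
    and \<phi>: "\<And>n x. x \<in> {a..b} \<Longrightarrow> (\<phi> n has_vector_derivative \<phi> (Suc n) x) (at x within {a..b})"
    and \<tau>: "\<And>n x. x \<in> {a..b} \<Longrightarrow> (\<tau> n has_vector_derivative \<tau> (Suc n) x) (at x within {a..b})"
    and nz: "\<And>x. x \<in> {a..b} \<Longrightarrow> \<tau> 1 x \<noteq> 0"
  obtains \<kappa> \<kappa>d :: "nat \<Rightarrow> nat \<Rightarrow> real \<Rightarrow> complex" where
    "\<And>n j x. x \<in> {a..b} \<Longrightarrow> (\<kappa> n j has_vector_derivative \<kappa>d n j x) (at x within {a..b})"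
    "\<And>n j x. x \<in> {a..b} \<Longrightarrow> \<kappa> (Suc n) j x = (\<kappa>d n j x + (if j = 0 then 0 else \<kappa> n (j - 1) x)) / of_real (\<tau> 1 x)"
    "\<And>n j x. x \<in> {a..b} \<Longrightarrow> n < j \<Longrightarrow> \<kappa> n j x = 0"
    "\<And>n x. x \<in> {a..b} \<Longrightarrow> \<kappa> n n x = \<phi> 0 x / of_real (\<tau> 1 x) ^ n"
proof -
  let ?A = "derivative_algebra {a..b} \<phi> \<tau>"
  have "\<forall>f. \<exists>f'. ?A f \<longrightarrow> ?A f' \<and> (\<forall>x\<in>{a..b}. (f has_vector_derivative f' x) (at x within {a..b}))"
  proof
    fix f show "\<exists>f'. ?A f \<longrightarrow> ?A f' \<and> (\<forall>x\<in>{a..b}. (f has_vector_derivative f' x) (at x within {a..b}))"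
      using derivative_algebra_derivative[of "{a..b}" \<phi> \<tau> f] assms by (cases "?A f") auto
  qed
  from choice[OF this] obtain der where der: "\<And>f. ?A f \<Longrightarrow> ?A (der f)"
    "\<And>f x. ?A f \<Longrightarrow> x \<in> {a..b} \<Longrightarrow> (f has_vector_derivative der f x) (at x within {a..b})" by blast
  define \<kappa> :: "nat \<Rightarrow> nat \<Rightarrow> real \<Rightarrow> complex" where "\<kappa> = rec_nat (\<lambda>j. if j = 0 then \<phi> 0 else (\<lambda>x. 0))
     (\<lambda>n k j x. (der (k j) x + (if j = 0 then (\<lambda>x. 0) else k (j - 1)) x) * of_real (inverse (\<tau> 1 x)))"
  have \<kappa>0: "\<kappa> 0 j = (if j = 0 then \<phi> 0 else (\<lambda>x. 0))" for j by (simp add: \<kappa>_def)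
  have \<kappa>S: "\<kappa> (Suc n) j = (\<lambda>x. (der (\<kappa> n j) x + (if j = 0 then (\<lambda>x. 0) else \<kappa> n (j - 1)) x) * of_real (inverse (\<tau> 1 x)))" for n j
    by (simp add: \<kappa>_def)
  have A: "?A (\<kappa> n j)" for n j
  proof (induction n arbitrary: j)
    case 0 show ?case by (auto simp: \<kappa>0 intro: derivative_algebra.intros)
  next
    case (Suc n)
    show ?case unfolding \<kappa>S
      by (intro derivative_algebra.mult derivative_algebra.add derivative_algebra.inverse der(1) Suc)
        (auto intro: derivative_algebra.const Suc)
  qed
  have S': "\<kappa> (Suc n) j x = (der (\<kappa> n j) x + (if j = 0 then 0 else \<kappa> n (j - 1) x)) / of_real (\<tau> 1 x)" for n j x
    by (simp add: \<kappa>S divide_inverse)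
  have z: "\<kappa> n j x = 0" if "n < j" "x \<in> {a..b}" for n j x
    using that
  proof (induction n arbitrary: j x)
    case (Suc n)
    have "der (\<kappa> n j) x = 0"
      by (rule derivative_zero_if_zero[OF der(2)[OF A Suc.prems(2)] _ Suc.prems(2) ab]) (use Suc in auto)
    thus ?case unfolding S' using Suc by auto
  qed (simp add: \<kappa>0)
  have d: "\<kappa> n n x = \<phi> 0 x / of_real (\<tau> 1 x) ^ n" if "x \<in> {a..b}" for n x
    using that
  proof (induction n)
    case (Suc n)
    have "der (\<kappa> n (Suc n)) x = 0"
      by (rule derivative_zero_if_zero[OF der(2)[OF A Suc.prems] _ Suc.prems ab]) (use z in auto)
    thus ?case unfolding S' using Suc by simp
  qed (simp add: \<kappa>0)
  show thesis
    by (rule that[of \<kappa> "\<lambda>n j. der (\<kappa> n j)"]) (use der(2)[OF A] S' z d in auto)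
qed

text \<open>A branch extended to its closed interval, with the coefficients of the chain rule.\<close>

locale branch =
  fixes a b :: real and \<tau> \<tau>' :: "real \<Rightarrow> real" and \<kappa> \<kappa>d :: "nat \<Rightarrow> nat \<Rightarrow> real \<Rightarrow> complex"
  assumes ab: "a < b"
    and der: "x \<in> {a..b} \<Longrightarrow> (\<tau> has_vector_derivative \<tau>' x) (at x within {a..b})"
    and nz: "x \<in> {a..b} \<Longrightarrow> \<tau>' x \<noteq> 0"
    and \<kappa>der: "x \<in> {a..b} \<Longrightarrow> (\<kappa> n j has_vector_derivative \<kappa>d n j x) (at x within {a..b})"
    and \<kappa>S: "x \<in> {a..b} \<Longrightarrow> \<kappa> (Suc n) j x = (\<kappa>d n j x + (if j = 0 then 0 else \<kappa> n (j - 1) x)) / of_real (\<tau>' x)"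
    and \<kappa>z: "x \<in> {a..b} \<Longrightarrow> n < j \<Longrightarrow> \<kappa> n j x = 0"
begin

lemma der_real: "x \<in> {a<..<b} \<Longrightarrow> (\<tau> has_real_derivative \<tau>' x) (at x)"
  using der[of x] by (simp add: at_within_Icc_at has_real_derivative_iff_has_vector_derivative)

lemma cont: "continuous_on {a..b} \<tau>"
  unfolding continuous_on_eq_continuous_within by (intro ballI has_vector_derivative_continuous[OF der])

lemma inj: "inj_on \<tau> {a..b}"
proof -
  have ne: "\<tau> x \<noteq> \<tau> y" if xy: "x \<in> {a..b}" "y \<in> {a..b}" "x < y" for x y
  proof
    assume eq: "\<tau> x = \<tau> y"
    have "(\<tau> has_derivative (\<lambda>h. h * \<tau>' z)) (at z within {x..y})" if z: "x \<le> z" "z \<le> y" for z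
    proof -
      have "(\<tau> has_vector_derivative \<tau>' z) (at z within {x..y})"
        using xy z by (intro has_vector_derivative_within_subset[OF der]) auto
      thus ?thesis by (simp add: has_vector_derivative_def)
    qed
    from mvt_simple[OF xy(3) this] have "\<exists>z\<in>{x<..<y}. \<tau> y - \<tau> x = (y - x) * \<tau>' z" by simp
    then obtain z where "x < z" "z < y" "(y - x) * \<tau>' z = 0" using eq by auto
    thus False using nz[of z] xy by auto
  qed
  show ?thesis by (rule linorder_inj_onI') (use ne in auto)
qed

definition \<psi> :: "real \<Rightarrow> real" where "\<psi> = inv_into {a..b} \<tau>"

lemma \<psi>_\<tau>: "x \<in> {a..b} \<Longrightarrow> \<psi> (\<tau> x) = x"
  unfolding \<psi>_def by (rule inv_into_f_f[OF inj])

lemma \<tau>_image_closed: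
  assumes "a \<le> s" "s < e" "e \<le> b" shows "\<tau> ` {s..e} = {min (\<tau> s) (\<tau> e)..max (\<tau> s) (\<tau> e)}"
proof -
  have c: "continuous_on {s..e} \<tau>" by (rule continuous_on_subset[OF cont]) (use assms in auto)
  have i: "inj_on \<tau> {s..e}" by (rule inj_on_subset[OF inj]) (use assms in auto)
  show ?thesis
  proof (intro subset_antisym subsetI)
    fix y assume "y \<in> \<tau> ` {s..e}"
    then obtain x where x: "x \<in> {s..e}" "y = \<tau> x" by auto
    show "y \<in> {min (\<tau> s) (\<tau> e)..max (\<tau> s) (\<tau> e)}"
      using continuous_inj_imp_mono[of s x e \<tau>, OF _ _ c i] x by (cases "x = s \<or> x = e") (auto simp: min_def max_def)
  next
    fix y assume y: "y \<in> {min (\<tau> s) (\<tau> e)..max (\<tau> s) (\<tau> e)}"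
    show "y \<in> \<tau> ` {s..e}"
    proof (cases "\<tau> s \<le> \<tau> e")
      case True
      thus ?thesis using IVT'[of \<tau> s y e] y c assms by (auto simp: min_def max_def)
    next
      case False
      thus ?thesis using IVT2'[of \<tau> e y s] y c assms by (auto simp: min_def max_def)
    qed
  qed
qed

lemma \<tau>_image_open:
  assumes "a \<le> s" "s < e" "e \<le> b" shows "\<tau> ` {s<..<e} = {min (\<tau> s) (\<tau> e)<..<max (\<tau> s) (\<tau> e)}"
proof -
  have i: "inj_on \<tau> {s..e}" by (rule inj_on_subset[OF inj]) (use assms in auto)
  have "\<tau> ` {s<..<e} = \<tau> ` ({s..e} - {s, e})" by (rule arg_cong[of _ _ "(`) \<tau>"]) auto
  also have "\<dots> = \<tau> ` {s..e} - \<tau> ` {s, e}"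
    by (rule inj_on_image_set_diff[OF i]) (use assms in auto)
  also have "\<dots> = {min (\<tau> s) (\<tau> e)<..<max (\<tau> s) (\<tau> e)}"
    unfolding \<tau>_image_closed[OF assms] by (auto simp: min_def max_def split: if_splits)
  finally show ?thesis .
qed

lemma \<tau>_ends_neq: assumes "a \<le> s" "s < e" "e \<le> b" shows "min (\<tau> s) (\<tau> e) < max (\<tau> s) (\<tau> e)"
  using inj_onD[OF inj, of s e] assms by (auto simp: min_def max_def less_le)

lemma \<psi>_in:
  assumes "a \<le> s" "s < e" "e \<le> b"
  shows "y \<in> {min (\<tau> s) (\<tau> e)..max (\<tau> s) (\<tau> e)} \<Longrightarrow> \<psi> y \<in> {s..e} \<and> \<tau> (\<psi> y) = y"
    and "y \<in> {min (\<tau> s) (\<tau> e)<..<max (\<tau> s) (\<tau> e)} \<Longrightarrow> \<psi> y \<in> {s<..<e}"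
proof -
  assume "y \<in> {min (\<tau> s) (\<tau> e)..max (\<tau> s) (\<tau> e)}"
  then obtain x where "x \<in> {s..e}" "y = \<tau> x" unfolding \<tau>_image_closed[OF assms, symmetric] by auto
  thus "\<psi> y \<in> {s..e} \<and> \<tau> (\<psi> y) = y" using \<psi>_\<tau>[of x] assms by auto
next
  assume "y \<in> {min (\<tau> s) (\<tau> e)<..<max (\<tau> s) (\<tau> e)}"
  then obtain x where "x \<in> {s<..<e}" "y = \<tau> x" unfolding \<tau>_image_open[OF assms, symmetric] by auto
  thus "\<psi> y \<in> {s<..<e}" using \<psi>_\<tau>[of x] assms by auto
qed

lemma \<psi>_cont:
  assumes "a \<le> s" "s < e" "e \<le> b" shows "continuous_on {min (\<tau> s) (\<tau> e)..max (\<tau> s) (\<tau> e)} \<psi>"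
  unfolding \<tau>_image_closed[OF assms, symmetric]
  by (rule continuous_on_inv) (use assms continuous_on_subset[OF cont, of "{s..e}"] \<psi>_\<tau> in auto)

lemma \<psi>_isCont:
  assumes "a \<le> s" "s < e" "e \<le> b" "y \<in> {min (\<tau> s) (\<tau> e)<..<max (\<tau> s) (\<tau> e)}" shows "isCont \<psi> y"
  by (rule continuous_on_interior[OF \<psi>_cont[OF assms(1-3)]]) (use assms in auto)

lemma \<psi>_deriv:
  assumes "a \<le> s" "s < e" "e \<le> b" and y: "y \<in> {min (\<tau> s) (\<tau> e)<..<max (\<tau> s) (\<tau> e)}"
  shows "(\<psi> has_real_derivative inverse (\<tau>' (\<psi> y))) (at y)"
proof (rule DERIV_inverse_function)
  have "\<psi> y \<in> {s<..<e}" by (rule \<psi>_in(2)[OF assms(1-3) y])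
  hence x: "\<psi> y \<in> {a<..<b}" using assms by auto
  show "(\<tau> has_real_derivative \<tau>' (\<psi> y)) (at (\<psi> y))" by (rule der_real[OF x])
  show "\<tau>' (\<psi> y) \<noteq> 0" by (rule nz) (use x in auto)
  show "min (\<tau> s) (\<tau> e) < y" "y < max (\<tau> s) (\<tau> e)" using y by auto
  show "isCont \<psi> y" by (rule \<psi>_isCont[OF assms])
qed (use \<psi>_in(1)[OF assms(1-3)] in auto)

text \<open>If \<open>D k\<close> is the derivative of order \<open>r - k\<close> of \<open>h\<close>, then
  \<open>pushed r D k \<circ> \<psi>\<close> is that of \<open>(\<phi> * h) \<circ>
  \<psi>\<close>.\<close>

definition pushed :: "nat \<Rightarrow> (nat \<Rightarrow> real \<Rightarrow> complex) \<Rightarrow> nat \<Rightarrow> real \<Rightarrow> complex" where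
  "pushed r D k x = (\<Sum>j\<le>r. \<kappa> (r - k) j x * D (r - j) x)"

lemma \<kappa>_cont: "continuous_on {a..b} (\<kappa> n j)"
  unfolding continuous_on_eq_continuous_within by (intro ballI has_vector_derivative_continuous[OF \<kappa>der])

lemma \<kappa>_isCont: "x \<in> {a<..<b} \<Longrightarrow> isCont (\<kappa> n j) x"
  by (rule continuous_on_interior[OF \<kappa>_cont]) auto

lemma pushed_cont:
  assumes D: "\<And>k. k < r \<Longrightarrow> continuous_on {s..e} (D (Suc k))" and se: "a \<le> s" "e \<le> b" and k: "k < r"
  shows "continuous_on {s..e} (pushed r D (Suc k))"
proof -
  have "continuous_on {s..e} (\<lambda>x. \<Sum>j<r. \<kappa> (r - Suc k) j x * D (r - j) x)"
  proof (intro continuous_on_sum continuous_on_mult)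
    fix j assume "j \<in> {..<r}"
    hence "r - j = Suc (r - j - 1)" "r - j - 1 < r" by auto
    thus "continuous_on {s..e} (D (r - j))" using D by metis
    show "continuous_on {s..e} (\<kappa> (r - Suc k) j)" by (rule continuous_on_subset[OF \<kappa>_cont]) (use se in auto)
  qed
  thus ?thesis
  proof (rule continuous_on_cong[THEN iffD1, rotated -1])
    fix x assume "x \<in> {s..e}"
    hence "\<kappa> (r - Suc k) r x = 0" using se k by (intro \<kappa>z) auto
    thus "(\<Sum>j<r. \<kappa> (r - Suc k) j x * D (r - j) x) = pushed r D (Suc k) x"
      by (simp add: pushed_def lessThan_Suc_atMost[symmetric])
  qed simp
qed

lemma pushed_deriv:
  assumes D: "\<And>k. k < r \<Longrightarrow> (D (Suc k) has_vector_derivative D k x) (at x)" and x: "x \<in> {a<..<b}" and k: "k < r"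
  shows "(pushed r D (Suc k) has_vector_derivative of_real (\<tau>' x) * pushed r D k x) (at x)"
proof -
  define n where "n = r - Suc k"
  have n: "r - k = Suc n" "n < r" using k by (auto simp: n_def)
  have \<kappa>x: "(\<kappa> n j has_vector_derivative \<kappa>d n j x) (at x)" for j
    using \<kappa>der[of x n j] x by (simp add: at_within_Icc_at)
  have xab: "x \<in> {a..b}" using x by auto
  have "((\<lambda>x. \<Sum>j<r. \<kappa> n j x * D (r - j) x) has_vector_derivative
      (\<Sum>j<r. \<kappa> n j x * D (r - Suc j) x + \<kappa>d n j x * D (r - j) x)) (at x)"
  proof (intro has_vector_derivative_sum has_vector_derivative_mult \<kappa>x)
    fix j assume "j \<in> {..<r}"
    hence "r - j = Suc (r - Suc j)" "r - Suc j < r" by auto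
    thus "(D (r - j) has_vector_derivative D (r - Suc j) x) (at x)" using D by metis
  qed
  moreover have "(\<Sum>j<r. \<kappa> n j x * D (r - Suc j) x + \<kappa>d n j x * D (r - j) x) = of_real (\<tau>' x) * pushed r D k x"
  proof -
    have \<kappa>dr: "\<kappa>d n r x = 0"
      by (rule derivative_zero_if_zero[OF \<kappa>der[OF xab] _ xab ab]) (use \<kappa>z n in auto)
    have "of_real (\<tau>' x) * pushed r D k x = (\<Sum>j\<le>r. (\<kappa>d n j x + (if j = 0 then 0 else \<kappa> n (j - 1) x)) * D (r - j) x)"
      unfolding pushed_def n(1) sum_distrib_left using nz[OF xab] by (intro sum.cong) (auto simp: \<kappa>S[OF xab])
    also have "\<dots> = (\<Sum>j\<le>r. \<kappa>d n j x * D (r - j) x) + (\<Sum>j\<le>r. (if j = 0 then 0 else \<kappa> n (j - 1) x) * D (r - j) x)"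
      by (simp add: distrib_right sum.distrib)
    also have "(\<Sum>j\<le>r. \<kappa>d n j x * D (r - j) x) = (\<Sum>j<r. \<kappa>d n j x * D (r - j) x)"
      by (simp add: lessThan_Suc_atMost[symmetric] \<kappa>dr)
    also have "(\<Sum>j\<le>r. (if j = 0 then 0 else \<kappa> n (j - 1) x) * D (r - j) x) = (\<Sum>j<r. \<kappa> n j x * D (r - Suc j) x)"
      by (subst lessThan_Suc_atMost[symmetric], subst sum.lessThan_Suc_shift) simp
    finally show ?thesis by (simp add: sum.distrib)
  qed
  ultimately have "((\<lambda>x. \<Sum>j<r. \<kappa> n j x * D (r - j) x) has_vector_derivative of_real (\<tau>' x) * pushed r D k x) (at x)"
    by simp
  thus ?thesis
  proof (rule has_vector_derivative_transform_within_open)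
    show "open {a<..<b}" "x \<in> {a<..<b}" using x by auto
    fix t assume "t \<in> {a<..<b}"
    thus "(\<Sum>j<r. \<kappa> n j t * D (r - j) t) = pushed r D (Suc k) t"
      using \<kappa>z[of t n r] n by (simp add: pushed_def lessThan_Suc_atMost[symmetric] n_def)
  qed
qed

lemma tame_compose:
  assumes f: "tame_on {s<..<e} f" and se: "a \<le> s" "s < e" "e \<le> b"
  shows "tame_on {min (\<tau> s) (\<tau> e)<..<max (\<tau> s) (\<tau> e)} (\<lambda>y. f (\<psi> y))"
proof -
  obtain M where M: "\<And>x. x \<in> {s<..<e} \<Longrightarrow> cmod (f x) \<le> M" using tame_on_bounded[OF f] by blast
  obtain Z where Z: "countable Z" "\<And>x. x \<in> {s<..<e} \<Longrightarrow> x \<notin> Z \<Longrightarrow> isCont f x" using tame_on_cont[OF f] by blast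
  show ?thesis
  proof (rule tame_onI[of _ _ M "\<tau> ` Z"])
    fix y assume y: "y \<in> {min (\<tau> s) (\<tau> e)<..<max (\<tau> s) (\<tau> e)}" "y \<notin> \<tau> ` Z"
    have "\<tau> (\<psi> y) = y" using \<psi>_in(1)[OF se, of y] y by auto
    hence "\<psi> y \<notin> Z" using y by force
    thus "isCont (\<lambda>y. f (\<psi> y)) y"
      by (rule isCont_o2[OF \<psi>_isCont[OF se y(1)] Z(2)[OF \<psi>_in(2)[OF se y(1)]]])
  next
    fix y assume "y \<in> {min (\<tau> s) (\<tau> e)<..<max (\<tau> s) (\<tau> e)}"
    thus "cmod (f (\<psi> y)) \<le> M" by (rule M[OF \<psi>_in(2)[OF se]])
  qed (use Z in simp)
qed

lemma tame_\<kappa>: assumes "a \<le> s" "e \<le> b" shows "tame_on {s<..<e} (\<kappa> n j)"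
proof -
  have "bounded (\<kappa> n j ` {a..b})" by (rule compact_imp_bounded[OF compact_continuous_image[OF \<kappa>_cont]]) simp
  then obtain M where "\<forall>x\<in>{a..b}. cmod (\<kappa> n j x) \<le> M" by (auto simp: bounded_iff)
  thus ?thesis by (intro tame_onI[of _ _ M "{}"]) (use assms \<kappa>_isCont in auto)
qed

lemma pushed_tame:
  assumes D: "\<And>k. k \<le> r \<Longrightarrow> tame_on {s<..<e} (D k)" and se: "a \<le> s" "s < e" "e \<le> b"
  shows "tame_on {s<..<e} (pushed r D k)"
  unfolding pushed_def by (intro tame_on_sum tame_on_mult tame_\<kappa> D) (use se in auto)

lemma pushed_compose_deriv:
  assumes D: "\<And>k. k < r \<Longrightarrow> (D (Suc k) has_vector_derivative D k (\<psi> y)) (at (\<psi> y))"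
    and se: "a \<le> s" "s < e" "e \<le> b" and y: "y \<in> {min (\<tau> s) (\<tau> e)<..<max (\<tau> s) (\<tau> e)}" and k: "k < r"
  shows "((\<lambda>y. pushed r D (Suc k) (\<psi> y)) has_vector_derivative pushed r D k (\<psi> y)) (at y)"
proof -
  have x: "\<psi> y \<in> {a<..<b}" using \<psi>_in(2)[OF se y] se by auto
  have P: "(pushed r D (Suc k) has_vector_derivative of_real (\<tau>' (\<psi> y)) * pushed r D k (\<psi> y)) (at (\<psi> y))"
    by (rule pushed_deriv[OF _ x k]) (rule D)
  have Q: "(\<psi> has_vector_derivative inverse (\<tau>' (\<psi> y))) (at y)"
    using \<psi>_deriv[OF se y] by (simp add: has_real_derivative_iff_has_vector_derivative)
  have "(pushed r D (Suc k) \<circ> \<psi> has_vector_derivative inverse (\<tau>' (\<psi> y)) *\<^sub>R (of_real (\<tau>' (\<psi> y)) * pushed r D k (\<psi> y))) (at y)"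
    by (rule vector_diff_chain_at[OF Q P])
  moreover have "inverse (\<tau>' (\<psi> y)) *\<^sub>R (of_real (\<tau>' (\<psi> y)) * pushed r D k (\<psi> y)) = pushed r D k (\<psi> y)"
    using nz[of "\<psi> y"] x by (simp add: scaleR_conv_of_real)
  ultimately show ?thesis by (simp add: o_def)
qed

end

section \<open>Jets of atoms and of regular functions\<close>

lemma sum_collect:
  assumes "finite I" "finite E" "h ` I \<subseteq> E"
  shows "(\<Sum>i\<in>I. c i * h i x) = (\<Sum>e\<in>E. (\<Sum>i\<in>{i\<in>I. h i = e}. c i) * (e x :: complex))"
proof -
  have "(\<Sum>i\<in>I. c i * h i x) = (\<Sum>e\<in>E. \<Sum>i\<in>{i\<in>I. h i = e}. c i * h i x)"
    by (rule sum.group[symmetric]) (use assms in auto)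
  also have "\<dots> = (\<Sum>e\<in>E. (\<Sum>i\<in>{i\<in>I. h i = e}. c i) * e x)"
    by (intro sum.cong refl) (simp add: sum_distrib_right)
  finally show ?thesis .
qed

lemma norm_sum_collect:
  assumes "finite I" "\<And>i. i \<in> I \<Longrightarrow> cmod (c i) \<le> C" "0 \<le> C"
  shows "cmod (\<Sum>i\<in>{i\<in>I. Q i}. c i) \<le> real (card I) * C"
proof -
  have "cmod (\<Sum>i\<in>{i\<in>I. Q i}. c i) \<le> (\<Sum>i\<in>{i\<in>I. Q i}. C)" by (rule sum_norm_le) (use assms in auto)
  also have "\<dots> \<le> (\<Sum>i\<in>I. C)" by (rule sum_mono2) (use assms in auto)
  finally show ?thesis by simp
qed

context jump_space begin

lemma finite_left_ends: "finite left_ends"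
proof (rule finite_subset)
  show "left_ends \<subseteq> Inf ` \<Omega>"
  proof
    fix a assume "a \<in> left_ends"
    then obtain b where "a < b" "{a<..<b} \<in> \<Omega>" by (auto simp: left_ends_def)
    thus "a \<in> Inf ` \<Omega>" by (intro image_eqI[of _ _ "{a<..<b}"]) (auto simp: cInf_greaterThanLessThan)
  qed
qed (use fin in simp)

lemma right_end_not_U: assumes "{a<..<b} \<in> \<Omega>" "a < b" shows "b \<notin> U"
proof
  assume "b \<in> U"
  then obtain a' b' where 1: "{a'<..<b'} \<in> \<Omega>" "b \<in> {a'<..<b'}" using ivl_exists by blast
  obtain t where t: "max a a' < t" "t < b" using dense[of "max a a'" b] 1 assms by auto
  have "{a'<..<b'} = {a<..<b}" by (rule unique_ivl[of _ _ t]) (use 1 assms t in auto)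
  with 1(2) show False by auto
qed

lemma P_cases: "p \<in> P \<Longrightarrow> p \<in> left_ends \<or> p \<in> U"
proof -
  assume "p \<in> P"
  then obtain a b where ab: "{a<..<b} \<in> \<Omega>" "a \<le> p" "p < b" using P by blast
  show ?thesis
  proof (cases "p = a")
    case True thus ?thesis using ab by (auto simp: left_ends_def)
  next
    case False
    hence "p \<in> {a<..<b}" using ab by auto
    thus ?thesis using ab(1) by blast
  qed
qed

text \<open>On the element of the partition that contains \<open>q\<close>, the atom and its derivatives are
  monomials in \<open>x - q\<close> to the right of \<open>q\<close>; elsewhere the atom is zero.\<close>

definition atom_jet :: "real \<Rightarrow> nat \<Rightarrow> nat \<Rightarrow> real \<Rightarrow> complex" where
  "atom_jet q k0 k x = (if k \<le> k0 then 0 else of_real ((x - q) ^ (k - Suc k0) / fact (k - Suc k0)))"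

lemma atom_jet_deriv: "(atom_jet q k0 (Suc k) has_vector_derivative atom_jet q k0 k x) (at x)"
proof (cases "k \<le> k0")
  case True
  have "atom_jet q k0 (Suc k) = (\<lambda>x. atom_jet q k0 (Suc k) q)"
    using True by (auto simp: atom_jet_def fun_eq_iff le_antisym Suc_diff_le not_le)
  moreover have "((\<lambda>x. atom_jet q k0 (Suc k) q) has_vector_derivative 0) (at x)" by (rule has_vector_derivative_const)
  ultimately show ?thesis using True by (simp add: atom_jet_def[of q k0 k])
next
  case False
  then obtain n where "k = Suc k0 + n" using le_Suc_ex[of "Suc k0" k] by auto
  hence n: "k - Suc k0 = n" "Suc k - Suc k0 = Suc n" "\<not> Suc k \<le> k0" by auto
  have "((\<lambda>x. (x - q) ^ Suc n) has_real_derivative real (Suc n) * (x - q) ^ n) (at x)"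
    by (rule derivative_eq_intros refl | simp)+
  from DERIV_cdivide[OF this, of "fact (Suc n)"]
  have "((\<lambda>x. (x - q) ^ Suc n / fact (Suc n)) has_real_derivative (x - q) ^ n / fact n) (at x)"
    by (simp del: of_nat_Suc power_Suc add: fact_Suc)
  from has_vector_derivative_of_real[OF this]
  have "((\<lambda>x. of_real ((x - q) ^ Suc n / fact (Suc n)) :: complex) has_vector_derivative of_real ((x - q) ^ n / fact n)) (at x)" .
  moreover have "atom_jet q k0 (Suc k) = (\<lambda>x. of_real ((x - q) ^ Suc n / fact (Suc n)))"
    unfolding atom_jet_def[abs_def] n(2) using n(3) by (simp only: if_False)
  moreover have "atom_jet q k0 k x = of_real ((x - q) ^ n / fact n)"
    unfolding atom_jet_def n(1) using False by (simp only: if_False)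
  ultimately show ?thesis by (simp only:)
qed

lemma atom_jet_cont: "continuous_on S (atom_jet q k0 (Suc k))"
  by (intro continuous_at_imp_continuous_on ballI has_vector_derivative_continuous[OF atom_jet_deriv])

lemma atom_jet_bound: "q \<le> x \<Longrightarrow> x - q \<le> 1 \<Longrightarrow> cmod (atom_jet q k0 k x) \<le> 1"
proof -
  assume x: "q \<le> x" "x - q \<le> 1"
  have "(x - q) ^ n / fact n \<le> 1" for n
    using x order_trans[OF power_le_one fact_ge_1, of "x - q" n n] by (simp add: divide_le_eq)
  moreover have "0 \<le> (x - q) ^ n / fact n" for n using x by simp
  ultimately show ?thesis unfolding atom_jet_def by (simp only: norm_of_real abs_of_nonneg split: if_splits) auto
qed

lemma atom_jet_isCont: "isCont (atom_jet q k0 k) x"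
proof (cases k)
  case 0
  hence "atom_jet q k0 k = (\<lambda>x. 0)" by (auto simp: atom_jet_def)
  thus ?thesis by simp
next
  case (Suc n)
  thus ?thesis using has_vector_derivative_continuous[OF atom_jet_deriv] by simp
qed

lemma atom_jet_tame: "x - q \<le> 1 \<Longrightarrow> tame_on {q<..<x} (atom_jet q k0 k)"
  by (rule tame_onI[of _ _ 1 "{}"]) (auto intro!: atom_jet_bound atom_jet_isCont)

lemma atom_jet_start: "atom_jet q k0 k q = (if k = Suc k0 then 1 else 0)"
  by (auto simp: atom_jet_def power_0_left)

lemma atom_eq:
  assumes q: "q \<in> P" "{a<..<b} \<in> \<Omega>" "a \<le> q" "q < b" and left: "left_ends \<subseteq> P" and k0: "k0 < r" and x: "x \<in> U"
  shows "atom q k0 x = (if q < x \<and> x \<le> b then atom_jet q k0 r x else 0)"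
proof -
  have ab: "0 \<le> a" "b \<le> 1" using ivl'[OF q(2), of "(q + b) / 2"] q by auto
  have bU: "b \<notin> U" by (rule right_end_not_U[OF q(2)]) (use q in auto)
  have Lq: "p \<notin> left_ends" if "q < p" "p < b" for p
  proof -
    have "p \<in> {a<..<b}" using that q by auto
    hence "p \<in> U" using q(2) by blast
    thus ?thesis using left_ends_not_U by blast
  qed
  have "atom q k0 x = glue (jump_data q b (atom_jet q k0)) (\<lambda>x. if q < x \<and> x \<le> b then atom_jet q k0 0 x else 0) r x"
    unfolding atom_def
  proof (rule glue_cong[OF _ _ order_refl x])
    fix p k assume "p \<in> P" "k < r"
    show "atom_data q k0 p k = jump_data q b (atom_jet q k0) p k"
      using bU Lq by (auto simp: atom_data_def jump_data_def atom_jet_start simp del: Union_iff)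
  qed (simp add: atom_jet_def)
  also have "\<dots> = (if q < x \<and> x \<le> b then atom_jet q k0 r x else 0)"
  proof (rule jump_decomposition[OF q(4) _ _ _ _ left _ _ order_refl x])
    show "continuous_on {q..b} (atom_jet q k0 (Suc k))" for k by (rule atom_jet_cont)
    show "countable {}" by simp
    show "(atom_jet q k0 (Suc k) has_vector_derivative atom_jet q k0 k x) (at x)" for k x by (rule atom_jet_deriv)
    show "tame_on {q<..<b} (atom_jet q k0 k)" for k by (rule atom_jet_tame) (use ab q in auto)
  qed (use q bU in auto)
  finally show ?thesis .
qed

lemma rep_sum:
  assumes "finite I" "\<And>i. i \<in> I \<Longrightarrow> rep (f i) (M i)"
  shows "rep (\<lambda>x. \<Sum>i\<in>I. c i * f i x) (\<Sum>i\<in>I. cmod (c i) * M i)"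
  using assms
proof (induction I rule: finite_induct)
  case (insert i I)
  have "rep (\<lambda>x. (\<Sum>i\<in>I. c i * f i x) + c i * f i x) ((\<Sum>i\<in>I. cmod (c i) * M i) + cmod (c i) * M i)"
    by (rule rep_add_scale) (use insert in auto)
  thus ?case using insert by (simp add: add.commute)
qed (simp add: rep_zero)

text \<open>The decomposition into the regular function of the top derivative and finitely many atoms: jumps
  occur only at the ends of the interval and at left end points of the partition. The values at
  \<open>\<beta>\<close> are immaterial up to null sets.\<close>

lemma piece_decomposition:
  fixes \<alpha> \<beta> :: real and E :: "nat \<Rightarrow> real \<Rightarrow> complex"
  assumes ab: "\<alpha> < \<beta>" and cont: "\<And>k. k < r \<Longrightarrow> continuous_on {\<alpha>..\<beta>} (E (Suc k))"
    and tame: "\<And>k. k \<le> r \<Longrightarrow> tame_on {\<alpha><..<\<beta>} (E k)"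
    and Z: "countable Z"
    and der: "\<And>k x. k < r \<Longrightarrow> x \<in> {\<alpha><..<\<beta>} - Z \<Longrightarrow> (E (Suc k) has_vector_derivative E k x) (at x)"
    and left: "left_ends \<subseteq> P" and \<alpha>P: "\<alpha> \<in> U \<Longrightarrow> \<alpha> \<in> P" and \<beta>P: "\<beta> \<in> U \<Longrightarrow> \<beta> \<in> P"
    and Q: "finite Q" "Q \<subseteq> P" "P \<inter> ({\<alpha>, \<beta>} \<union> left_ends) \<subseteq> Q"
    and gm: "\<And>x. x \<in> U \<Longrightarrow> g x \<le> gm" and r: "0 < r"
    and h: "\<And>x. x \<in> U \<Longrightarrow> h x = (if \<alpha> < x \<and> x < \<beta> then E r x else 0)"
  shows "tame_on U (\<lambda>x. if \<alpha> < x \<and> x < \<beta> then E 0 x else 0)"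
    and "AE x in lebesgue_on {0..1}. h x = regular (\<lambda>x. if \<alpha> < x \<and> x < \<beta> then E 0 x else 0) x
       + (\<Sum>(q,k)\<in>Q \<times> {..<r}. jump_data \<alpha> \<beta> E q k * atom q k x)"
proof -
  define E' where "E' k = (if k = 0 then (\<lambda>x. if \<alpha> < x \<and> x < \<beta> then E 0 x else 0) else E k)" for k
  define G where "G = (\<lambda>x. if \<alpha> < x \<and> x < \<beta> then E 0 x else 0)"
  have Geq: "(\<lambda>x. if \<alpha> < x \<and> x \<le> \<beta> then E' 0 x else 0) = G" by (auto simp: E'_def G_def fun_eq_iff)
  have tame': "tame_on {\<alpha><..<\<beta>} (E' k)" if "k \<le> r" for k
    by (rule tame_on_cong_open[OF _ _ tame[OF that]]) (auto simp: E'_def)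
  have tG: "tame_on U G" using tame_on_cutoff[OF tame'[of 0], of U] unfolding Geq by simp
  thus "tame_on U (\<lambda>x. if \<alpha> < x \<and> x < \<beta> then E 0 x else 0)" by (simp add: G_def)
  obtain M where M: "M \<ge> 0" "\<And>x. x \<in> U \<Longrightarrow> cmod (G x) \<le> M" using tame_on_bounded[OF tG] by blast
  have DG: "data_le (\<lambda>_ _. 0) G (\<bar>gm\<bar> * M) 0"
  proof (rule data_le_regular[OF tG])
    fix x assume x: "x \<in> U"
    show "g x * cmod (G x) \<le> \<bar>gm\<bar> * M"
      using gm[OF x] g_pos[OF x] M by (intro mult_mono M x) auto
  qed (use M in auto)
  have jd: "jump_data \<alpha> \<beta> E' = jump_data \<alpha> \<beta> E" by (auto simp: jump_data_def E'_def fun_eq_iff)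
  have eq: "(if \<alpha> < x \<and> x \<le> \<beta> then E r x else 0) = regular G x + (\<Sum>(q,k)\<in>Q \<times> {..<r}. jump_data \<alpha> \<beta> E q k * atom q k x)"
    if x: "x \<in> U" for x
  proof -
    have "(if \<alpha> < x \<and> x \<le> \<beta> then E' r x else 0) = glue (jump_data \<alpha> \<beta> E') (\<lambda>x. if \<alpha> < x \<and> x \<le> \<beta> then E' 0 x else 0) r x"
    proof (rule jump_decomposition[OF ab _ tame' Z _ left \<alpha>P \<beta>P order_refl x, symmetric])
      fix k x assume k: "k < r"
      show "continuous_on {\<alpha>..\<beta>} (E' (Suc k))" using cont[OF k] by (simp add: E'_def)
      assume "x \<in> {\<alpha><..<\<beta>} - Z"
      thus "(E' (Suc k) has_vector_derivative E' k x) (at x)" using der[OF k, of x] by (cases k) (auto simp: E'_def)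
    qed auto
    also have "\<dots> = glue (jump_data \<alpha> \<beta> E) G r x" unfolding Geq jd ..
    also have "\<dots> = regular G x + (\<Sum>(q,k)\<in>Q \<times> {..<r}. jump_data \<alpha> \<beta> E q k * atom q k x)"
    proof (rule glue_finite[OF _ _ DG _ x])
      fix p k assume "p \<in> P" "k < r" "(p, k) \<notin> Q \<times> {..<r}"
      hence "p \<notin> {\<alpha>, \<beta>} \<union> left_ends" using Q by auto
      thus "jump_data \<alpha> \<beta> E p k = 0" by (auto simp: jump_data_def)
    qed (use Q in auto)
    finally have "(if \<alpha> < x \<and> x \<le> \<beta> then E' r x else 0) = regular G x + (\<Sum>(q,k)\<in>Q \<times> {..<r}. jump_data \<alpha> \<beta> E q k * atom q k x)" .
    moreover have "E' r = E r" using r by (simp add: E'_def)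
    ultimately show ?thesis by (simp only:)
  qed
  have "AE x in lebesgue_on {0..1}. x \<noteq> \<beta>"
    unfolding AE_unit_interval_iff by (rule negligible_subset[of "{\<beta>}"]) auto
  thus "AE x in lebesgue_on {0..1}. h x = regular (\<lambda>x. if \<alpha> < x \<and> x < \<beta> then E 0 x else 0) x
       + (\<Sum>(q,k)\<in>Q \<times> {..<r}. jump_data \<alpha> \<beta> E q k * atom q k x)"
    using AE_in_U
  proof eventually_elim
    case (elim x)
    show ?case using eq[OF elim(2)] h[OF elim(2)] elim(1) unfolding G_def by (auto split: if_splits)
  qed
qed

text \<open>The iterated integrals from a fixed base point. They agree with the jet of the regular function on
  the interval that starts at \<open>a\<close>, but, unlike \<open>glue\<close>, are also
  continuous at its end points.\<close>

definition regular_jet :: "real \<Rightarrow> (real \<Rightarrow> complex) \<Rightarrow> nat \<Rightarrow> real \<Rightarrow> complex" where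
  "regular_jet a G = rec_nat G (\<lambda>k f x. integral {a..x} f)"

lemma regular_jet_0 [simp]: "regular_jet a G 0 = G"
  and regular_jet_Suc [simp]: "regular_jet a G (Suc k) = (\<lambda>x. integral {a..x} (regular_jet a G k))"
  by (simp_all add: regular_jet_def)

lemma jumps_ok_0: "jumps_ok (\<lambda>_ _. 0)" by (simp add: jumps_ok_def)

lemma regular_jet_eq_glue:
  assumes "{a<..<b} \<in> \<Omega>"
  shows "k \<le> r \<Longrightarrow> x \<in> {a<..<b} \<Longrightarrow> regular_jet a G k x = glue (\<lambda>_ _. 0) G k x"
proof (induction k arbitrary: x)
  case (Suc k)
  have "integral {a..x} (regular_jet a G k) = integral {a..x} (glue (\<lambda>_ _. 0) G k)"
    by (rule integral_spike[of "{a}"]) (use Suc in auto)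
  moreover have "jumps_before P a (\<lambda>p. 0) x = 0" unfolding jumps_before_def by (rule infsum_0) auto
  ultimately show ?case unfolding glue_on[OF assms Suc.prems(2)] by simp
qed simp

lemma regular_jet_tame:
  assumes "{a<..<b} \<in> \<Omega>" "tame_on U G" "k \<le> r" shows "tame_on {a<..<b} (regular_jet a G k)"
  by (rule tame_on_cong_open[OF _ regular_jet_eq_glue[OF assms(1,3)] tame_glue_ivl[OF assms(2) jumps_ok_0 assms(3,1)]]) auto

lemma regular_jet_bound:
  assumes G: "data_le (\<lambda>_ _. 0) G M 0" and o: "{a<..<b} \<in> \<Omega>"
  shows "k \<le> r \<Longrightarrow> x \<in> {a<..<b} \<Longrightarrow> cmod (regular_jet a G k x) \<le> M / m"
    and "k < r \<Longrightarrow> x \<in> {a..b} \<Longrightarrow> cmod (regular_jet a G (Suc k) x) \<le> M / m"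
proof -
  note D = data_leD[OF G]
  show 1: "cmod (regular_jet a G k x) \<le> M / m" if k: "k \<le> r" and x: "x \<in> {a<..<b}" for k x
  proof -
    have xU: "x \<in> U" using x o by blast
    have "cmod (glue (\<lambda>_ _. 0) G k x) \<le> M / m + real k * 0"
      by (rule glue_bound[OF D(3,4) _ _ _ _ k xU]) (use D m in auto)
    thus ?thesis using regular_jet_eq_glue[OF o k x] by simp
  qed
  assume k: "k < r" and x: "x \<in> {a..b}"
  show "cmod (regular_jet a G (Suc k) x) \<le> M / m"
  proof (cases "a < x")
    case True
    have "cmod (integral {a..x} (regular_jet a G k)) \<le> M / m * (x - a)"
    proof (rule tame_on_integral_bound)
      show "tame_on {a<..<x} (regular_jet a G k)"
        by (rule tame_on_subset[OF regular_jet_tame[OF o D(3)]]) (use k x in auto)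
    qed (use 1 k x in auto)
    also have "\<dots> \<le> M / m * 1"
      using ivl'[OF o, of "(a + b) / 2"] True x D m by (intro mult_left_mono) auto
    finally show ?thesis by simp
  next
    case False
    thus ?thesis using x D m by (cases "x = a") auto
  qed
qed

lemma regular_jet_linear:
  assumes o: "{a<..<b} \<in> \<Omega>" and G: "tame_on U G" and H: "tame_on U H"
  shows "k \<le> r \<Longrightarrow> x \<in> {a..b} \<Longrightarrow>
    regular_jet a (\<lambda>x. G x + c * H x) k x = regular_jet a G k x + c * regular_jet a H k x"
proof (induction k arbitrary: x)
  case (Suc k)
  have i: "regular_jet a G k integrable_on {a..x}" "regular_jet a H k integrable_on {a..x}"
    by (rule tame_on_integrable[OF tame_on_subset[OF regular_jet_tame[OF o]]]; use G H Suc.prems in auto)+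
  have "integral {a..x} (regular_jet a (\<lambda>x. G x + c * H x) k) = integral {a..x} (\<lambda>x. regular_jet a G k x + c * regular_jet a H k x)"
    by (rule integral_cong) (use Suc in auto)
  thus ?case using i by (simp add: integral_add integrable_on_mult_right)
qed simp

lemma regular_jet_null:
  assumes Z: "countable Z" and z: "\<And>x. x \<in> U - Z \<Longrightarrow> G x = 0" and o: "{a<..<b} \<in> \<Omega>"
  shows "x \<in> {a..b} \<Longrightarrow> regular_jet a G (Suc k) x = 0"
proof (induction k arbitrary: x)
  case 0
  have "integral {a..x} G = integral {a..x} (\<lambda>_. 0)"
  proof (rule integral_spike)
    show "negligible (Z \<union> {a, b})" using Z by (intro negligible_if_countable) simp
    fix t assume "t \<in> {a..x} - (Z \<union> {a, b})"
    hence "t \<in> {a<..<b}" "t \<notin> Z" using 0 by auto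
    hence "t \<in> U - Z" using o by blast
    thus "0 = G t" using z by simp
  qed
  thus ?case by simp
next
  case (Suc k)
  have "integral {a..x} (regular_jet a G (Suc k)) = integral {a..x} (\<lambda>_. 0)"
    by (rule integral_cong) (use Suc in \<open>auto simp del: regular_jet_Suc\<close>)
  thus ?case by simp
qed

end

section \<open>The transfer operator on atoms\<close>

lemma transfer_operator_linear:
  "transfer_operator T \<Omega> \<phi> (\<lambda>x. f x + a * h x) = (\<lambda>x. transfer_operator T \<Omega> \<phi> f x + a * transfer_operator T \<Omega> \<phi> h x)"
proof
  fix y
  show "transfer_operator T \<Omega> \<phi> (\<lambda>x. f x + a * h x) y = transfer_operator T \<Omega> \<phi> f y + a * transfer_operator T \<Omega> \<phi> h y"
    unfolding transfer_operator_def sum_distrib_left sum.distrib[symmetric]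
    by (intro sum.cong refl) (auto simp: algebra_simps)
qed

lemma transfer_operator_cong:
  assumes "\<And>x. x \<in> \<Union>\<Omega> \<Longrightarrow> f x = h x" shows "transfer_operator T \<Omega> \<phi> f = transfer_operator T \<Omega> \<phi> h"
  unfolding transfer_operator_def
proof (intro ext sum.cong refl)
  fix y \<omega> assume o: "\<omega> \<in> \<Omega>"
  have "f (inv_into \<omega> T y) = h (inv_into \<omega> T y)" if "y \<in> T ` \<omega>"
    by (rule assms, rule UnionI[OF o inv_into_into[OF that]])
  thus "(if y \<in> T ` \<omega> then \<phi> (inv_into \<omega> T y) * f (inv_into \<omega> T y) else 0) =
     (if y \<in> T ` \<omega> then \<phi> (inv_into \<omega> T y) * h (inv_into \<omega> T y) else 0)" by simp
qed

lemma (in jump_space) jump_data_bound: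
  assumes "\<And>y. y \<in> {\<alpha>..\<beta>} \<Longrightarrow> cmod (E (Suc k) y) \<le> B" "0 \<le> B" "\<alpha> \<le> \<beta>"
  shows "cmod (jump_data \<alpha> \<beta> E q k) \<le> 2 * B"
proof -
  have 1: "cmod (if q = \<alpha> \<or> q \<in> left_ends \<and> \<alpha> < q \<and> q < \<beta> then E (Suc k) q else 0) \<le> B" using assms by auto
  have 2: "cmod (if q = \<beta> \<and> \<beta> \<in> U then E (Suc k) \<beta> else 0) \<le> B" using assms by auto
  show ?thesis unfolding jump_data_def using norm_triangle_ineq4 1 2 by (smt (verit))
qed

text \<open>The set of jump points is invariant under \<open>T\<close> as long as orbits avoid the boundary of
  the partition, and it contains the images of the end points of the partition. These are the
  points to which \<open>L\<close> moves jumps and at which it creates them.\<close>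

locale expanding_branches = jump_space \<Omega> P r g wt m
  for \<Omega> :: "real set set" and P :: "real set" and r :: nat and g :: "real \<Rightarrow> real" and wt :: "real \<Rightarrow> nat \<Rightarrow> real" and m :: real +
  fixes T :: "real \<Rightarrow> real" and \<phi> :: "real \<Rightarrow> complex" and \<tau> \<tau>' :: "real set \<Rightarrow> real \<Rightarrow> real"
    and \<kappa> \<kappa>d :: "real set \<Rightarrow> nat \<Rightarrow> nat \<Rightarrow> real \<Rightarrow> complex" and C gm :: real
  assumes br: "\<omega> \<in> \<Omega> \<Longrightarrow> branch (Inf \<omega>) (Sup \<omega>) (\<tau> \<omega>) (\<tau>' \<omega>) (\<kappa> \<omega>) (\<kappa>d \<omega>)"
    and T_eq: "\<omega> \<in> \<Omega> \<Longrightarrow> x \<in> \<omega> \<Longrightarrow> T x = \<tau> \<omega> x"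
    and \<phi>_eq: "\<omega> \<in> \<Omega> \<Longrightarrow> x \<in> \<omega> \<Longrightarrow> \<kappa> \<omega> 0 0 x = \<phi> x"
    and \<kappa>_bound: "\<omega> \<in> \<Omega> \<Longrightarrow> x \<in> {Inf \<omega>..Sup \<omega>} \<Longrightarrow> n \<le> r \<Longrightarrow> j \<le> r \<Longrightarrow> cmod (\<kappa> \<omega> n j x) \<le> C"
    and C: "0 \<le> C"
    and g_le: "x \<in> U \<Longrightarrow> g x \<le> gm"
    and r_pos: "0 < r"
    and left_P: "left_ends \<subseteq> P"
    and end_P: "\<omega> \<in> \<Omega> \<Longrightarrow> v = Inf \<omega> \<or> v = Sup \<omega> \<Longrightarrow> \<tau> \<omega> v \<in> U \<Longrightarrow> \<tau> \<omega> v \<in> P"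
    and P_T: "p \<in> P \<Longrightarrow> p \<in> U \<Longrightarrow> T p \<in> U \<Longrightarrow> T p \<in> P"
begin

abbreviation "L \<equiv> transfer_operator T \<Omega> \<phi>"

lemma omega: assumes "\<omega> \<in> \<Omega>"
  shows "\<omega> = {Inf \<omega><..<Sup \<omega>}" "0 \<le> Inf \<omega>" "Inf \<omega> < Sup \<omega>" "Sup \<omega> \<le> 1" "{Inf \<omega><..<Sup \<omega>} \<in> \<Omega>"
proof -
  obtain a b where ab: "0 \<le> a" "a < b" "b \<le> 1" "\<omega> = {a<..<b}" using ivl[OF assms] by blast
  have "Inf \<omega> = a" "Sup \<omega> = b" using ab by (auto simp: cInf_greaterThanLessThan cSup_greaterThanLessThan)
  with ab assms show "\<omega> = {Inf \<omega><..<Sup \<omega>}" "0 \<le> Inf \<omega>" "Inf \<omega> < Sup \<omega>" "Sup \<omega> \<le> 1" "{Inf \<omega><..<Sup \<omega>} \<in> \<Omega>" by simp_all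
qed

lemma omega_mem: assumes "\<omega> \<in> \<Omega>" shows "x \<in> \<omega> \<longleftrightarrow> Inf \<omega> < x \<and> x < Sup \<omega>"
proof -
  obtain a b where ab: "\<omega> = {a<..<b}" "a < b" using ivl[OF assms] by blast
  thus ?thesis by (simp add: cInf_greaterThanLessThan cSup_greaterThanLessThan)
qed

definition inv_branch :: "real set \<Rightarrow> real \<Rightarrow> real" where
  "inv_branch \<omega> = branch.\<psi> (Inf \<omega>) (Sup \<omega>) (\<tau> \<omega>)"

text \<open>The jet of \<open>L h\<close>, restricted to the image of \<open>\<omega>\<close>, for a function
  \<open>h\<close> with the jet \<open>D\<close> on \<open>\<omega>\<close>.\<close>

definition push :: "real set \<Rightarrow> (nat \<Rightarrow> real \<Rightarrow> complex) \<Rightarrow> nat \<Rightarrow> real \<Rightarrow> complex" where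
  "push \<omega> D k y = (\<Sum>j\<le>r. \<kappa> \<omega> (r - k) j (inv_branch \<omega> y) * D (r - j) (inv_branch \<omega> y))"

abbreviation lo :: "real set \<Rightarrow> real \<Rightarrow> real \<Rightarrow> real" where "lo \<omega> s e \<equiv> min (\<tau> \<omega> s) (\<tau> \<omega> e)"
abbreviation hi :: "real set \<Rightarrow> real \<Rightarrow> real \<Rightarrow> real" where "hi \<omega> s e \<equiv> max (\<tau> \<omega> s) (\<tau> \<omega> e)"

lemma push_eq: assumes "\<omega> \<in> \<Omega>" shows "push \<omega> D k y = branch.pushed (\<kappa> \<omega>) r D k (inv_branch \<omega> y)"
proof -
  interpret b: branch "Inf \<omega>" "Sup \<omega>" "\<tau> \<omega>" "\<tau>' \<omega>" "\<kappa> \<omega>" "\<kappa>d \<omega>" by (rule br[OF assms])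
  show ?thesis by (simp add: push_def b.pushed_def)
qed

lemma push_bound:
  assumes o: "\<omega> \<in> \<Omega>" and x: "inv_branch \<omega> y \<in> {Inf \<omega>..Sup \<omega>}" and B: "\<And>i. i \<le> r \<Longrightarrow> cmod (D i (inv_branch \<omega> y)) \<le> B"
  shows "cmod (push \<omega> D k y) \<le> (real r + 1) * (C * B)"
proof -
  have "cmod (push \<omega> D k y) \<le> (\<Sum>j\<le>r. C * B)"
    unfolding push_def
  proof (rule sum_norm_le)
    fix j assume "j \<in> {..r}"
    thus "cmod (\<kappa> \<omega> (r - k) j (inv_branch \<omega> y) * D (r - j) (inv_branch \<omega> y)) \<le> C * B"
      unfolding norm_mult by (intro mult_mono \<kappa>_bound[OF o x] B C) auto
  qed
  thus ?thesis by (simp add: algebra_simps)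
qed

lemma push_bound_Suc:
  assumes o: "\<omega> \<in> \<Omega>" and x: "inv_branch \<omega> y \<in> {Inf \<omega>..Sup \<omega>}"
    and B: "\<And>i. i < r \<Longrightarrow> cmod (D (Suc i) (inv_branch \<omega> y)) \<le> B" "0 \<le> B" and k: "k < r"
  shows "cmod (push \<omega> D (Suc k) y) \<le> (real r + 1) * (C * B)"
proof -
  interpret b: branch "Inf \<omega>" "Sup \<omega>" "\<tau> \<omega>" "\<tau>' \<omega>" "\<kappa> \<omega>" "\<kappa>d \<omega>" by (rule br[OF o])
  have "cmod (push \<omega> D (Suc k) y) \<le> (\<Sum>j\<le>r. C * B)"
    unfolding push_def
  proof (rule sum_norm_le)
    fix j assume j: "j \<in> {..r}"
    show "cmod (\<kappa> \<omega> (r - Suc k) j (inv_branch \<omega> y) * D (r - j) (inv_branch \<omega> y)) \<le> C * B"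
    proof (cases "j = r")
      case True
      hence "\<kappa> \<omega> (r - Suc k) j (inv_branch \<omega> y) = 0" using k x by (intro b.\<kappa>z) auto
      thus ?thesis using C B by simp
    next
      case False
      then obtain i where "r - j = Suc i" "i < r" using j by (cases "r - j") auto
      thus ?thesis unfolding norm_mult using j B(1)[of i] by (intro mult_mono \<kappa>_bound[OF o x] C) auto
    qed
  qed
  thus ?thesis by (simp add: algebra_simps)
qed

text \<open>A function carried by a subinterval of one element of the partition is seen by one branch only.\<close>

lemma L_piece:
  assumes o: "\<omega> \<in> \<Omega>" and se: "Inf \<omega> \<le> s" "s < e" "e \<le> Sup \<omega>"
    and f: "\<And>x. x \<in> U \<Longrightarrow> f x = (if s < x \<and> x < e then D r x else 0)"
  shows "L f y = (if lo \<omega> s e < y \<and> y < hi \<omega> s e then push \<omega> D r y else 0)"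
proof -
  interpret b: branch "Inf \<omega>" "Sup \<omega>" "\<tau> \<omega>" "\<tau>' \<omega>" "\<kappa> \<omega>" "\<kappa>d \<omega>" by (rule br[OF o])
  have injT: "inj_on T \<omega>"
  proof -
    have "inj_on (\<tau> \<omega>) \<omega>" by (rule inj_on_subset[OF b.inj]) (auto simp: omega_mem[OF o])
    thus ?thesis using T_eq[OF o] inj_on_cong by metis
  qed
  have sub: "x \<in> \<omega>" if "s < x" "x < e" for x using that se by (simp add: omega_mem[OF o])
  let ?t = "\<lambda>\<omega>'. if y \<in> T ` \<omega>' then \<phi> (inv_into \<omega>' T y) * f (inv_into \<omega>' T y) else 0"
  have other: "?t \<omega>' = 0" if "\<omega>' \<in> \<Omega> - {\<omega>}" for \<omega>'
  proof (cases "y \<in> T ` \<omega>'")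
    case True
    let ?x = "inv_into \<omega>' T y"
    have x: "?x \<in> \<omega>'" by (rule inv_into_into[OF True])
    hence xU: "?x \<in> U" using that by blast
    have "\<not> (s < ?x \<and> ?x < e)" using sub[of ?x] unique_ivl[of \<omega>' \<omega> ?x] o x that by blast
    thus ?thesis using f[OF xU] by auto
  qed simp
  have "L f y = sum ?t \<Omega>" by (simp add: transfer_operator_def)
  also have "\<dots> = ?t \<omega>"
    using sum.mono_neutral_right[OF fin, of "{\<omega>}" ?t] other o by auto
  also have "\<dots> = (if lo \<omega> s e < y \<and> y < hi \<omega> s e then push \<omega> D r y else 0)"
  proof (cases "lo \<omega> s e < y \<and> y < hi \<omega> s e")
    case True
    hence "y \<in> \<tau> \<omega> ` {s<..<e}" unfolding b.\<tau>_image_open[OF se] by auto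
    then obtain x where x: "x \<in> {s<..<e}" "y = \<tau> \<omega> x" by auto
    have x\<omega>: "x \<in> \<omega>" using x sub by auto
    have xcl: "x \<in> {Inf \<omega>..Sup \<omega>}" using x se by auto
    have y: "y = T x" using x T_eq[OF o x\<omega>] by simp
    have inv: "inv_into \<omega> T y = x" unfolding y by (rule inv_into_f_f[OF injT x\<omega>])
    have \<psi>: "inv_branch \<omega> y = x" unfolding inv_branch_def x(2) by (rule b.\<psi>_\<tau>[OF xcl])
    have xU: "x \<in> U" using x\<omega> o by blast
    have "push \<omega> D r y = (\<Sum>j\<le>r. if j = 0 then \<kappa> \<omega> 0 0 x * D r x else 0)"
      unfolding push_def \<psi> by (intro sum.cong) (auto simp: b.\<kappa>z[OF xcl])
    also have "\<dots> = \<phi> x * D r x" by (simp add: \<phi>_eq[OF o x\<omega>])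
    finally have "push \<omega> D r y = \<phi> x * D r x" .
    moreover have "y \<in> T ` \<omega>" using y x\<omega> by auto
    ultimately show ?thesis using True inv f[OF xU] x by simp
  next
    case False
    have "?t \<omega> = 0"
    proof (cases "y \<in> T ` \<omega>")
      case yT: True
      let ?x = "inv_into \<omega> T y"
      have x: "?x \<in> \<omega>" by (rule inv_into_into[OF yT])
      have Tx: "T ?x = y" by (rule f_inv_into_f[OF yT])
      have "\<not> (s < ?x \<and> ?x < e)"
      proof
        assume "s < ?x \<and> ?x < e"
        hence "?x \<in> {s<..<e}" by simp
        hence "\<tau> \<omega> ?x \<in> \<tau> \<omega> ` {s<..<e}" by (rule imageI)
        thus False using False Tx T_eq[OF o x] unfolding b.\<tau>_image_open[OF se] by auto
      qed
      moreover have "?x \<in> U" using x o by blast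
      ultimately show ?thesis using f[of ?x] by auto
    qed simp
    thus ?thesis unfolding if_not_P[OF False] .
  qed
  finally show ?thesis .
qed

lemma piece_jets:
  assumes o: "\<omega> \<in> \<Omega>" and se: "Inf \<omega> \<le> s" "s < e" "e \<le> Sup \<omega>"
    and cont: "\<And>k. k < r \<Longrightarrow> continuous_on {s..e} (D (Suc k))"
    and tame: "\<And>k. k \<le> r \<Longrightarrow> tame_on {s<..<e} (D k)"
    and Z: "countable Z"
    and der: "\<And>k x. k < r \<Longrightarrow> x \<in> {s<..<e} - Z \<Longrightarrow> (D (Suc k) has_vector_derivative D k x) (at x)"
    and Q: "finite Q" "Q \<subseteq> P" "P \<inter> ({lo \<omega> s e, hi \<omega> s e} \<union> left_ends) \<subseteq> Q"
    and endP: "\<tau> \<omega> s \<in> U \<Longrightarrow> \<tau> \<omega> s \<in> P" "\<tau> \<omega> e \<in> U \<Longrightarrow> \<tau> \<omega> e \<in> P"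
    and f: "\<And>x. x \<in> U \<Longrightarrow> f x = (if s < x \<and> x < e then D r x else 0)"
  shows "tame_on U (\<lambda>y. if lo \<omega> s e < y \<and> y < hi \<omega> s e then push \<omega> D 0 y else 0)"
    and "AE y in lebesgue_on {0..1}. L f y = regular (\<lambda>y. if lo \<omega> s e < y \<and> y < hi \<omega> s e then push \<omega> D 0 y else 0) y
       + (\<Sum>(q,k)\<in>Q \<times> {..<r}. jump_data (lo \<omega> s e) (hi \<omega> s e) (push \<omega> D) q k * atom q k y)"
proof -
  interpret b: branch "Inf \<omega>" "Sup \<omega>" "\<tau> \<omega>" "\<tau>' \<omega>" "\<kappa> \<omega>" "\<kappa>d \<omega>" by (rule br[OF o])
  have pe: "push \<omega> D k = (\<lambda>y. b.pushed r D k (b.\<psi> y))" for k by (auto simp: push_eq[OF o] inv_branch_def)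
  have ne: "lo \<omega> s e < hi \<omega> s e" by (rule b.\<tau>_ends_neq[OF se])
  have c: "continuous_on {lo \<omega> s e..hi \<omega> s e} (push \<omega> D (Suc k))" if k: "k < r" for k
    unfolding pe
  proof (rule continuous_on_compose2[OF _ b.\<psi>_cont[OF se]])
    show "continuous_on {s..e} (b.pushed r D (Suc k))" by (rule b.pushed_cont[OF _ se(1,3) k]) (rule cont)
    show "b.\<psi> ` {lo \<omega> s e..hi \<omega> s e} \<subseteq> {s..e}" using b.\<psi>_in(1)[OF se] by blast
  qed
  have t: "tame_on {lo \<omega> s e<..<hi \<omega> s e} (push \<omega> D k)" if "k \<le> r" for k
    unfolding pe
  proof (rule b.tame_compose[OF _ se])
    show "tame_on {s<..<e} (b.pushed r D k)" by (rule b.pushed_tame[OF _ se]) (rule tame)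
  qed
  have d: "(push \<omega> D (Suc k) has_vector_derivative push \<omega> D k y) (at y)"
    if k: "k < r" and y: "y \<in> {lo \<omega> s e<..<hi \<omega> s e} - \<tau> \<omega> ` Z" for k y
    unfolding pe
  proof (rule b.pushed_compose_deriv[OF _ se _ k])
    have y': "y \<in> {lo \<omega> s e<..<hi \<omega> s e}" using y by simp
    have "\<tau> \<omega> (b.\<psi> y) = y" using b.\<psi>_in(1)[OF se, of y] y' by auto
    hence "b.\<psi> y \<notin> Z" using y by force
    hence "b.\<psi> y \<in> {s<..<e} - Z" using b.\<psi>_in(2)[OF se y'] by simp
    thus "\<And>k. k < r \<Longrightarrow> (D (Suc k) has_vector_derivative D k (b.\<psi> y)) (at (b.\<psi> y))" by (rule der[rotated])
    show "y \<in> {lo \<omega> s e<..<hi \<omega> s e}" by (rule y')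
  qed
  have lP: "lo \<omega> s e \<in> U \<Longrightarrow> lo \<omega> s e \<in> P" "hi \<omega> s e \<in> U \<Longrightarrow> hi \<omega> s e \<in> P"
    using endP by (cases "\<tau> \<omega> s \<le> \<tau> \<omega> e"; simp add: min_def max_def del: Union_iff)+
  have Z': "countable (\<tau> \<omega> ` Z)" using Z by simp
  have LP: "L f y = (if lo \<omega> s e < y \<and> y < hi \<omega> s e then push \<omega> D r y else 0)" for y
    by (rule L_piece[OF o se]) (rule f)
  show "tame_on U (\<lambda>y. if lo \<omega> s e < y \<and> y < hi \<omega> s e then push \<omega> D 0 y else 0)"
    by (rule piece_decomposition(1)[where E = "push \<omega> D" and Q = Q and h = "L f" and gm = gm];
      (rule ne Z' left_P r_pos Q LP | erule c | erule t | erule (1) d | erule lP | erule g_le))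
  show "AE y in lebesgue_on {0..1}. L f y = regular (\<lambda>y. if lo \<omega> s e < y \<and> y < hi \<omega> s e then push \<omega> D 0 y else 0) y
       + (\<Sum>(q,k)\<in>Q \<times> {..<r}. jump_data (lo \<omega> s e) (hi \<omega> s e) (push \<omega> D) q k * atom q k y)"
    by (rule piece_decomposition(2)[where E = "push \<omega> D" and Q = Q and h = "L f" and gm = gm];
      (rule ne Z' left_P r_pos Q LP | erule c | erule t | erule (1) d | erule lP | erule g_le))
qed

text \<open>The jump points at which \<open>L\<close> creates jumps. Atoms at these finitely many points span
  the range of a finite-rank operator.\<close>

definition Ends :: "real set" where
  "Ends = P \<inter> (left_ends \<union> (\<Union>\<omega>\<in>\<Omega>. {\<tau> \<omega> (Inf \<omega>), \<tau> \<omega> (Sup \<omega>)}))"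

lemma finite_Ends: "finite Ends" unfolding Ends_def using fin finite_left_ends by auto

lemma Ends_P: "Ends \<subseteq> P" by (auto simp: Ends_def)

lemma p_branch:
  assumes "p \<in> P" obtains \<omega> where "\<omega> \<in> \<Omega>" "Inf \<omega> \<le> p" "p < Sup \<omega>" "p = Inf \<omega> \<or> p \<in> \<omega>"
proof -
  obtain a b where ab: "{a<..<b} \<in> \<Omega>" "a \<le> p" "p < b" using P[OF assms] by blast
  have "Inf {a<..<b} = a" "Sup {a<..<b} = b" using ab by (auto simp: cInf_greaterThanLessThan cSup_greaterThanLessThan)
  note i = this
  show thesis by (rule that[OF ab(1)]) (use ab in \<open>auto simp: i\<close>)
qed

text \<open>The image of an atom at \<open>p\<close> is carried by the image of the interval from
  \<open>p\<close> to the right end point of its element \<open>\<omega>\<close>. It has jumps at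
  the image of \<open>p\<close>, at the image of the right end point and at left end points of the
  partition. The jump at the image of \<open>p\<close> consists of a single coefficient of the
  chain rule, because only one entry of the jet of an atom is nonzero at \<open>p\<close>.\<close>

lemma L_atom:
  assumes p: "p \<in> P" and o: "\<omega> \<in> \<Omega>" "Inf \<omega> \<le> p" "p < Sup \<omega>" "p = Inf \<omega> \<or> p \<in> \<omega>" and k0: "k0 < r"
    and Q: "finite Q" "Q \<subseteq> P" "P \<inter> ({\<tau> \<omega> p, \<tau> \<omega> (Sup \<omega>)} \<union> left_ends) \<subseteq> Q"
  defines "\<alpha> \<equiv> lo \<omega> p (Sup \<omega>)" and "\<beta> \<equiv> hi \<omega> p (Sup \<omega>)"
  defines "G \<equiv> (\<lambda>y. if \<alpha> < y \<and> y < \<beta> then push \<omega> (atom_jet p k0) 0 y else 0)"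
  shows "data_le (\<lambda>_ _. 0) G (\<bar>gm\<bar> * ((real r + 1) * C)) 0"
    and "AE y in lebesgue_on {0..1}. L (atom p k0) y = regular G y
       + (\<Sum>(q,k)\<in>Q \<times> {..<r}. jump_data \<alpha> \<beta> (push \<omega> (atom_jet p k0)) q k * atom q k y)"
    and "\<And>q k. k < r \<Longrightarrow> cmod (jump_data \<alpha> \<beta> (push \<omega> (atom_jet p k0)) q k) \<le> 2 * ((real r + 1) * C)"
    and "\<And>k. k < r \<Longrightarrow> \<tau> \<omega> p \<notin> left_ends \<Longrightarrow>
        cmod (jump_data \<alpha> \<beta> (push \<omega> (atom_jet p k0)) (\<tau> \<omega> p) k) \<le> cmod (\<kappa> \<omega> (r - Suc k) (r - Suc k0) p)"
proof -
  interpret b: branch "Inf \<omega>" "Sup \<omega>" "\<tau> \<omega>" "\<tau>' \<omega>" "\<kappa> \<omega>" "\<kappa>d \<omega>" by (rule br[OF o(1)])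
  note w = omega[OF o(1)]
  let ?D = "atom_jet p k0"
  have se: "Inf \<omega> \<le> p" "p < Sup \<omega>" "Sup \<omega> \<le> Sup \<omega>" using o by auto
  have ne: "\<alpha> < \<beta>" unfolding \<alpha>_def \<beta>_def by (rule b.\<tau>_ends_neq[OF se])
  have f: "atom p k0 x = (if p < x \<and> x < Sup \<omega> then ?D r x else 0)" if x: "x \<in> U" for x
  proof -
    have "x \<noteq> Sup \<omega>" using right_end_not_U[OF w(5,3)] x by auto
    thus ?thesis using atom_eq[OF p w(5) o(2,3) left_P k0 x] by auto
  qed
  have eP: "\<tau> \<omega> p \<in> U \<Longrightarrow> \<tau> \<omega> p \<in> P"
  proof -
    assume U: "\<tau> \<omega> p \<in> U"
    show "\<tau> \<omega> p \<in> P"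
    proof (cases "p = Inf \<omega>")
      case True thus ?thesis using end_P[OF o(1), of p] U by blast
    next
      case False
      hence "p \<in> \<omega>" using o by simp
      hence "p \<in> U" "T p = \<tau> \<omega> p" using o(1) T_eq by blast+
      thus ?thesis using P_T[OF p] U by simp
    qed
  qed
  have eP': "\<tau> \<omega> (Sup \<omega>) \<in> U \<Longrightarrow> \<tau> \<omega> (Sup \<omega>) \<in> P" using end_P[OF o(1), of "Sup \<omega>"] by blast
  have len: "Sup \<omega> - p \<le> 1" using w o by simp
  have Q3: "P \<inter> ({lo \<omega> p (Sup \<omega>), hi \<omega> p (Sup \<omega>)} \<union> left_ends) \<subseteq> Q" using Q(3) by (auto simp: min_def max_def)
  have jets: "\<And>k. k < r \<Longrightarrow> continuous_on {p..Sup \<omega>} (?D (Suc k))" "\<And>k. k \<le> r \<Longrightarrow> tame_on {p<..<Sup \<omega>} (?D k)"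
    "countable ({} :: real set)" "\<And>k x. k < r \<Longrightarrow> x \<in> {p<..<Sup \<omega>} - {} \<Longrightarrow> (?D (Suc k) has_vector_derivative ?D k x) (at x)"
    using atom_jet_cont atom_jet_tame[OF len] atom_jet_deriv by auto
  show "AE y in lebesgue_on {0..1}. L (atom p k0) y = regular G y
       + (\<Sum>(q,k)\<in>Q \<times> {..<r}. jump_data \<alpha> \<beta> (push \<omega> ?D) q k * atom q k y)"
    unfolding G_def \<alpha>_def \<beta>_def by (rule piece_jets(2)[OF o(1) se jets Q(1,2) Q3 eP eP' f])
  have tG: "tame_on U G"
    unfolding G_def \<alpha>_def \<beta>_def by (rule piece_jets(1)[where f = "atom p k0", OF o(1) se jets Q(1,2) Q3 eP eP' f])
  have inv: "inv_branch \<omega> y \<in> {p..Sup \<omega>}" if "y \<in> {\<alpha>..\<beta>}" for y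
    using b.\<psi>_in(1)[OF se, of y] that by (simp add: inv_branch_def \<alpha>_def \<beta>_def)
  have pb: "cmod (push \<omega> ?D k y) \<le> (real r + 1) * C" if y: "y \<in> {\<alpha>..\<beta>}" for k y
  proof -
    have "inv_branch \<omega> y \<in> {p..Sup \<omega>}" by (rule inv[OF y])
    hence "cmod (push \<omega> ?D k y) \<le> (real r + 1) * (C * 1)"
      by (intro push_bound[OF o(1)] atom_jet_bound) (use o len in auto)
    thus ?thesis by simp
  qed
  have rC: "0 \<le> (real r + 1) * C" using C by simp
  show "data_le (\<lambda>_ _. 0) G (\<bar>gm\<bar> * ((real r + 1) * C)) 0"
  proof (rule data_le_regular[OF tG])
    fix x assume x: "x \<in> U"
    have "cmod (G x) \<le> (real r + 1) * C" using pb[of x 0] rC by (auto simp: G_def)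
    thus "g x * cmod (G x) \<le> \<bar>gm\<bar> * ((real r + 1) * C)" using g_le[OF x] g_pos[OF x] by (intro mult_mono) auto
  qed (use rC in auto)
  show "cmod (jump_data \<alpha> \<beta> (push \<omega> ?D) q k) \<le> 2 * ((real r + 1) * C)" if "k < r" for q k
    by (rule jump_data_bound) (use pb rC ne in auto)
  show "cmod (jump_data \<alpha> \<beta> (push \<omega> ?D) (\<tau> \<omega> p) k) \<le> cmod (\<kappa> \<omega> (r - Suc k) (r - Suc k0) p)"
    if k: "k < r" and nl: "\<tau> \<omega> p \<notin> left_ends" for k
  proof -
    have "inv_branch \<omega> (\<tau> \<omega> p) = p" unfolding inv_branch_def by (rule b.\<psi>_\<tau>) (use o in auto)
    hence "push \<omega> ?D (Suc k) (\<tau> \<omega> p) = (\<Sum>j\<le>r. if j = r - Suc k0 then \<kappa> \<omega> (r - Suc k) (r - Suc k0) p else 0)"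
      unfolding push_def using k0 by (intro sum.cong) (auto simp: atom_jet_start)
    hence "push \<omega> ?D (Suc k) (\<tau> \<omega> p) = \<kappa> \<omega> (r - Suc k) (r - Suc k0) p" by simp
    moreover have "jump_data \<alpha> \<beta> (push \<omega> ?D) (\<tau> \<omega> p) k =
       (if \<tau> \<omega> p = \<alpha> then push \<omega> ?D (Suc k) (\<tau> \<omega> p) else 0) - (if \<tau> \<omega> p = \<beta> \<and> \<beta> \<in> U then push \<omega> ?D (Suc k) (\<tau> \<omega> p) else 0)"
      unfolding jump_data_def using nl by auto
    ultimately show ?thesis using ne by auto
  qed
qed

lemma atom_space: "q \<in> P \<Longrightarrow> k < r \<Longrightarrow> atom q k \<in> space_of" using rep_atom rep_in_space by blast

lemma rep_atom_sum:
  assumes "finite Q" "Q \<subseteq> P \<times> {..<r}"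
  shows "rep (\<lambda>x. \<Sum>(q,k)\<in>Q. c q k * atom q k x) (\<Sum>(q,k)\<in>Q. cmod (c q k) * wt q k)"
proof -
  have "rep (\<lambda>x. \<Sum>i\<in>Q. c (fst i) (snd i) * atom (fst i) (snd i) x) (\<Sum>i\<in>Q. cmod (c (fst i) (snd i)) * wt (fst i) (snd i))"
    by (rule rep_sum[OF assms(1)]) (rule rep_atom; use assms(2) in auto)
  thus ?thesis by (simp add: case_prod_beta)
qed

lemma L_atom_space:
  assumes p: "p \<in> P" and k0: "k0 < r" shows "L (atom p k0) \<in> space_of"
proof -
  obtain \<omega> where o: "\<omega> \<in> \<Omega>" "Inf \<omega> \<le> p" "p < Sup \<omega>" "p = Inf \<omega> \<or> p \<in> \<omega>" using p_branch[OF p] .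
  define Q where "Q = P \<inter> ({\<tau> \<omega> p, \<tau> \<omega> (Sup \<omega>)} \<union> left_ends)"
  have Q: "finite Q" "Q \<subseteq> P" "P \<inter> ({\<tau> \<omega> p, \<tau> \<omega> (Sup \<omega>)} \<union> left_ends) \<subseteq> Q" using finite_left_ends by (auto simp: Q_def)
  note LA = L_atom[OF p o k0 Q]
  have QQ: "finite (Q \<times> {..<r})" "Q \<times> {..<r} \<subseteq> P \<times> {..<r}" using Q by auto
  show ?thesis
    by (rule space_of_cong[OF rep_in_space[OF rep_add[OF rep_regular[OF LA(1)] rep_atom_sum[OF QQ]]]])
      (use LA(2) in \<open>eventually_elim; simp\<close>)
qed

text \<open>The jumps at the points of \<open>Ends\<close> are absorbed by the span of \<open>E\<close>. What
  remains is the jump at \<open>T p\<close>, which is estimated by \<open>q1\<close>, and the top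
  derivative, which is estimated by \<open>q2\<close>.\<close>

lemma L_atom_contraction:
  assumes p: "p \<in> P" "p \<in> U" and k0: "k0 < r"
    and main: "\<And>\<omega>. \<omega> \<in> \<Omega> \<Longrightarrow> p \<in> \<omega> \<Longrightarrow> T p \<in> U \<Longrightarrow> (\<Sum>k<r. cmod (\<kappa> \<omega> (r - Suc k) (r - Suc k0) p) * wt (T p) k) \<le> q1 * wt p k0"
    and cross: "\<bar>gm\<bar> * ((real r + 1) * C) \<le> q2 * wt p k0" and q1: "0 \<le> q1"
    and E: "finite E" "\<And>q k. q \<in> Ends \<Longrightarrow> k < r \<Longrightarrow> atom q k \<in> E"
  shows "\<exists>c. (\<forall>e\<in>E. cmod (c e) \<le> real (card (Ends \<times> {..<r})) * (2 * ((real r + 1) * C))) \<and>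
    rep (\<lambda>x. L (atom p k0) x - (\<Sum>e\<in>E. c e * e x)) ((q1 + q2) * wt p k0)"
proof -
  obtain \<omega> where o: "\<omega> \<in> \<Omega>" "p \<in> \<omega>" using p by blast
  note w = omega[OF o(1)]
  have o': "Inf \<omega> \<le> p" "p < Sup \<omega>" "p = Inf \<omega> \<or> p \<in> \<omega>" using o(2) unfolding omega_mem[OF o(1)] by auto
  define Q1 where "Q1 = (P \<inter> {\<tau> \<omega> p}) - Ends"
  define Q where "Q = Q1 \<union> Ends"
  have Q: "finite Q" "Q \<subseteq> P" "P \<inter> ({\<tau> \<omega> p, \<tau> \<omega> (Sup \<omega>)} \<union> left_ends) \<subseteq> Q"
    using finite_Ends Ends_P o by (auto simp: Q_def Q1_def Ends_def)
  define jd where "jd = jump_data (lo \<omega> p (Sup \<omega>)) (hi \<omega> p (Sup \<omega>)) (push \<omega> (atom_jet p k0))"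
  define G where "G = (\<lambda>y. if lo \<omega> p (Sup \<omega>) < y \<and> y < hi \<omega> p (Sup \<omega>) then push \<omega> (atom_jet p k0) 0 y else 0)"
  note LA = L_atom[OF p(1) o(1) o' k0 Q, folded jd_def G_def]
  define c where "c e = (\<Sum>i\<in>{i\<in>Ends \<times> {..<r}. atom (fst i) (snd i) = e}. jd (fst i) (snd i))" for e
  have cE: "(\<Sum>i\<in>Ends \<times> {..<r}. jd (fst i) (snd i) * atom (fst i) (snd i) x) = (\<Sum>e\<in>E. c e * e x)" for x
    unfolding c_def
  proof (rule sum_collect)
    show "(\<lambda>i. atom (fst i) (snd i)) ` (Ends \<times> {..<r}) \<subseteq> E" using E(2) by auto
  qed (use finite_Ends E in auto)
  have rC: "0 \<le> 2 * ((real r + 1) * C)" using C by simp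
  have cb: "cmod (c e) \<le> real (card (Ends \<times> {..<r})) * (2 * ((real r + 1) * C))" for e
    unfolding c_def by (rule norm_sum_collect) (use finite_Ends LA(3) rC in auto)
  have Q1sum: "(\<Sum>(q,k)\<in>Q1 \<times> {..<r}. cmod (jd q k) * wt q k) \<le> q1 * wt p k0"
  proof (cases "Q1 = {}")
    case True thus ?thesis using q1 wt_pos[OF p(1) k0] by simp
  next
    case False
    hence Q1: "Q1 = {\<tau> \<omega> p}" "\<tau> \<omega> p \<in> P" "\<tau> \<omega> p \<notin> Ends" by (auto simp: Q1_def)
    hence nl: "\<tau> \<omega> p \<notin> left_ends" by (auto simp: Ends_def)
    have Tp: "T p = \<tau> \<omega> p" by (rule T_eq[OF o])
    have "T p \<in> U" using P_cases[OF Q1(2)] nl Tp by simp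
    have "(\<Sum>(q,k)\<in>Q1 \<times> {..<r}. cmod (jd q k) * wt q k) = (\<Sum>k<r. cmod (jd (\<tau> \<omega> p) k) * wt (T p) k)"
      unfolding Q1(1) Tp using sum.cartesian_product[of "\<lambda>q k. cmod (jd q k) * wt q k" "{..<r}" "{\<tau> \<omega> p}"] by simp
    also have "\<dots> \<le> (\<Sum>k<r. cmod (\<kappa> \<omega> (r - Suc k) (r - Suc k0) p) * wt (T p) k)"
      using LA(4)[OF _ nl] wt_pos[OF Q1(2)] Tp by (intro sum_mono mult_right_mono) (auto simp: less_imp_le)
    also have "\<dots> \<le> q1 * wt p k0" by (rule main[OF o \<open>T p \<in> U\<close>])
    finally show ?thesis .
  qed
  have "rep (\<lambda>x. regular G x + (\<Sum>(q,k)\<in>Q1 \<times> {..<r}. jd q k * atom q k x))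
      (\<bar>gm\<bar> * ((real r + 1) * C) + (\<Sum>(q,k)\<in>Q1 \<times> {..<r}. cmod (jd q k) * wt q k))"
    by (intro rep_add rep_regular[OF LA(1)] rep_atom_sum) (auto simp: Q1_def)
  hence "rep (\<lambda>x. regular G x + (\<Sum>(q,k)\<in>Q1 \<times> {..<r}. jd q k * atom q k x)) ((q1 + q2) * wt p k0)"
    by (rule rep_mono) (use Q1sum cross in \<open>simp add: algebra_simps\<close>)
  moreover have "AE x in lebesgue_on {0..1}. regular G x + (\<Sum>(q,k)\<in>Q1 \<times> {..<r}. jd q k * atom q k x) =
      L (atom p k0) x - (\<Sum>e\<in>E. c e * e x)"
    using LA(2)
  proof eventually_elim
    case (elim x)
    have "(\<Sum>(q,k)\<in>Q \<times> {..<r}. jd q k * atom q k x) = (\<Sum>(q,k)\<in>Q1 \<times> {..<r}. jd q k * atom q k x) + (\<Sum>(q,k)\<in>Ends \<times> {..<r}. jd q k * atom q k x)"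
      unfolding Q_def Sigma_Un_distrib1 by (rule sum.union_disjoint) (use finite_Ends in \<open>auto simp: Q1_def\<close>)
    thus ?case using elim cE[of x] by (simp add: case_prod_beta)
  qed
  ultimately have "rep (\<lambda>x. L (atom p k0) x - (\<Sum>e\<in>E. c e * e x)) ((q1 + q2) * wt p k0)" by (rule rep_cong)
  thus ?thesis using cb by blast
qed

text \<open>The branches are differentiable, so they map null sets to null sets.\<close>

lemma L_Linf:
  assumes ae: "AE x in lebesgue_on {0..1}. cmod (f x) \<le> c"
  shows "AE x in lebesgue_on {0..1}. cmod (L f x) \<le> (real (card \<Omega>) * C) * c"
proof (cases "0 \<le> c")
  case False
  show ?thesis using ae
  proof eventually_elim
    case (elim x) thus ?case using False norm_ge_zero[of "f x"] by linarith
  qed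
next
  case c: True
  define S where "S = {x\<in>{0..1}. \<not> cmod (f x) \<le> c}"
  have S: "negligible S" using ae unfolding AE_unit_interval_iff S_def .
  have nT: "negligible (\<Union>\<omega>\<in>\<Omega>. T ` (S \<inter> \<omega>))"
  proof (intro negligible_Union finite_imageI fin, clarify)
    fix \<omega> assume o: "\<omega> \<in> \<Omega>"
    interpret b: branch "Inf \<omega>" "Sup \<omega>" "\<tau> \<omega>" "\<tau>' \<omega>" "\<kappa> \<omega>" "\<kappa>d \<omega>" by (rule br[OF o])
    have "negligible (\<tau> \<omega> ` (S \<inter> \<omega>))"
    proof (rule negligible_differentiable_image_negligible[OF order_refl])
      show "negligible (S \<inter> \<omega>)" by (rule negligible_subset[OF S]) auto
      show "\<tau> \<omega> differentiable_on S \<inter> \<omega>"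
        unfolding differentiable_on_def
      proof
        fix x assume "x \<in> S \<inter> \<omega>"
        hence "x \<in> {Inf \<omega><..<Sup \<omega>}" using omega(1)[OF o] by blast
        hence "(\<tau> \<omega> has_derivative (*) (\<tau>' \<omega> x)) (at x)"
          using b.der_real[of x] by (simp add: has_field_derivative_def)
        hence "\<tau> \<omega> differentiable at x" by (rule differentiableI)
        thus "\<tau> \<omega> differentiable at x within S \<inter> \<omega>" by (rule differentiable_at_withinI)
      qed
    qed
    moreover have "T ` (S \<inter> \<omega>) = \<tau> \<omega> ` (S \<inter> \<omega>)" by (rule image_cong) (use T_eq[OF o] in auto)
    ultimately show "negligible (T ` (S \<inter> \<omega>))" by simp
  qed
  have "cmod (L f y) \<le> (real (card \<Omega>) * C) * c" if y: "y \<notin> (\<Union>\<omega>\<in>\<Omega>. T ` (S \<inter> \<omega>))" for y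
  proof -
    have "cmod (L f y) \<le> (\<Sum>\<omega>\<in>\<Omega>. C * c)"
      unfolding transfer_operator_def
    proof (rule sum_norm_le)
      fix \<omega> assume o: "\<omega> \<in> \<Omega>"
      show "cmod (if y \<in> T ` \<omega> then \<phi> (inv_into \<omega> T y) * f (inv_into \<omega> T y) else 0) \<le> C * c"
      proof (cases "y \<in> T ` \<omega>")
        case True
        let ?x = "inv_into \<omega> T y"
        have x: "?x \<in> \<omega>" "T ?x = y" using inv_into_into[OF True] f_inv_into_f[OF True] by auto
        have "?x \<notin> S"
        proof
          assume "?x \<in> S"
          hence "T ?x \<in> T ` (S \<inter> \<omega>)" using x(1) by (intro imageI) simp
        hence "T ?x \<in> (\<Union>\<omega>\<in>\<Omega>. T ` (S \<inter> \<omega>))" using o by (rule UN_I[rotated])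
          thus False using y x(2) by simp
        qed
        moreover have "?x \<in> U" using x o by blast
        hence "?x \<in> {0..1}" using U_sub by blast
        ultimately have "cmod (f ?x) \<le> c" by (simp add: S_def)
        moreover have "cmod (\<phi> ?x) \<le> C"
        proof -
          have "?x \<in> {Inf \<omega><..<Sup \<omega>}" using x(1) omega(1)[OF o] by blast
          hence "cmod (\<kappa> \<omega> 0 0 ?x) \<le> C" by (intro \<kappa>_bound[OF o]) auto
          thus ?thesis using \<phi>_eq[OF o x(1)] by simp
        qed
        ultimately show ?thesis using True C by (simp add: norm_mult mult_mono)
      next
        case False thus ?thesis using C c by (simp only: if_False norm_zero) simp
      qed
    qed
    thus ?thesis by simp
  qed
  hence "{y\<in>{0..1}. \<not> cmod (L f y) \<le> (real (card \<Omega>) * C) * c} \<subseteq> (\<Union>\<omega>\<in>\<Omega>. T ` (S \<inter> \<omega>))" by blast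
  thus ?thesis unfolding AE_unit_interval_iff using negligible_subset[OF nT] by blast
qed

end

section \<open>The transfer operator on regular functions\<close>

lemma sum_Times: "(\<Sum>i\<in>A \<times> B. F i) = (\<Sum>a\<in>A. \<Sum>b\<in>B. F (a, b))"
  by (simp add: sum.cartesian_product)

context expanding_branches begin

text \<open>The interval \<open>\<omega>\<close> is divided into cells of length at most \<open>1 / K\<close>,
  with a point \<open>sample \<omega> K l\<close> in the cell with the number \<open>l\<close>.
  For an empty cell the point is arbitrary; the corresponding \<open>cell_function\<close> is
  zero. Replacing the lower derivatives in the top derivative of the image by their values at the
  sample points gives an operator of finite rank, whose range is spanned by the regular functions
  of the cell functions.\<close>

definition sample :: "real set \<Rightarrow> nat \<Rightarrow> nat \<Rightarrow> real" where
  "sample \<omega> K l = (SOME x. x \<in> \<omega> \<and> \<lfloor>real K * x\<rfloor> = int l)"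

definition cell_function :: "real set \<Rightarrow> nat \<Rightarrow> nat \<Rightarrow> nat \<Rightarrow> real \<Rightarrow> complex" where
  "cell_function \<omega> K j l y = (if lo \<omega> (Inf \<omega>) (Sup \<omega>) < y \<and> y < hi \<omega> (Inf \<omega>) (Sup \<omega>)
      then \<kappa> \<omega> r j (inv_branch \<omega> y) * (if \<lfloor>real K * inv_branch \<omega> y\<rfloor> = int l then 1 else 0) else 0)"

lemma sample_near:
  assumes "\<omega> \<in> \<Omega>" "x \<in> \<omega>" "0 < K" "\<lfloor>real K * x\<rfloor> = int l"
  shows "sample \<omega> K l \<in> \<omega>" "\<bar>x - sample \<omega> K l\<bar> \<le> 1 / real K"
proof -
  have s: "sample \<omega> K l \<in> \<omega> \<and> \<lfloor>real K * sample \<omega> K l\<rfloor> = int l"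
    unfolding sample_def by (rule someI[of _ x]) (use assms(2,4) in simp)
  thus "sample \<omega> K l \<in> \<omega>" by simp
  have "\<bar>real K * x - real K * sample \<omega> K l\<bar> \<le> 1"
    using s assms(4) floor_correct[of "real K * x"] floor_correct[of "real K * sample \<omega> K l"]
    by (simp add: abs_le_iff)
  moreover have "real K * x - real K * sample \<omega> K l = real K * (x - sample \<omega> K l)" by (simp add: right_diff_distrib)
  ultimately have "real K * \<bar>x - sample \<omega> K l\<bar> \<le> 1" by (simp add: abs_mult)
  thus "\<bar>x - sample \<omega> K l\<bar> \<le> 1 / real K" using assms(3) by (simp add: field_simps)
qed

lemma cell_index:
  assumes "\<omega> \<in> \<Omega>" "x \<in> \<omega>"
  shows "(\<Sum>l\<le>K. c l * (if \<lfloor>real K * x\<rfloor> = int l then 1 else 0)) = (c (nat \<lfloor>real K * x\<rfloor>) :: complex)"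
    and "\<lfloor>real K * x\<rfloor> = int (nat \<lfloor>real K * x\<rfloor>)"
proof -
  have x: "0 \<le> x" "x \<le> 1" using assms omega(2,4)[OF assms(1)] unfolding omega_mem[OF assms(1)] by auto
  hence "0 \<le> real K * x" "real K * x \<le> real K" using mult_left_le[of x "real K"] by auto
  hence fl: "0 \<le> \<lfloor>real K * x\<rfloor>" "\<lfloor>real K * x\<rfloor> \<le> int K" by (auto simp: floor_le_iff)
  thus "\<lfloor>real K * x\<rfloor> = int (nat \<lfloor>real K * x\<rfloor>)" by simp
  have "(\<Sum>l\<le>K. c l * (if \<lfloor>real K * x\<rfloor> = int l then 1 else 0)) = (\<Sum>l\<in>{..K}. if l = nat \<lfloor>real K * x\<rfloor> then c l else 0)"
    using fl by (intro sum.cong) auto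
  also have "\<dots> = c (nat \<lfloor>real K * x\<rfloor>)" using fl by (simp add: sum.delta)
  finally show "(\<Sum>l\<le>K. c l * (if \<lfloor>real K * x\<rfloor> = int l then 1 else 0)) = c (nat \<lfloor>real K * x\<rfloor>)" .
qed

lemma tame_cell: "tame_on {s<..<e} (\<lambda>x. if \<lfloor>real K * x\<rfloor> = int l then 1 else 0)"
proof (rule tame_onI[of _ _ 1 "{real l / real K, (real l + 1) / real K}"])
  fix x assume "x \<notin> {real l / real K, (real l + 1) / real K}"
  hence ne: "K = 0 \<or> (real K * x \<noteq> real l \<and> real K * x \<noteq> real l + 1)" by (cases "K = 0") (auto simp: field_simps)
  show "isCont (\<lambda>x. if \<lfloor>real K * x\<rfloor> = int l then 1 else 0 :: complex) x"
  proof (cases "K = 0")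
    case True thus ?thesis by simp
  next
    case False
    have op: "open {t. real l < real K * t \<and> real K * t < real l + 1}" "open {t. real K * t < real l \<or> real l + 1 < real K * t}"
      by (intro open_Collect_conj open_Collect_disj open_Collect_less continuous_intros)+
    consider "x \<in> {t. real l < real K * t \<and> real K * t < real l + 1}" | "x \<in> {t. real K * t < real l \<or> real l + 1 < real K * t}"
      using ne False by fastforce
    thus ?thesis
    proof cases
      case 1
      have "\<forall>\<^sub>F t in nhds x. t \<in> {t. real l < real K * t \<and> real K * t < real l + 1}" by (rule eventually_nhds_in_open[OF op(1) 1])
      hence "\<forall>\<^sub>F t in nhds x. (if \<lfloor>real K * t\<rfloor> = int l then 1 else 0 :: complex) = 1"
        by eventually_elim (auto simp: floor_eq_iff)
      thus ?thesis using isCont_cong[of _ "\<lambda>_. 1" x] by simp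
    next
      case 2
      have "\<forall>\<^sub>F t in nhds x. t \<in> {t. real K * t < real l \<or> real l + 1 < real K * t}" by (rule eventually_nhds_in_open[OF op(2) 2])
      hence "\<forall>\<^sub>F t in nhds x. (if \<lfloor>real K * t\<rfloor> = int l then 1 else 0 :: complex) = 0"
        by eventually_elim (auto simp: floor_eq_iff)
      thus ?thesis using isCont_cong[of _ "\<lambda>_. 0" x] by simp
    qed
  qed
qed auto

lemma tame_cell_function:
  assumes o: "\<omega> \<in> \<Omega>" shows "tame_on U (cell_function \<omega> K j l)"
proof -
  interpret b: branch "Inf \<omega>" "Sup \<omega>" "\<tau> \<omega>" "\<tau>' \<omega>" "\<kappa> \<omega>" "\<kappa>d \<omega>" by (rule br[OF o])
  have se: "Inf \<omega> \<le> Inf \<omega>" "Inf \<omega> < Sup \<omega>" "Sup \<omega> \<le> Sup \<omega>" using omega[OF o] by auto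
  let ?f = "\<lambda>x. \<kappa> \<omega> r j x * (if \<lfloor>real K * x\<rfloor> = int l then 1 else 0)"
  have "tame_on {Inf \<omega><..<Sup \<omega>} ?f" by (intro tame_on_mult b.tame_\<kappa> tame_cell) auto
  from b.tame_compose[OF this se]
  have t: "tame_on {lo \<omega> (Inf \<omega>) (Sup \<omega>)<..<hi \<omega> (Inf \<omega>) (Sup \<omega>)} (\<lambda>y. ?f (inv_branch \<omega> y))" by (simp add: inv_branch_def)
  have "tame_on {lo \<omega> (Inf \<omega>) (Sup \<omega>)<..<hi \<omega> (Inf \<omega>) (Sup \<omega>)} (cell_function \<omega> K j l)"
    by (rule tame_on_cong_open[OF _ _ t]) (auto simp: cell_function_def)
  from tame_on_cutoff[OF this, of U] show ?thesis
    by (rule back_subst[of "tame_on U"]) (auto simp: cell_function_def fun_eq_iff)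
qed

lemma data_le_exists: assumes "tame_on U G" shows "\<exists>M. data_le (\<lambda>_ _. 0) G M 0"
proof -
  obtain M where M: "M \<ge> 0" "\<And>x. x \<in> U \<Longrightarrow> cmod (G x) \<le> M" using tame_on_bounded[OF assms] by blast
  have "data_le (\<lambda>_ _. 0) G (\<bar>gm\<bar> * M) 0"
  proof (rule data_le_regular[OF assms])
    fix x assume x: "x \<in> U"
    show "g x * cmod (G x) \<le> \<bar>gm\<bar> * M" using g_le[OF x] g_pos[OF x] M by (intro mult_mono M x) auto
  qed (use M in auto)
  thus ?thesis by blast
qed

lemma regular_cell_space: "\<omega> \<in> \<Omega> \<Longrightarrow> regular (cell_function \<omega> K j l) \<in> space_of"
  using data_le_exists[OF tame_cell_function] rep_regular rep_in_space by blast

lemma regular_add: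
  assumes "tame_on U G" "tame_on U H" "x \<in> U" shows "regular (\<lambda>x. G x + c * H x) x = regular G x + c * regular H x"
  using glue_add_scale[OF assms(1,2) jumps_ok_0 jumps_ok_0 order_refl assms(3), of c] by (simp add: regular_def)

lemma regular_sum:
  assumes "finite I" "\<And>i. i \<in> I \<Longrightarrow> tame_on U (G i)" "x \<in> U"
  shows "regular (\<lambda>x. \<Sum>i\<in>I. c i * G i x) x = (\<Sum>i\<in>I. c i * regular (G i) x)"
  using assms
proof (induction I rule: finite_induct)
  case empty thus ?case by (simp add: regular_def glue_zero del: Union_iff)
next
  case (insert i I)
  have "regular (\<lambda>x. (\<Sum>i\<in>I. c i * G i x) + c i * G i x) x = regular (\<lambda>x. \<Sum>i\<in>I. c i * G i x) x + c i * regular (G i) x"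
    by (rule regular_add) (use insert in \<open>auto intro!: tame_on_sum tame_on_cmult\<close>)
  thus ?case using insert by (simp add: add.commute)
qed

text \<open>The jumps of the image, under the branch of \<open>\<omega>\<close>, of the regular function of
  \<open>G\<close>.\<close>

definition jd_reg :: "real set \<Rightarrow> (real \<Rightarrow> complex) \<Rightarrow> real \<Rightarrow> nat \<Rightarrow> complex" where
  "jd_reg \<omega> G = jump_data (lo \<omega> (Inf \<omega>) (Sup \<omega>)) (hi \<omega> (Inf \<omega>) (Sup \<omega>)) (push \<omega> (regular_jet (Inf \<omega>) G))"

text \<open>The top derivative of the image of a regular function, less its approximation of finite rank.\<close>

definition main_part :: "real set \<Rightarrow> nat \<Rightarrow> (real \<Rightarrow> complex) \<Rightarrow> real \<Rightarrow> complex" where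
  "main_part \<omega> K G y = (if lo \<omega> (Inf \<omega>) (Sup \<omega>) < y \<and> y < hi \<omega> (Inf \<omega>) (Sup \<omega>)
     then push \<omega> (regular_jet (Inf \<omega>) G) 0 y else 0)
     + (-1) * (\<Sum>(j,l)\<in>{..<r} \<times> {..K}. regular_jet (Inf \<omega>) G (r - j) (sample \<omega> K l) * cell_function \<omega> K j l y)"

lemma full_branch:
  assumes o: "\<omega> \<in> \<Omega>" and y: "lo \<omega> (Inf \<omega>) (Sup \<omega>) < y" "y < hi \<omega> (Inf \<omega>) (Sup \<omega>)"
  shows "inv_branch \<omega> y \<in> \<omega>" "T (inv_branch \<omega> y) = y"
proof -
  interpret b: branch "Inf \<omega>" "Sup \<omega>" "\<tau> \<omega>" "\<tau>' \<omega>" "\<kappa> \<omega>" "\<kappa>d \<omega>" by (rule br[OF o])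
  have se: "Inf \<omega> \<le> Inf \<omega>" "Inf \<omega> < Sup \<omega>" "Sup \<omega> \<le> Sup \<omega>" using omega[OF o] by auto
  have "inv_branch \<omega> y \<in> {Inf \<omega><..<Sup \<omega>}" unfolding inv_branch_def by (rule b.\<psi>_in(2)[OF se]) (use y in auto)
  thus i: "inv_branch \<omega> y \<in> \<omega>" by (simp add: omega_mem[OF o])
  have "\<tau> \<omega> (inv_branch \<omega> y) = y" unfolding inv_branch_def using b.\<psi>_in(1)[OF se, of y] y by auto
  thus "T (inv_branch \<omega> y) = y" using T_eq[OF o i] by simp
qed

lemma inv_closed:
  assumes o: "\<omega> \<in> \<Omega>" and y: "y \<in> {lo \<omega> (Inf \<omega>) (Sup \<omega>)..hi \<omega> (Inf \<omega>) (Sup \<omega>)}"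
  shows "inv_branch \<omega> y \<in> {Inf \<omega>..Sup \<omega>}"
proof -
  interpret b: branch "Inf \<omega>" "Sup \<omega>" "\<tau> \<omega>" "\<tau>' \<omega>" "\<kappa> \<omega>" "\<kappa>d \<omega>" by (rule br[OF o])
  show ?thesis unfolding inv_branch_def using b.\<psi>_in(1)[of "Inf \<omega>" "Sup \<omega>" y] omega[OF o] y by auto
qed

lemma lo_less_hi: assumes o: "\<omega> \<in> \<Omega>" shows "lo \<omega> (Inf \<omega>) (Sup \<omega>) < hi \<omega> (Inf \<omega>) (Sup \<omega>)"
proof -
  interpret b: branch "Inf \<omega>" "Sup \<omega>" "\<tau> \<omega>" "\<tau>' \<omega>" "\<kappa> \<omega>" "\<kappa>d \<omega>" by (rule br[OF o])
  show ?thesis by (rule b.\<tau>_ends_neq) (use omega[OF o] in auto)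
qed

text \<open>The coefficient of \<open>G\<close> in the top derivative is \<open>\<kappa> \<omega> r r\<close>,
  which contributes the contraction factor \<open>\<rho>\<close>. In the other terms the lower
  derivatives of a regular function are Lipschitz continuous with constant \<open>M / m\<close>,
  so sampling with mesh \<open>1 / K\<close> leaves an error of order \<open>1 / K\<close>.\<close>

lemma main_part_bound:
  assumes o: "\<omega> \<in> \<Omega>" and G: "data_le (\<lambda>_ _. 0) G M 0" and y: "y \<in> U" and K: "0 < K"
    and top: "\<And>x. x \<in> \<omega> \<Longrightarrow> T x \<in> U \<Longrightarrow> g (T x) * cmod (\<kappa> \<omega> r r x) \<le> \<rho> * g x" and \<rho>: "0 \<le> \<rho>"
  shows "g y * cmod (main_part \<omega> K G y) \<le> (\<rho> + \<bar>gm\<bar> * (real r * C) / (m * real K)) * M"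
proof (cases "lo \<omega> (Inf \<omega>) (Sup \<omega>) < y \<and> y < hi \<omega> (Inf \<omega>) (Sup \<omega>)")
  case False
  hence "main_part \<omega> K G y = 0" unfolding main_part_def if_not_P[OF False]
    by (simp add: cell_function_def case_prod_beta if_not_P[OF False] del: Union_iff) 
  thus ?thesis using \<rho> C m K data_leD(1)[OF G] by simp
next
  case True
  note D = data_leD[OF G]
  note w = omega[OF o]
  define x where "x = inv_branch \<omega> y"
  have x: "x \<in> \<omega>" "T x = y" using full_branch[OF o] True by (auto simp: x_def)
  have xI: "x \<in> {Inf \<omega><..<Sup \<omega>}" using x(1) by (simp add: omega_mem[OF o])
  have xU: "x \<in> U" using x o by blast
  define R where "R = regular_jet (Inf \<omega>) G"
  define l where "l = nat \<lfloor>real K * x\<rfloor>"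
  define s where "s = sample \<omega> K l"
  have s: "s \<in> \<omega>" "\<bar>x - s\<bar> \<le> 1 / real K"
    using sample_near[OF o x(1) K cell_index(2)[OF o x(1)]] by (auto simp: s_def l_def)
  have sI: "s \<in> {Inf \<omega><..<Sup \<omega>}" using s(1) by (simp add: omega_mem[OF o])
  have "(\<Sum>(j,l)\<in>{..<r} \<times> {..K}. R (r - j) (sample \<omega> K l) * cell_function \<omega> K j l y)
      = (\<Sum>j<r. \<Sum>l\<le>K. R (r - j) (sample \<omega> K l) * cell_function \<omega> K j l y)"
    by (simp add: sum.cartesian_product)
  also have "\<dots> = (\<Sum>j<r. \<kappa> \<omega> r j x * R (r - j) s)"
  proof (intro sum.cong refl)
    fix j
    have "(\<Sum>l\<le>K. R (r - j) (sample \<omega> K l) * cell_function \<omega> K j l y) =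
        (\<Sum>l\<le>K. (\<kappa> \<omega> r j x * R (r - j) (sample \<omega> K l)) * (if \<lfloor>real K * x\<rfloor> = int l then 1 else 0))"
      using True by (intro sum.cong refl) (simp add: cell_function_def x_def)
    also have "\<dots> = \<kappa> \<omega> r j x * R (r - j) s" by (subst cell_index(1)[OF o x(1)]) (simp add: s_def l_def)
    finally show "(\<Sum>l\<le>K. R (r - j) (sample \<omega> K l) * cell_function \<omega> K j l y) = \<kappa> \<omega> r j x * R (r - j) s" .
  qed
  finally have S: "(\<Sum>(j,l)\<in>{..<r} \<times> {..K}. R (r - j) (sample \<omega> K l) * cell_function \<omega> K j l y) = (\<Sum>j<r. \<kappa> \<omega> r j x * R (r - j) s)" .
  have "push \<omega> R 0 y = (\<Sum>j<r. \<kappa> \<omega> r j x * R (r - j) x) + \<kappa> \<omega> r r x * G x"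
    by (simp add: push_def x_def[symmetric] lessThan_Suc_atMost[symmetric] R_def)
  hence mp: "main_part \<omega> K G y = \<kappa> \<omega> r r x * G x + (\<Sum>j<r. \<kappa> \<omega> r j x * (R (r - j) x - R (r - j) s))"
    unfolding main_part_def if_P[OF True] R_def[symmetric] S by (simp add: sum_subtractf right_diff_distrib)
  have t1: "g y * cmod (\<kappa> \<omega> r r x * G x) \<le> \<rho> * M"
  proof -
    have "g y * cmod (\<kappa> \<omega> r r x) \<le> \<rho> * g x" using top[OF x(1)] x(2) y by simp
    hence "g y * cmod (\<kappa> \<omega> r r x) * cmod (G x) \<le> \<rho> * g x * cmod (G x)" by (rule mult_right_mono) simp
    also have "\<dots> \<le> \<rho> * M"
    proof -
      have "\<forall>x\<in>U. g x * cmod (G x) \<le> M" using G by (simp add: data_le_def)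
      thus ?thesis unfolding mult.assoc using xU \<rho> by (intro mult_left_mono) blast+
    qed
    finally show ?thesis by (simp add: norm_mult mult.assoc)
  qed
  have "cmod (\<Sum>j<r. \<kappa> \<omega> r j x * (R (r - j) x - R (r - j) s)) \<le> (\<Sum>j<r. C * (M / m * (1 / real K)))"
  proof (rule sum_norm_le)
    fix j assume j: "j \<in> {..<r}"
    then obtain i where i: "r - j = Suc i" "i < r" by (cases "r - j") auto
    have "cmod (R (Suc i) x - R (Suc i) s) \<le> M / m * \<bar>x - s\<bar>"
      unfolding R_def regular_jet_Suc
      by (rule tame_on_integral_lipschitz[OF regular_jet_tame[OF w(5) D(3)]])
        (use i regular_jet_bound(1)[OF G w(5)] xI sI in auto)
    also have "\<dots> \<le> M / m * (1 / real K)" using s D m by (intro mult_left_mono) auto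
    finally have "cmod (R (r - j) x - R (r - j) s) \<le> M / m * (1 / real K)" by (simp add: i)
    moreover have "cmod (\<kappa> \<omega> r j x) \<le> C" by (rule \<kappa>_bound[OF o]) (use xI j in auto)
    ultimately show "cmod (\<kappa> \<omega> r j x * (R (r - j) x - R (r - j) s)) \<le> C * (M / m * (1 / real K))"
      unfolding norm_mult using C by (intro mult_mono) auto
  qed
  hence t2: "cmod (\<Sum>j<r. \<kappa> \<omega> r j x * (R (r - j) x - R (r - j) s)) \<le> real r * C * M / (m * real K)" by simp
  have nn: "0 \<le> real r * C * M / (m * real K)" using C D m by simp
  have "g y * cmod (main_part \<omega> K G y) \<le> g y * (cmod (\<kappa> \<omega> r r x * G x) + real r * C * M / (m * real K))"
    unfolding mp using g_pos[OF y] by (intro mult_left_mono order_trans[OF norm_triangle_ineq] add_left_mono t2) auto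
  also have "\<dots> \<le> \<rho> * M + \<bar>gm\<bar> * (real r * C * M / (m * real K))"
    unfolding distrib_left using t1 g_le[OF y] g_pos[OF y] nn by (intro add_mono mult_right_mono) auto
  finally show ?thesis by (simp add: algebra_simps)
qed

lemma L_regular_piece:
  assumes o: "\<omega> \<in> \<Omega>" and G: "data_le (\<lambda>_ _. 0) G M 0" and K: "0 < K"
    and top: "\<And>x. x \<in> \<omega> \<Longrightarrow> T x \<in> U \<Longrightarrow> g (T x) * cmod (\<kappa> \<omega> r r x) \<le> \<rho> * g x" and \<rho>: "0 \<le> \<rho>"
  defines "f \<equiv> (\<lambda>x. if x \<in> \<omega> then regular_jet (Inf \<omega>) G r x else 0)"
  shows "rep (\<lambda>y. L f y - (\<Sum>(q,k)\<in>Ends \<times> {..<r}. jd_reg \<omega> G q k * atom q k y)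
      - (\<Sum>(j,l)\<in>{..<r} \<times> {..K}. regular_jet (Inf \<omega>) G (r - j) (sample \<omega> K l) * regular (cell_function \<omega> K j l) y))
      ((\<rho> + \<bar>gm\<bar> * (real r * C) / (m * real K)) * M)"
proof -
  interpret b: branch "Inf \<omega>" "Sup \<omega>" "\<tau> \<omega>" "\<tau>' \<omega>" "\<kappa> \<omega>" "\<kappa>d \<omega>" by (rule br[OF o])
  note w = omega[OF o] and D = data_leD[OF G]
  let ?R = "regular_jet (Inf \<omega>) G"
  have se: "Inf \<omega> \<le> Inf \<omega>" "Inf \<omega> < Sup \<omega>" "Sup \<omega> \<le> Sup \<omega>" using w by auto
  have tR: "tame_on {Inf \<omega><..<Sup \<omega>} (?R k)" if "k \<le> r" for k by (rule regular_jet_tame[OF w(5) D(3) that])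
  have cR: "continuous_on {Inf \<omega>..Sup \<omega>} (?R (Suc k))" if "k < r" for k
    unfolding regular_jet_Suc by (rule tame_on_integral_continuous[OF tR]) (use that in auto)
  have "\<exists>Z. countable Z \<and> (\<forall>x\<in>{Inf \<omega><..<Sup \<omega>}. x \<notin> Z \<longrightarrow> isCont (?R (min k r)) x)" for k
    by (rule tame_on_cont[OF tR]) simp
  then obtain Z where Z: "\<And>k. countable (Z k)" "\<And>k x. x \<in> {Inf \<omega><..<Sup \<omega>} \<Longrightarrow> x \<notin> Z k \<Longrightarrow> isCont (?R (min k r)) x"
    by metis
  have dR: "(?R (Suc k) has_vector_derivative ?R k x) (at x)" if k: "k < r" and x: "x \<in> {Inf \<omega><..<Sup \<omega>} - (\<Union>k. Z k)" for k x
    unfolding regular_jet_Suc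
    by (rule integral_deriv_at_cont[OF tR]) (use k x Z(2)[of x k] in \<open>auto simp: min_absorb1\<close>)
  have cZ: "countable (\<Union>k. Z k)" using Z(1) by simp
  have Q: "finite Ends" "Ends \<subseteq> P" "P \<inter> ({lo \<omega> (Inf \<omega>) (Sup \<omega>), hi \<omega> (Inf \<omega>) (Sup \<omega>)} \<union> left_ends) \<subseteq> Ends"
    using finite_Ends Ends_P o by (auto simp: Ends_def min_def max_def)
  have eP: "\<tau> \<omega> (Inf \<omega>) \<in> U \<Longrightarrow> \<tau> \<omega> (Inf \<omega>) \<in> P" "\<tau> \<omega> (Sup \<omega>) \<in> U \<Longrightarrow> \<tau> \<omega> (Sup \<omega>) \<in> P" using end_P[OF o] by blast+
  have f: "f x = (if Inf \<omega> < x \<and> x < Sup \<omega> then ?R r x else 0)" for x by (simp add: f_def omega_mem[OF o])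
  define E0 where "E0 = (\<lambda>y. if lo \<omega> (Inf \<omega>) (Sup \<omega>) < y \<and> y < hi \<omega> (Inf \<omega>) (Sup \<omega>) then push \<omega> ?R 0 y else 0)"
  have tE0: "tame_on U E0"
    unfolding E0_def by (rule piece_jets(1)[where f = f, OF o se cR tR cZ dR Q eP f])
  have ae: "AE y in lebesgue_on {0..1}. L f y = regular E0 y + (\<Sum>(q,k)\<in>Ends \<times> {..<r}. jd_reg \<omega> G q k * atom q k y)"
    unfolding E0_def jd_reg_def by (rule piece_jets(2)[where f = f, OF o se cR tR cZ dR Q eP f])
  let ?B = "\<lambda>y. \<Sum>i\<in>{..<r} \<times> {..K}. ?R (r - fst i) (sample \<omega> K (snd i)) * cell_function \<omega> K (fst i) (snd i) y"
  have mp: "main_part \<omega> K G = (\<lambda>y. E0 y + (-1) * ?B y)" by (simp add: main_part_def E0_def case_prod_beta fun_eq_iff)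
  have tB: "tame_on U ?B" by (intro tame_on_sum tame_on_cmult tame_cell_function o) auto
  have tmp: "tame_on U (main_part \<omega> K G)" unfolding mp by (intro tame_on_add tame_on_cmult tE0 tB)
  have "data_le (\<lambda>_ _. 0) (main_part \<omega> K G) ((\<rho> + \<bar>gm\<bar> * (real r * C) / (m * real K)) * M) 0"
    by (rule data_le_regular[OF tmp main_part_bound[OF o G _ K top \<rho>]]) (use \<rho> C m D in auto)
  from rep_regular[OF this] show ?thesis
  proof (rule rep_cong)
    show "AE y in lebesgue_on {0..1}. regular (main_part \<omega> K G) y =
      L f y - (\<Sum>(q,k)\<in>Ends \<times> {..<r}. jd_reg \<omega> G q k * atom q k y)
      - (\<Sum>(j,l)\<in>{..<r} \<times> {..K}. ?R (r - j) (sample \<omega> K l) * regular (cell_function \<omega> K j l) y)"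
      using ae AE_in_U
    proof eventually_elim
      case (elim y)
      have "regular (main_part \<omega> K G) y = regular E0 y + (-1) * regular ?B y"
        unfolding mp by (rule regular_add[OF tE0 tB elim(2)])
      also have "regular ?B y = (\<Sum>i\<in>{..<r} \<times> {..K}. ?R (r - fst i) (sample \<omega> K (snd i)) * regular (cell_function \<omega> K (fst i) (snd i)) y)"
        by (rule regular_sum) (use tame_cell_function o elim in auto)
      finally show ?case using elim(1) by (simp add: case_prod_beta)
    qed
  qed
qed

lemma jump_data_linear:
  assumes "\<And>y. y \<in> {\<alpha>..\<beta>} \<Longrightarrow> E (Suc k) y = E1 (Suc k) y + c * E2 (Suc k) y" "\<alpha> \<le> \<beta>"
  shows "jump_data \<alpha> \<beta> E q k = jump_data \<alpha> \<beta> E1 q k + c * jump_data \<alpha> \<beta> E2 q k"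
  unfolding jump_data_def using assms by (auto simp: algebra_simps)

lemma jd_reg_linear:
  assumes o: "\<omega> \<in> \<Omega>" and G: "tame_on U G" "tame_on U H"
  shows "jd_reg \<omega> (\<lambda>x. G x + c * H x) q k = jd_reg \<omega> G q k + c * jd_reg \<omega> H q k"
  unfolding jd_reg_def
proof (rule jump_data_linear)
  fix y assume y: "y \<in> {lo \<omega> (Inf \<omega>) (Sup \<omega>)..hi \<omega> (Inf \<omega>) (Sup \<omega>)}"
  show "push \<omega> (regular_jet (Inf \<omega>) (\<lambda>x. G x + c * H x)) (Suc k) y =
      push \<omega> (regular_jet (Inf \<omega>) G) (Suc k) y + c * push \<omega> (regular_jet (Inf \<omega>) H) (Suc k) y"
    unfolding push_def sum_distrib_left sum.distrib[symmetric]
    by (intro sum.cong refl) (simp add: regular_jet_linear[OF omega(5)[OF o] G _ inv_closed[OF o y]] algebra_simps)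
qed (use lo_less_hi[OF o] in simp)

lemma jd_reg_bound:
  assumes o: "\<omega> \<in> \<Omega>" and G: "data_le (\<lambda>_ _. 0) G M 0" and k: "k < r"
  shows "cmod (jd_reg \<omega> G q k) \<le> 2 * ((real r + 1) * (C * (M / m)))"
  unfolding jd_reg_def
proof (rule jump_data_bound)
  fix y assume y: "y \<in> {lo \<omega> (Inf \<omega>) (Sup \<omega>)..hi \<omega> (Inf \<omega>) (Sup \<omega>)}"
  show "cmod (push \<omega> (regular_jet (Inf \<omega>) G) (Suc k) y) \<le> (real r + 1) * (C * (M / m))"
  proof (rule push_bound_Suc[OF o inv_closed[OF o y] _ _ k])
    show "cmod (regular_jet (Inf \<omega>) G (Suc i) (inv_branch \<omega> y)) \<le> M / m" if "i < r" for i
      by (rule regular_jet_bound(2)[OF G omega(5)[OF o] that inv_closed[OF o y]])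
  qed (use data_leD(1)[OF G] m in auto)
next
  show "0 \<le> (real r + 1) * (C * (M / m))" using C m data_leD(1)[OF G] by simp
qed (use lo_less_hi[OF o] in simp)

lemma jd_reg_null:
  assumes o: "\<omega> \<in> \<Omega>" and Z: "countable Z" "\<And>x. x \<in> U - Z \<Longrightarrow> G x = 0" and k: "k < r"
  shows "jd_reg \<omega> G q k = 0"
proof -
  have "cmod (jd_reg \<omega> G q k) \<le> 2 * 0"
    unfolding jd_reg_def
  proof (rule jump_data_bound)
    fix y assume y: "y \<in> {lo \<omega> (Inf \<omega>) (Sup \<omega>)..hi \<omega> (Inf \<omega>) (Sup \<omega>)}"
    have "cmod (push \<omega> (regular_jet (Inf \<omega>) G) (Suc k) y) \<le> (real r + 1) * (C * 0)"
      by (rule push_bound_Suc[OF o inv_closed[OF o y] _ _ k])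
        (use regular_jet_null[OF Z omega(5)[OF o] inv_closed[OF o y]] in \<open>simp_all del: regular_jet_Suc\<close>)
    thus "cmod (push \<omega> (regular_jet (Inf \<omega>) G) (Suc k) y) \<le> 0" by simp
  qed (use lo_less_hi[OF o] in simp_all)
  thus ?thesis by simp
qed

lemma L_sum:
  assumes "finite I" shows "L (\<lambda>x. \<Sum>i\<in>I. f i x) = (\<lambda>y. \<Sum>i\<in>I. L (f i) y)"
  using assms
proof (induction I rule: finite_induct)
  case empty
  show ?case using transfer_operator_linear[of T \<Omega> \<phi> "\<lambda>_. 0" "-1" "\<lambda>_. 0"] by simp
next
  case (insert i I)
  have "L (\<lambda>x. (\<Sum>i\<in>I. f i x) + 1 * f i x) = (\<lambda>y. L (\<lambda>x. \<Sum>i\<in>I. f i x) y + 1 * L (f i) y)"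
    by (rule transfer_operator_linear)
  thus ?case using insert by (simp add: add.commute)
qed

lemma L_regular:
  "L (regular G) y = (\<Sum>\<omega>\<in>\<Omega>. L (\<lambda>x. if x \<in> \<omega> then regular_jet (Inf \<omega>) G r x else 0) y)"
proof -
  have "L (regular G) = L (\<lambda>x. \<Sum>\<omega>\<in>\<Omega>. if x \<in> \<omega> then regular_jet (Inf \<omega>) G r x else 0)"
  proof (rule transfer_operator_cong)
    fix x assume "x \<in> U"
    then obtain \<omega> where o: "\<omega> \<in> \<Omega>" "x \<in> \<omega>" by blast
    have "(\<Sum>\<omega>\<in>\<Omega>. if x \<in> \<omega> then regular_jet (Inf \<omega>) G r x else 0) = (\<Sum>\<omega>\<in>{\<omega>}. if x \<in> \<omega> then regular_jet (Inf \<omega>) G r x else 0)"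
      by (rule sum.mono_neutral_right[OF fin]) (use o unique_ivl in auto)
    also have "\<dots> = regular G x"
      using o regular_jet_eq_glue[OF omega(5)[OF o(1)] order_refl, of x G] by (simp add: regular_def omega_mem)
    finally show "regular G x = (\<Sum>\<omega>\<in>\<Omega>. if x \<in> \<omega> then regular_jet (Inf \<omega>) G r x else 0)" ..
  qed
  thus ?thesis by (simp add: L_sum[OF fin])
qed

text \<open>The span of \<open>E\<close> contains the atoms at the points of \<open>Ends\<close>, the images
  of the atoms at the finitely many jump points outside \<open>Good\<close>, and the regular
  functions of the cell functions. Modulo this span, atoms at points of \<open>Good\<close> are
  contracted by \<open>q1 + q2\<close>, the other atoms vanish, and regular functions are
  contracted by a factor that tends to \<open>card \<Omega> * \<rho>\<close> as the mesh of the
  cells tends to zero, with one contribution \<open>\<rho>\<close> from each branch.\<close>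

theorem quasi_compact:
  assumes Good: "Good \<subseteq> P \<inter> U" "finite (P - Good)"
    and main: "\<And>\<omega> p k0. p \<in> Good \<Longrightarrow> k0 < r \<Longrightarrow> \<omega> \<in> \<Omega> \<Longrightarrow> p \<in> \<omega> \<Longrightarrow> T p \<in> U \<Longrightarrow>
        (\<Sum>k<r. cmod (\<kappa> \<omega> (r - Suc k) (r - Suc k0) p) * wt (T p) k) \<le> q1 * wt p k0"
    and cross: "\<And>p k0. p \<in> Good \<Longrightarrow> k0 < r \<Longrightarrow> \<bar>gm\<bar> * ((real r + 1) * C) \<le> q2 * wt p k0"
    and top: "\<And>\<omega> x. \<omega> \<in> \<Omega> \<Longrightarrow> x \<in> \<omega> \<Longrightarrow> T x \<in> U \<Longrightarrow> g (T x) * cmod (\<kappa> \<omega> r r x) \<le> \<rho> * g x"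
    and nn: "0 \<le> q1" "0 \<le> q2" "0 \<le> \<rho>" and q: "q1 + q2 \<le> q" "real (card \<Omega>) * \<rho> < q"
  shows "bounded_operator space_of norm_of L"
    and "\<And>z. q < cmod z \<Longrightarrow> fredholm space_of norm_of (\<lambda>f x. z * f x - L f x)"
proof -
  define N where "N = real (card \<Omega>)"
  define c1 where "c1 = \<bar>gm\<bar> * (real r * C) / m"
  have c1: "0 \<le> c1" using C m by (simp add: c1_def)
  \<comment> \<open>The mesh \<open>1 / K\<close> has to make the sampling errors of all branches fit into the gap
    between \<open>card \<Omega> * \<rho>\<close> and \<open>q\<close>.\<close>
  obtain K where K: "real K > N * c1 / (q - N * \<rho>)" "0 < K"
  proof -
    obtain n where "real n > N * c1 / (q - N * \<rho>)" using reals_Archimedean2 by blast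
    thus thesis using that[of "Suc n"] by simp
  qed
  have qN: "0 < q - N * \<rho>" using q by (simp add: N_def)
  have Kq: "N * (\<rho> + \<bar>gm\<bar> * (real r * C) / (m * real K)) \<le> q"
  proof -
    have "N * c1 \<le> (q - N * \<rho>) * real K" using K(1) qN by (simp add: field_simps)
    hence "N * (c1 / real K) \<le> q - N * \<rho>" using K(2) by (simp add: field_simps)
    moreover have "\<bar>gm\<bar> * (real r * C) / (m * real K) = c1 / real K" by (simp add: c1_def)
    ultimately show ?thesis by (simp add: distrib_left)
  qed
  define I2 where "I2 = \<Omega> \<times> ({..<r} \<times> {..K})"
  define h2 where "h2 = (\<lambda>(\<omega>,j,l). regular (cell_function \<omega> K j l))"
  define E where "E = (\<lambda>(q,k). atom q k) ` (Ends \<times> {..<r}) \<union> (\<lambda>(p,k). L (atom p k)) ` ((P - Good) \<times> {..<r}) \<union> h2 ` I2"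
  have finI2: "finite I2" using fin by (simp add: I2_def)
  have E: "finite E" using finite_Ends Good finI2 by (auto simp: E_def)
  have E_space: "E \<subseteq> space_of"
    unfolding E_def h2_def I2_def using Ends_P atom_space L_atom_space regular_cell_space by auto
  have E_atom: "atom q k \<in> E" if "q \<in> Ends" "k < r" for q k unfolding E_def using that by force
  have E_bad: "L (atom p k) \<in> E" if "p \<in> P - Good" "k < r" for p k unfolding E_def using that by force
  define J where "J = real (card (Ends \<times> {..<r})) * (2 * ((real r + 1) * C))"
  have J: "0 \<le> J" using C by (simp add: J_def)
  define I1 where "I1 = \<Omega> \<times> (Ends \<times> {..<r})"
  define h1 :: "real set \<times> real \<times> nat \<Rightarrow> real \<Rightarrow> complex" where "h1 = (\<lambda>(\<omega>,q,k). atom q k)"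
  have finI1: "finite I1" using fin finite_Ends by (simp add: I1_def)
  \<comment> \<open>In the coefficients, the sample point of an empty cell is replaced by the end point \<open>Inf
    \<omega>\<close>, which lies in the domain of the jets. This keeps the coefficients linear
    and bounded; it does not change the sum because the cell function vanishes.\<close>
  define c1f :: "(real \<Rightarrow> complex) \<Rightarrow> real set \<times> real \<times> nat \<Rightarrow> complex" where "c1f G = (\<lambda>(\<omega>,q,k). jd_reg \<omega> G q k)" for G
  define c2f :: "(real \<Rightarrow> complex) \<Rightarrow> real set \<times> nat \<times> nat \<Rightarrow> complex" where "c2f G = (\<lambda>(\<omega>,j,l). regular_jet (Inf \<omega>) G (r - j) (if sample \<omega> K l \<in> \<omega> then sample \<omega> K l else Inf \<omega>))" for G
  define cr where "cr G e = (\<Sum>i\<in>{i\<in>I1. h1 i = e}. c1f G i) + (\<Sum>i\<in>{i\<in>I2. h2 i = e}. c2f G i)" for G e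
  have h1E: "h1 ` I1 \<subseteq> E" using E_atom by (auto simp: h1_def I1_def)
  have h2E: "h2 ` I2 \<subseteq> E" by (auto simp: E_def)
  have cr_sum: "(\<Sum>e\<in>E. cr G e * e x) = (\<Sum>i\<in>I1. c1f G i * h1 i x) + (\<Sum>i\<in>I2. c2f G i * h2 i x)" for G x
    unfolding cr_def distrib_right sum.distrib sum_collect[OF finI1 E h1E] sum_collect[OF finI2 E h2E] ..
  have samp: "(if sample \<omega> K l \<in> \<omega> then sample \<omega> K l else Inf \<omega>) \<in> {Inf \<omega>..Sup \<omega>}" if "\<omega> \<in> \<Omega>" for \<omega> l
    using omega(3)[OF that] by (auto simp: omega_mem[OF that])
  have cell0: "cell_function \<omega> K j l y = 0" if o: "\<omega> \<in> \<Omega>" and ns: "sample \<omega> K l \<notin> \<omega>" for \<omega> j l y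
  proof (rule ccontr)
    assume "cell_function \<omega> K j l y \<noteq> 0"
    hence y: "lo \<omega> (Inf \<omega>) (Sup \<omega>) < y" "y < hi \<omega> (Inf \<omega>) (Sup \<omega>)" "\<lfloor>real K * inv_branch \<omega> y\<rfloor> = int l"
      by (auto simp: cell_function_def split: if_splits)
    show False using sample_near(1)[OF o full_branch(1)[OF o y(1,2)] K(2) y(3)] ns by simp
  qed
  \<comment> \<open>A common bound for the coefficients: they are bounded by \<open>J\<close> or by 1 on atoms,
    where the weight is at least \<open>m\<close>, and by the second term on regular functions.\<close>
  define KK where "KK = max (max J 1 * max 1 (1 / m)) (real (card I1) * (2 * ((real r + 1) * (C * (1 / m)))) + real (card I2) * (1 / m))"
  have KK1: "1 \<le> KK * m"
  proof -
    have "1 / m \<le> max J 1 * max 1 (1 / m)" using m by (smt (verit) max.cobounded2 mult_le_cancel_right1 divide_pos_pos)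
    also have "\<dots> \<le> KK" by (simp add: KK_def)
    finally show ?thesis using m by (simp add: field_simps)
  qed
  have KK2: "J \<le> KK * m"
  proof -
    have "J / m \<le> max J 1 * (1 / m)" using m by (simp add: divide_right_mono)
    also have "\<dots> \<le> max J 1 * max 1 (1 / m)" by (intro mult_left_mono) auto
    also have "\<dots> \<le> KK" by (simp add: KK_def)
    finally show ?thesis using m by (simp add: field_simps)
  qed
  have KK3: "real (card I1) * (2 * ((real r + 1) * (C * (1 / m)))) + real (card I2) * (1 / m) \<le> KK" by (simp add: KK_def)
  have KK0: "0 \<le> KK" using KK3 C m by (smt (verit) divide_nonneg_pos mult_nonneg_nonneg of_nat_0_le_iff)
  have q0: "0 \<le> q" using q nn by simp
  have lin: "L (\<lambda>x. f x + a * h x) = (\<lambda>x. L f x + a * L h x)" for f h a by (rule transfer_operator_linear)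
  have atoms: "\<exists>c. (\<forall>e\<in>E. cmod (c e) \<le> KK * wt p k) \<and> rep (\<lambda>x. L (atom p k) x - (\<Sum>e\<in>E. c e * e x)) (q * wt p k)"
    if p: "p \<in> P" and k: "k < r" for p k
  proof (cases "p \<in> Good")
    case True
    have mw: "KK * m \<le> KK * wt p k" using m(3)[OF p k] KK0 by (intro mult_left_mono) auto
    obtain c where c: "\<forall>e\<in>E. cmod (c e) \<le> J" "rep (\<lambda>x. L (atom p k) x - (\<Sum>e\<in>E. c e * e x)) ((q1 + q2) * wt p k)"
      using L_atom_contraction[OF p _ k main[OF True k] cross[OF True k] nn(1) E E_atom] Good True
      unfolding J_def by blast
    have "rep (\<lambda>x. L (atom p k) x - (\<Sum>e\<in>E. c e * e x)) (q * wt p k)"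
      by (rule rep_mono[OF c(2)]) (use q wt_pos[OF p k] in \<open>auto intro: mult_right_mono\<close>)
    moreover have "\<forall>e\<in>E. cmod (c e) \<le> KK * wt p k" using c(1) KK2 mw by force
    ultimately show ?thesis by blast
  next
    case False
    define c where "c e = (if e = L (atom p k) then 1 else 0 :: complex)" for e
    have "(\<Sum>e\<in>E. c e * e x) = L (atom p k) x" for x
      using E E_bad[of p k] p k False by (simp add: c_def if_distrib[of "\<lambda>t. t * _"] sum.delta cong: if_cong)
    hence "rep (\<lambda>x. L (atom p k) x - (\<Sum>e\<in>E. c e * e x)) (q * wt p k)"
      using rep_mono[OF rep_zero, of "q * wt p k"] q0 wt_pos[OF p k] by simp
    moreover have "1 \<le> KK * wt p k" using KK1 mult_left_mono[OF m(3)[OF p k] KK0] by simp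
    hence "\<forall>e\<in>E. cmod (c e) \<le> KK * wt p k" by (auto simp: c_def)
    ultimately show ?thesis by blast
  qed
  have reg: "rep (\<lambda>x. L (regular G) x - (\<Sum>e\<in>E. cr G e * e x)) (q * M)" if G: "data_le (\<lambda>_ _. 0) G M 0" for G M
  proof -
    let ?q = "(\<rho> + \<bar>gm\<bar> * (real r * C) / (m * real K)) * M"
    let ?h = "\<lambda>\<omega> y. L (\<lambda>x. if x \<in> \<omega> then regular_jet (Inf \<omega>) G r x else 0) y - (\<Sum>(q,k)\<in>Ends \<times> {..<r}. jd_reg \<omega> G q k * atom q k y)
      - (\<Sum>(j,l)\<in>{..<r} \<times> {..K}. regular_jet (Inf \<omega>) G (r - j) (sample \<omega> K l) * regular (cell_function \<omega> K j l) y)"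
    have "rep (\<lambda>y. \<Sum>\<omega>\<in>\<Omega>. 1 * ?h \<omega> y) (\<Sum>\<omega>\<in>\<Omega>. cmod 1 * ?q)"
      by (rule rep_sum[OF fin L_regular_piece[OF _ G K(2) top nn(3)]])
    moreover have "(\<Sum>\<omega>\<in>\<Omega>. cmod 1 * ?q) \<le> q * M"
      using mult_right_mono[OF Kq data_leD(1)[OF G]] by (simp add: N_def mult.assoc)
    ultimately have R: "rep (\<lambda>y. \<Sum>\<omega>\<in>\<Omega>. 1 * ?h \<omega> y) (q * M)" by (rule rep_mono)
    show ?thesis
    proof (rule rep_cong[OF R], rule AE_U)
      fix y assume y: "y \<in> U"
      have s1: "(\<Sum>i\<in>I1. c1f G i * h1 i y) = (\<Sum>\<omega>\<in>\<Omega>. \<Sum>(q,k)\<in>Ends \<times> {..<r}. jd_reg \<omega> G q k * atom q k y)"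
        unfolding I1_def
      proof (subst sum_Times[of _ \<Omega>], intro sum.cong refl)
        fix \<omega> i assume "\<omega> \<in> \<Omega>" "i \<in> Ends \<times> {..<r}"
        thus "c1f G (\<omega>, i) * h1 (\<omega>, i) y = (case i of (q,k) \<Rightarrow> jd_reg \<omega> G q k * atom q k y)"
          by (cases i) (auto simp: c1f_def h1_def)
      qed
      have z: "regular (cell_function \<omega> K j l) y = 0" if "\<omega> \<in> \<Omega>" "sample \<omega> K l \<notin> \<omega>" for \<omega> j l
      proof -
        have "cell_function \<omega> K j l = (\<lambda>_. 0)" using cell0[OF that] by auto
        thus ?thesis using glue_zero[OF y order_refl] by (simp add: regular_def)
      qed
      have s2: "(\<Sum>i\<in>I2. c2f G i * h2 i y) = (\<Sum>\<omega>\<in>\<Omega>. \<Sum>(j,l)\<in>{..<r} \<times> {..K}. regular_jet (Inf \<omega>) G (r - j) (sample \<omega> K l) * regular (cell_function \<omega> K j l) y)"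
        unfolding I2_def
      proof (subst sum_Times[of _ \<Omega>], intro sum.cong refl)
        fix \<omega> i assume "\<omega> \<in> \<Omega>" "i \<in> {..<r} \<times> {..K}"
        thus "c2f G (\<omega>, i) * h2 (\<omega>, i) y = (case i of (j,l) \<Rightarrow> regular_jet (Inf \<omega>) G (r - j) (sample \<omega> K l) * regular (cell_function \<omega> K j l) y)"
          using z by (cases i) (auto simp: c2f_def h2_def)
      qed
      show "(\<Sum>\<omega>\<in>\<Omega>. 1 * ?h \<omega> y) = L (regular G) y - (\<Sum>e\<in>E. cr G e * e y)"
        unfolding cr_sum s1 s2 L_regular[of G y] by (simp add: sum_subtractf)
    qed
  qed
  have c1_lin: "c1f (\<lambda>x. G x + a * H x) i = c1f G i + a * c1f H i" if "tame_on U G" "tame_on U H" "i \<in> I1" for G H a i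
    using that jd_reg_linear by (auto simp: c1f_def I1_def)
  have c2_lin: "c2f (\<lambda>x. G x + a * H x) i = c2f G i + a * c2f H i" if "tame_on U G" "tame_on U H" "i \<in> I2" for G H a i
    using that regular_jet_linear[OF omega(5) that(1,2) _ samp] by (auto simp: c2f_def I2_def)
  have cr_lin: "cr (\<lambda>x. G x + a * H x) e = cr G e + a * cr H e" if "tame_on U G" "tame_on U H" for G H a e
  proof -
    have "(\<Sum>i\<in>{i\<in>I1. h1 i = e}. c1f (\<lambda>x. G x + a * H x) i) = (\<Sum>i\<in>{i\<in>I1. h1 i = e}. c1f G i + a * c1f H i)"
      by (intro sum.cong refl c1_lin that) auto
    moreover have "(\<Sum>i\<in>{i\<in>I2. h2 i = e}. c2f (\<lambda>x. G x + a * H x) i) = (\<Sum>i\<in>{i\<in>I2. h2 i = e}. c2f G i + a * c2f H i)"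
      by (intro sum.cong refl c2_lin that) auto
    ultimately show ?thesis by (simp add: cr_def sum.distrib sum_distrib_left algebra_simps)
  qed
  have cr_bound: "cmod (cr G e) \<le> KK * M" if G: "data_le (\<lambda>_ _. 0) G M 0" for G M e
  proof -
    have M: "0 \<le> M" by (rule data_leD(1)[OF G])
    have b1: "cmod (c1f G i) \<le> 2 * ((real r + 1) * (C * (M / m)))" if "i \<in> I1" for i
      using that jd_reg_bound[OF _ G] by (auto simp: c1f_def I1_def)
    have b2: "cmod (c2f G i) \<le> M / m" if iI: "i \<in> I2" for i
    proof -
      obtain \<omega> j l where i: "i = (\<omega>, j, l)" "\<omega> \<in> \<Omega>" "j < r" using iI by (auto simp: I2_def)
      then obtain n where "r - j = Suc n" "n < r" by (cases "r - j") auto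
      thus ?thesis using regular_jet_bound(2)[OF G omega(5)[OF i(2)] _ samp[OF i(2)]] i by (simp add: c2f_def del: regular_jet_Suc)
    qed
    have "cmod (cr G e) \<le> real (card I1) * (2 * ((real r + 1) * (C * (M / m)))) + real (card I2) * (M / m)"
      unfolding cr_def using M C m
      by (intro norm_triangle_mono norm_sum_collect finI1 finI2 b1 b2) auto
    also have "\<dots> = (real (card I1) * (2 * ((real r + 1) * (C * (1 / m)))) + real (card I2) * (1 / m)) * M"
      by (simp add: algebra_simps add_divide_distrib)
    also have "\<dots> \<le> KK * M" using KK3 M by (rule mult_right_mono)
    finally show ?thesis .
  qed
  have cr_null: "cr G e = 0" if Z: "countable Z" "\<And>x. x \<in> U - Z \<Longrightarrow> G x = 0" for G Z e
  proof -
    have n1: "c1f G i = 0" if "i \<in> I1" for i using that jd_reg_null[OF _ Z] by (auto simp: c1f_def I1_def)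
    have n2: "c2f G i = 0" if iI: "i \<in> I2" for i
    proof -
      obtain \<omega> j l where i: "i = (\<omega>, j, l)" "\<omega> \<in> \<Omega>" "j < r" using iI by (auto simp: I2_def)
      then obtain n where "r - j = Suc n" by (cases "r - j") auto
      thus ?thesis using regular_jet_null[OF Z omega(5)[OF i(2)] samp[OF i(2)]] i by (simp add: c2f_def del: regular_jet_Suc)
    qed
    show ?thesis unfolding cr_def using n1 n2 by (simp add: sum.neutral)
  qed
  have KL: "0 \<le> real (card \<Omega>) * C" using C by simp
  show "bounded_operator space_of norm_of L"
    by (rule fredholm_from_atoms(1)[OF lin L_Linf E E_space atoms reg cr_lin cr_bound cr_null KK0 KL q0])
  show "fredholm space_of norm_of (\<lambda>f x. z * f x - L f x)" if "q < cmod z" for z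
    by (rule fredholm_from_atoms(2)[OF lin L_Linf E E_space atoms reg cr_lin cr_bound cr_null KK0 KL q0 that])
qed

end

section \<open>Products of weights along orbits\<close>

text \<open>The orbit of \<open>x\<close> meets the boundary of the partition at no time before
  \<open>k\<close>. Only such orbit segments enter the suprema below, since a jump that hits the
  boundary is absorbed by finitely many atoms.\<close>

definition stays :: "real set \<Rightarrow> (real \<Rightarrow> real) \<Rightarrow> real \<Rightarrow> nat \<Rightarrow> bool" where
  "stays U T x k \<longleftrightarrow> (\<forall>i<k. (T ^^ i) x \<in> U)"

definition orbit_prod :: "(real \<Rightarrow> real) \<Rightarrow> (real \<Rightarrow> real) \<Rightarrow> real \<Rightarrow> nat \<Rightarrow> real" where
  "orbit_prod a T x k = (\<Prod>i<k. a ((T ^^ i) x))"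

definition orbit_prods :: "real set \<Rightarrow> (real \<Rightarrow> real) \<Rightarrow> (real \<Rightarrow> real) \<Rightarrow> real \<Rightarrow> real set" where
  "orbit_prods U T a x = orbit_prod a T x ` {k. stays U T x k}"

definition orbit_sup :: "real set \<Rightarrow> (real \<Rightarrow> real) \<Rightarrow> (real \<Rightarrow> real) \<Rightarrow> real \<Rightarrow> real" where
  "orbit_sup U T a x = Sup (orbit_prods U T a x)"

lemma stays_0 [simp]: "stays U T x 0" by (simp add: stays_def)

lemma one_in_orbit_prods: "1 \<in> orbit_prods U T a x"
  unfolding orbit_prods_def by (rule image_eqI[of _ _ 0]) (auto simp: orbit_prod_def)

lemma orbit_sup_ge_1: "bdd_above (orbit_prods U T a x) \<Longrightarrow> 1 \<le> orbit_sup U T a x"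
  unfolding orbit_sup_def by (rule cSup_upper[OF one_in_orbit_prods])

lemma stays_step: "x \<in> U \<Longrightarrow> stays U T (T x) k \<Longrightarrow> stays U T x (Suc k)"
  unfolding stays_def by (auto simp: less_Suc_eq_0_disj funpow_Suc_right simp del: funpow.simps)

lemma orbit_prod_step: "orbit_prod a T x (Suc k) = a x * orbit_prod a T (T x) k"
  unfolding orbit_prod_def by (subst prod.lessThan_Suc_shift) (simp add: funpow_Suc_right del: funpow.simps(2))

text \<open>Prepending \<open>x\<close> to an orbit segment of \<open>T x\<close> multiplies its product by
  \<open>a x\<close>. The supremum is thus the adapted weight that turns a bound on products into
  a bound for one step.\<close>

lemma orbit_sup_step:
  assumes x: "x \<in> U" and a: "0 < a x" and b: "bdd_above (orbit_prods U T a x)"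
  shows "bdd_above (orbit_prods U T a (T x))" "a x * orbit_sup U T a (T x) \<le> orbit_sup U T a x"
proof -
  have le: "y \<le> orbit_sup U T a x / a x" if y: "y \<in> orbit_prods U T a (T x)" for y
  proof -
    obtain k where k: "stays U T (T x) k" "y = orbit_prod a T (T x) k" using y by (auto simp: orbit_prods_def)
    have "orbit_prod a T x (Suc k) \<in> orbit_prods U T a x"
      unfolding orbit_prods_def using stays_step[OF x k(1)] by blast
    hence "a x * y \<le> orbit_sup U T a x" unfolding k(2) orbit_prod_step[symmetric] orbit_sup_def by (rule cSup_upper[OF _ b])
    thus ?thesis using a by (simp add: field_simps)
  qed
  thus "bdd_above (orbit_prods U T a (T x))" by (auto simp: bdd_above_def)
  have "orbit_sup U T a (T x) \<le> orbit_sup U T a x / a x"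
    unfolding orbit_sup_def[of U T a "T x"] by (rule cSup_least) (use le one_in_orbit_prods[of U T a "T x"] in auto)
  thus "a x * orbit_sup U T a (T x) \<le> orbit_sup U T a x" using a by (simp add: field_simps)
qed

lemma deriv_iterate:
  assumes d: "\<And>x. x \<in> U \<Longrightarrow> (T has_real_derivative T' x) (at x)" and s: "stays U T x k"
  shows "((T ^^ k) has_real_derivative (\<Prod>i<k. T' ((T ^^ i) x))) (at x)"
  using s
proof (induction k)
  case 0 show ?case by (simp add: id_def)
next
  case (Suc k)
  have "stays U T x k" "(T ^^ k) x \<in> U" using Suc.prems by (auto simp: stays_def)
  from DERIV_chain[OF d[OF this(2)] Suc.IH[OF this(1)]] show ?case by (simp add: mult.commute o_def)
qed

text \<open>As long as the orbit of the one-sided limit \<open>q\<close> meets no discontinuity, the one-sided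
  orbit of the end point is the orbit of \<open>q\<close>.\<close>

lemma orbit_limit:
  fixes F :: "real filter"
  assumes c: "\<And>x. x \<in> U \<Longrightarrow> isCont T x" and q: "(T \<longlongrightarrow> q) F" and s: "stays U T q k"
  shows "((T ^^ Suc k) \<longlongrightarrow> (T ^^ k) q) F"
  using s
proof (induction k)
  case 0 thus ?case using q by simp
next
  case (Suc k)
  have k: "stays U T q k" "(T ^^ k) q \<in> U" using Suc.prems by (auto simp: stays_def)
  have "((\<lambda>x. T ((T ^^ Suc k) x)) \<longlongrightarrow> T ((T ^^ k) q)) F"
    by (rule isCont_tendsto_compose[OF c[OF k(2)] Suc.IH[OF k(1)]])
  thus ?case by (simp add: o_def)
qed

text \<open>Beyond some length the products are at most 1, since the upper limit of their roots is smaller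
  than \<open>l\<close>; there are only finitely many shorter products.\<close>

lemma orbit_prods_bounded:
  fixes \<phi> :: "real \<Rightarrow> complex"
  assumes cT: "\<And>x. x \<in> U \<Longrightarrow> isCont T x" and c\<phi>: "\<And>x. x \<in> U \<Longrightarrow> isCont \<phi> x"
    and F: "at v within \<omega> \<noteq> bot" and q: "(T \<longlongrightarrow> q) (at v within \<omega>)"
    and L: "Lambda_sup_at T \<phi> (\<omega>, v) < ereal l" and l: "0 < l"
  shows "bdd_above (orbit_prods U T (\<lambda>x. cmod (\<phi> x) / l) q)"
proof -
  have w: "weight_along_orbit T \<phi> (\<omega>, v) (Suc k) = \<phi> ((T ^^ k) q)" if "stays U T q (Suc k)" for k
  proof -
    have k: "stays U T q k" "(T ^^ k) q \<in> U" using that by (auto simp: stays_def)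
    have "((\<lambda>x. \<phi> ((T ^^ Suc k) x)) \<longlongrightarrow> \<phi> ((T ^^ k) q)) (at v within \<omega>)"
      by (rule isCont_tendsto_compose[OF c\<phi>[OF k(2)] orbit_limit[OF cT q k(1)]])
    from tendsto_Lim[OF F this] show ?thesis by (simp add: weight_along_orbit_def)
  qed
  have "\<forall>\<^sub>F n in sequentially. ereal (root n (cmod (\<Prod>k=1..n. weight_along_orbit T \<phi> (\<omega>, v) k))) < ereal l"
    using L unfolding Lambda_sup_at_def by (rule Limsup_lessD)
  then obtain N where N: "\<And>n. n \<ge> N \<Longrightarrow> root n (cmod (\<Prod>k=1..n. weight_along_orbit T \<phi> (\<omega>, v) k)) < l"
    by (auto simp: eventually_sequentially)
  have small: "orbit_prod (\<lambda>x. cmod (\<phi> x) / l) T q n \<le> 1" if n: "stays U T q n" "n \<ge> N" "n > 0" for n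
  proof -
    have "(\<Prod>k=1..n. weight_along_orbit T \<phi> (\<omega>, v) k) = (\<Prod>k<n. weight_along_orbit T \<phi> (\<omega>, v) (Suc k))"
      by (simp add: prod.atLeast1_atMost_eq)
    also have "\<dots> = (\<Prod>k<n. \<phi> ((T ^^ k) q))"
    proof (rule prod.cong[OF refl])
      fix k assume "k \<in> {..<n}"
      hence "stays U T q (Suc k)" using n by (auto simp: stays_def)
      thus "weight_along_orbit T \<phi> (\<omega>, v) (Suc k) = \<phi> ((T ^^ k) q)" by (rule w)
    qed
    finally have eq: "cmod (\<Prod>k=1..n. weight_along_orbit T \<phi> (\<omega>, v) k) = (\<Prod>k<n. cmod (\<phi> ((T ^^ k) q)))"
      by (simp add: prod_norm)
    have nn: "0 \<le> (\<Prod>k<n. cmod (\<phi> ((T ^^ k) q)))" by (rule prod_nonneg) simp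
    have "root n (\<Prod>k<n. cmod (\<phi> ((T ^^ k) q))) < l" using N[OF n(2)] eq by simp
    hence "root n (\<Prod>k<n. cmod (\<phi> ((T ^^ k) q))) ^ n \<le> l ^ n"
      using nn n(3) by (intro power_mono) auto
    hence "(\<Prod>k<n. cmod (\<phi> ((T ^^ k) q))) \<le> l ^ n" using real_root_pow_pos2[OF n(3) nn] by simp
    thus ?thesis using l by (simp add: orbit_prod_def prod_dividef)
  qed
  define B where "B = (\<Sum>n\<le>N. \<bar>orbit_prod (\<lambda>x. cmod (\<phi> x) / l) T q n\<bar>)"
  have "y \<le> B + 1" if y: "y \<in> orbit_prods U T (\<lambda>x. cmod (\<phi> x) / l) q" for y
  proof -
    obtain n where n: "stays U T q n" "y = orbit_prod (\<lambda>x. cmod (\<phi> x) / l) T q n" using y by (auto simp: orbit_prods_def)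
    have B0: "0 \<le> B" by (simp add: B_def sum_nonneg)
    show ?thesis
    proof (cases "n \<le> N")
      case True
      have "\<bar>orbit_prod (\<lambda>x. cmod (\<phi> x) / l) T q n\<bar> \<le> B" unfolding B_def by (rule member_le_sum) (use True in auto)
      thus ?thesis using n by simp
    next
      case False thus ?thesis using small[OF n(1)] n B0 by simp
    qed
  qed
  thus ?thesis by (auto simp: bdd_above_def)
qed

lemma orbit_finite:
  assumes cT: "\<And>x. x \<in> U \<Longrightarrow> isCont T x" and F: "at v within \<omega> \<noteq> bot" and q: "(T \<longlongrightarrow> q) (at v within \<omega>)"
    and fin: "finite (orbit_point T (\<omega>, v) ` {1..})"
  shows "finite {(T ^^ k) q |k. stays U T q (Suc k)}"
proof (rule finite_subset[OF _ fin], clarify)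
  fix k assume s: "stays U T q (Suc k)"
  hence "stays U T q k" by (auto simp: stays_def)
  from tendsto_Lim[OF F orbit_limit[OF cT q this]]
  have "orbit_point T (\<omega>, v) (Suc k) = (T ^^ k) q" by (simp add: orbit_point_def)
  thus "(T ^^ k) q \<in> orbit_point T (\<omega>, v) ` {1..}" by (intro image_eqI[of _ _ "Suc k"]) auto
qed

lemma smooth_up_to_boundary_jets:
  fixes f :: "real \<Rightarrow> 'a::real_normed_vector"
  assumes "smooth_up_to_boundary {a<..<b} f" "a < b"
  shows "\<exists>D. (\<forall>n. \<forall>x\<in>{a..b}. (D n has_vector_derivative D (Suc n) x) (at x within {a..b})) \<and>
    (\<forall>x\<in>{a<..<b}. D 0 x = f x)"
proof -
  obtain h where h: "smooth_within (closure {a<..<b}) h" "\<And>x. x \<in> {a<..<b} \<Longrightarrow> h x = f x"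
    using assms(1) by (auto simp: smooth_up_to_boundary_def)
  have cl: "closure {a<..<b} = {a..b}" using assms(2) by simp
  obtain D where D: "\<And>x. x \<in> {a..b} \<Longrightarrow> D 0 x = h x"
    "\<And>n x. x \<in> {a..b} \<Longrightarrow> (D n has_vector_derivative D (Suc n) x) (at x within {a..b})"
    using h(1) unfolding smooth_within_def cl by blast
  show ?thesis by (rule exI[of _ D]) (use D h(2) in auto)
qed

context jump_space begin

text \<open>The jets of a piecewise smooth function are bounded, and each piece has jumps only at end points.\<close>

lemma piecewise_smooth_mem:
  assumes h: "h \<in> piecewise_smooth_functions \<Omega>" and left: "left_ends \<subseteq> P"
    and gm: "\<And>x. x \<in> U \<Longrightarrow> g x \<le> gm" and r: "0 < r"
  shows "h \<in> space_of"
proof -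
  have piece: "(\<lambda>x. if x \<in> \<omega> then h x else 0) \<in> space_of" if o: "\<omega> \<in> \<Omega>" for \<omega>
  proof -
    obtain a b where ab: "0 \<le> a" "a < b" "b \<le> 1" "\<omega> = {a<..<b}" using ivl[OF o] by blast
    have sm: "smooth_up_to_boundary {a<..<b} h" using h o ab by (auto simp: piecewise_smooth_functions_def)
    obtain D where D: "\<And>n x. x \<in> {a..b} \<Longrightarrow> (D n has_vector_derivative D (Suc n) x) (at x within {a..b})"
      "\<And>x. x \<in> {a<..<b} \<Longrightarrow> D 0 x = h x" using smooth_up_to_boundary_jets[OF sm ab(2)] by blast
    define E where "E k = D (r - k)" for k
    have cD: "continuous_on {a..b} (D n)" for n
      unfolding continuous_on_eq_continuous_within by (intro ballI has_vector_derivative_continuous[OF D(1)])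
    have tD: "tame_on {a<..<b} (D n)" for n
    proof -
      have "bounded (D n ` {a..b})" by (rule compact_imp_bounded[OF compact_continuous_image[OF cD]]) simp
      then obtain M where "\<forall>x\<in>{a..b}. cmod (D n x) \<le> M" by (auto simp: bounded_iff)
      thus ?thesis by (intro tame_onI[of _ _ M "{}"]) (auto intro: continuous_on_interior[OF cD])
    qed
    have dE: "(E (Suc k) has_vector_derivative E k x) (at x)" if "k < r" "x \<in> {a<..<b} - {}" for k x
    proof -
      have "r - k = Suc (r - Suc k)" using that by simp
      thus ?thesis using D(1)[of x "r - Suc k"] that by (simp add: E_def at_within_Icc_at)
    qed
    have aL: "a \<in> left_ends" using o ab unfolding left_ends_def by blast
    have aU: "a \<notin> U" by (rule left_ends_not_U[OF aL])
    have bU: "b \<notin> U" using right_end_not_U[of a b] o ab by simp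
    define Q where "Q = P \<inter> ({a, b} \<union> left_ends)"
    have Q: "finite Q" "Q \<subseteq> P" "P \<inter> ({a, b} \<union> left_ends) \<subseteq> Q" using finite_left_ends by (auto simp: Q_def)
    define G where "G = (\<lambda>x. if a < x \<and> x < b then E 0 x else 0)"
    have hE: "(if x \<in> \<omega> then h x else 0) = (if a < x \<and> x < b then E r x else 0)" for x
      using D(2)[of x] by (auto simp: ab(4) E_def)
    have cE: "continuous_on {a..b} (E (Suc k))" and tE: "tame_on {a<..<b} (E k)" for k by (auto simp: E_def cD tD)
    have tG: "tame_on U G" unfolding G_def
      by (rule piece_decomposition(1)[where E = E and Q = Q and gm = gm and h = "\<lambda>x. if x \<in> \<omega> then h x else 0" and Z = "{}"];
        (rule ab(2) left r Q hE cE tE countable_empty | erule (1) dE | erule gm | (erule notE[OF aU]) | (erule notE[OF bU])))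
    have ae: "AE x in lebesgue_on {0..1}. (if x \<in> \<omega> then h x else 0) = regular G x + (\<Sum>(q,k)\<in>Q \<times> {..<r}. jump_data a b E q k * atom q k x)"
      unfolding G_def
      by (rule piece_decomposition(2)[where E = E and Q = Q and gm = gm and h = "\<lambda>x. if x \<in> \<omega> then h x else 0" and Z = "{}"];
        (rule ab(2) left r Q hE cE tE countable_empty | erule (1) dE | erule gm | (erule notE[OF aU]) | (erule notE[OF bU])))
    obtain M where M: "M \<ge> 0" "\<And>x. x \<in> U \<Longrightarrow> cmod (G x) \<le> M" using tame_on_bounded[OF tG] by blast
    have DG: "data_le (\<lambda>_ _. 0) G (\<bar>gm\<bar> * M) 0"
    proof (rule data_le_regular[OF tG])
      fix x assume x: "x \<in> U"
      show "g x * cmod (G x) \<le> \<bar>gm\<bar> * M" using gm[OF x] g_pos[OF x] M by (intro mult_mono M x) auto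
    qed (use M in auto)
    have "(\<lambda>x. \<Sum>i\<in>Q \<times> {..<r}. jump_data a b E (fst i) (snd i) * atom (fst i) (snd i) x) \<in> space_of"
      by (rule sum_mem) (use Q in \<open>auto intro!: rep_in_space[OF rep_atom]\<close>)
    hence S: "(\<lambda>x. \<Sum>(q,k)\<in>Q \<times> {..<r}. jump_data a b E q k * atom q k x) \<in> space_of" by (simp add: case_prod_beta)
    show ?thesis
      by (rule space_of_cong[OF space_of_add[OF rep_in_space[OF rep_regular[OF DG]] S]]) (use ae in \<open>eventually_elim; simp\<close>)
  qed
  have "(\<lambda>x. \<Sum>\<omega>\<in>\<Omega>. 1 * (if x \<in> \<omega> then h x else 0)) \<in> space_of"
    by (rule sum_mem[OF fin]) (rule piece)
  thus ?thesis
  proof (rule space_of_cong, intro AE_U)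
    fix x assume "x \<in> U"
    then obtain \<omega> where o: "\<omega> \<in> \<Omega>" "x \<in> \<omega>" by blast
    have "(\<Sum>\<omega>\<in>\<Omega>. 1 * (if x \<in> \<omega> then h x else 0)) = (\<Sum>\<omega>\<in>{\<omega>}. 1 * (if x \<in> \<omega> then h x else 0))"
      by (rule sum.mono_neutral_right[OF fin]) (use o unique_ivl in auto)
    thus "(\<Sum>\<omega>\<in>\<Omega>. 1 * (if x \<in> \<omega> then h x else 0)) = h x" using o by simp
  qed
qed

end

lemma Lambda_sup_at_nonneg: "0 \<le> Lambda_sup_at T \<phi> p"
  unfolding Lambda_sup_at_def by (rule le_Limsup) (auto intro!: always_eventually real_root_ge_zero)

lemma Lambda_sup_properties:
  assumes fin: "finite \<Omega>" and ivl: "\<And>\<omega>. \<omega> \<in> \<Omega> \<Longrightarrow> \<exists>a b. a < b \<and> \<omega> = {a<..<b}"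
  shows "0 \<le> Lambda_sup T \<Omega> \<phi>"
    and "p \<in> nontrivial_discontinuities T \<Omega> \<Longrightarrow> Lambda_sup_at T \<phi> p \<le> Lambda_sup T \<Omega> \<phi>"
proof -
  let ?S = "nontrivial_discontinuities T \<Omega>"
  have "finite (Sigma \<Omega> frontier)"
  proof (rule finite_SigmaI[OF fin])
    fix \<omega> assume "\<omega> \<in> \<Omega>"
    then obtain a b where "a < b" "\<omega> = {a<..<b}" using ivl by blast
    hence "frontier \<omega> = {a..b} - {a<..<b}" by (simp add: frontier_def interior_open)
    hence "frontier \<omega> \<subseteq> {a, b}" by auto
    thus "finite (frontier \<omega>)" by (rule finite_subset) simp
  qed
  hence f: "finite ?S" by (rule rev_finite_subset) (auto simp: nontrivial_discontinuities_def)
  show le: "Lambda_sup_at T \<phi> p \<le> Lambda_sup T \<Omega> \<phi>" if "p \<in> ?S" for p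
    using that f by (auto simp: Lambda_sup_def)
  show "0 \<le> Lambda_sup T \<Omega> \<phi>"
  proof (cases "?S = {}")
    case False
    then obtain p where "p \<in> ?S" by blast
    from order_trans[OF Lambda_sup_at_nonneg le[OF this]] show ?thesis .
  qed (simp add: Lambda_sup_def)
qed

section \<open>The essential spectral radius of the transfer operator\<close>

text \<open>The lower bound on the derivative survives at the end points of the interval by continuity, so the
  branch is a diffeomorphism of the closed interval onto its image.\<close>

lemma branch_exists:
  assumes ab: "a < b" and T: "smooth_up_to_boundary {a<..<b} T" and \<phi>: "smooth_up_to_boundary {a<..<b} \<phi>"
    and lower: "0 < c" "\<And>x. x \<in> {a<..<b} \<Longrightarrow> c \<le> \<bar>deriv T x\<bar>"
  shows "\<exists>\<tau> \<tau>' \<kappa> \<kappa>d. branch a b \<tau> \<tau>' \<kappa> \<kappa>d \<and> (\<forall>x\<in>{a<..<b}. T x = \<tau> x \<and> \<kappa> 0 0 x = \<phi> x \<and>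
      (T has_real_derivative \<tau>' x) (at x) \<and> isCont \<phi> x \<and> (\<forall>n. \<kappa> n n x = \<phi> x / of_real (\<tau>' x) ^ n))"
proof -
  obtain D where D: "\<And>n x. x \<in> {a..b} \<Longrightarrow> (D n has_vector_derivative D (Suc n) x) (at x within {a..b})"
      "\<And>x. x \<in> {a<..<b} \<Longrightarrow> D 0 x = T x" using smooth_up_to_boundary_jets[OF T ab] by blast
  obtain E where E: "\<And>n x. x \<in> {a..b} \<Longrightarrow> (E n has_vector_derivative E (Suc n) x) (at x within {a..b})"
      "\<And>x. x \<in> {a<..<b} \<Longrightarrow> E 0 x = \<phi> x" using smooth_up_to_boundary_jets[OF \<phi> ab] by blast
  have cD: "continuous_on {a..b} (D n)" for n
    unfolding continuous_on_eq_continuous_within by (intro ballI has_vector_derivative_continuous[OF D(1)])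
  have dT: "(T has_real_derivative D 1 x) (at x)" if x: "x \<in> {a<..<b}" for x
  proof -
    have "(D 0 has_vector_derivative D 1 x) (at x)" using D(1)[of x 0] x by (simp add: at_within_Icc_at)
    hence "(T has_vector_derivative D 1 x) (at x)"
      by (rule has_vector_derivative_transform_within_open[of _ _ _ "{a<..<b}"]) (use x D(2) in auto)
    thus ?thesis by (simp add: has_real_derivative_iff_has_vector_derivative)
  qed
  have nz: "D 1 x \<noteq> 0" if x: "x \<in> {a..b}" for x
  proof -
    have "c \<le> \<bar>D 1 x\<bar>"
    proof (rule continuous_ge_on_closure[of "{a<..<b}" "\<lambda>x. \<bar>D 1 x\<bar>"])
      show "continuous_on (closure {a<..<b}) (\<lambda>x. \<bar>D 1 x\<bar>)" using cD ab by (auto intro: continuous_intros)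
      show "x \<in> closure {a<..<b}" using x ab by simp
      show "c \<le> \<bar>D 1 x\<bar>" if "x \<in> {a<..<b}" for x using lower(2)[OF that] DERIV_imp_deriv[OF dT[OF that]] by simp
    qed
    thus ?thesis using lower(1) by auto
  qed
  obtain \<kappa> \<kappa>d where k: "\<And>n j x. x \<in> {a..b} \<Longrightarrow> (\<kappa> n j has_vector_derivative \<kappa>d n j x) (at x within {a..b})"
    "\<And>n j x. x \<in> {a..b} \<Longrightarrow> \<kappa> (Suc n) j x = (\<kappa>d n j x + (if j = 0 then 0 else \<kappa> n (j - 1) x)) / of_real (D 1 x)"
    "\<And>n j x. x \<in> {a..b} \<Longrightarrow> n < j \<Longrightarrow> \<kappa> n j x = 0"
    "\<And>n x. x \<in> {a..b} \<Longrightarrow> \<kappa> n n x = E 0 x / of_real (D 1 x) ^ n"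
    by (rule chain_rule_coefficients[of a b E D]) (use ab E(1) D(1) nz in blast)+
  have "branch a b (D 0) (D 1) \<kappa> \<kappa>d"
    by unfold_locales (use ab D(1)[of _ 0] nz k(1-3) in \<open>simp_all\<close>)
  moreover have "isCont \<phi> x" if x: "x \<in> {a<..<b}" for x
  proof -
    have "(E 0 has_vector_derivative E 1 x) (at x)" using E(1)[of x 0] x by (simp add: at_within_Icc_at)
    hence "(\<phi> has_vector_derivative E 1 x) (at x)"
      by (rule has_vector_derivative_transform_within_open[of _ _ _ "{a<..<b}"]) (use x E(2) in auto)
    thus ?thesis by (rule has_vector_derivative_continuous)
  qed
  moreover have "\<kappa> n n x = \<phi> x / of_real (D 1 x) ^ n" if "x \<in> {a<..<b}" for n x
    using k(4)[of x n] that E(2)[OF that] by simp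
  moreover have "\<kappa> 0 0 x = \<phi> x" if "x \<in> {a<..<b}" for x
    using k(4)[of x 0] that E(2)[OF that] by simp
  ultimately have "branch a b (D 0) (D 1) \<kappa> \<kappa>d \<and> (\<forall>x\<in>{a<..<b}. T x = D 0 x \<and> \<kappa> 0 0 x = \<phi> x \<and>
      (T has_real_derivative D 1 x) (at x) \<and> isCont \<phi> x \<and> (\<forall>n. \<kappa> n n x = \<phi> x / of_real (D 1 x) ^ n))"
    using D(2) dT by simp
  thus ?thesis by (intro exI)
qed

lemma (in branch) \<kappa>_uniform_bound: "\<exists>C\<ge>0. \<forall>n\<le>r. \<forall>j\<le>r. \<forall>x\<in>{a..b}. cmod (\<kappa> n j x) \<le> C"
proof -
  have "\<exists>M. \<forall>x\<in>{a..b}. cmod (\<kappa> n j x) \<le> M" for n j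
  proof -
    have "bounded (\<kappa> n j ` {a..b})" by (rule compact_imp_bounded[OF compact_continuous_image[OF \<kappa>_cont]]) simp
    thus ?thesis by (auto simp: bounded_iff)
  qed
  then obtain M where M: "\<And>n j x. x \<in> {a..b} \<Longrightarrow> cmod (\<kappa> n j x) \<le> M n j" by metis
  have "cmod (\<kappa> n j x) \<le> (\<Sum>n\<le>r. \<Sum>j\<le>r. \<bar>M n j\<bar>)" if "n \<le> r" "j \<le> r" "x \<in> {a..b}" for n j x
  proof -
    have "cmod (\<kappa> n j x) \<le> \<bar>M n j\<bar>" using M[OF that(3), of n j] by simp
    also have "\<dots> \<le> (\<Sum>j\<le>r. \<bar>M n j\<bar>)" by (rule member_le_sum) (use that in auto)
    also have "\<dots> \<le> (\<Sum>n\<le>r. \<Sum>j\<le>r. \<bar>M n j\<bar>)"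
      by (rule member_le_sum[of n _ "\<lambda>n. \<Sum>j\<le>r. \<bar>M n j\<bar>"]) (use that in \<open>auto intro: sum_nonneg\<close>)
    finally show ?thesis .
  qed
  thus ?thesis by (intro exI[of _ "\<Sum>n\<le>r. \<Sum>j\<le>r. \<bar>M n j\<bar>"]) (auto intro: sum_nonneg)
qed

theorem theorem3:
  fixes T :: "real \<Rightarrow> real" and \<Omega> :: "real set set"
    and \<phi> :: "real \<Rightarrow> complex" and \<Lambda> :: real
  assumes "smooth_piecewise_monotone T \<Omega>"
    and "\<forall>\<omega>\<in>\<Omega>. smooth_up_to_boundary \<omega> \<phi>"
    and "\<exists>c>0. \<forall>x\<in>{0..1}. c \<le> cmod (\<phi> x)"
    and "uniformly_expanding T \<Omega>"
    and "Linf_norm (\<lambda>x. \<phi> x * of_real (deriv T x)) < \<infinity>"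
    and "Lambda_sup T \<Omega> \<phi> < ereal \<Lambda>"
  shows "\<exists>B N. banach_subspace_Linf B N \<and>
           piecewise_smooth_functions \<Omega> \<subseteq> B \<and>
           bounded_operator B N (transfer_operator T \<Omega> \<phi>) \<and>
           essential_spectral_radius B N (transfer_operator T \<Omega> \<phi>) \<le> ereal \<Lambda>"
proof -
  define U where "U = \<Union>\<Omega>"
  have part: "smooth_monotone_partition T \<Omega>" using assms(1) by (simp add: smooth_piecewise_monotone_def)
  have fin: "finite \<Omega>" and disj: "disjoint \<Omega>" and null: "{0..1} - \<Union>\<Omega> \<in> null_sets lborel"
    and ivl: "\<And>\<omega>. \<omega> \<in> \<Omega> \<Longrightarrow> \<exists>a b. 0 \<le> a \<and> a < b \<and> b \<le> 1 \<and> \<omega> = {a<..<b}"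
    and smT: "\<And>\<omega>. \<omega> \<in> \<Omega> \<Longrightarrow> smooth_up_to_boundary \<omega> T"
    using part by (auto simp: smooth_monotone_partition_def)
  have om: "\<omega> = {Inf \<omega><..<Sup \<omega>} \<and> 0 \<le> Inf \<omega> \<and> Inf \<omega> < Sup \<omega> \<and> Sup \<omega> \<le> 1" if o: "\<omega> \<in> \<Omega>" for \<omega>
  proof -
    obtain a b where "0 \<le> a" "a < b" "b \<le> 1" "\<omega> = {a<..<b}" using ivl[OF o] by blast
    thus ?thesis by (simp add: cInf_greaterThanLessThan cSup_greaterThanLessThan)
  qed
  have mem: "x \<in> \<omega> \<longleftrightarrow> Inf \<omega> < x \<and> x < Sup \<omega>" if "\<omega> \<in> \<Omega>" for x \<omega>
    using om[OF that] by (metis greaterThanLessThan_iff)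
  have U01: "x \<in> {0..1}" if xU: "x \<in> U" for x
  proof -
    obtain \<omega> where "\<omega> \<in> \<Omega>" "x \<in> \<omega>" using xU by (auto simp: U_def)
    thus ?thesis using om[of \<omega>] mem[of \<omega> x] by auto
  qed
  obtain C0 \<theta> where C0: "C0 > 0" and \<theta>: "0 < \<theta>" "\<theta> < 1"
    and exp: "\<And>n x. x \<in> {0..1} \<Longrightarrow> \<forall>k<n. (T ^^ k) x \<in> U \<Longrightarrow> C0 * (1 / \<theta>) ^ n \<le> \<bar>deriv (T ^^ n) x\<bar>"
    using assms(4) unfolding uniformly_expanding_def U_def by blast
  obtain c0 where c0: "c0 > 0" "\<And>x. x \<in> {0..1} \<Longrightarrow> c0 \<le> cmod (\<phi> x)" using assms(3) by blast
  have lower: "C0 * (1 / \<theta>) \<le> \<bar>deriv T x\<bar>" if "x \<in> U" for x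
    using exp[OF U01[OF that], of 1] that by simp
  have C0\<theta>: "0 < C0 * (1 / \<theta>)" using C0 \<theta> by simp
  have "\<forall>\<omega>\<in>\<Omega>. \<exists>q. branch (Inf \<omega>) (Sup \<omega>) (fst q) (fst (snd q)) (fst (snd (snd q))) (snd (snd (snd q))) \<and>
     (\<forall>x\<in>\<omega>. T x = fst q x \<and> fst (snd (snd q)) 0 0 x = \<phi> x \<and> (T has_real_derivative fst (snd q) x) (at x) \<and>
       isCont \<phi> x \<and> (\<forall>n. fst (snd (snd q)) n n x = \<phi> x / of_real (fst (snd q) x) ^ n))"
  proof
    fix \<omega> assume o: "\<omega> \<in> \<Omega>"
    define a b where "a = Inf \<omega>" and "b = Sup \<omega>"
    have ab: "\<omega> = {a<..<b}" "a < b" using om[OF o] by (auto simp: a_def b_def)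
    have "\<exists>\<tau> \<tau>' \<kappa> \<kappa>d. branch a b \<tau> \<tau>' \<kappa> \<kappa>d \<and> (\<forall>x\<in>{a<..<b}. T x = \<tau> x \<and> \<kappa> 0 0 x = \<phi> x \<and>
      (T has_real_derivative \<tau>' x) (at x) \<and> isCont \<phi> x \<and> (\<forall>n. \<kappa> n n x = \<phi> x / of_real (\<tau>' x) ^ n))"
    proof (rule branch_exists[OF ab(2) _ _ C0\<theta>])
      show "smooth_up_to_boundary {a<..<b} T" using smT[OF o] ab by simp
      show "smooth_up_to_boundary {a<..<b} \<phi>" using assms(2) o ab by auto
      show "C0 * (1 / \<theta>) \<le> \<bar>deriv T x\<bar>" if "x \<in> {a<..<b}" for x
        by (rule lower) (use that o ab in \<open>auto simp: U_def\<close>)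
    qed
    then obtain \<tau> \<tau>' \<kappa> \<kappa>d where t: "branch a b \<tau> \<tau>' \<kappa> \<kappa>d" "\<forall>x\<in>\<omega>. T x = \<tau> x \<and> \<kappa> 0 0 x = \<phi> x \<and>
      (T has_real_derivative \<tau>' x) (at x) \<and> isCont \<phi> x \<and> (\<forall>n. \<kappa> n n x = \<phi> x / of_real (\<tau>' x) ^ n)"
      unfolding ab(1) by blast
    show "\<exists>q. branch (Inf \<omega>) (Sup \<omega>) (fst q) (fst (snd q)) (fst (snd (snd q))) (snd (snd (snd q))) \<and>
     (\<forall>x\<in>\<omega>. T x = fst q x \<and> fst (snd (snd q)) 0 0 x = \<phi> x \<and> (T has_real_derivative fst (snd q) x) (at x) \<and>
       isCont \<phi> x \<and> (\<forall>n. fst (snd (snd q)) n n x = \<phi> x / of_real (fst (snd q) x) ^ n))"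
      by (rule exI[of _ "(\<tau>, \<tau>', \<kappa>, \<kappa>d)"]) (use t in \<open>simp add: a_def b_def\<close>)
  qed
  from bchoice[OF this] obtain Q where Q: "\<forall>\<omega>\<in>\<Omega>. branch (Inf \<omega>) (Sup \<omega>) (fst (Q \<omega>)) (fst (snd (Q \<omega>))) (fst (snd (snd (Q \<omega>)))) (snd (snd (snd (Q \<omega>)))) \<and>
     (\<forall>x\<in>\<omega>. T x = fst (Q \<omega>) x \<and> fst (snd (snd (Q \<omega>))) 0 0 x = \<phi> x \<and> (T has_real_derivative fst (snd (Q \<omega>)) x) (at x) \<and>
       isCont \<phi> x \<and> (\<forall>n. fst (snd (snd (Q \<omega>))) n n x = \<phi> x / of_real (fst (snd (Q \<omega>)) x) ^ n))" by blast
  define \<tau> \<tau>' \<kappa> \<kappa>d where "\<tau> \<omega> = fst (Q \<omega>)" and "\<tau>' \<omega> = fst (snd (Q \<omega>))" and "\<kappa> \<omega> = fst (snd (snd (Q \<omega>)))" and "\<kappa>d \<omega> = snd (snd (snd (Q \<omega>)))" for \<omega>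
  have br: "branch (Inf \<omega>) (Sup \<omega>) (\<tau> \<omega>) (\<tau>' \<omega>) (\<kappa> \<omega>) (\<kappa>d \<omega>)" if "\<omega> \<in> \<Omega>" for \<omega>
    using Q that by (simp add: \<tau>_def \<tau>'_def \<kappa>_def \<kappa>d_def)
  have Tx: "T x = \<tau> \<omega> x" and \<kappa>0: "\<kappa> \<omega> 0 0 x = \<phi> x" and dT: "(T has_real_derivative \<tau>' \<omega> x) (at x)"
    and c\<phi>: "isCont \<phi> x" and \<kappa>n: "\<kappa> \<omega> n n x = \<phi> x / of_real (\<tau>' \<omega> x) ^ n" if "\<omega> \<in> \<Omega>" "x \<in> \<omega>" for \<omega> x n
    using Q that by (simp_all add: \<tau>_def \<tau>'_def \<kappa>_def)
  have dTU: "(T has_real_derivative deriv T x) (at x)" if "x \<in> U" for x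
    using that dT DERIV_imp_deriv[OF dT] unfolding U_def by force
  have dTeq: "deriv T x = \<tau>' \<omega> x" if "\<omega> \<in> \<Omega>" "x \<in> \<omega>" for \<omega> x by (rule DERIV_imp_deriv[OF dT[OF that]])
  have cTU: "isCont T x" and c\<phi>U: "isCont \<phi> x" if "x \<in> U" for x
    using DERIV_isCont[OF dTU[OF that]] c\<phi> that unfolding U_def by auto
  obtain \<Lambda>' where \<Lambda>': "Lambda_sup T \<Omega> \<phi> < ereal \<Lambda>'" "\<Lambda>' < \<Lambda>"
    using ereal_dense3[OF assms(6)] ereal_dense2[OF assms(6)] by auto
  have ivl2: "\<exists>a b. a < b \<and> \<omega> = {a<..<b}" if "\<omega> \<in> \<Omega>" for \<omega> using ivl[OF that] by blast
  have lam0: "0 \<le> Lambda_sup T \<Omega> \<phi>" by (rule Lambda_sup_properties(1)[OF fin ivl2])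
  have lam: "Lambda_sup_at T \<phi> p \<le> Lambda_sup T \<Omega> \<phi>" if "p \<in> nontrivial_discontinuities T \<Omega>" for p
    by (rule Lambda_sup_properties(2)[OF fin ivl2 that])
  have "ereal 0 < ereal \<Lambda>'" using order_le_less_trans[OF lam0 \<Lambda>'(1)] by (simp add: zero_ereal_def)
  hence \<Lambda>'0: "0 < \<Lambda>'" by simp
  define au where "au x = 1 / (\<theta> * \<bar>deriv T x\<bar>)" for x
  define aw where "aw x = cmod (\<phi> x) / \<Lambda>'" for x
  define u where "u = orbit_sup U T au"
  define w where "w = orbit_sup U T aw"
  have dpos: "0 < \<bar>deriv T x\<bar>" if "x \<in> U" for x using lower[OF that] C0\<theta> by linarith
  have u_le: "y \<le> 1 / C0" if x: "x \<in> U" and y: "y \<in> orbit_prods U T au x" for x y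
  proof -
    obtain k where k: "stays U T x k" "y = orbit_prod au T x k" using y by (auto simp: orbit_prods_def)
    have "C0 * (1 / \<theta>) ^ k \<le> \<bar>\<Prod>i<k. deriv T ((T ^^ i) x)\<bar>"
      using exp[OF U01[OF x], of k] k(1) DERIV_imp_deriv[OF deriv_iterate[OF dTU k(1)]] by (simp add: stays_def)
    moreover have "y = 1 / (\<theta> ^ k * \<bar>\<Prod>i<k. deriv T ((T ^^ i) x)\<bar>)"
      unfolding k(2) orbit_prod_def au_def by (simp add: prod_dividef prod.distrib abs_prod)
    moreover have "C0 \<le> \<theta> ^ k * \<bar>\<Prod>i<k. deriv T ((T ^^ i) x)\<bar>"
      using calculation(1) \<theta> by (simp add: power_one_over field_simps)
    ultimately show ?thesis using C0 by (simp add: frac_le)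
  qed
  have u_bdd: "bdd_above (orbit_prods U T au x)" if "x \<in> U" for x using u_le[OF that] by (auto simp: bdd_above_def)
  have u1: "1 \<le> u x" if "x \<in> U" for x unfolding u_def by (rule orbit_sup_ge_1[OF u_bdd[OF that]])
  have uC: "u x \<le> 1 / C0" if "x \<in> U" for x
    unfolding u_def orbit_sup_def by (rule cSup_least) (use one_in_orbit_prods u_le[OF that] in blast)+
  have u_step: "u (T x) / \<bar>deriv T x\<bar> \<le> \<theta> * u x" if x: "x \<in> U" for x
  proof -
    have "0 < au x" using dpos[OF x] \<theta> by (simp add: au_def)
    from orbit_sup_step(2)[OF x this u_bdd[OF x]] show ?thesis
      using \<theta> dpos[OF x] by (simp add: u_def au_def field_simps)
  qed
  \<comment> \<open>The points where the supremum \<open>w\<close> is finite. This set need not be countable: only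
    the points on the orbits of the end points are relevant, but the set is invariant without
    further ado.\<close>
  define Good where "Good = {x\<in>U. bdd_above (orbit_prods U T aw x)}"
  have w1: "1 \<le> w x" if "x \<in> Good" for x unfolding w_def using that by (intro orbit_sup_ge_1) (simp add: Good_def)
  have aw: "0 < aw x" if "x \<in> U" for x using c0(1) c0(2)[OF U01[OF that]] \<Lambda>'0 unfolding aw_def by (intro divide_pos_pos) linarith+
  have Good_T: "T x \<in> Good" if "x \<in> Good" "T x \<in> U" for x
    using orbit_sup_step(1)[of x U aw T] aw that by (simp add: Good_def)
  have w_step: "cmod (\<phi> x) * w (T x) \<le> \<Lambda>' * w x" if "x \<in> Good" for x
    using orbit_sup_step(2)[of x U aw T] aw that \<Lambda>'0 by (simp add: Good_def w_def aw_def field_simps)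
  define V where "V = (\<Union>\<omega>\<in>\<Omega>. {(\<omega>, Inf \<omega>), (\<omega>, Sup \<omega>)})"
  have finV: "finite V" using fin by (simp add: V_def)
  have Vlim: "at v within \<omega> \<noteq> bot" "(T \<longlongrightarrow> \<tau> \<omega> v) (at v within \<omega>)" "\<omega> \<in> \<Omega>" "v \<in> frontier \<omega>" if "(\<omega>, v) \<in> V" for \<omega> v
  proof -
    show o: "\<omega> \<in> \<Omega>" using that by (auto simp: V_def)
    define a b where "a = Inf \<omega>" and "b = Sup \<omega>"
    have ab: "\<omega> = {a<..<b}" "a < b" using om[OF o] by (auto simp: a_def b_def)
    have v: "v = a \<or> v = b" using that o by (auto simp: V_def a_def b_def)
    show "v \<in> frontier \<omega>" using v ab by (auto simp: frontier_def interior_open)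
    show "at v within \<omega> \<noteq> bot"
      using v ab by (auto simp: at_within_eq_bot_iff closure_greaterThanLessThan)
    interpret b: branch "Inf \<omega>" "Sup \<omega>" "\<tau> \<omega>" "\<tau>' \<omega>" "\<kappa> \<omega>" "\<kappa>d \<omega>" by (rule br[OF o])
    have "v \<in> {Inf \<omega>..Sup \<omega>}" using v ab(2) unfolding a_def b_def by fastforce
    hence "(\<tau> \<omega> \<longlongrightarrow> \<tau> \<omega> v) (at v within {Inf \<omega>..Sup \<omega>})" using b.cont unfolding continuous_on_def by blast
    moreover have "\<omega> \<subseteq> {Inf \<omega>..Sup \<omega>}" by (rule subsetI) (simp add: mem[OF o])
    ultimately have "(\<tau> \<omega> \<longlongrightarrow> \<tau> \<omega> v) (at v within \<omega>)" by (rule tendsto_within_subset)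
    moreover have "\<forall>\<^sub>F x in at v within \<omega>. T x = \<tau> \<omega> x"
      unfolding eventually_at_filter by (intro always_eventually) (use Tx[OF o] in auto)
    ultimately show "(T \<longlongrightarrow> \<tau> \<omega> v) (at v within \<omega>)" using tendsto_cong by blast
  qed
  \<comment> \<open>The orbits of the images of end points with a finite orbit, up to the time when they meet the
    boundary of the partition.\<close>
  define bad where "bad = (\<lambda>(\<omega>, v). {(T ^^ k) (\<tau> \<omega> v) |k. stays U T (\<tau> \<omega> v) (Suc k)})"
  define Bad where "Bad = (\<Union>p\<in>V - nontrivial_discontinuities T \<Omega>. bad p)"
  have finBad: "finite Bad"
    unfolding Bad_def
  proof (intro finite_UN_I finite_Diff finV)
    fix p assume p: "p \<in> V - nontrivial_discontinuities T \<Omega>"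
    obtain \<omega> v where pv: "p = (\<omega>, v)" by (cases p)
    have V: "(\<omega>, v) \<in> V" using p pv by simp
    have "finite (orbit_point T (\<omega>, v) ` {1..})"
      using p pv Vlim(3,4)[OF V] by (auto simp: nontrivial_discontinuities_def)
    from orbit_finite[OF cTU Vlim(1,2)[OF V] this] show "finite (bad p)" by (simp add: bad_def pv)
  qed
  have BadU: "Bad \<subseteq> U" by (auto simp: Bad_def bad_def stays_def)
  have Bad_T: "T p \<in> Bad" if p: "p \<in> Bad" "T p \<in> U" for p
  proof -
    obtain \<omega> v k where k: "(\<omega>, v) \<in> V - nontrivial_discontinuities T \<Omega>" "p = (T ^^ k) (\<tau> \<omega> v)" "stays U T (\<tau> \<omega> v) (Suc k)"
      using p(1) by (auto simp: Bad_def bad_def)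
    have "stays U T (\<tau> \<omega> v) (Suc (Suc k))" using k p(2) by (auto simp: stays_def less_Suc_eq)
    moreover have "T p = (T ^^ Suc k) (\<tau> \<omega> v)" by (simp add: k(2))
    ultimately have "T p \<in> bad (\<omega>, v)" unfolding bad_def by blast
    thus ?thesis using k(1) unfolding Bad_def by blast
  qed
  have end_mem: "\<tau> \<omega> v \<in> Good \<union> Bad" if V: "(\<omega>, v) \<in> V" and q: "\<tau> \<omega> v \<in> U" for \<omega> v
  proof (cases "(\<omega>, v) \<in> nontrivial_discontinuities T \<Omega>")
    case True
    have "Lambda_sup_at T \<phi> (\<omega>, v) < ereal \<Lambda>'" using order_le_less_trans[OF lam[OF True] \<Lambda>'(1)] .
    from orbit_prods_bounded[OF cTU c\<phi>U Vlim(1,2)[OF V] this \<Lambda>'0]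
    have "bdd_above (orbit_prods U T aw (\<tau> \<omega> v))" by (simp add: aw_def[abs_def])
    thus ?thesis using q by (simp add: Good_def)
  next
    case False
    have "stays U T (\<tau> \<omega> v) (Suc 0)" using q by (simp add: stays_def)
    hence "\<tau> \<omega> v \<in> bad (\<omega>, v)" unfolding bad_def by (auto intro!: exI[of _ 0])
    thus ?thesis using V False unfolding Bad_def by blast
  qed
  \<comment> \<open>Jumps are allowed at the left end points of the partition (initial values), on the finite
    orbits, and where the products of weights are bounded.\<close>
  define le where "le = {a. \<exists>b. a < b \<and> {a<..<b} \<in> \<Omega>}"
  define P where "P = Good \<union> Bad \<union> le"
  have "\<forall>\<omega>\<in>\<Omega>. \<exists>C\<ge>0. \<forall>x\<in>\<omega>. cmod (\<phi> x) \<le> C"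
  proof
    fix \<omega> assume o: "\<omega> \<in> \<Omega>"
    interpret b: branch "Inf \<omega>" "Sup \<omega>" "\<tau> \<omega>" "\<tau>' \<omega>" "\<kappa> \<omega>" "\<kappa>d \<omega>" by (rule br[OF o])
    obtain C where C: "C \<ge> 0" "\<forall>n\<le>0. \<forall>j\<le>0. \<forall>x\<in>{Inf \<omega>..Sup \<omega>}. cmod (\<kappa> \<omega> n j x) \<le> C" using b.\<kappa>_uniform_bound[of 0] by blast
    have "cmod (\<phi> x) \<le> C" if "x \<in> \<omega>" for x
    proof -
      have "x \<in> {Inf \<omega>..Sup \<omega>}" using mem[OF o, of x] that by simp
      hence "cmod (\<kappa> \<omega> 0 0 x) \<le> C" using C(2) by blast
      thus ?thesis by (simp add: \<kappa>0[OF o that])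
    qed
    thus "\<exists>C\<ge>0. \<forall>x\<in>\<omega>. cmod (\<phi> x) \<le> C" using C(1) by blast
  qed
  from bchoice[OF this] obtain F where F: "\<forall>\<omega>\<in>\<Omega>. 0 \<le> F \<omega> \<and> (\<forall>x\<in>\<omega>. cmod (\<phi> x) \<le> F \<omega>)" by blast
  define C\<phi> where "C\<phi> = (\<Sum>\<omega>\<in>\<Omega>. F \<omega>)"
  have C\<phi>0: "0 \<le> C\<phi>" unfolding C\<phi>_def using F by (intro sum_nonneg) auto
  have \<phi>_le: "cmod (\<phi> x) \<le> C\<phi>" if "\<omega> \<in> \<Omega>" "x \<in> \<omega>" for \<omega> x
  proof -
    have "F \<omega> \<le> C\<phi>" unfolding C\<phi>_def by (rule member_le_sum) (use F that fin in auto)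
    thus ?thesis using F that by force
  qed
  have "(\<lambda>n. real (card \<Omega>) * (C\<phi> * \<theta> ^ n)) \<longlonglongrightarrow> real (card \<Omega>) * (C\<phi> * 0)"
    using \<theta> by (intro tendsto_intros LIMSEQ_realpow_zero) auto
  hence "\<forall>\<^sub>F n in sequentially. real (card \<Omega>) * (C\<phi> * \<theta> ^ n) < \<Lambda>'"
    by (rule order_tendstoD) (use \<Lambda>'0 in simp)
  \<comment> \<open>The order \<open>r\<close> of differentiability is chosen so that the top derivative is
    contracted by less than \<open>\<Lambda>'\<close>.\<close>
  then obtain n0 where "\<forall>n\<ge>n0. real (card \<Omega>) * (C\<phi> * \<theta> ^ n) < \<Lambda>'"
    unfolding eventually_sequentially by blast
  then obtain r where r: "0 < r" "real (card \<Omega>) * (C\<phi> * \<theta> ^ r) < \<Lambda>'"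
    by (meson le_SucI order_refl zero_less_Suc)
  have "\<forall>\<omega>\<in>\<Omega>. \<exists>C\<ge>0. \<forall>n\<le>r. \<forall>j\<le>r. \<forall>x\<in>{Inf \<omega>..Sup \<omega>}. cmod (\<kappa> \<omega> n j x) \<le> C"
    using branch.\<kappa>_uniform_bound[OF br] by blast
  from bchoice[OF this] obtain H where H: "\<forall>\<omega>\<in>\<Omega>. 0 \<le> H \<omega> \<and> (\<forall>n\<le>r. \<forall>j\<le>r. \<forall>x\<in>{Inf \<omega>..Sup \<omega>}. cmod (\<kappa> \<omega> n j x) \<le> H \<omega>)" by blast
  define C where "C = (\<Sum>\<omega>\<in>\<Omega>. H \<omega>)"
  have C: "0 \<le> C" unfolding C_def using H by (intro sum_nonneg) auto
  have \<kappa>_le: "cmod (\<kappa> \<omega> n j x) \<le> C" if "\<omega> \<in> \<Omega>" "x \<in> {Inf \<omega>..Sup \<omega>}" "n \<le> r" "j \<le> r" for \<omega> n j x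
  proof -
    have "H \<omega> \<le> C" unfolding C_def by (rule member_le_sum) (use H that fin in auto)
    moreover have "cmod (\<kappa> \<omega> n j x) \<le> H \<omega>" using H that by blast
    ultimately show ?thesis by simp
  qed
  define D where "D = max 1 (1 / C0) ^ r"
  have D: "1 \<le> D" unfolding D_def by (rule one_le_power) simp
  have uD: "u x ^ n \<le> D" if "x \<in> U" "n \<le> r" for x n
  proof -
    have "u x ^ n \<le> max 1 (1 / C0) ^ n" using u1[OF that(1)] uC[OF that(1)] by (intro power_mono) auto
    also have "\<dots> \<le> D" unfolding D_def by (rule power_increasing) (use that in auto)
    finally show ?thesis .
  qed
  \<comment> \<open>The constant \<open>A\<close> bounds the entries off the diagonal of the matrix
    \<open>\<kappa>\<close>, relative to the weights without \<open>\<eta>\<close>; here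
    \<open>w (T p) \<le> \<Lambda>' / c0 * w p\<close> because \<open>|\<phi>| \<ge> c0\<close>.
    The constant \<open>A2\<close> bounds the top derivative of the image of an atom.\<close>
  define A where "A = C * (\<Lambda>' / c0) * D"
  have A: "0 \<le> A" using C \<Lambda>'0 c0 D by (simp add: A_def)
  define A2 where "A2 = D * ((real r + 1) * C)"
  have A2: "0 \<le> A2" using C D by (simp add: A2_def)
  define \<eta> where "\<eta> = min 1 ((\<Lambda> - \<Lambda>') / (real r * A + A2 + 1))"
  have den: "0 < real r * A + A2 + 1" using A A2 by (simp add: add_nonneg_pos)
  have \<eta>: "0 < \<eta>" "\<eta> \<le> 1" using \<Lambda>'(2) den by (auto simp: \<eta>_def)
  have \<eta>q: "\<Lambda>' + real r * (\<eta> * A) + \<eta> * A2 \<le> \<Lambda>"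
  proof -
    have "\<eta> * (real r * A + A2 + 1) \<le> (\<Lambda> - \<Lambda>') / (real r * A + A2 + 1) * (real r * A + A2 + 1)"
      using den by (intro mult_right_mono) (auto simp: \<eta>_def)
    hence "\<eta> * (real r * A + A2 + 1) \<le> \<Lambda> - \<Lambda>'" using den by simp
    thus ?thesis using \<eta> by (simp add: algebra_simps)
  qed
  define g where "g x = \<eta> ^ r * u x ^ r" for x
  define wt where "wt p k = (if p \<in> Good then \<eta> ^ (r - Suc k) * (w p * u p ^ (r - Suc k)) else 1)" for p k
  have GoodU: "x \<in> U" if "x \<in> Good" for x using that by (simp add: Good_def)
  have wu1: "1 \<le> w p * u p ^ n" if "p \<in> Good" for p n
    using mult_mono[OF w1[OF that] one_le_power[OF u1[OF GoodU[OF that]]], of n] w1[OF that] by simp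
  have wt_ge: "\<eta> ^ (r - Suc k) \<le> wt p k" for p k
    using mult_left_mono[OF wu1, of p "\<eta> ^ (r - Suc k)" "r - Suc k"] \<eta> by (auto simp: wt_def power_le_one)
  interpret jump_space \<Omega> P r g wt "\<eta> ^ r"
  proof
    show "finite \<Omega>" by (rule fin)
    show "\<omega> \<in> \<Omega> \<Longrightarrow> \<exists>a b. 0 \<le> a \<and> a < b \<and> b \<le> 1 \<and> \<omega> = {a<..<b}" for \<omega> by (rule ivl)
    show "disjoint \<Omega>" by (rule disj)
    show "{0..1} - \<Union>\<Omega> \<in> null_sets lborel" by (rule null)
    show "\<exists>a b. {a<..<b} \<in> \<Omega> \<and> a \<le> p \<and> p < b" if "p \<in> P" for p
    proof (cases "p \<in> le")
      case True thus ?thesis by (auto simp: le_def)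
    next
      case False
      hence "p \<in> U" using that BadU GoodU by (auto simp: P_def)
      then obtain \<omega> where "\<omega> \<in> \<Omega>" "p \<in> \<omega>" by (auto simp: U_def)
      thus ?thesis using ivl[of \<omega>] by fastforce
    qed
    show "0 < \<eta> ^ r" using \<eta> by simp
    show "\<eta> ^ r \<le> g x" if "x \<in> \<Union>\<Omega>" for x
      using mult_left_mono[OF one_le_power[OF u1, of x r], of "\<eta> ^ r"] that \<eta> by (simp add: g_def U_def)
    show "\<eta> ^ r \<le> wt p k" if "p \<in> P" "k < r" for p k
    proof -
      have "\<eta> ^ r \<le> \<eta> ^ (r - Suc k)" using \<eta> by (intro power_decreasing) auto
      thus ?thesis using wt_ge[of k p] by simp
    qed
  qed
  have le_eq: "left_ends = le" by (simp add: left_ends_def le_def)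
  have g_le: "g x \<le> \<eta> ^ r * D" if "x \<in> \<Union>\<Omega>" for x
    unfolding g_def using uD[of x r] that \<eta> by (intro mult_left_mono) (auto simp: U_def)
  interpret expanding_branches \<Omega> P r g wt "\<eta> ^ r" T \<phi> \<tau> \<tau>' \<kappa> \<kappa>d C "\<eta> ^ r * D"
  proof (intro expanding_branches.intro expanding_branches_axioms.intro)
    show "jump_space \<Omega> P r g wt (\<eta> ^ r)" by (rule jump_space_axioms)
    show "\<omega> \<in> \<Omega> \<Longrightarrow> branch (Inf \<omega>) (Sup \<omega>) (\<tau> \<omega>) (\<tau>' \<omega>) (\<kappa> \<omega>) (\<kappa>d \<omega>)" for \<omega> by (rule br)
    show "\<omega> \<in> \<Omega> \<Longrightarrow> x \<in> \<omega> \<Longrightarrow> T x = \<tau> \<omega> x" for \<omega> x by (rule Tx)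
    show "\<omega> \<in> \<Omega> \<Longrightarrow> x \<in> \<omega> \<Longrightarrow> \<kappa> \<omega> 0 0 x = \<phi> x" for \<omega> x by (rule \<kappa>0)
    show "\<omega> \<in> \<Omega> \<Longrightarrow> x \<in> {Inf \<omega>..Sup \<omega>} \<Longrightarrow> n \<le> r \<Longrightarrow> j \<le> r \<Longrightarrow> cmod (\<kappa> \<omega> n j x) \<le> C" for \<omega> x n j by (rule \<kappa>_le)
    show "0 \<le> C" by (rule C)
    show "x \<in> \<Union>\<Omega> \<Longrightarrow> g x \<le> \<eta> ^ r * D" for x by (rule g_le)
    show "0 < r" by (rule r(1))
    show "left_ends \<subseteq> P" by (auto simp: le_eq P_def)
    show "\<tau> \<omega> v \<in> P" if "\<omega> \<in> \<Omega>" "v = Inf \<omega> \<or> v = Sup \<omega>" "\<tau> \<omega> v \<in> \<Union>\<Omega>" for \<omega> v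
      using end_mem[of \<omega> v] that by (auto simp: V_def P_def U_def)
    show "T p \<in> P" if p: "p \<in> P" "p \<in> \<Union>\<Omega>" "T p \<in> \<Union>\<Omega>" for p
    proof -
      have "p \<notin> le" using left_ends_not_U[of p] p(2) unfolding le_eq by blast
      hence "p \<in> Good \<or> p \<in> Bad" using p(1) by (auto simp: P_def)
      thus ?thesis using Good_T[of p] Bad_T[of p] p(3) by (auto simp: P_def U_def)
    qed
  qed
  have gm_abs: "\<bar>\<eta> ^ r * D\<bar> = \<eta> ^ r * D" using \<eta> D by simp
  \<comment> \<open>Jumps of derivatives of order \<open>j\<close> feed jumps of order \<open>n \<ge> j\<close>: the
    diagonal \<open>n = j\<close> gives \<open>\<Lambda>' * \<theta> ^ j\<close>, and each entry
    with \<open>n > j\<close> carries a factor \<open>\<eta>\<close> from the ratio of the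
    weights.\<close>
  have main: "(\<Sum>k<r. cmod (\<kappa> \<omega> (r - Suc k) (r - Suc k0) p) * wt (T p) k) \<le> (\<Lambda>' + real r * (\<eta> * A)) * wt p k0"
    if p: "p \<in> Good" and k0: "k0 < r" and o: "\<omega> \<in> \<Omega>" "p \<in> \<omega>" and TU: "T p \<in> \<Union>\<Omega>" for \<omega> p k0
  proof -
    define j where "j = r - Suc k0"
    have TU': "T p \<in> U" using TU by (simp add: U_def)
    have TG: "T p \<in> Good" by (rule Good_T[OF p TU'])
    have pU: "p \<in> U" by (rule GoodU[OF p])
    have pI: "p \<in> {Inf \<omega>..Sup \<omega>}" using mem[OF o(1), of p] o(2) by auto
    have W: "wt p k0 = \<eta> ^ j * (w p * u p ^ j)" using p by (simp add: wt_def j_def)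
    have W0: "0 \<le> wt p k0" using wt_ge[of k0 p] zero_le_power[of \<eta>] \<eta> by (meson less_imp_le order_trans)
    have wTp: "w (T p) \<le> \<Lambda>' / c0 * w p"
    proof -
      have "c0 * w (T p) \<le> cmod (\<phi> p) * w (T p)"
        using c0(2)[OF U01[OF pU]] w1[OF TG] by (intro mult_right_mono) auto
      also have "\<dots> \<le> \<Lambda>' * w p" by (rule w_step[OF p])
      finally show ?thesis using c0(1) by (simp add: field_simps)
    qed
    have summand: "cmod (\<kappa> \<omega> (r - Suc k) j p) * wt (T p) k \<le> (if k = k0 then \<Lambda>' * wt p k0 else 0) + \<eta> * A * wt p k0"
      if k: "k < r" for k
    proof -
      define n where "n = r - Suc k"
      have Wn: "wt (T p) k = \<eta> ^ n * (w (T p) * u (T p) ^ n)" using TG by (simp add: wt_def n_def)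
      have extra: "0 \<le> \<eta> * A * wt p k0" using \<eta> A W0 by simp
      have n: "n \<le> r" "j \<le> r" by (auto simp: n_def j_def)
      consider "n < j" | "n = j" | "j < n" by linarith
      thus ?thesis
      proof cases
        case 1
        have "\<kappa> \<omega> n j p = 0" by (rule branch.\<kappa>z[OF br[OF o(1)] pI 1])
        hence "cmod (\<kappa> \<omega> (r - Suc k) j p) * wt (T p) k = 0" by (simp add: n_def)
        thus ?thesis using extra W0 \<Lambda>'0 by auto
      next
        case 2
        hence kk: "k = k0" using k k0 by (auto simp: n_def j_def)
        have "cmod (\<kappa> \<omega> n j p) * wt (T p) k = \<eta> ^ j * ((cmod (\<phi> p) * w (T p)) * (u (T p) / \<bar>deriv T p\<bar>) ^ j)"
          unfolding Wn 2 \<kappa>n[OF o] dTeq[OF o] by (simp add: norm_divide norm_power power_divide)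
        also have "\<dots> \<le> \<eta> ^ j * ((\<Lambda>' * w p) * (\<theta> * u p) ^ j)"
        proof (rule mult_left_mono[OF mult_mono])
          show "cmod (\<phi> p) * w (T p) \<le> \<Lambda>' * w p" by (rule w_step[OF p])
          show "(u (T p) / \<bar>deriv T p\<bar>) ^ j \<le> (\<theta> * u p) ^ j"
            using u1[OF TU'] by (intro power_mono u_step pU) auto
          show "0 \<le> \<Lambda>' * w p" using \<Lambda>'0 w1[OF p] by simp
          show "0 \<le> (u (T p) / \<bar>deriv T p\<bar>) ^ j" using u1[OF TU'] by simp
        qed (use \<eta> in auto)
        also have "\<dots> = \<theta> ^ j * (\<Lambda>' * wt p k0)" by (simp add: W power_mult_distrib mult_ac)
        also have "\<dots> \<le> 1 * (\<Lambda>' * wt p k0)"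
          using \<theta> \<Lambda>'0 W0 by (intro mult_right_mono power_le_one) auto
        finally show ?thesis using extra kk by (simp add: n_def)
      next
        case 3
        have "cmod (\<kappa> \<omega> n j p) * wt (T p) k \<le> C * (\<eta> ^ Suc j * ((\<Lambda>' / c0 * w p) * D))"
          unfolding Wn
        proof (intro mult_mono)
          show "cmod (\<kappa> \<omega> n j p) \<le> C" by (rule \<kappa>_le[OF o(1) pI n])
          show "\<eta> ^ n \<le> \<eta> ^ Suc j" using \<eta> 3 by (intro power_decreasing) auto
          show "w (T p) \<le> \<Lambda>' / c0 * w p" by (rule wTp)
          show "u (T p) ^ n \<le> D" by (rule uD[OF TU' n(1)])
        qed (use C \<eta> u1[OF TU'] w1[OF TG] w1[OF p] \<Lambda>'0 c0 D in auto)
        also have "\<dots> = \<eta> * A * (\<eta> ^ j * w p)" by (simp add: A_def mult_ac)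
        also have "\<dots> \<le> \<eta> * A * wt p k0"
          unfolding W using \<eta> A w1[OF p] one_le_power[OF u1[OF pU], of j]
          by (intro mult_left_mono) (auto simp: mult_le_cancel_left1)
        finally show ?thesis using W0 \<Lambda>'0 by (simp add: n_def add_increasing)
      qed
    qed
    have "(\<Sum>k<r. cmod (\<kappa> \<omega> (r - Suc k) j p) * wt (T p) k) \<le>
        (\<Sum>k<r. (if k = k0 then \<Lambda>' * wt p k0 else 0) + \<eta> * A * wt p k0)"
      by (rule sum_mono) (use summand in auto)
    also have "\<dots> = (\<Lambda>' + real r * (\<eta> * A)) * wt p k0"
      using k0 by (simp add: sum.distrib algebra_simps)
    finally show ?thesis by (simp add: j_def)
  qed
  have cross: "\<bar>\<eta> ^ r * D\<bar> * ((real r + 1) * C) \<le> \<eta> * A2 * wt p k0" if "k0 < r" for p k0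
  proof -
    have "\<eta> ^ r \<le> \<eta> * \<eta> ^ (r - Suc k0)"
      using \<eta> that power_decreasing[of "Suc (r - Suc k0)" r \<eta>] by simp
    also have "\<dots> \<le> \<eta> * wt p k0" using wt_ge[of k0 p] \<eta> by (intro mult_left_mono) auto
    finally have "\<eta> ^ r * A2 \<le> \<eta> * wt p k0 * A2" using A2 by (intro mult_right_mono)
    thus ?thesis unfolding gm_abs by (simp add: A2_def mult_ac)
  qed
  have top: "g (T x) * cmod (\<kappa> \<omega> r r x) \<le> (C\<phi> * \<theta> ^ r) * g x" if o: "\<omega> \<in> \<Omega>" "x \<in> \<omega>" and TU: "T x \<in> \<Union>\<Omega>" for \<omega> x
  proof -
    have xU: "x \<in> U" and TU': "T x \<in> U" using o TU by (auto simp: U_def)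
    have "g (T x) * cmod (\<kappa> \<omega> r r x) = \<eta> ^ r * (cmod (\<phi> x) * (u (T x) / \<bar>deriv T x\<bar>) ^ r)"
      unfolding g_def \<kappa>n[OF o] dTeq[OF o] by (simp add: norm_divide norm_power power_divide)
    also have "\<dots> \<le> \<eta> ^ r * (C\<phi> * (\<theta> * u x) ^ r)"
    proof (intro mult_left_mono mult_mono)
      show "cmod (\<phi> x) \<le> C\<phi>" by (rule \<phi>_le[OF o])
      show "(u (T x) / \<bar>deriv T x\<bar>) ^ r \<le> (\<theta> * u x) ^ r" using u1[OF TU'] by (intro power_mono u_step xU) auto
      show "0 \<le> (u (T x) / \<bar>deriv T x\<bar>) ^ r" using u1[OF TU'] by simp
    qed (use \<eta> C\<phi>0 in auto)
    also have "\<dots> = (C\<phi> * \<theta> ^ r) * g x" by (simp add: g_def power_mult_distrib mult_ac)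
    finally show ?thesis .
  qed
  have GP: "Good \<subseteq> P \<inter> \<Union>\<Omega>" using GoodU by (auto simp: P_def U_def)
  have finPG: "finite (P - Good)"
    by (rule finite_subset[of _ "Bad \<union> left_ends"]) (use finBad finite_left_ends in \<open>auto simp: P_def le_eq\<close>)
  have q0: "0 \<le> \<Lambda>' + real r * (\<eta> * A)" "0 \<le> \<eta> * A2" "0 \<le> C\<phi> * \<theta> ^ r"
    using \<Lambda>'0 \<eta> A A2 C\<phi>0 \<theta> by auto
  have q2: "real (card \<Omega>) * (C\<phi> * \<theta> ^ r) < \<Lambda>" using r(2) \<Lambda>'(2) by simp
  note QC = quasi_compact[of Good "\<Lambda>' + real r * (\<eta> * A)" "\<eta> * A2" "C\<phi> * \<theta> ^ r" \<Lambda>, OF GP finPG main cross top q0 \<eta>q q2]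
  have "essential_spectral_radius space_of norm_of (transfer_operator T \<Omega> \<phi>) \<le> ereal \<Lambda>"
    unfolding essential_spectral_radius_def
  proof (rule SUP_least)
    fix z assume "z \<in> essential_spectrum space_of norm_of (transfer_operator T \<Omega> \<phi>)"
    hence "\<not> \<Lambda> < cmod z" using QC(2)[of z] by (auto simp: essential_spectrum_def)
    thus "ereal (cmod z) \<le> ereal \<Lambda>" by simp
  qed
  moreover have "piecewise_smooth_functions \<Omega> \<subseteq> space_of"
    using piecewise_smooth_mem[OF _ left_P g_le r(1)] by blast
  ultimately show ?thesis using banach QC(1) by blast
qed

end
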